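(* Fix $\alpha\in(0,2\pi]$. Let $v_n\to v\in[0,1)$ and $q_n\to q\in[0,1)$ as $n\to\infty$, let $r_n>0$, and set $\mu_n:=\frac{\alpha}{2}\,n\,r_n^2(1-v_n)(1-q_n)$. Suppose that $\inf_{n>0}\mu_n>0$ and that $\mu_n^{1+\varepsilon}=o(\ln n)$ for some $\varepsilon>0$. Then there exists a sequence of integers $\{k_n\}_{n\ge1}$ such that, setting $\xi_n:=P(\mathrm{Poi}(\mu_n)\ge k_n)$, $$P(\Delta_n^{'out}=k_n-1)-e^{-n(1-v_n)\xi_n}\to0,\qquad P(\Delta_n^{'out}=k_n)+e^{-n(1-v_n)\xi_n}\to1,$$ as $n\to\infty$, and the same two limit statements hold (with the same sequence $k_n$) when $\Delta_n^{'out}$ is replaced by each of $\Delta_n^{'in}$, $\Delta_n^{out}$ and $\Delta_n^{in}$.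
   Context: For $x\in\mathbb{R}^2$, $y\in[0,2\pi)$, $r>0$, the sector $S(x,y,r)$ is the circular sector centred at $x$ with radius $r$, central angle $\alpha$, whose first bounding ray makes angle $y$ (measured anticlockwise) with the horizontal direction, i.e. $S(x,y,r)=\{x+t(\cos\phi,\sin\phi):0\le t\le r,\ \phi\in[y,y+\alpha]\}$. Binomial model: $X_1,\dots,X_n$ are i.i.d. uniform points in $[0,1]^2$ and $Y_1,\dots,Y_n$ are i.i.d. uniform on $[0,2\pi)$, all independent. Each vertex $X_i$ independently fails with probability $v_n$ (independently of the point process), and each potential out-edge $(X_i,X_j)$, $i\neq j$, independently fails with probability $q_n$. The random faulty scaled sector graph $G_\alpha(\mathcal{X}_n,\mathcal{Y}_n,v_n,q_n,r_n)$ is the directed graph whose vertices are the non-failed points $X_i$, with an arc from $X_i$ to $X_j$ ($i\ne j$, both non-failed) if and only if $X_j\in S(X_i,Y_i,r_n)$ and the edge $(X_i,X_j)$ has not failed. $\Delta_n^{out}$ and $\Delta_n^{in}$ denote its maximum out-degree and maximum in-degree. Poisson model: the same construction with the number of points replaced by $N_n\sim\mathrm{Poi}(n)$ independent of everything else (points $X_1,\dots,X_{N_n}$, angles $Y_1,\dots,Y_{N_n}$); $\Delta_n^{'out}$, $\Delta_n^{'in}$ denote the maximum out-/in-degree of this Poisson faulty scaled sector graph. $\mathrm{Poi}(\mu)$ denotes a Poisson random variable with mean $\mu$. *)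

theory Defs
  imports
    "HOL-Probability.Probability"
    "HOL-Library.Landau_Symbols"
    "Graph_Theory.Digraph"
begin

definition sector :: "real \<Rightarrow> real \<times> real \<Rightarrow> real \<Rightarrow> real \<Rightarrow> (real \<times> real) set" where
  "sector \<alpha> x y r =
     {x + t *\<^sub>R (cos \<phi>, sin \<phi>) | t \<phi>. 0 \<le> t \<and> t \<le> r \<and> y \<le> \<phi> \<and> \<phi> \<le> y + \<alpha>}"

text \<open>
  The faulty scaled sector graph on the points \<open>X 0, \<dots>, X (m - 1)\<close> with angles \<open>Y i\<close>.
  \<open>F i\<close> says that vertex \<open>i\<close> has failed, \<open>E (i, j)\<close> that the potential arc from
  \<open>i\<close> to \<open>j\<close> has failed.  The vertex \<open>X i\<close> is represented by its index \<open>i\<close>.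
\<close>

definition faulty_sector_graph ::
  "real \<Rightarrow> real \<Rightarrow> nat \<Rightarrow> (nat \<Rightarrow> real \<times> real) \<Rightarrow> (nat \<Rightarrow> real) \<Rightarrow> (nat \<Rightarrow> bool)
    \<Rightarrow> (nat \<times> nat \<Rightarrow> bool) \<Rightarrow> (nat, nat \<times> nat) pre_digraph" where
  "faulty_sector_graph \<alpha> r m X Y F E =
     \<lparr> verts = {i. i < m \<and> \<not> F i},
       arcs = {(i, j). i < m \<and> j < m \<and> i \<noteq> j \<and> \<not> F i \<and> \<not> F j
                 \<and> X j \<in> sector \<alpha> (X i) (Y i) r \<and> \<not> E (i, j)},
       tail = fst,
       head = snd \<rparr>"

text \<open>The maximum degrees of the graph without vertices are \<open>0\<close>.\<close>

definition max_out_degree :: "('a, 'b) pre_digraph \<Rightarrow> nat" where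
  "max_out_degree G = (if verts G = {} then 0 else Max (out_degree G ` verts G))"

definition max_in_degree :: "('a, 'b) pre_digraph \<Rightarrow> nat" where
  "max_in_degree G = (if verts G = {} then 0 else Max (in_degree G ` verts G))"

text \<open>
  The sample space carries the joint law of infinite i.i.d. families of points, angles, vertex
  failures and edge failures, and of a Poisson count with mean \<open>n\<close>, all independent.  The
  binomial model uses the first \<open>n\<close> indices, the Poisson model as many as the count says.
\<close>

type_synonym sample =
  "(nat \<Rightarrow> real \<times> real) \<times> (nat \<Rightarrow> real) \<times> (nat \<Rightarrow> bool) \<times> (nat \<times> nat \<Rightarrow> bool) \<times> nat"

definition sample_space :: "nat \<Rightarrow> real \<Rightarrow> real \<Rightarrow> sample measure" where
  "sample_space n p_vert p_edge =
     (\<Pi>\<^sub>M i\<in>UNIV. uniform_measure lborel ({0..1} \<times> {0..1}))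
     \<Otimes>\<^sub>M (\<Pi>\<^sub>M i\<in>UNIV. uniform_measure lborel {0..<2 * pi})
     \<Otimes>\<^sub>M (\<Pi>\<^sub>M i\<in>UNIV. measure_pmf (bernoulli_pmf p_vert))
     \<Otimes>\<^sub>M (\<Pi>\<^sub>M e\<in>UNIV. measure_pmf (bernoulli_pmf p_edge))
     \<Otimes>\<^sub>M measure_pmf (poisson_pmf (real n))"

definition binomial_graph ::
  "real \<Rightarrow> real \<Rightarrow> nat \<Rightarrow> sample \<Rightarrow> (nat, nat \<times> nat) pre_digraph" where
  "binomial_graph \<alpha> r n = (\<lambda>(X, Y, F, E, N). faulty_sector_graph \<alpha> r n X Y F E)"

definition poisson_graph :: "real \<Rightarrow> real \<Rightarrow> sample \<Rightarrow> (nat, nat \<times> nat) pre_digraph" where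
  "poisson_graph \<alpha> r = (\<lambda>(X, Y, F, E, N). faulty_sector_graph \<alpha> r N X Y F E)"

end

theory Submission
  imports Defs "HOL-Real_Asymp.Real_Asymp"
begin

text \<open>
  Write \<open>f n k = n P(Poi(\<mu> n) \<ge> k)\<close> and let \<open>k\<close> be the least index with \<open>f n k * f n (k + 1) \<le> 1\<close>.
  Since \<open>\<mu> n\<close> is of smaller order than \<open>ln n\<close>, the ratios \<open>f n (k + 1) / f n k\<close> tend to \<open>0\<close>
  near this index, so \<open>f n (k - 1)\<close> tends to infinity and \<open>f n (k + 1)\<close> to \<open>0\<close>.  It therefore
  suffices that \<open>P(\<Delta> < j) - exp (- (1 - v\<^sub>n) f n j)\<close> tends to \<open>0\<close> for \<open>j = k - 1, k, k + 1\<close>.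

  This follows from the asymptotic independence of the events ``vertex \<open>i\<close> has degree at least
  \<open>j\<close>''.  To decouple one vertex from the others, take an independent copy of the configuration and
  exchange all points that lie, in either copy, within distance \<open>r\<close> of that vertex.  The exchange
  preserves the joint law, so the error is the probability that two vertices at distance at most
  \<open>2 r\<close> both have large degree.  Their two neighbourhoods overlap in all but a proportion \<open>\<eta>\<close> only
  if the second vertex lies in a set of diameter of order \<open>\<eta> r\<close>, and otherwise a joint Chernoff
  bound gains a factor \<open>exp (- \<eta> j / 8)\<close>; the choice \<open>\<eta> = j\<^bsup>-3/4\<^esup>\<close> makes both contributions
  negligible.  The Poisson model is a mixture of binomial models whose sizes concentrate around \<open>n\<close>.
\<close>

section \<open>Families of independent random variables\<close>

text \<open>The obstacle is clustering. About \<open>n r^2\<close> vertices, a number of order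
  \<mu>, lie near a given one, and \<mu> may be unbounded, so proximity alone does not make a second
  large degree rare. Lowering a degree threshold from \<open>j\<close> to \<open>j - 1\<close>,
  which frees a count from one more vertex, costs a factor \<open>j / \<mu>\<close>. Relative to the
  tail, strongly overlapping pairs thus contribute about
  \<open>\<eta>^2 \<mu> (j / \<mu>) = \<eta>^2 j\<close>, the others at most about
  \<open>j^2 exp (- \<eta> j / 8)\<close>. So \<eta> must be well below \<open>j^(-1/2)\<close> and
  well above \<open>(ln j) / j\<close>, which the exponent 3/4 satisfies. An arc failure enters one
  out-degree and one in-degree. Storing it in the mark of the vertex whose degree is studied makes
  the marks i.i.d., separately for out- and in-degrees. The vertices are exposed one by one. The
  dependence error of each step is bounded relative to the probability of one exceedance, so it does
  not add up over the vertices. The product of two consecutive values of \<open>f n\<close> is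
  compared with 1 because \<open>f n k\<close> itself may stay bounded away from 0 and infinity;
  then the degrees \<open>k - 1\<close> and \<open>k\<close> share the mass.\<close>

lemma prob_space_iid: "prob_space M \<Longrightarrow> prob_space (\<Pi>\<^sub>M i\<in>I. M)"
  by (intro prob_space_PiM)

text \<open>Cylinders over finite index sets determine a product measure. The premise offers
  measurability of every \<open>A j\<close>, also outside \<open>J\<close>, so that its proof needs
  no case distinction; outside \<open>J\<close> it is applied with the empty set.\<close>

lemma iid_eqI:
  assumes M: "prob_space M" and Q: "sets Q = sets (\<Pi>\<^sub>M i\<in>(UNIV::'i set). M)"
    and eq: "\<And>J A. finite J \<Longrightarrow> (\<And>j. A j \<in> sets M) \<Longrightarrow>
      emeasure Q {x\<in>space Q. \<forall>j\<in>J. x j \<in> A j} = (\<Prod>j\<in>J. emeasure M (A j))"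
  shows "Q = (\<Pi>\<^sub>M i\<in>(UNIV::'i set). M)"
proof -
  interpret product_prob_space "\<lambda>_. M" "UNIV :: 'i set" by (rule product_prob_spaceI) (rule M)
  have sp: "space Q = space (\<Pi>\<^sub>M i\<in>(UNIV::'i set). M)" by (rule sets_eq_imp_space_eq[OF Q])
  show ?thesis
  proof (rule PiM_eq[OF Q])
    fix J F assume J: "finite J" "J \<subseteq> (UNIV::'i set)" and F: "\<And>j. j \<in> J \<Longrightarrow> F j \<in> sets M"
    have "prod_emb (UNIV::'i set) (\<lambda>_. M) J (Pi\<^sub>E J F) = {x\<in>space Q. \<forall>j\<in>J. x j \<in> (if j \<in> J then F j else {})}"
      unfolding sp by (auto simp: prod_emb_def space_PiM PiE_iff)
    then show "emeasure Q (prod_emb (UNIV::'i set) (\<lambda>_. M) J (Pi\<^sub>E J F)) = (\<Prod>j\<in>J. emeasure M (F j))"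
      using eq[of J "\<lambda>j. if j \<in> J then F j else {}"] J F by simp
  qed
qed

lemma nn_integral_iid_prod:
  assumes M: "prob_space M" and J: "finite J" and g[measurable]: "\<And>j. j \<in> J \<Longrightarrow> g j \<in> borel_measurable M"
  shows "(\<integral>\<^sup>+x. (\<Prod>j\<in>J. g j (x j)) \<partial>(\<Pi>\<^sub>M i\<in>(UNIV::'i set). M)) = (\<Prod>j\<in>J. \<integral>\<^sup>+x. g j x \<partial>M)"
proof -
  interpret product_prob_space "\<lambda>_. M" "UNIV :: 'i set" by (rule product_prob_spaceI) (rule M)
  have *: "(\<integral>\<^sup>+x. (\<Prod>j\<in>J. g j (x j)) \<partial>(\<Pi>\<^sub>M i\<in>J. M)) = (\<Prod>j\<in>J. \<integral>\<^sup>+x. g j x \<partial>M)"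
    using J g by (intro product_nn_integral_prod) auto
  have [measurable]: "(\<lambda>x. \<Prod>j\<in>J. g j (x j)) \<in> borel_measurable (\<Pi>\<^sub>M i\<in>J. M)"
    using g by (intro borel_measurable_prod_ennreal) auto
  have "(\<integral>\<^sup>+x. (\<Prod>j\<in>J. g j (x j)) \<partial>(\<Pi>\<^sub>M i\<in>J. M))
      = (\<integral>\<^sup>+x. (\<Prod>j\<in>J. g j (x j)) \<partial>(distr (\<Pi>\<^sub>M i\<in>(UNIV::'i set). M) (\<Pi>\<^sub>M i\<in>J. M) (\<lambda>x. restrict x J)))"
    using J by (subst distr_PiM_restrict_finite) auto
  also have "\<dots> = (\<integral>\<^sup>+x. (\<Prod>j\<in>J. g j (restrict x J j)) \<partial>(\<Pi>\<^sub>M i\<in>(UNIV::'i set). M))"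
    by (subst nn_integral_distr) (auto intro: measurable_restrict_subset)
  also have "\<dots> = (\<integral>\<^sup>+x. (\<Prod>j\<in>J. g j (x j)) \<partial>(\<Pi>\<^sub>M i\<in>(UNIV::'i set). M))"
    by (intro nn_integral_cong prod.cong) auto
  finally show ?thesis using * by simp
qed

lemma emeasure_iid_Collect:
  assumes M: "prob_space M" and J: "finite J" and A: "\<And>j. j \<in> J \<Longrightarrow> A j \<in> sets M"
  shows "emeasure (\<Pi>\<^sub>M i\<in>(UNIV::'i set). M) {x\<in>space (\<Pi>\<^sub>M i\<in>(UNIV::'i set). M). \<forall>j\<in>J. x j \<in> A j} = (\<Prod>j\<in>J. emeasure M (A j))"
proof -
  interpret product_prob_space "\<lambda>_. M" "UNIV :: 'i set" by (rule product_prob_spaceI) (rule M)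
  show ?thesis using J A by (subst emeasure_PiM_Collect) auto
qed

lemma distr_iid_map:
  fixes T :: "'a \<Rightarrow> 'b"
  assumes M: "prob_space M" and T[measurable]: "T \<in> measurable M N"
  shows "distr (\<Pi>\<^sub>M i\<in>(UNIV::'i set). M) (\<Pi>\<^sub>M i\<in>(UNIV::'i set). N) (\<lambda>x i. T (x i)) = (\<Pi>\<^sub>M i\<in>(UNIV::'i set). distr M N T)"
proof (rule iid_eqI)
  show "prob_space (distr M N T)" by (rule prob_space.prob_space_distr[OF M T])
  show "sets (distr (\<Pi>\<^sub>M i\<in>(UNIV::'i set). M) (\<Pi>\<^sub>M i\<in>(UNIV::'i set). N) (\<lambda>x i. T (x i))) = sets (\<Pi>\<^sub>M i\<in>(UNIV::'i set). distr M N T)"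
    by (simp cong: sets_PiM_cong)
  fix J :: "'i set" and A :: "'i \<Rightarrow> 'b set" assume J: "finite J" and A: "\<And>j. A j \<in> sets (distr M N T)"
  then have [measurable]: "\<And>j. A j \<in> sets N" by simp
  have meas: "(\<lambda>x i. T (x i)) \<in> measurable (\<Pi>\<^sub>M i\<in>(UNIV::'i set). M) (\<Pi>\<^sub>M i\<in>(UNIV::'i set). N)"
    by (rule measurable_PiM_single') (auto simp: space_PiM Pi_iff PiE_iff intro!: measurable_space[OF T])
  have set: "{x \<in> space (\<Pi>\<^sub>M i\<in>(UNIV::'i set). N). \<forall>j\<in>J. x j \<in> A j} \<in> sets (\<Pi>\<^sub>M i\<in>(UNIV::'i set). N)"
    using J by measurable
  have "emeasure (distr (\<Pi>\<^sub>M i\<in>(UNIV::'i set). M) (\<Pi>\<^sub>M i\<in>(UNIV::'i set). N) (\<lambda>x i. T (x i)))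
      {x \<in> space (\<Pi>\<^sub>M i\<in>(UNIV::'i set). N). \<forall>j\<in>J. x j \<in> A j}
    = emeasure (\<Pi>\<^sub>M i\<in>(UNIV::'i set). M) {x\<in>space (\<Pi>\<^sub>M i\<in>(UNIV::'i set). M). \<forall>j\<in>J. x j \<in> T -` A j \<inter> space M}"
    unfolding emeasure_distr[OF meas set]
    by (rule arg_cong[where f="emeasure _"]) (use measurable_space[OF meas] in \<open>auto simp: space_PiM PiE_iff\<close>)
  also have "\<dots> = (\<Prod>j\<in>J. emeasure (distr M N T) (A j))"
    using J by (subst emeasure_iid_Collect[OF M]) (auto simp: emeasure_distr)
  finally show "emeasure (distr (\<Pi>\<^sub>M i\<in>(UNIV::'i set). M) (\<Pi>\<^sub>M i\<in>(UNIV::'i set). N) (\<lambda>x i. T (x i)))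
      {x \<in> space (distr (\<Pi>\<^sub>M i\<in>(UNIV::'i set). M) (\<Pi>\<^sub>M i\<in>(UNIV::'i set). N) (\<lambda>x i. T (x i))). \<forall>j\<in>J. x j \<in> A j}
     = (\<Prod>j\<in>J. emeasure (distr M N T) (A j))" by simp
qed

definition zip_seq :: "('i \<Rightarrow> 'a) \<times> ('i \<Rightarrow> 'b) \<Rightarrow> 'i \<Rightarrow> 'a \<times> 'b" where
  "zip_seq = (\<lambda>(a, b) i. (a i, b i))"

lemma zip_seq_apply [simp]: "zip_seq x i = (fst x i, snd x i)"
  by (simp add: zip_seq_def case_prod_beta)

lemma measurable_zip_seq [measurable]:
  "zip_seq \<in> measurable ((\<Pi>\<^sub>M i\<in>(UNIV::'i set). A) \<Otimes>\<^sub>M (\<Pi>\<^sub>M i\<in>(UNIV::'i set). B)) (\<Pi>\<^sub>M i\<in>(UNIV::'i set). A \<Otimes>\<^sub>M B)"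
  by (rule measurable_PiM_single') (auto simp: space_PiM PiE_iff space_pair_measure)

text \<open>With the first sequence fixed, a cylinder condition on the zipped sequence is a cylinder
  condition on the second one, whose probability is a product over the indices; integrating that
  product over the first sequence gives the product of the pair probabilities.\<close>

lemma distr_zip_seq:
  fixes A :: "'a measure" and B :: "'b measure"
  assumes A: "prob_space A" and B: "prob_space B"
  shows "distr ((\<Pi>\<^sub>M i\<in>(UNIV::'i set). A) \<Otimes>\<^sub>M (\<Pi>\<^sub>M i\<in>(UNIV::'i set). B)) (\<Pi>\<^sub>M i\<in>(UNIV::'i set). A \<Otimes>\<^sub>M B) zip_seq
    = (\<Pi>\<^sub>M i\<in>(UNIV::'i set). A \<Otimes>\<^sub>M B)"
proof (rule iid_eqI)
  interpret A: prob_space A by fact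
  interpret B: prob_space B by fact
  interpret AB: pair_prob_space A B ..
  interpret pA: prob_space "\<Pi>\<^sub>M i\<in>(UNIV::'i set). A" by (rule prob_space_iid) fact
  interpret pB: prob_space "\<Pi>\<^sub>M i\<in>(UNIV::'i set). B" by (rule prob_space_iid) fact
  show "prob_space (A \<Otimes>\<^sub>M B)" by (rule AB.prob_space_axioms)
  fix J :: "'i set" and F :: "'i \<Rightarrow> ('a \<times> 'b) set" assume J: "finite J" and [measurable]: "\<And>j. F j \<in> sets (A \<Otimes>\<^sub>M B)"
  let ?Z = "{x \<in> space (\<Pi>\<^sub>M i\<in>(UNIV::'i set). A \<Otimes>\<^sub>M B). \<forall>j\<in>J. x j \<in> F j}"
  have [measurable]: "?Z \<in> sets (\<Pi>\<^sub>M i\<in>(UNIV::'i set). A \<Otimes>\<^sub>M B)" using J by measurable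
  have "emeasure (distr ((\<Pi>\<^sub>M i\<in>(UNIV::'i set). A) \<Otimes>\<^sub>M (\<Pi>\<^sub>M i\<in>(UNIV::'i set). B)) (\<Pi>\<^sub>M i\<in>(UNIV::'i set). A \<Otimes>\<^sub>M B) zip_seq) ?Z
    = emeasure ((\<Pi>\<^sub>M i\<in>(UNIV::'i set). A) \<Otimes>\<^sub>M (\<Pi>\<^sub>M i\<in>(UNIV::'i set). B)) (zip_seq -` ?Z \<inter> space ((\<Pi>\<^sub>M i\<in>(UNIV::'i set). A) \<Otimes>\<^sub>M (\<Pi>\<^sub>M i\<in>(UNIV::'i set). B)))"
    by (rule emeasure_distr) measurable
  also have "\<dots> = (\<integral>\<^sup>+a. emeasure (\<Pi>\<^sub>M i\<in>(UNIV::'i set). B) (Pair a -` (zip_seq -` ?Z \<inter> space ((\<Pi>\<^sub>M i\<in>(UNIV::'i set). A) \<Otimes>\<^sub>M (\<Pi>\<^sub>M i\<in>(UNIV::'i set). B)))) \<partial>(\<Pi>\<^sub>M i\<in>(UNIV::'i set). A))"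
    by (rule pB.emeasure_pair_measure_alt) measurable
  also have "\<dots> = (\<integral>\<^sup>+a. (\<Prod>j\<in>J. emeasure B (Pair (a j) -` F j)) \<partial>(\<Pi>\<^sub>M i\<in>(UNIV::'i set). A))"
  proof (rule nn_integral_cong)
    fix a assume a: "a \<in> space (\<Pi>\<^sub>M i\<in>(UNIV::'i set). A)"
    then have aj: "a j \<in> space A" for j by (auto simp: space_PiM PiE_iff)
    have [measurable]: "Pair (a j) -` F j \<in> sets B" for j by (rule sets_Pair1) measurable
    have "Pair a -` (zip_seq -` ?Z \<inter> space ((\<Pi>\<^sub>M i\<in>(UNIV::'i set). A) \<Otimes>\<^sub>M (\<Pi>\<^sub>M i\<in>(UNIV::'i set). B)))
       = {b\<in>space (\<Pi>\<^sub>M i\<in>(UNIV::'i set). B). \<forall>j\<in>J. b j \<in> Pair (a j) -` F j}"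
      using a aj by (auto simp: space_pair_measure space_PiM PiE_iff)
    then show "emeasure (\<Pi>\<^sub>M i\<in>(UNIV::'i set). B) (Pair a -` (zip_seq -` ?Z \<inter> space ((\<Pi>\<^sub>M i\<in>(UNIV::'i set). A) \<Otimes>\<^sub>M (\<Pi>\<^sub>M i\<in>(UNIV::'i set). B))))
       = (\<Prod>j\<in>J. emeasure B (Pair (a j) -` F j))"
      using J by (simp only:) (rule emeasure_iid_Collect[OF B], auto)
  qed
  also have "\<dots> = (\<Prod>j\<in>J. \<integral>\<^sup>+a. emeasure B (Pair a -` F j) \<partial>A)"
    by (rule nn_integral_iid_prod[OF A J]) (auto intro!: B.measurable_emeasure_Pair)
  also have "\<dots> = (\<Prod>j\<in>J. emeasure (A \<Otimes>\<^sub>M B) (F j))"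
    by (subst B.emeasure_pair_measure_alt) auto
  finally show "emeasure (distr ((\<Pi>\<^sub>M i\<in>(UNIV::'i set). A) \<Otimes>\<^sub>M (\<Pi>\<^sub>M i\<in>(UNIV::'i set). B)) (\<Pi>\<^sub>M i\<in>(UNIV::'i set). A \<Otimes>\<^sub>M B) zip_seq)
      {x \<in> space (distr ((\<Pi>\<^sub>M i\<in>(UNIV::'i set). A) \<Otimes>\<^sub>M (\<Pi>\<^sub>M i\<in>(UNIV::'i set). B)) (\<Pi>\<^sub>M i\<in>(UNIV::'i set). A \<Otimes>\<^sub>M B) zip_seq). \<forall>j\<in>J. x j \<in> F j}
     = (\<Prod>j\<in>J. emeasure (A \<Otimes>\<^sub>M B) (F j))" by simp
qed simp

lemma distr_unzip_seq:
  assumes A: "prob_space A" and B: "prob_space B"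
  shows "distr (\<Pi>\<^sub>M i\<in>(UNIV::'i set). A \<Otimes>\<^sub>M B) ((\<Pi>\<^sub>M i\<in>(UNIV::'i set). A) \<Otimes>\<^sub>M (\<Pi>\<^sub>M i\<in>(UNIV::'i set). B))
      (\<lambda>f. (\<lambda>i. fst (f i), \<lambda>i. snd (f i))) = (\<Pi>\<^sub>M i\<in>(UNIV::'i set). A) \<Otimes>\<^sub>M (\<Pi>\<^sub>M i\<in>(UNIV::'i set). B)"
proof -
  have m1: "(\<lambda>f i. fst (f i)) \<in> measurable (\<Pi>\<^sub>M i\<in>(UNIV::'i set). A \<Otimes>\<^sub>M B) (\<Pi>\<^sub>M i\<in>(UNIV::'i set). A)"
    by (rule measurable_PiM_single') (auto simp: space_PiM PiE_iff space_pair_measure mem_Times_iff)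
  have m2: "(\<lambda>f i. snd (f i)) \<in> measurable (\<Pi>\<^sub>M i\<in>(UNIV::'i set). A \<Otimes>\<^sub>M B) (\<Pi>\<^sub>M i\<in>(UNIV::'i set). B)"
    by (rule measurable_PiM_single') (auto simp: space_PiM PiE_iff space_pair_measure mem_Times_iff)
  show ?thesis
    apply (subst distr_zip_seq[OF A B, symmetric])
    apply (subst distr_distr)
    using m1 m2 apply measurable
    apply (simp add: comp_def distr_id)
    done
qed

text \<open>Injectivity of \<open>g\<close> makes the index sets of different rows disjoint, and
  restrictions of an i.i.d. family to disjoint index sets are independent. This turns the doubly
  indexed family of arc failures into an i.i.d. sequence of rows.\<close>

lemma distr_rows:
  assumes B: "prob_space B" and g: "inj (\<lambda>(i, j). g i j)"
  shows "distr (\<Pi>\<^sub>M e\<in>(UNIV::'e set). B) (\<Pi>\<^sub>M i\<in>(UNIV::'i set). \<Pi>\<^sub>M j\<in>(UNIV::'j set). B) (\<lambda>E i j. E (g i j)) = (\<Pi>\<^sub>M i\<in>(UNIV::'i set). \<Pi>\<^sub>M j\<in>(UNIV::'j set). B)"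
proof -
  let ?E = "\<Pi>\<^sub>M e\<in>(UNIV::'e set). B"
  interpret E: prob_space ?E by (rule prob_space_iid) fact
  interpret Q: product_prob_space "\<lambda>_. B" UNIV by (rule product_prob_spaceI) (rule B)
  have row: "distr ?E (\<Pi>\<^sub>M j\<in>(UNIV::'j set). B) (\<lambda>E j. E (g i j)) = (\<Pi>\<^sub>M j\<in>(UNIV::'j set). B)" for i
    using distr_PiM_reindex[of UNIV "\<lambda>_. B" "g i" UNIV] B g by (auto simp: inj_on_def restrict_def)
  have m: "(\<lambda>E j. E (g i j)) \<in> measurable ?E (\<Pi>\<^sub>M j\<in>(UNIV::'j set). B)" for i
    by (rule measurable_PiM_single') (auto simp: space_PiM PiE_iff)
  have ind0: "E.indep_vars (\<lambda>_. B) (\<lambda>e E. E e) UNIV"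
  proof -
    have "distr ?E B (\<lambda>E. E e) = B" for e by (rule distr_PiM_component) (auto simp: B)
    then show ?thesis
      by (subst E.indep_vars_iff_distr_eq_PiM) (auto simp: restrict_def distr_id)
  qed
  define K where "K i = range (g i)" for i
  have "disjoint_family_on K UNIV"
    using g by (auto simp: disjoint_family_on_def K_def inj_on_def)
  then have ind1: "E.indep_vars (\<lambda>i. PiM (K i) (\<lambda>_. B)) (\<lambda>i E. restrict E (K i)) UNIV"
    using E.indep_vars_restrict[OF ind0, of UNIV K] by auto
  have mi: "(\<lambda>f j. f (g i j)) \<in> measurable (PiM (K i) (\<lambda>_. B)) (\<Pi>\<^sub>M j\<in>(UNIV::'j set). B)" for i
    by (rule measurable_PiM_single') (auto simp: space_PiM PiE_iff K_def)
  have "E.indep_vars (\<lambda>i. \<Pi>\<^sub>M j\<in>(UNIV::'j set). B) (\<lambda>i. (\<lambda>f j. f (g i j)) \<circ> (\<lambda>E. restrict E (K i))) UNIV"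
    by (rule E.indep_vars_compose[OF ind1]) (rule mi)
  then have "E.indep_vars (\<lambda>i. \<Pi>\<^sub>M j\<in>(UNIV::'j set). B) (\<lambda>i E j. E (g i j)) UNIV"
    by (simp add: comp_def K_def)
  then show ?thesis
    by (subst (asm) E.indep_vars_iff_distr_eq_PiM) (auto simp: row m restrict_def)
qed

lemma distr_upd:
  assumes "prob_space M"
  shows "distr (M \<Otimes>\<^sub>M (\<Pi>\<^sub>M i\<in>(UNIV::'i set). M)) (\<Pi>\<^sub>M i\<in>(UNIV::'i set). M) (\<lambda>(x, X). X(i := x)) = (\<Pi>\<^sub>M i\<in>(UNIV::'i set). M)"
  using distr_pair_PiM_eq_PiM[of UNIV "\<lambda>_. M" i] assms by simp

text \<open>Fubini in conditional form: \<open>Q\<close> is a consequence of \<open>P\<close>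
  visible in the first coordinate, and the bound on the fibre is only required where
  \<open>Q\<close> holds. This is how one independent component is separated from the rest in the
  estimates below.\<close>

lemma measure_pair_le:
  assumes A: "prob_space A" and B: "prob_space B"
    and P[measurable]: "Measurable.pred (A \<Otimes>\<^sub>M B) P" and Q[measurable]: "Measurable.pred A Q"
    and c: "0 \<le> c"
    and le: "\<And>x. x \<in> space A \<Longrightarrow> Q x \<Longrightarrow> \<P>(y in B. P (x, y)) \<le> c"
    and imp: "\<And>x y. x \<in> space A \<Longrightarrow> y \<in> space B \<Longrightarrow> P (x, y) \<Longrightarrow> Q x"
  shows "\<P>(z in A \<Otimes>\<^sub>M B. P z) \<le> c * \<P>(x in A. Q x)"
proof -
  interpret A: prob_space A by fact
  interpret B: prob_space B by fact
  interpret AB: pair_prob_space A B ..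
  have "emeasure (A \<Otimes>\<^sub>M B) {z\<in>space (A \<Otimes>\<^sub>M B). P z}
      = (\<integral>\<^sup>+x. emeasure B (Pair x -` {z\<in>space (A \<Otimes>\<^sub>M B). P z}) \<partial>A)"
    by (rule B.emeasure_pair_measure_alt) measurable
  also have "\<dots> \<le> (\<integral>\<^sup>+x. ennreal c * indicator {x\<in>space A. Q x} x \<partial>A)"
  proof (rule nn_integral_mono)
    fix x assume x: "x \<in> space A"
    then have eq: "Pair x -` {z\<in>space (A \<Otimes>\<^sub>M B). P z} = {y\<in>space B. P (x, y)}"
      by (auto simp: space_pair_measure)
    show "emeasure B (Pair x -` {z\<in>space (A \<Otimes>\<^sub>M B). P z}) \<le> ennreal c * indicator {x\<in>space A. Q x} x"
    proof (cases "Q x")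
      case True
      then show ?thesis using x le[OF x] unfolding eq
        by (simp add: B.emeasure_eq_measure ennreal_leI)
    next
      case False
      then have "{y\<in>space B. P (x, y)} = {}" using imp[OF x] by auto
      then show ?thesis unfolding eq by (simp only: emeasure_empty) simp
    qed
  qed
  also have "\<dots> = ennreal (c * \<P>(x in A. Q x))"
    using c by (simp add: nn_integral_cmult A.emeasure_eq_measure ennreal_mult)
  finally show ?thesis
    using c by (simp add: AB.emeasure_eq_measure)
qed

lemma measure_pair_ge:
  assumes A: "prob_space A" and B: "prob_space B"
    and P[measurable]: "Measurable.pred (A \<Otimes>\<^sub>M B) P" and Q[measurable]: "Measurable.pred A Q"
    and c: "0 \<le> c"
    and le: "\<And>x. x \<in> space A \<Longrightarrow> Q x \<Longrightarrow> c \<le> \<P>(y in B. P (x, y))"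
  shows "c * \<P>(x in A. Q x) \<le> \<P>(z in A \<Otimes>\<^sub>M B. P z)"
proof -
  interpret A: prob_space A by fact
  interpret B: prob_space B by fact
  interpret AB: pair_prob_space A B ..
  have "ennreal (c * \<P>(x in A. Q x)) = (\<integral>\<^sup>+x. ennreal c * indicator {x\<in>space A. Q x} x \<partial>A)"
    using c by (simp add: nn_integral_cmult A.emeasure_eq_measure ennreal_mult)
  also have "\<dots> \<le> (\<integral>\<^sup>+x. emeasure B (Pair x -` {z\<in>space (A \<Otimes>\<^sub>M B). P z}) \<partial>A)"
  proof (rule nn_integral_mono)
    fix x assume x: "x \<in> space A"
    then have eq: "Pair x -` {z\<in>space (A \<Otimes>\<^sub>M B). P z} = {y\<in>space B. P (x, y)}"
      by (auto simp: space_pair_measure)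
    show "ennreal c * indicator {x\<in>space A. Q x} x \<le> emeasure B (Pair x -` {z\<in>space (A \<Otimes>\<^sub>M B). P z})"
      using x le[OF x] unfolding eq
      by (cases "Q x") (simp_all add: B.emeasure_eq_measure ennreal_leI)
  qed
  also have "\<dots> = emeasure (A \<Otimes>\<^sub>M B) {z\<in>space (A \<Otimes>\<^sub>M B). P z}"
    by (rule B.emeasure_pair_measure_alt[symmetric]) measurable
  finally show ?thesis
    using c by (simp add: AB.emeasure_eq_measure)
qed

lemma measure_pair_cong:
  assumes A: "prob_space A" and B: "prob_space B"
    and P[measurable]: "Measurable.pred (A \<Otimes>\<^sub>M B) P" and Q[measurable]: "Measurable.pred A Q"
    and c: "0 \<le> c"
    and eq: "\<And>x. x \<in> space A \<Longrightarrow> Q x \<Longrightarrow> \<P>(y in B. P (x, y)) = c"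
    and imp: "\<And>x y. x \<in> space A \<Longrightarrow> y \<in> space B \<Longrightarrow> P (x, y) \<Longrightarrow> Q x"
  shows "\<P>(z in A \<Otimes>\<^sub>M B. P z) = c * \<P>(x in A. Q x)"
  using measure_pair_le[OF A B P Q c _ imp] measure_pair_ge[OF A B P Q c] eq
  by (intro antisym) auto

lemma measure_distr_pred:
  assumes "distr M N f = N'" "f \<in> measurable M N" "Measurable.pred N P" "sets N' = sets N"
  shows "\<P>(x in N'. P x) = \<P>(x in M. P (f x))"
proof -
  have [measurable]: "f \<in> measurable M N" "Measurable.pred N P" by fact+
  have sp: "space N' = space N" by (rule sets_eq_imp_space_eq) fact
  have "\<P>(x in N'. P x) = measure (distr M N f) {x\<in>space N. P x}" using assms(1) sp by simp
  also have "\<dots> = measure M (f -` {x\<in>space N. P x} \<inter> space M)"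
    by (rule measure_distr) measurable
  also have "f -` {x\<in>space N. P x} \<inter> space M = {x\<in>space M. P (f x)}"
    using measurable_space[OF assms(2)] by auto
  finally show ?thesis .
qed

lemma measurable_upd[measurable (raw)]:
  assumes f: "f \<in> measurable N (\<Pi>\<^sub>M i\<in>(UNIV::'i set). M)" and g: "g \<in> measurable N M"
  shows "(\<lambda>x. (f x)(i := g x)) \<in> measurable N (\<Pi>\<^sub>M i\<in>(UNIV::'i set). M)"
  using measurable_fun_upd[where J=UNIV and I=UNIV, OF _ f g] by simp

text \<open>Overwriting one coordinate by an independent mark of the same law does not change the
  law of the sequence. This is how a vertex is isolated from the configuration around it.\<close>

lemma prob_upd:
  assumes M: "prob_space M" and P: "Measurable.pred (\<Pi>\<^sub>M i\<in>(UNIV::'i set). M) P"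
  shows "\<P>(x in (\<Pi>\<^sub>M i\<in>(UNIV::'i set). M). P x) = \<P>(x in M \<Otimes>\<^sub>M (\<Pi>\<^sub>M i\<in>(UNIV::'i set). M). P ((snd x)(i := fst x)))"
proof -
  have "(\<lambda>(x, X). X(i := x)) \<in> measurable (M \<Otimes>\<^sub>M (\<Pi>\<^sub>M i\<in>(UNIV::'i set). M)) (\<Pi>\<^sub>M i\<in>(UNIV::'i set). M)"
    by measurable
  from measure_distr_pred[OF distr_upd[OF M] this P] show ?thesis by (simp add: case_prod_beta)
qed

lemma measure_pair_swap:
  assumes A: "prob_space A" and B: "prob_space B"
    and P: "Measurable.pred (A \<Otimes>\<^sub>M B) P"
  shows "\<P>(x in A \<Otimes>\<^sub>M B. P x) = \<P>(x in B \<Otimes>\<^sub>M A. P (snd x, fst x))"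
proof -
  interpret A: prob_space A by fact
  interpret B: prob_space B by fact
  interpret AB: pair_prob_space A B ..
  show ?thesis
    using measure_distr_pred[OF AB.distr_pair_swap[symmetric] _ P] by (simp add: case_prod_beta)
qed

lemma emeasure_pred_nn:
  assumes "Measurable.pred M P"
  shows "emeasure M {x\<in>space M. P x} = (\<integral>\<^sup>+x. of_bool (P x) \<partial>M)"
proof -
  have "(\<integral>\<^sup>+x. of_bool (P x) \<partial>M) = (\<integral>\<^sup>+x. indicator {x\<in>space M. P x} x \<partial>M)"
    by (rule nn_integral_cong) (auto simp: indicator_def)
  then show ?thesis using assms by simp
qed

lemma measure_pair_assoc:
  assumes A: "prob_space A" and B: "prob_space B" and C: "prob_space C"
    and P[measurable]: "Measurable.pred ((A \<Otimes>\<^sub>M B) \<Otimes>\<^sub>M C) P"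
  shows "\<P>(x in (A \<Otimes>\<^sub>M B) \<Otimes>\<^sub>M C. P x) = \<P>(x in A \<Otimes>\<^sub>M (B \<Otimes>\<^sub>M C). P ((fst x, fst (snd x)), snd (snd x)))"
proof -
  interpret A: prob_space A by fact
  interpret B: prob_space B by fact
  interpret C: prob_space C by fact
  interpret AB: pair_prob_space A B ..
  interpret BC: pair_prob_space B C ..
  have *: "(\<integral>\<^sup>+y. of_bool (P ((x, fst y), snd y)) \<partial>(B \<Otimes>\<^sub>M C)) = (\<integral>\<^sup>+y. \<integral>\<^sup>+z. of_bool (P ((x, y), z)) \<partial>C \<partial>B)"
    if "x \<in> space A" for x
    using that by (subst C.nn_integral_fst[symmetric]) auto
  have "emeasure ((A \<Otimes>\<^sub>M B) \<Otimes>\<^sub>M C) {x\<in>space ((A \<Otimes>\<^sub>M B) \<Otimes>\<^sub>M C). P x}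
     = emeasure (A \<Otimes>\<^sub>M (B \<Otimes>\<^sub>M C)) {x\<in>space (A \<Otimes>\<^sub>M (B \<Otimes>\<^sub>M C)). P ((fst x, fst (snd x)), snd (snd x))}"
    by (simp add: emeasure_pred_nn C.nn_integral_fst[symmetric] B.nn_integral_fst[symmetric] BC.nn_integral_fst[symmetric] * cong: nn_integral_cong)
  then show ?thesis unfolding measure_def by simp
qed

lemma measure_pair_swap_nested:
  assumes A: "prob_space A" and B: "prob_space B" and C: "prob_space C"
    and P[measurable]: "Measurable.pred (A \<Otimes>\<^sub>M (B \<Otimes>\<^sub>M C)) P"
  shows "\<P>(x in A \<Otimes>\<^sub>M (B \<Otimes>\<^sub>M C). P x) = \<P>(x in B \<Otimes>\<^sub>M (A \<Otimes>\<^sub>M C). P (fst (snd x), (fst x, snd (snd x))))"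
proof -
  interpret A: prob_space A by fact
  interpret B: prob_space B by fact
  interpret C: prob_space C by fact
  interpret AB: pair_prob_space A B ..
  interpret BC: pair_prob_space B C ..
  interpret AC: pair_prob_space A C ..
  have 1: "(\<integral>\<^sup>+y. of_bool (P (x, y)) \<partial>(B \<Otimes>\<^sub>M C)) = (\<integral>\<^sup>+y. \<integral>\<^sup>+z. of_bool (P (x, (y, z))) \<partial>C \<partial>B)"
    if "x \<in> space A" for x
    using that by (subst C.nn_integral_fst[symmetric]) auto
  have 2: "(\<integral>\<^sup>+y. of_bool (P (fst y, (x, snd y))) \<partial>(A \<Otimes>\<^sub>M C)) = (\<integral>\<^sup>+y. \<integral>\<^sup>+z. of_bool (P (y, (x, z))) \<partial>C \<partial>A)"
    if "x \<in> space B" for x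
    using that by (subst C.nn_integral_fst[symmetric]) auto
  have "emeasure (A \<Otimes>\<^sub>M (B \<Otimes>\<^sub>M C)) {x\<in>space (A \<Otimes>\<^sub>M (B \<Otimes>\<^sub>M C)). P x}
     = (\<integral>\<^sup>+a. \<integral>\<^sup>+b. \<integral>\<^sup>+c. of_bool (P (a, (b, c))) \<partial>C \<partial>B \<partial>A)"
    by (simp add: emeasure_pred_nn BC.nn_integral_fst[symmetric] 1 cong: nn_integral_cong)
  also have "\<dots> = (\<integral>\<^sup>+b. \<integral>\<^sup>+a. \<integral>\<^sup>+c. of_bool (P (a, (b, c))) \<partial>C \<partial>A \<partial>B)"
    by (rule AB.Fubini'[symmetric]) measurable
  also have "\<dots> = emeasure (B \<Otimes>\<^sub>M (A \<Otimes>\<^sub>M C)) {x\<in>space (B \<Otimes>\<^sub>M (A \<Otimes>\<^sub>M C)). P (fst (snd x), (fst x, snd (snd x)))}"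
    by (simp add: emeasure_pred_nn AC.nn_integral_fst[symmetric] 2 cong: nn_integral_cong)
  finally show ?thesis unfolding measure_def by simp
qed

lemma prob_pair_fst:
  assumes A: "prob_space A" and B: "prob_space B" and P[measurable]: "Measurable.pred A P"
  shows "\<P>(x in A \<Otimes>\<^sub>M B. P (fst x)) = \<P>(x in A. P x)"
proof -
  interpret B: prob_space B by fact
  have "distr (A \<Otimes>\<^sub>M B) A fst = A" by (rule B.distr_pair_fst)
  from measure_distr_pred[OF this measurable_fst P] show ?thesis by simp
qed

lemma prob_pair_snd:
  assumes A: "prob_space A" and B: "prob_space B" and P[measurable]: "Measurable.pred B P"
  shows "\<P>(x in A \<Otimes>\<^sub>M B. P (snd x)) = \<P>(x in B. P x)"
  using measure_pair_swap[OF A B, of "\<lambda>x. P (snd x)"] prob_pair_fst[OF B A P] by simp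

lemma prob_pair_Times:
  assumes A: "prob_space A" and B: "prob_space B"
    and P[measurable]: "Measurable.pred A P" and Q[measurable]: "Measurable.pred B Q"
  shows "\<P>(x in A \<Otimes>\<^sub>M B. P (fst x) \<and> Q (snd x)) = \<P>(x in A. P x) * \<P>(x in B. Q x)"
  by (subst measure_pair_cong[OF A B, where Q=P and c="\<P>(x in B. Q x)"]) (auto simp: cong: conj_cong)

lemma prob_union_bound:
  assumes M: "prob_space M" and I: "finite I"
    and P[measurable]: "\<And>i. i \<in> I \<Longrightarrow> Measurable.pred M (P i)"
    and b: "\<And>i. i \<in> I \<Longrightarrow> \<P>(x in M. P i x) \<le> b i"
  shows "\<P>(x in M. \<exists>i\<in>I. P i x) \<le> (\<Sum>i\<in>I. b i)"
proof -
  interpret prob_space M by fact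
  have "{x\<in>space M. \<exists>i\<in>I. P i x} = (\<Union>i\<in>I. {x\<in>space M. P i x})" by auto
  moreover have "prob \<dots> \<le> (\<Sum>i\<in>I. \<P>(x in M. P i x))"
    using I by (intro measure_UNION_le) auto
  ultimately show ?thesis using sum_mono[of I "\<lambda>i. \<P>(x in M. P i x)" b] b by simp
qed

lemma prob_mono_pred:
  assumes M: "prob_space M" and Q[measurable]: "Measurable.pred M Q"
    and imp: "\<And>x. x \<in> space M \<Longrightarrow> P x \<Longrightarrow> Q x"
  shows "\<P>(x in M. P x) \<le> \<P>(x in M. Q x)"
proof -
  interpret prob_space M by fact
  show ?thesis using imp by (intro finite_measure_mono) auto
qed

section \<open>Binomial upper tails, counts of i.i.d. marks and a joint Chernoff bound\<close>

fun btail :: "nat \<Rightarrow> real \<Rightarrow> nat \<Rightarrow> real" where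
  "btail N p 0 = 1"
| "btail 0 p (Suc a) = 0"
| "btail (Suc N) p (Suc a) = p * btail N p a + (1 - p) * btail N p (Suc a)"

lemma btail_01: "0 \<le> p \<Longrightarrow> p \<le> 1 \<Longrightarrow> 0 \<le> btail N p a \<and> btail N p a \<le> 1"
proof (induction N p a rule: btail.induct)
  case (3 N p a)
  have "p * btail N p a + (1 - p) * btail N p (Suc a) \<le> p * 1 + (1 - p) * 1"
    using 3 by (intro add_mono mult_left_mono) auto
  with 3 show ?case by auto
qed auto

lemmas btail_nonneg = btail_01[THEN conjunct1] and btail_le_1 = btail_01[THEN conjunct2]

lemma btail_Suc_le: "0 \<le> p \<Longrightarrow> p \<le> 1 \<Longrightarrow> btail N p (Suc a) \<le> btail N p a"
proof (induction N arbitrary: a)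
  case 0
  then show ?case by (cases a) auto
next
  case (Suc N)
  show ?case
  proof (cases a)
    case 0
    then show ?thesis using btail_le_1[of p "Suc N" "Suc 0"] Suc.prems by simp
  next
    case [simp]: (Suc b)
    show ?thesis using Suc.IH[of b] Suc.IH[of "Suc b"] Suc.prems by (auto intro!: add_mono mult_left_mono)
  qed
qed

lemma btail_mono_N: "0 \<le> p \<Longrightarrow> p \<le> 1 \<Longrightarrow> N \<le> N' \<Longrightarrow> btail N p a \<le> btail N' p a"
proof (rule lift_Suc_mono_le[where f="\<lambda>N. btail N p a"])
  fix N assume p: "0 \<le> p" "p \<le> 1"
  show "btail N p a \<le> btail (Suc N) p a"
  proof (cases a)
    case (Suc b)
    have "0 \<le> p * (btail N p b - btail N p (Suc b))" using p btail_Suc_le[of p N b] by auto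
    then show ?thesis unfolding Suc by (simp add: algebra_simps)
  qed simp
qed

lemma btail_mono_p: "0 \<le> p \<Longrightarrow> p \<le> p' \<Longrightarrow> p' \<le> 1 \<Longrightarrow> btail N p a \<le> btail N p' a"
proof (induction N arbitrary: a)
  case 0
  then show ?case by (cases a) auto
next
  case (Suc N)
  show ?case
  proof (cases a)
    case [simp]: (Suc b)
    have "p * btail N p b + (1 - p) * btail N p (Suc b) \<le> p * btail N p' b + (1 - p) * btail N p' (Suc b)"
      using Suc.prems Suc.IH by (intro add_mono mult_left_mono) auto
    also have "0 \<le> (p' - p) * (btail N p' b - btail N p' (Suc b))"
      using Suc.prems btail_Suc_le[of p' N b] by auto
    then have "p * btail N p' b + (1 - p) * btail N p' (Suc b) \<le> p' * btail N p' b + (1 - p') * btail N p' (Suc b)"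
      by (simp add: algebra_simps)
    finally show ?thesis by simp
  qed simp
qed

lemma card_Collect_insert:
  assumes "finite V" "i \<notin> V"
  shows "card {j\<in>insert i V. P j} = of_bool (P i) + card {j\<in>V. P j}"
proof (cases "P i")
  case True
  then have "{j\<in>insert i V. P j} = insert i {j\<in>V. P j}" by auto
  then show ?thesis using assms True by simp
next
  case False
  then have "{j\<in>insert i V. P j} = {j\<in>V. P j}" by auto
  then show ?thesis using False by simp
qed

lemma card_Collect_sum:
  "finite V \<Longrightarrow> real (card {j\<in>V. P j}) = (\<Sum>j\<in>V. if P j then 1 else 0)"
  by (simp add: sum.If_cases Int_def)

lemma pred_card_Collect[measurable (raw)]:
  assumes V: "finite V" and P[measurable]: "\<And>j. j \<in> V \<Longrightarrow> Measurable.pred M (\<lambda>x. P x j)"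
  shows "Measurable.pred M (\<lambda>x. a \<le> card {j\<in>V. P x j})"
proof -
  have "Measurable.pred M (\<lambda>x. real a \<le> (\<Sum>j\<in>V. if P x j then 1 else 0))"
    by measurable
  then show ?thesis
    using V by (simp add: card_Collect_sum[symmetric])
qed

text \<open>The premise \<open>indep\<close> expresses that \<open>E\<close> ignores coordinate
  \<open>i\<close>; after resampling that coordinate the two events live on different
  factors.\<close>

lemma prob_iid_insert:
  assumes M: "prob_space M" and Q[measurable]: "Measurable.pred M Q"
    and E[measurable]: "Measurable.pred (\<Pi>\<^sub>M i\<in>(UNIV::'i set). M) E"
    and indep: "\<And>f c. E (f(i := c)) = E f"
  shows "\<P>(f in (\<Pi>\<^sub>M i\<in>(UNIV::'i set). M). Q (f i) \<and> E f) = \<P>(x in M. Q x) * \<P>(f in (\<Pi>\<^sub>M i\<in>(UNIV::'i set). M). E f)"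
  by (subst prob_upd[OF M, where i=i]) (auto simp: indep prob_pair_Times M prob_space_iid)

text \<open>Splitting off one index of \<open>V\<close> and conditioning on \<open>Q\<close> there
  yields exactly the recursion of \<open>btail\<close>, so the count is seen to have the binomial
  upper tail without any binomial coefficients.\<close>

lemma prob_iid_card:
  assumes M: "prob_space M" and Q[measurable]: "Measurable.pred M Q" and V: "finite V"
  shows "\<P>(f in (\<Pi>\<^sub>M i\<in>(UNIV::'i set). M). a \<le> card {j\<in>V. Q (f j)}) = btail (card V) \<P>(x in M. Q x) a"
  using V
proof (induction V arbitrary: a)
  case empty
  interpret prob_space "\<Pi>\<^sub>M i\<in>(UNIV::'i set). M" by (rule prob_space_iid) (rule M)
  show ?case by (cases a) (auto simp: prob_space)
next
  case (insert i V)
  let ?O = "\<Pi>\<^sub>M i\<in>(UNIV::'i set). M"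
  interpret O: prob_space ?O by (rule prob_space_iid) (rule M)
  interpret M: prob_space M by (rule M)
  note [simp] = \<open>finite V\<close>
  show ?case
  proof (cases a)
    case 0
    then show ?thesis by (simp add: O.prob_space)
  next
    case [simp]: (Suc b)
    have c: "card {j\<in>V. Q ((f(i := x)) j)} = card {j\<in>V. Q (f j)}" for f x
      using insert.hyps by (intro arg_cong[where f=card]) auto
    have "\<P>(f in ?O. a \<le> card {j\<in>insert i V. Q (f j)})
       = \<P>(f in ?O. (Q (f i) \<and> b \<le> card {j\<in>V. Q (f j)}) \<or> (\<not> Q (f i) \<and> a \<le> card {j\<in>V. Q (f j)}))"
      by (subst card_Collect_insert[OF insert.hyps(1,2)]) (intro arg_cong[where f="measure _"], auto)
    also have "\<dots> = O.prob ({f\<in>space ?O. Q (f i) \<and> b \<le> card {j\<in>V. Q (f j)}} \<union> {f\<in>space ?O. \<not> Q (f i) \<and> a \<le> card {j\<in>V. Q (f j)}})"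
      by (intro arg_cong[where f="measure _"]) auto
    also have "\<dots> = \<P>(f in ?O. Q (f i) \<and> b \<le> card {j\<in>V. Q (f j)}) + \<P>(f in ?O. \<not> Q (f i) \<and> a \<le> card {j\<in>V. Q (f j)})"
      by (rule O.finite_measure_Union) auto
    also have "\<P>(f in ?O. Q (f i) \<and> b \<le> card {j\<in>V. Q (f j)}) = \<P>(x in M. Q x) * btail (card V) \<P>(x in M. Q x) b"
      by (subst prob_iid_insert[OF M]) (simp_all add: c insert.IH del: fun_upd_apply)
    also have "\<P>(f in ?O. \<not> Q (f i) \<and> a \<le> card {j\<in>V. Q (f j)}) = \<P>(x in M. \<not> Q x) * btail (card V) \<P>(x in M. Q x) a"
      by (subst prob_iid_insert[OF M, where Q="\<lambda>x. \<not> Q x"]) (simp_all add: c insert.IH del: fun_upd_apply)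
    also have "\<P>(x in M. \<not> Q x) = 1 - \<P>(x in M. Q x)"
      by (rule M.prob_neg) simp
    finally show ?thesis using insert.hyps by simp
  qed
qed

lemma prob_zip_seq:
  assumes A: "prob_space A" and B: "prob_space B"
    and P: "Measurable.pred (\<Pi>\<^sub>M i\<in>(UNIV::'i set). A \<Otimes>\<^sub>M B) P"
  shows "\<P>(f in (\<Pi>\<^sub>M i\<in>(UNIV::'i set). A \<Otimes>\<^sub>M B). P f)
    = \<P>(x in (\<Pi>\<^sub>M i\<in>(UNIV::'i set). A) \<Otimes>\<^sub>M (\<Pi>\<^sub>M i\<in>(UNIV::'i set). B). P (zip_seq x))"
  by (rule measure_distr_pred[OF distr_zip_seq[OF A B] measurable_zip_seq P refl])

lemma prob_pair_cong_fst:
  assumes A: "prob_space A" and B: "prob_space B"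
    and P[measurable]: "Measurable.pred (A \<Otimes>\<^sub>M B) P" and Q[measurable]: "Measurable.pred (A \<Otimes>\<^sub>M C) Q"
    and C: "prob_space C"
    and eq: "\<And>x. x \<in> space A \<Longrightarrow> \<P>(y in B. P (x, y)) = \<P>(y in C. Q (x, y))"
  shows "\<P>(z in A \<Otimes>\<^sub>M B. P z) = \<P>(z in A \<Otimes>\<^sub>M C. Q z)"
proof -
  interpret A: prob_space A by fact
  interpret B: prob_space B by fact
  interpret C: prob_space C by fact
  have "emeasure (A \<Otimes>\<^sub>M B) {z\<in>space (A \<Otimes>\<^sub>M B). P z}
      = (\<integral>\<^sup>+x. emeasure B (Pair x -` {z\<in>space (A \<Otimes>\<^sub>M B). P z}) \<partial>A)"
    by (rule B.emeasure_pair_measure_alt) measurable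
  also have "\<dots> = (\<integral>\<^sup>+x. emeasure C (Pair x -` {z\<in>space (A \<Otimes>\<^sub>M C). Q z}) \<partial>A)"
  proof (rule nn_integral_cong)
    fix x assume x: "x \<in> space A"
    have "Pair x -` {z\<in>space (A \<Otimes>\<^sub>M B). P z} = {y\<in>space B. P (x, y)}"
      "Pair x -` {z\<in>space (A \<Otimes>\<^sub>M C). Q z} = {y\<in>space C. Q (x, y)}"
      using x by (auto simp: space_pair_measure)
    then show "emeasure B (Pair x -` {z\<in>space (A \<Otimes>\<^sub>M B). P z}) = emeasure C (Pair x -` {z\<in>space (A \<Otimes>\<^sub>M C). Q z})"
      using eq[OF x] by (simp add: B.emeasure_eq_measure C.emeasure_eq_measure)
  qed
  also have "\<dots> = emeasure (A \<Otimes>\<^sub>M C) {z\<in>space (A \<Otimes>\<^sub>M C). Q z}"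
    by (rule C.emeasure_pair_measure_alt[symmetric]) measurable
  finally show ?thesis by (simp add: measure_def)
qed

lemma prob_zip_seq3:
  assumes A: "prob_space A" and B: "prob_space B" and C: "prob_space C"
    and P[measurable]: "Measurable.pred (\<Pi>\<^sub>M i\<in>(UNIV::'i set). A \<Otimes>\<^sub>M (B \<Otimes>\<^sub>M C)) P"
  shows "\<P>(f in (\<Pi>\<^sub>M i\<in>(UNIV::'i set). A \<Otimes>\<^sub>M (B \<Otimes>\<^sub>M C)). P f)
    = \<P>(x in (\<Pi>\<^sub>M i\<in>(UNIV::'i set). A) \<Otimes>\<^sub>M ((\<Pi>\<^sub>M i\<in>(UNIV::'i set). B) \<Otimes>\<^sub>M (\<Pi>\<^sub>M i\<in>(UNIV::'i set). C)).
        P (zip_seq (fst x, zip_seq (snd x))))"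
proof -
  have BC: "prob_space (B \<Otimes>\<^sub>M C)"
  proof -
    interpret B: prob_space B by fact
    interpret C: prob_space C by fact
    interpret BC: pair_prob_space B C ..
    show ?thesis by (rule BC.prob_space_axioms)
  qed
  show ?thesis
    unfolding prob_zip_seq[OF A BC P]
  proof (rule prob_pair_cong_fst)
    fix w :: "'i \<Rightarrow> 'a" assume [measurable]: "w \<in> space (\<Pi>\<^sub>M i\<in>(UNIV::'i set). A)"
    show "\<P>(y in (\<Pi>\<^sub>M i\<in>(UNIV::'i set). B \<Otimes>\<^sub>M C). P (zip_seq (w, y)))
      = \<P>(y in (\<Pi>\<^sub>M i\<in>(UNIV::'i set). B) \<Otimes>\<^sub>M (\<Pi>\<^sub>M i\<in>(UNIV::'i set). C).
        P (zip_seq (fst (w, y), zip_seq (snd (w, y)))))"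
      by (subst prob_zip_seq[OF B C]) auto
  qed (measurable, auto intro!: prob_space_iid A B C BC prob_space_pair)
qed

text \<open>Markov's inequality for \<open>s\<close> to the power of the sum of the two counts. A
  single mark contributes the expectation of \<open>h\<close>, which is
  \<open>1 + (s - 1) P(Q1) + (s - 1) P(Q2) + (s - 1)^2 P(Q1 and Q2)\<close>; only the last term sees
  the dependence, and it is where a small overlap pays off.\<close>

lemma joint_chernoff:
  fixes s :: real
  assumes M: "prob_space M" and Q1[measurable]: "Measurable.pred M Q1" and Q2[measurable]: "Measurable.pred M Q2"
    and V: "finite V" and s: "1 \<le> s"
    and p1: "\<P>(x in M. Q1 x) \<le> p" and p2: "\<P>(x in M. Q2 x) \<le> p" and p12: "\<P>(x in M. Q1 x \<and> Q2 x) \<le> p12"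
  shows "\<P>(f in (\<Pi>\<^sub>M i\<in>(UNIV::'i set). M). a \<le> card {j\<in>V. Q1 (f j)} \<and> a \<le> card {j\<in>V. Q2 (f j)})
    \<le> (1 / s) ^ (2 * a) * exp (card V * (2 * p * (s - 1) + p12 * (s - 1)\<^sup>2))"
proof -
  let ?O = "\<Pi>\<^sub>M i\<in>(UNIV::'i set). M"
  interpret O: prob_space ?O by (rule prob_space_iid) (rule M)
  interpret M: prob_space M by (rule M)
  note [simp] = V
  define h where "h x = s ^ (of_bool (Q1 x)) * s ^ (of_bool (Q2 x))" for x
  have h_nonneg: "0 \<le> h x" for x using s by (simp add: h_def)
  have h_eq: "h x = 1 + (s - 1) * of_bool (Q1 x) + (s - 1) * of_bool (Q2 x) + (s - 1)\<^sup>2 * of_bool (Q1 x \<and> Q2 x)" for x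
    by (cases "Q1 x"; cases "Q2 x") (auto simp: h_def power2_eq_square algebra_simps)
  have [measurable]: "h \<in> borel_measurable M" unfolding h_eq of_bool_def by measurable
  have int: "integrable M (\<lambda>x. indicator {x\<in>space M. Q x} x :: real)" if [measurable]: "Measurable.pred M Q" for Q
    by (rule integrable_real_indicator) (auto simp: M.emeasure_eq_measure)
  have "(\<integral>\<^sup>+x. ennreal (h x) \<partial>M)
    = (\<integral>\<^sup>+x. ennreal (1 + (s - 1) * indicator {x\<in>space M. Q1 x} x + (s - 1) * indicator {x\<in>space M. Q2 x} x
        + (s - 1)\<^sup>2 * indicator {x\<in>space M. Q1 x \<and> Q2 x} x) \<partial>M)"
    by (rule nn_integral_cong) (auto simp: h_eq indicator_def)
  also have "\<dots> = ennreal (\<integral>x. (1 + (s - 1) * indicator {x\<in>space M. Q1 x} x + (s - 1) * indicator {x\<in>space M. Q2 x} x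
        + (s - 1)\<^sup>2 * indicator {x\<in>space M. Q1 x \<and> Q2 x} x) \<partial>M)"
    using s by (intro nn_integral_eq_integral) (auto intro!: Bochner_Integration.integrable_add int AE_I2)
  also have "\<dots> = ennreal (1 + (s - 1) * \<P>(x in M. Q1 x) + (s - 1) * \<P>(x in M. Q2 x) + (s - 1)\<^sup>2 * \<P>(x in M. Q1 x \<and> Q2 x))"
    by (simp add: int M.prob_space)
  also have "\<dots> \<le> ennreal (exp (2 * p * (s - 1) + p12 * (s - 1)\<^sup>2))"
  proof (rule ennreal_leI)
    have "1 + (s - 1) * \<P>(x in M. Q1 x) + (s - 1) * \<P>(x in M. Q2 x) + (s - 1)\<^sup>2 * \<P>(x in M. Q1 x \<and> Q2 x)
       \<le> 1 + (s - 1) * p + (s - 1) * p + (s - 1)\<^sup>2 * p12"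
      using s p1 p2 p12 by (intro add_mono mult_left_mono) auto
    also have "\<dots> = 1 + (2 * p * (s - 1) + p12 * (s - 1)\<^sup>2)" by (simp add: algebra_simps)
    also have "\<dots> \<le> exp (2 * p * (s - 1) + p12 * (s - 1)\<^sup>2)" by (rule exp_ge_add_one_self)
    finally show "1 + (s - 1) * \<P>(x in M. Q1 x) + (s - 1) * \<P>(x in M. Q2 x) + (s - 1)\<^sup>2 * \<P>(x in M. Q1 x \<and> Q2 x)
      \<le> exp (2 * p * (s - 1) + p12 * (s - 1)\<^sup>2)" .
  qed
  finally have E: "(\<integral>\<^sup>+x. ennreal (h x) \<partial>M) \<le> ennreal (exp (2 * p * (s - 1) + p12 * (s - 1)\<^sup>2))" .
  have prod: "(\<Prod>j\<in>V. h (f j)) = s ^ card {j\<in>V. Q1 (f j)} * s ^ card {j\<in>V. Q2 (f j)}" for f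
  proof -
    have "(\<Sum>j\<in>V. of_bool (Q (f j))) = card {j\<in>V. Q (f j)}" for Q
      by (simp add: of_bool_def sum.If_cases Int_def)
    then show ?thesis
      unfolding h_def prod.distrib power_sum[symmetric] by simp
  qed
  have "emeasure ?O {f\<in>space ?O. a \<le> card {j\<in>V. Q1 (f j)} \<and> a \<le> card {j\<in>V. Q2 (f j)}}
    = (\<integral>\<^sup>+f. indicator {f\<in>space ?O. a \<le> card {j\<in>V. Q1 (f j)} \<and> a \<le> card {j\<in>V. Q2 (f j)}} f \<partial>?O)"
    by simp
  also have "\<dots> \<le> (\<integral>\<^sup>+f. ennreal ((1 / s) ^ (2 * a)) * (\<Prod>j\<in>V. ennreal (h (f j))) \<partial>?O)"
  proof (rule nn_integral_mono)
    fix f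
    have pe: "(\<Prod>j\<in>V. ennreal (h (f j))) = ennreal (\<Prod>j\<in>V. h (f j))" using h_nonneg by (simp add: prod_ennreal)
    have "1 \<le> (1 / s) ^ (2 * a) * (\<Prod>j\<in>V. h (f j))" if "a \<le> card {j\<in>V. Q1 (f j)}" "a \<le> card {j\<in>V. Q2 (f j)}"
    proof -
      have "s ^ (2 * a) = s ^ a * s ^ a" by (simp add: mult_2 power_add)
      also have "\<dots> \<le> (\<Prod>j\<in>V. h (f j))"
        unfolding prod using s that by (intro mult_mono power_increasing) auto
      finally show ?thesis using s by (simp add: power_divide field_simps)
    qed
    then show "indicator {f\<in>space ?O. a \<le> card {j\<in>V. Q1 (f j)} \<and> a \<le> card {j\<in>V. Q2 (f j)}} f
       \<le> ennreal ((1 / s) ^ (2 * a)) * (\<Prod>j\<in>V. ennreal (h (f j)))"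
      unfolding pe using s h_nonneg
      by (auto simp: indicator_def ennreal_mult[symmetric] prod_nonneg)
  qed
  also have "\<dots> = ennreal ((1 / s) ^ (2 * a)) * (\<integral>\<^sup>+x. ennreal (h x) \<partial>M) ^ card V"
    using nn_integral_iid_prod[OF M V, of "\<lambda>_ x. ennreal (h x)"] by (subst nn_integral_cmult) auto
  also have "\<dots> \<le> ennreal ((1 / s) ^ (2 * a)) * ennreal (exp (2 * p * (s - 1) + p12 * (s - 1)\<^sup>2)) ^ card V"
    by (intro mult_left_mono power_mono E) auto
  also have "\<dots> = ennreal ((1 / s) ^ (2 * a) * exp (card V * (2 * p * (s - 1) + p12 * (s - 1)\<^sup>2)))"
    using s by (simp add: ennreal_power ennreal_mult exp_of_nat_mult)
  finally show ?thesis
    using s by (simp add: O.emeasure_eq_measure)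
qed

section \<open>Degrees in a marked point model\<close>

text \<open>
  The mark of a vertex is a point of \<open>K\<close> together with the row of failures of the potential arcs
  incident to it in one direction; \<open>R a b\<close> says that \<open>b\<close> may count towards the degree of \<open>a\<close>.
  Out- and in-degrees are two instances.
\<close>

abbreviation edges :: "real \<Rightarrow> (nat \<Rightarrow> bool) measure" where
  "edges q \<equiv> \<Pi>\<^sub>M j\<in>(UNIV::nat set). measure_pmf (bernoulli_pmf q)"

text \<open>The connection probability is bounded by \<open>p0\<close> only from above, since a
  sector may stick out of the unit square. In \<open>near_le\<close>, \<open>4 * \<rho>^2\<close> is
  the area of a square around the disc. In \<open>level_le\<close>, \<open>256 = 4 * 8^2\<close>:
  for given angle and failure state of \<open>b\<close>, the positions with large overlap have
  mutual distance at most \<open>8 * \<eta> * r\<close>.\<close>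

locale mark_model =
  fixes K :: "'z measure" and R :: "'z \<Rightarrow> 'z \<Rightarrow> bool" and ok :: "'z \<Rightarrow> bool"
    and X :: "'z \<Rightarrow> real \<times> real" and r q p0 :: real
  assumes K: "prob_space K"
    and R_measurable: "Measurable.pred (K \<Otimes>\<^sub>M K) (\<lambda>x. R (fst x) (snd x))"
    and ok_measurable[measurable]: "Measurable.pred K ok"
    and X_measurable[measurable]: "X \<in> borel_measurable K"
    and q: "0 \<le> q" "q \<le> 1"
    and R_near: "\<And>a b. R a b \<Longrightarrow> dist (X a) (X b) \<le> r"
    and r: "0 < r"
    and near_le: "\<And>x \<rho>. 0 \<le> \<rho> \<Longrightarrow> \<P>(b in K. dist x (X b) \<le> \<rho>) \<le> 4 * \<rho>\<^sup>2"
    and R_le: "\<And>a. a \<in> space K \<Longrightarrow> \<P>(b in K. R a b) \<le> p0"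
    and p0: "0 \<le> p0" "p0 \<le> 1"
    and level_le: "\<And>a \<eta>. a \<in> space K \<Longrightarrow> 0 \<le> \<eta> \<Longrightarrow>
      \<P>(b in K. dist (X a) (X b) \<le> 2 * r \<and> (1 - \<eta>) * p0 < \<P>(c in K. R a c \<and> R b c)) \<le> 256 * \<eta>\<^sup>2 * r\<^sup>2"
begin

abbreviation Mk :: "('z \<times> (nat \<Rightarrow> bool)) measure" where "Mk \<equiv> K \<Otimes>\<^sub>M edges q"

abbreviation Om :: "(nat \<Rightarrow> 'z \<times> (nat \<Rightarrow> bool)) measure" where "Om \<equiv> \<Pi>\<^sub>M i\<in>(UNIV::nat set). Mk"

text \<open>The index \<open>j\<close> is passed besides the mark \<open>b\<close> because the
  failure of the arc joining the two vertices is stored in the row of \<open>a\<close> at position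
  \<open>j\<close>, not in \<open>b\<close>.\<close>

definition hit :: "'z \<times> (nat \<Rightarrow> bool) \<Rightarrow> nat \<Rightarrow> 'z \<times> (nat \<Rightarrow> bool) \<Rightarrow> bool" where
  "hit a j b \<longleftrightarrow> R (fst a) (fst b) \<and> \<not> snd a j"

definition cnt :: "nat set \<Rightarrow> 'z \<times> (nat \<Rightarrow> bool) \<Rightarrow> (nat \<Rightarrow> 'z \<times> (nat \<Rightarrow> bool)) \<Rightarrow> nat" where
  "cnt V a Z = card {j\<in>V. hit a j (Z j)}"

definition exc :: "nat \<Rightarrow> nat set \<Rightarrow> (nat \<Rightarrow> 'z \<times> (nat \<Rightarrow> bool)) \<Rightarrow> nat \<Rightarrow> bool" where
  "exc k V Z i \<longleftrightarrow> ok (fst (Z i)) \<and> k \<le> cnt (V - {i}) (Z i) Z"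

definition near :: "real \<Rightarrow> 'z \<times> (nat \<Rightarrow> bool) \<Rightarrow> 'z \<times> (nat \<Rightarrow> bool) \<Rightarrow> bool" where
  "near \<rho> a b \<longleftrightarrow> dist (X (fst a)) (X (fst b)) \<le> \<rho>"

definition overlap :: "'z \<Rightarrow> 'z \<Rightarrow> real" where
  "overlap a b = \<P>(c in K. R a c \<and> R b c)"

definition p :: real where "p = (1 - q) * p0"

lemma p01: "0 \<le> p" "p \<le> 1"
  using q p0 by (auto simp: p_def mult_le_one)

lemma edges: "prob_space (edges q)"
  by (rule prob_space_iid) (rule measure_pmf.prob_space_axioms)

lemma Mk: "prob_space Mk"
  by (rule prob_space_pair[OF K edges])

lemma Om: "prob_space Om"
  by (rule prob_space_iid[OF Mk])

lemma R_meas[measurable (raw)]: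
  assumes "f \<in> measurable N K" "g \<in> measurable N K"
  shows "Measurable.pred N (\<lambda>x. R (f x) (g x))"
  using measurable_compose[OF measurable_Pair[OF assms] R_measurable] by (simp only: fst_conv snd_conv)

lemma hit_meas[measurable (raw)]:
  assumes [measurable]: "f \<in> measurable N Mk" "g \<in> measurable N Mk"
  shows "Measurable.pred N (\<lambda>x. hit (f x) j (g x))"
proof -
  have "(\<lambda>x. snd (f x) j) \<in> measurable N (measure_pmf (bernoulli_pmf q))"
    using measurable_component_singleton[of j UNIV "\<lambda>_. measure_pmf (bernoulli_pmf q)"]
    by (intro measurable_compose[OF assms(1)] measurable_compose[OF measurable_snd]) auto
  then have [measurable]: "Measurable.pred N (\<lambda>x. snd (f x) j)" by simp
  show ?thesis unfolding hit_def by measurable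
qed

lemma cnt_meas[measurable (raw)]:
  assumes [measurable]: "f \<in> measurable N Mk" "g \<in> measurable N Om" and V: "finite V"
  shows "(\<lambda>x. cnt V (f x) (g x)) \<in> borel_measurable N"
proof -
  have "(\<lambda>x. \<Sum>j\<in>V. if hit (f x) j (g x j) then 1 else 0 :: nat) \<in> borel_measurable N"
    by measurable
  moreover have "cnt V a Z = (\<Sum>j\<in>V. if hit a j (Z j) then 1 else 0)" for a Z
    unfolding cnt_def using V by (simp add: sum.If_cases Int_def)
  ultimately show ?thesis by simp
qed

lemma exc_meas[measurable (raw)]:
  assumes [measurable]: "g \<in> measurable N Om" and V: "finite V"
  shows "Measurable.pred N (\<lambda>x. exc k V (g x) i)"
proof -
  have [measurable]: "(\<lambda>x. cnt (V - {i}) (g x i) (g x)) \<in> borel_measurable N"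
    by (rule cnt_meas) (use V in auto)
  show ?thesis unfolding exc_def by measurable
qed

lemma near_meas[measurable (raw)]:
  assumes [measurable]: "f \<in> measurable N Mk" "g \<in> measurable N Mk"
  shows "Measurable.pred N (\<lambda>x. near \<rho> (f x) (g x))"
  unfolding near_def by measurable

lemma overlap_meas[measurable]: "(\<lambda>x. overlap (fst x) (snd x)) \<in> borel_measurable (K \<Otimes>\<^sub>M K)"
proof -
  interpret K: prob_space K by (rule K)
  have "(\<lambda>x. emeasure K {c\<in>space K. R (fst x) c \<and> R (snd x) c}) \<in> borel_measurable (K \<Otimes>\<^sub>M K)"
    by (rule K.measurable_emeasure) (auto, measurable)
  then show ?thesis unfolding overlap_def measure_def by measurable
qed

lemma overlap_meas'[measurable (raw)]:
  assumes "f \<in> measurable N K" "g \<in> measurable N K"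
  shows "(\<lambda>x. overlap (f x) (g x)) \<in> borel_measurable N"
  using measurable_compose[OF measurable_Pair[OF assms] overlap_meas] by (simp only: fst_conv snd_conv)

lemma R_upd: "cnt V a (Z(i := b)) = cnt V a Z" if "i \<notin> V"
  unfolding cnt_def using that by (intro arg_cong[where f=card]) auto

lemma hit_near: "hit a j b \<Longrightarrow> near r a b"
  by (auto simp: hit_def near_def R_near)

lemma near_prob: "a \<in> space Mk \<Longrightarrow> 0 \<le> \<rho> \<Longrightarrow> \<P>(b in Mk. near \<rho> a b) \<le> 4 * \<rho>\<^sup>2"
  using near_le[of \<rho> "X (fst a)"] prob_pair_fst[OF K edges, of "\<lambda>b. dist (X (fst a)) (X b) \<le> \<rho>"]
  by (simp add: near_def)

text \<open>
  The Chernoff bound with parameter \<open>s\<close> for the event that two vertices whose neighbourhoods overlap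
  in a proportion at most \<open>1 - \<eta>\<close> both have degree at least \<open>t\<close> among \<open>m\<close> others.
\<close>

definition J :: "nat \<Rightarrow> real \<Rightarrow> nat \<Rightarrow> real \<Rightarrow> real" where
  "J m \<eta> t s = (1 / s) ^ (2 * t) * exp (real m * p * (2 * (s - 1) + (1 - \<eta>) * (s - 1)\<^sup>2))"

lemma prob_bern_not: "\<P>(b in measure_pmf (bernoulli_pmf q). \<not> b) = 1 - q"
proof -
  have "{b\<in>space (measure_pmf (bernoulli_pmf q)). \<not> b} = {False}" by auto
  then show ?thesis using q by (simp add: measure_pmf_single)
qed

lemma one_zip:
  assumes z: "z \<in> space K"
  shows "\<P>(c in measure_pmf (bernoulli_pmf q) \<Otimes>\<^sub>M Mk. \<not> fst c \<and> R z (fst (snd c))) = (1 - q) * \<P>(b in K. R z b)"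
proof -
  note [measurable] = z
  show ?thesis
    apply (subst prob_pair_Times[where P="\<lambda>b. \<not> b" and Q="\<lambda>y. R z (fst y)"])
    using prob_bern_not prob_pair_fst[OF K edges, of "R z"]
    apply (auto simp: Mk measure_pmf.prob_space_axioms)
    done
qed

text \<open>The row of \<open>z\<close> and the configuration are zipped, so that index
  \<open>j\<close> carries its mark together with the failure of the arc joining it to
  \<open>z\<close>. These pairs are i.i.d., hence the count is exactly binomial.\<close>

lemma one_tail:
  assumes z: "z \<in> space K" and V: "finite V"
  shows "\<P>(x in edges q \<Otimes>\<^sub>M Om. t \<le> cnt V (z, fst x) (snd x)) = btail (card V) ((1 - q) * \<P>(b in K. R z b)) t"
proof -
  note [measurable] = z
  note [simp] = V
  have pp: "prob_space (measure_pmf (bernoulli_pmf q) \<Otimes>\<^sub>M Mk)"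
    by (intro prob_space_pair Mk measure_pmf.prob_space_axioms)
  have "\<P>(x in edges q \<Otimes>\<^sub>M Om. t \<le> cnt V (z, fst x) (snd x))
    = \<P>(x in edges q \<Otimes>\<^sub>M Om. t \<le> card {j\<in>V. \<not> fst (zip_seq x j) \<and> R z (fst (snd (zip_seq x j)))})"
    by (simp add: cnt_def hit_def conj_commute)
  also have "\<dots> = \<P>(f in (\<Pi>\<^sub>M i\<in>UNIV. measure_pmf (bernoulli_pmf q) \<Otimes>\<^sub>M Mk).
      t \<le> card {j\<in>V. \<not> fst (f j) \<and> R z (fst (snd (f j)))})"
    by (rule prob_zip_seq[symmetric]) (auto simp: Mk measure_pmf.prob_space_axioms)
  also have "\<dots> = btail (card V) ((1 - q) * \<P>(b in K. R z b)) t"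
    using prob_iid_card[OF pp, of "\<lambda>c. \<not> fst c \<and> R z (fst (snd c))" V t] by (simp add: one_zip[OF z])
  finally show ?thesis .
qed

lemma one_hit_tail:
  assumes z: "z \<in> space K" and V: "finite V" and i: "i \<notin> V"
  shows "\<P>(x in edges q \<Otimes>\<^sub>M Om. hit (z, fst x) i (snd x i) \<and> t \<le> cnt V (z, fst x) (snd x))
    = (1 - q) * \<P>(b in K. R z b) * btail (card V) ((1 - q) * \<P>(b in K. R z b)) t"
proof -
  note [measurable] = z
  note [simp] = V
  have pp: "prob_space (measure_pmf (bernoulli_pmf q) \<Otimes>\<^sub>M Mk)"
    by (intro prob_space_pair Mk measure_pmf.prob_space_axioms)
  have c: "card {j\<in>V. \<not> fst ((f(i := c)) j) \<and> R z (fst (snd ((f(i := c)) j)))}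
      = card {j\<in>V. \<not> fst (f j) \<and> R z (fst (snd (f j)))}" for f c
    using i by (intro arg_cong[where f=card]) auto
  let ?Q = "\<lambda>c. \<not> fst c \<and> R z (fst (snd c))"
  let ?E = "\<lambda>f. t \<le> card {j\<in>V. \<not> fst (f j) \<and> R z (fst (snd (f j)))}"
  have "\<P>(x in edges q \<Otimes>\<^sub>M Om. hit (z, fst x) i (snd x i) \<and> t \<le> cnt V (z, fst x) (snd x))
    = \<P>(x in edges q \<Otimes>\<^sub>M Om. ?Q (zip_seq x i) \<and> ?E (zip_seq x))"
    by (simp add: cnt_def hit_def conj_commute)
  also have "\<dots> = \<P>(f in (\<Pi>\<^sub>M i\<in>UNIV. measure_pmf (bernoulli_pmf q) \<Otimes>\<^sub>M Mk). ?Q (f i) \<and> ?E f)"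
    by (rule prob_zip_seq[symmetric]) (auto simp: Mk measure_pmf.prob_space_axioms)
  also have "\<dots> = \<P>(c in measure_pmf (bernoulli_pmf q) \<Otimes>\<^sub>M Mk. ?Q c)
      * \<P>(f in (\<Pi>\<^sub>M i\<in>UNIV. measure_pmf (bernoulli_pmf q) \<Otimes>\<^sub>M Mk). ?E f)"
  proof (rule prob_iid_insert[OF pp])
    show "?E (f(i := c)) = ?E f" for f c by (simp only: c)
  qed measurable
  also have "\<dots> = (1 - q) * \<P>(b in K. R z b) * btail (card V) ((1 - q) * \<P>(b in K. R z b)) t"
    using prob_iid_card[OF pp, of ?Q V t] by (simp add: one_zip[OF z])
  finally show ?thesis .
qed

lemma pz_le: "z \<in> space K \<Longrightarrow> 0 \<le> (1 - q) * \<P>(b in K. R z b) \<and> (1 - q) * \<P>(b in K. R z b) \<le> p"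
  using q R_le[of z] by (auto simp: p_def intro!: mult_left_mono)

lemma one_tail_le:
  assumes z: "z \<in> space K" and V: "finite V" "card V \<le> m"
  shows "\<P>(x in edges q \<Otimes>\<^sub>M Om. t \<le> cnt V (z, fst x) (snd x)) \<le> btail m p t"
  unfolding one_tail[OF z V(1)]
  using pz_le[OF z] p01 btail_mono_p[of _ p "card V" t] btail_mono_N[of p "card V" m t] V(2) by fastforce

lemma one_hit_tail_le:
  assumes z: "z \<in> space K" and V: "finite V" "card V \<le> m" and i: "i \<notin> V"
  shows "\<P>(x in edges q \<Otimes>\<^sub>M Om. hit (z, fst x) i (snd x i) \<and> t \<le> cnt V (z, fst x) (snd x)) \<le> p * btail m p t"
  unfolding one_hit_tail[OF z V(1) i]
  using one_tail_le[OF z V, of t] pz_le[OF z] p01 unfolding one_tail[OF z V(1)]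
  by (intro mult_mono) (auto intro: btail_nonneg)

lemma one_le:
  assumes [measurable]: "Measurable.pred K \<phi>" and V: "finite V" "card V \<le> m"
  shows "\<P>(x in Mk \<Otimes>\<^sub>M Om. \<phi> (fst (fst x)) \<and> t \<le> cnt V (fst x) (snd x)) \<le> btail m p t * \<P>(z in K. \<phi> z)"
proof -
  note [simp] = V
  show ?thesis
    apply (subst measure_pair_assoc[OF K edges Om])
     apply measurable
    apply (rule measure_pair_le[where Q=\<phi>, OF K prob_space_pair[OF edges Om]])
        apply measurable
    using p01 one_tail_le[OF _ V, of _ t]
    apply (auto intro!: btail_nonneg)
    done
qed

text \<open>A lower bound needs equality in \<open>R_le\<close>; \<phi> singles out marks for which
  it holds, later those away from the boundary of the square.\<close>

lemma one_ge:
  assumes [measurable]: "Measurable.pred K \<phi>" and V: "finite V" "card V = m"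
    and \<phi>: "\<And>z. z \<in> space K \<Longrightarrow> \<phi> z \<Longrightarrow> \<P>(b in K. R z b) = p0"
  shows "btail m p t * \<P>(z in K. \<phi> z) \<le> \<P>(x in Mk \<Otimes>\<^sub>M Om. \<phi> (fst (fst x)) \<and> t \<le> cnt V (fst x) (snd x))"
proof -
  note [simp] = V
  show ?thesis
    apply (subst measure_pair_assoc[OF K edges Om])
     apply measurable
    apply (rule measure_pair_ge[where Q=\<phi>, OF K prob_space_pair[OF edges Om]])
        apply measurable
    using p01 one_tail[OF _ V(1), of _ t] \<phi>
    apply (auto intro!: btail_nonneg simp: p_def[symmetric])
    done
qed

lemma one_hit_le:
  assumes V: "finite V" "card V \<le> m" and i: "i \<notin> V"
  shows "\<P>(x in Mk \<Otimes>\<^sub>M Om. hit (fst x) i (snd x i) \<and> t \<le> cnt V (fst x) (snd x)) \<le> p * btail m p t"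
proof -
  note [simp] = V
  interpret K: prob_space K by (rule K)
  have "\<P>(x in Mk \<Otimes>\<^sub>M Om. hit (fst x) i (snd x i) \<and> t \<le> cnt V (fst x) (snd x)) \<le> p * btail m p t * \<P>(z in K. True)"
    apply (subst measure_pair_assoc[OF K edges Om])
     apply measurable
    apply (rule measure_pair_le[OF K prob_space_pair[OF edges Om]])
        apply measurable
    using p01 one_hit_tail_le[OF _ V i, of _ t]
    apply (auto intro!: btail_nonneg mult_nonneg_nonneg)
    done
  then show ?thesis by (simp add: K.prob_space)
qed

text \<open>One index as seen from two fixed vertices: its arc failure with respect to the second
  vertex, that with respect to the first, and its own mark. The order is that in which
  \<open>pair_le\<close> leaves the two rows.\<close>

abbreviation B3 :: "(bool \<times> bool \<times> 'z \<times> (nat \<Rightarrow> bool)) measure" where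
  "B3 \<equiv> measure_pmf (bernoulli_pmf q) \<Otimes>\<^sub>M (measure_pmf (bernoulli_pmf q) \<Otimes>\<^sub>M Mk)"

lemma B3: "prob_space B3"
  by (intro prob_space_pair Mk measure_pmf.prob_space_axioms)

lemma two_zip:
  assumes "Measurable.pred (\<Pi>\<^sub>M i\<in>(UNIV::nat set). B3) P"
  shows "\<P>(x in edges q \<Otimes>\<^sub>M (edges q \<Otimes>\<^sub>M Om). P (zip_seq (fst x, zip_seq (snd x))))
    = \<P>(f in (\<Pi>\<^sub>M i\<in>(UNIV::nat set). B3). P f)"
  by (rule prob_zip_seq3[symmetric, OF _ _ Mk assms]) (rule measure_pmf.prob_space_axioms)+

lemma B3_1:
  assumes [measurable]: "Measurable.pred K \<phi>"
  shows "\<P>(c in B3. \<not> fst c \<and> \<phi> (fst (snd (snd c)))) = (1 - q) * \<P>(b in K. \<phi> b)"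
proof -
  have "\<P>(c in B3. \<not> fst c \<and> \<phi> (fst (snd (snd c)))) = \<P>(b in measure_pmf (bernoulli_pmf q). \<not> b)
      * \<P>(y in measure_pmf (bernoulli_pmf q) \<Otimes>\<^sub>M Mk. \<phi> (fst (snd y)))"
    by (rule prob_pair_Times) (auto intro!: prob_space_pair Mk measure_pmf.prob_space_axioms)
  also have "\<P>(y in measure_pmf (bernoulli_pmf q) \<Otimes>\<^sub>M Mk. \<phi> (fst (snd y))) = \<P>(y in Mk. \<phi> (fst y))"
    by (rule prob_pair_snd) (auto intro!: Mk measure_pmf.prob_space_axioms)
  also have "\<dots> = \<P>(y in K. \<phi> y)"
    by (rule prob_pair_fst) (auto intro!: K edges)
  finally show ?thesis unfolding prob_bern_not .
qed

lemma B3_2: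
  assumes [measurable]: "Measurable.pred K \<phi>"
  shows "\<P>(c in B3. \<not> fst (snd c) \<and> \<phi> (fst (snd (snd c)))) = (1 - q) * \<P>(b in K. \<phi> b)"
proof -
  have "\<P>(c in B3. \<not> fst (snd c) \<and> \<phi> (fst (snd (snd c)))) =
      \<P>(y in measure_pmf (bernoulli_pmf q) \<Otimes>\<^sub>M Mk. \<not> fst y \<and> \<phi> (fst (snd y)))"
    by (rule prob_pair_snd) (auto intro!: prob_space_pair Mk measure_pmf.prob_space_axioms)
  also have "\<dots> = \<P>(b in measure_pmf (bernoulli_pmf q). \<not> b) * \<P>(y in Mk. \<phi> (fst y))"
    by (rule prob_pair_Times) (auto intro!: Mk measure_pmf.prob_space_axioms)
  also have "\<P>(y in Mk. \<phi> (fst y)) = \<P>(y in K. \<phi> y)"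
    by (rule prob_pair_fst) (auto intro!: K edges)
  finally show ?thesis unfolding prob_bern_not .
qed

lemma J_nonneg: "1 \<le> s \<Longrightarrow> 0 \<le> J m \<eta> t s"
  by (auto simp: J_def)

lemma two_tail_iid:
  assumes z[measurable]: "z1 \<in> space K" "z2 \<in> space K" and V: "finite V" "card V \<le> m"
    and ov: "overlap z1 z2 \<le> (1 - \<eta>) * p0" and \<eta>: "\<eta> \<le> 1" and s: "1 \<le> s"
  shows "\<P>(f in (\<Pi>\<^sub>M i\<in>(UNIV::nat set). B3).
      t \<le> card {j\<in>V. \<not> fst (f j) \<and> R z2 (fst (snd (snd (f j))))} \<and>
      t \<le> card {j\<in>V. \<not> fst (snd (f j)) \<and> R z1 (fst (snd (snd (f j))))}) \<le> J m \<eta> t s"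
proof -
  let ?Q2 = "\<lambda>c. \<not> fst c \<and> R z2 (fst (snd (snd c)))"
  let ?Q1 = "\<lambda>c. \<not> fst (snd c) \<and> R z1 (fst (snd (snd c)))"
  have 12: "\<P>(c in B3. ?Q2 c \<and> ?Q1 c) \<le> (1 - \<eta>) * p"
  proof -
    \<comment> \<open>One of the two independent arc survivals is dropped; the remaining factor
      \<open>1 - q\<close> turns \<open>(1 - \<eta>) * p0\<close> into
      \<open>(1 - \<eta>) * p\<close>.\<close>
    have "\<P>(c in B3. ?Q2 c \<and> ?Q1 c) \<le> \<P>(c in B3. \<not> fst c \<and> (R z1 (fst (snd (snd c))) \<and> R z2 (fst (snd (snd c)))))"
      by (rule prob_mono_pred[OF B3]) auto
    also have "\<dots> = (1 - q) * overlap z1 z2"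
      unfolding overlap_def by (rule B3_1) measurable
    also have "\<dots> \<le> (1 - q) * ((1 - \<eta>) * p0)" using ov q by (intro mult_left_mono) auto
    finally show ?thesis by (simp add: p_def mult_ac)
  qed
  have "\<P>(f in (\<Pi>\<^sub>M i\<in>(UNIV::nat set). B3). t \<le> card {j\<in>V. ?Q2 (f j)} \<and> t \<le> card {j\<in>V. ?Q1 (f j)})
      \<le> (1 / s) ^ (2 * t) * exp (card V * (2 * p * (s - 1) + ((1 - \<eta>) * p) * (s - 1)\<^sup>2))"
    by (rule joint_chernoff[OF B3])
      (use V s 12 pz_le[OF z(1)] pz_le[OF z(2)] in \<open>auto simp: B3_1 B3_2\<close>)
  also have "\<dots> \<le> J m \<eta> t s"
  proof -
    have "card V * (2 * p * (s - 1) + ((1 - \<eta>) * p) * (s - 1)\<^sup>2) \<le> real m * (2 * p * (s - 1) + ((1 - \<eta>) * p) * (s - 1)\<^sup>2)"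
      using V p01 s \<eta> by (intro mult_right_mono) auto
    also have "\<dots> = real m * p * (2 * (s - 1) + (1 - \<eta>) * (s - 1)\<^sup>2)" by (simp add: algebra_simps)
    finally show ?thesis unfolding J_def using s by (intro mult_left_mono) auto
  qed
  finally show ?thesis .
qed

lemma two_tail_le:
  assumes z[measurable]: "z1 \<in> space K" "z2 \<in> space K" and V: "finite V" "card V \<le> m"
    and ov: "overlap z1 z2 \<le> (1 - \<eta>) * p0" and \<eta>: "\<eta> \<le> 1" and s: "1 \<le> s"
  shows "\<P>(x in edges q \<Otimes>\<^sub>M (edges q \<Otimes>\<^sub>M Om).
     t \<le> cnt V (z1, fst (snd x)) (snd (snd x)) \<and> t \<le> cnt V (z2, fst x) (snd (snd x))) \<le> J m \<eta> t s"
proof -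
  note [simp] = V
  show ?thesis
    using two_zip[of "\<lambda>f. t \<le> card {j\<in>V. \<not> fst (f j) \<and> R z2 (fst (snd (snd (f j))))} \<and>
      t \<le> card {j\<in>V. \<not> fst (snd (f j)) \<and> R z1 (fst (snd (snd (f j))))}"] two_tail_iid[OF assms, of t]
    by (simp add: cnt_def hit_def conj_commute)
qed

lemma two_hit_tail_le:
  assumes z[measurable]: "z1 \<in> space K" "z2 \<in> space K" and V: "finite V" "card V \<le> m" and i: "i \<notin> V"
    and ov: "overlap z1 z2 \<le> (1 - \<eta>) * p0" and \<eta>: "\<eta> \<le> 1" and s: "1 \<le> s"
  shows "\<P>(x in edges q \<Otimes>\<^sub>M (edges q \<Otimes>\<^sub>M Om). hit (z2, fst x) i (snd (snd x) i) \<and>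
     t \<le> cnt V (z1, fst (snd x)) (snd (snd x)) \<and> t \<le> cnt V (z2, fst x) (snd (snd x))) \<le> p * J m \<eta> t s"
proof -
  note [simp] = V
  let ?Q = "\<lambda>c. \<not> fst c \<and> R z2 (fst (snd (snd c)))"
  let ?E = "\<lambda>f. t \<le> card {j\<in>V. \<not> fst (f j) \<and> R z2 (fst (snd (snd (f j))))} \<and>
      t \<le> card {j\<in>V. \<not> fst (snd (f j)) \<and> R z1 (fst (snd (snd (f j))))}"
  have "\<P>(x in edges q \<Otimes>\<^sub>M (edges q \<Otimes>\<^sub>M Om). hit (z2, fst x) i (snd (snd x) i) \<and>
     t \<le> cnt V (z1, fst (snd x)) (snd (snd x)) \<and> t \<le> cnt V (z2, fst x) (snd (snd x)))
    = \<P>(f in (\<Pi>\<^sub>M i\<in>(UNIV::nat set). B3). ?Q (f i) \<and> ?E f)"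
    using two_zip[of "\<lambda>f. ?Q (f i) \<and> ?E f"] by (simp add: cnt_def hit_def conj_ac)
  also have "\<dots> = \<P>(c in B3. ?Q c) * \<P>(f in (\<Pi>\<^sub>M i\<in>(UNIV::nat set). B3). ?E f)"
  proof (rule prob_iid_insert[OF B3])
    show "?E (f(i := c)) = ?E f" for f c
      using i by (intro arg_cong2[where f="(\<and>)"] arg_cong[where f="\<lambda>S. t \<le> card S"]) auto
  qed measurable
  also have "\<dots> \<le> p * J m \<eta> t s"
    using two_tail_iid[OF z V ov \<eta> s, of t] pz_le[OF z(2)] p01 by (intro mult_mono) (auto simp: B3_1)
  finally show ?thesis .
qed

lemma two_hit_le:
  assumes z[measurable]: "z1 \<in> space K" "z2 \<in> space K" and V: "finite V" "card V \<le> m" and i: "i \<notin> V"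
  shows "\<P>(x in edges q \<Otimes>\<^sub>M (edges q \<Otimes>\<^sub>M Om). hit (z2, fst x) i (snd (snd x) i) \<and>
     t \<le> cnt V (z1, fst (snd x)) (snd (snd x))) \<le> p * btail m p t"
proof -
  note [simp] = V
  let ?Q = "\<lambda>c. \<not> fst c \<and> R z2 (fst (snd (snd c)))"
  let ?Q1 = "\<lambda>c. \<not> fst (snd c) \<and> R z1 (fst (snd (snd c)))"
  let ?E = "\<lambda>f. t \<le> card {j\<in>V. \<not> fst (snd (f j)) \<and> R z1 (fst (snd (snd (f j))))}"
  have "\<P>(x in edges q \<Otimes>\<^sub>M (edges q \<Otimes>\<^sub>M Om). hit (z2, fst x) i (snd (snd x) i) \<and>
     t \<le> cnt V (z1, fst (snd x)) (snd (snd x)))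
    = \<P>(f in (\<Pi>\<^sub>M i\<in>(UNIV::nat set). B3). ?Q (f i) \<and> ?E f)"
    using two_zip[of "\<lambda>f. ?Q (f i) \<and> ?E f"] by (simp add: cnt_def hit_def conj_ac)
  also have "\<dots> = \<P>(c in B3. ?Q c) * \<P>(f in (\<Pi>\<^sub>M i\<in>(UNIV::nat set). B3). ?E f)"
  proof (rule prob_iid_insert[OF B3])
    show "?E (f(i := c)) = ?E f" for f c
      using i by (intro arg_cong[where f="\<lambda>S. t \<le> card S"]) auto
  qed measurable
  also have "\<P>(f in (\<Pi>\<^sub>M i\<in>(UNIV::nat set). B3). ?E f) = btail (card V) ((1 - q) * \<P>(b in K. R z1 b)) t"
    using prob_iid_card[OF B3, of ?Q1 V t] by (simp add: B3_2)
  also have "\<dots> \<le> btail m p t"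
    using one_tail_le[OF z(1) V, of t] unfolding one_tail[OF z(1) V(1)] .
  also have "\<P>(c in B3. ?Q c) * btail m p t \<le> p * btail m p t"
    using pz_le[OF z(2)] p01 by (intro mult_right_mono) (auto simp: B3_1 intro: btail_nonneg)
  finally show ?thesis by (simp add: mult_left_mono)
qed

text \<open>The predicate \<phi> records what the event says about the two point marks alone.
  Peeling off the mark of the first vertex, moving the mark of the second past the row of the first
  and splitting it leaves both point marks fixed, with the row of \<open>z2\<close> in front of the
  row of \<open>z1\<close>; the fibre bound \<open>c\<close> and the bound \<open>d\<close> on
  \<phi> then multiply.\<close>

lemma pair_le:
  assumes P[measurable]: "Measurable.pred (Mk \<Otimes>\<^sub>M (Mk \<Otimes>\<^sub>M Om)) P"
    and \<phi>[measurable]: "Measurable.pred (K \<Otimes>\<^sub>M K) (\<lambda>x. \<phi> (fst x) (snd x))"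
    and imp: "\<And>a b Z. P (a, b, Z) \<Longrightarrow> \<phi> (fst a) (fst b)"
    and c: "0 \<le> c" and d: "0 \<le> d"
    and le: "\<And>z1 z2. z1 \<in> space K \<Longrightarrow> z2 \<in> space K \<Longrightarrow> \<phi> z1 z2 \<Longrightarrow>
      \<P>(x in edges q \<Otimes>\<^sub>M (edges q \<Otimes>\<^sub>M Om). P ((z1, fst (snd x)), (z2, fst x), snd (snd x))) \<le> c"
    and \<phi>_le: "\<And>z1. z1 \<in> space K \<Longrightarrow> \<P>(z2 in K. \<phi> z1 z2) \<le> d"
  shows "\<P>(x in Mk \<Otimes>\<^sub>M (Mk \<Otimes>\<^sub>M Om). P x) \<le> c * d"
proof -
  interpret K: prob_space K by (rule K)
  have eMO: "prob_space (edges q \<Otimes>\<^sub>M (Mk \<Otimes>\<^sub>M Om))" "prob_space (edges q \<Otimes>\<^sub>M Om)"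
    "prob_space (edges q \<Otimes>\<^sub>M (edges q \<Otimes>\<^sub>M Om))" "prob_space (Mk \<Otimes>\<^sub>M Om)"
    by (intro prob_space_pair edges Mk Om)+
  have "\<P>(x in Mk \<Otimes>\<^sub>M (Mk \<Otimes>\<^sub>M Om). P x)
    = \<P>(x in K \<Otimes>\<^sub>M (edges q \<Otimes>\<^sub>M (Mk \<Otimes>\<^sub>M Om)). P ((fst x, fst (snd x)), snd (snd x)))"
    by (rule measure_pair_assoc[OF K edges eMO(4)]) measurable
  also have "\<dots> \<le> (c * d) * \<P>(z in K. True)"
  proof (rule measure_pair_le[OF K eMO(1)])
    fix z1 assume z1[measurable]: "z1 \<in> space K"
    have "\<P>(y in edges q \<Otimes>\<^sub>M (Mk \<Otimes>\<^sub>M Om). P ((z1, fst y), snd y))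
      = \<P>(y in Mk \<Otimes>\<^sub>M (edges q \<Otimes>\<^sub>M Om). P ((z1, fst (snd y)), (fst y, snd (snd y))))"
      by (subst measure_pair_swap_nested[OF edges Mk Om]) auto
    also have "\<dots> = \<P>(y in K \<Otimes>\<^sub>M (edges q \<Otimes>\<^sub>M (edges q \<Otimes>\<^sub>M Om)).
        P ((z1, fst (snd (snd y))), ((fst y, fst (snd y)), snd (snd (snd y)))))"
      by (subst measure_pair_assoc[OF K edges eMO(2)]) auto
    also have "\<dots> \<le> c * \<P>(z2 in K. \<phi> z1 z2)"
    proof (rule measure_pair_le[OF K eMO(3)])
      have "(\<lambda>z2. (z1, z2)) \<in> measurable K (K \<Otimes>\<^sub>M K)" by measurable
      from measurable_compose[OF this \<phi>] show "Measurable.pred K (\<phi> z1)" by simp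
    qed (use le[OF z1] imp c in \<open>auto\<close>)
    also have "\<dots> \<le> c * d" using \<phi>_le[OF z1] c by (intro mult_left_mono) auto
    finally show "\<P>(y in edges q \<Otimes>\<^sub>M (Mk \<Otimes>\<^sub>M Om). P ((fst (z1, y), fst (snd (z1, y))), snd (snd (z1, y)))) \<le> c * d"
      by simp
  qed (use c d in auto)
  finally show ?thesis by (simp add: K.prob_space)
qed

end

section \<open>Exchange of coordinates between two independent copies\<close>

lemma prob_swap_cond:
  assumes M: "prob_space M" and c[measurable]: "Measurable.pred (M \<Otimes>\<^sub>M M) c"
    and sym: "\<And>u v. c (u, v) \<longleftrightarrow> c (v, u)"
    and P[measurable]: "Measurable.pred ((\<Pi>\<^sub>M i\<in>(UNIV::'i set). M) \<Otimes>\<^sub>M (\<Pi>\<^sub>M i\<in>(UNIV::'i set). M)) P"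
  shows "\<P>(x in (\<Pi>\<^sub>M i\<in>(UNIV::'i set). M) \<Otimes>\<^sub>M (\<Pi>\<^sub>M i\<in>(UNIV::'i set). M). P x) =
    \<P>(x in (\<Pi>\<^sub>M i\<in>(UNIV::'i set). M) \<Otimes>\<^sub>M (\<Pi>\<^sub>M i\<in>(UNIV::'i set). M).
      P (\<lambda>i. if c (fst x i, snd x i) then snd x i else fst x i, \<lambda>i. if c (fst x i, snd x i) then fst x i else snd x i))"
proof -
  interpret M: prob_space M by fact
  interpret MM: pair_prob_space M M ..
  define T where "T x = (if c x then (snd x, fst x) else x)" for x
  have T[measurable]: "T \<in> measurable (M \<Otimes>\<^sub>M M) (M \<Otimes>\<^sub>M M)" unfolding T_def by measurable
  \<comment> \<open>Symmetry of \<open>c\<close> makes \<open>T\<close> an involution that maps the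
    region \<open>c\<close> to itself, where it only swaps two equally distributed factors. Applied
    in every coordinate it gives the claim, since zipped pairs are i.i.d.\<close>
  have dT: "distr (M \<Otimes>\<^sub>M M) (M \<Otimes>\<^sub>M M) T = M \<Otimes>\<^sub>M M"
  proof (rule measure_eqI)
    fix S assume "S \<in> sets (distr (M \<Otimes>\<^sub>M M) (M \<Otimes>\<^sub>M M) T)"
    then have S[measurable]: "S \<in> sets (M \<Otimes>\<^sub>M M)" by simp
    have "emeasure (distr (M \<Otimes>\<^sub>M M) (M \<Otimes>\<^sub>M M) T) S = emeasure (M \<Otimes>\<^sub>M M) (T -` S \<inter> space (M \<Otimes>\<^sub>M M))"
      by (rule emeasure_distr) measurable
    also have "T -` S \<inter> space (M \<Otimes>\<^sub>M M) = {x\<in>space (M \<Otimes>\<^sub>M M). c x \<and> (snd x, fst x) \<in> S} \<union> {x\<in>space (M \<Otimes>\<^sub>M M). \<not> c x \<and> x \<in> S}"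
      by (auto simp: T_def split: if_splits)
    also have "emeasure (M \<Otimes>\<^sub>M M) \<dots> = emeasure (M \<Otimes>\<^sub>M M) {x\<in>space (M \<Otimes>\<^sub>M M). c x \<and> (snd x, fst x) \<in> S}
        + emeasure (M \<Otimes>\<^sub>M M) {x\<in>space (M \<Otimes>\<^sub>M M). \<not> c x \<and> x \<in> S}"
      by (rule plus_emeasure[symmetric]) (auto, measurable)
    also have "emeasure (M \<Otimes>\<^sub>M M) {x\<in>space (M \<Otimes>\<^sub>M M). c x \<and> (snd x, fst x) \<in> S}
       = emeasure (M \<Otimes>\<^sub>M M) {x\<in>space (M \<Otimes>\<^sub>M M). c x \<and> x \<in> S}"
      using measure_pair_swap[OF M M, of "\<lambda>x. c x \<and> x \<in> S"] sym
      by (simp add: MM.emeasure_eq_measure case_prod_beta)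
    also have "\<dots> + emeasure (M \<Otimes>\<^sub>M M) {x\<in>space (M \<Otimes>\<^sub>M M). \<not> c x \<and> x \<in> S}
       = emeasure (M \<Otimes>\<^sub>M M) ({x\<in>space (M \<Otimes>\<^sub>M M). c x \<and> x \<in> S} \<union> {x\<in>space (M \<Otimes>\<^sub>M M). \<not> c x \<and> x \<in> S})"
      by (rule plus_emeasure) (auto, measurable)
    also have "{x\<in>space (M \<Otimes>\<^sub>M M). c x \<and> x \<in> S} \<union> {x\<in>space (M \<Otimes>\<^sub>M M). \<not> c x \<and> x \<in> S} = S"
      using sets.sets_into_space[OF S] by auto
    finally show "emeasure (distr (M \<Otimes>\<^sub>M M) (M \<Otimes>\<^sub>M M) T) S = emeasure (M \<Otimes>\<^sub>M M) S" .
  qed simp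
  let ?unzip = "\<lambda>f :: 'i \<Rightarrow> _. (\<lambda>i. fst (f i), \<lambda>i. snd (f i))"
  let ?MM = "\<Pi>\<^sub>M i\<in>(UNIV::'i set). M \<Otimes>\<^sub>M M"
  have Ts: "fst (T u) \<in> space M \<and> snd (T u) \<in> space M" if "fst u \<in> space M" "snd u \<in> space M" for u
    using measurable_space[OF T, of u] that by (auto simp: space_pair_measure mem_Times_iff)
  have fs: "(\<lambda>f i. fst (f i)) \<in> measurable ?MM (\<Pi>\<^sub>M i\<in>(UNIV::'i set). M)"
      "(\<lambda>f i. snd (f i)) \<in> measurable ?MM (\<Pi>\<^sub>M i\<in>(UNIV::'i set). M)"
      "(\<lambda>f i. T (f i)) \<in> measurable ?MM ?MM"
    by (auto intro!: measurable_PiM_single' simp: Ts space_PiM PiE_iff space_pair_measure mem_Times_iff)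
  then have un[measurable]: "?unzip \<in> measurable ?MM ((\<Pi>\<^sub>M i\<in>(UNIV::'i set). M) \<Otimes>\<^sub>M (\<Pi>\<^sub>M i\<in>(UNIV::'i set). M))"
    by (rule_tac measurable_Pair) auto
  have "\<P>(x in (\<Pi>\<^sub>M i\<in>(UNIV::'i set). M) \<Otimes>\<^sub>M (\<Pi>\<^sub>M i\<in>(UNIV::'i set). M). P x) = \<P>(f in ?MM. P (?unzip f))"
    by (rule measure_distr_pred[OF distr_unzip_seq[OF M M] un P refl])
  also have "\<dots> = \<P>(f in ?MM. P (?unzip (\<lambda>i. T (f i))))"
  proof (rule measure_distr_pred)
    show "distr ?MM ?MM (\<lambda>f i. T (f i)) = ?MM"
      using distr_iid_map[OF MM.prob_space_axioms T] unfolding dT .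
  qed (use fs in \<open>auto\<close>)
  also have "\<dots> = \<P>(x in (\<Pi>\<^sub>M i\<in>(UNIV::'i set). M) \<Otimes>\<^sub>M (\<Pi>\<^sub>M i\<in>(UNIV::'i set). M). P (?unzip (\<lambda>i. T (zip_seq x i))))"
  proof (rule prob_zip_seq[OF M M])
    note [measurable] = fs(3)
    show "Measurable.pred ?MM (\<lambda>f. P (?unzip (\<lambda>i. T (f i))))"
      using measurable_compose[OF fs(3) measurable_compose[OF un P]] by simp
  qed
  finally show ?thesis by (simp add: T_def if_distrib[of fst] if_distrib[of snd] cong: if_cong)
qed

context mark_model
begin

lemma MkOm: "prob_space (Mk \<Otimes>\<^sub>M Om)"
  by (rule prob_space_pair[OF Mk Om])

lemma pair_upd:
  assumes P[measurable]: "Measurable.pred (Mk \<Otimes>\<^sub>M Om) P"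
  shows "\<P>(x in Mk \<Otimes>\<^sub>M Om. P x) = \<P>(x in Mk \<Otimes>\<^sub>M (Mk \<Otimes>\<^sub>M Om). P (fst x, (snd (snd x))(j := fst (snd x))))"
proof (rule prob_pair_cong_fst)
  fix a assume a[measurable]: "a \<in> space Mk"
  show "\<P>(y in Om. P (a, y)) = \<P>(y in Mk \<Otimes>\<^sub>M Om. P (fst (a, y), (snd (snd (a, y)))(j := fst (snd (a, y)))))"
    by (subst prob_upd[OF Mk, where i=j]) (auto simp del: fun_upd_apply)
qed (auto simp: Mk Om MkOm)

lemma prob_component:
  assumes [measurable]: "Measurable.pred Mk Q"
  shows "\<P>(Z in Om. Q (Z j)) = \<P>(b in Mk. Q b)"
  using prob_iid_insert[OF Mk assms, of "\<lambda>_. True" j] prob_space.prob_space[OF Om] by simp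

lemma near_comp: "a \<in> space Mk \<Longrightarrow> 0 \<le> \<rho> \<Longrightarrow> \<P>(Z in Om. near \<rho> a (Z j)) \<le> 4 * \<rho>\<^sup>2"
  using prob_component[of "near \<rho> a" j] near_prob[of a \<rho>] by simp

lemma two_fst_le:
  assumes z[measurable]: "z1 \<in> space K" and V: "finite V" "card V \<le> m"
  shows "\<P>(x in edges q \<Otimes>\<^sub>M (edges q \<Otimes>\<^sub>M Om). t \<le> cnt V (z1, fst (snd x)) (snd (snd x))) \<le> btail m p t"
proof -
  note [simp] = V
  show ?thesis
    using prob_pair_snd[OF edges prob_space_pair[OF edges Om], of "\<lambda>x. t \<le> cnt V (z1, fst x) (snd x)"]
      one_tail_le[OF z V, of t] by simp
qed

text \<open>Since \<open>j\<close> is not in \<open>V\<close>, the count does not involve the mark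
  of \<open>j\<close>, and proximity contributes an independent factor.\<close>

lemma near_cnt1:
  assumes V: "finite V" "card V \<le> m" and j: "j \<notin> V" and \<rho>: "0 \<le> \<rho>"
  shows "\<P>(x in Mk \<Otimes>\<^sub>M Om. near \<rho> (fst x) (snd x j) \<and> t \<le> cnt V (fst x) (snd x)) \<le> 4 * \<rho>\<^sup>2 * btail m p t"
proof -
  note [simp] = V
  have "\<P>(x in Mk \<Otimes>\<^sub>M (Mk \<Otimes>\<^sub>M Om). near \<rho> (fst x) (fst (snd x)) \<and> t \<le> cnt V (fst x) (snd (snd x))) \<le> btail m p t * (4 * \<rho>\<^sup>2)"
  proof (rule pair_le[where \<phi>="\<lambda>z1 z2. dist (X z1) (X z2) \<le> \<rho>"])
    fix z1 z2 assume z[measurable]: "z1 \<in> space K" "z2 \<in> space K"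
    show "\<P>(x in edges q \<Otimes>\<^sub>M edges q \<Otimes>\<^sub>M Om.
              near \<rho> (fst ((z1, fst (snd x)), (z2, fst x), snd (snd x))) (fst (snd ((z1, fst (snd x)), (z2, fst x), snd (snd x)))) \<and>
              t \<le> cnt V (fst ((z1, fst (snd x)), (z2, fst x), snd (snd x))) (snd (snd ((z1, fst (snd x)), (z2, fst x), snd (snd x)))))
            \<le> btail m p t"
      by (rule order_trans[OF prob_mono_pred two_fst_le[OF z(1) V]]) (auto intro!: prob_space_pair edges Om)
  qed (use p01 \<rho> near_le in \<open>auto simp: near_def intro: btail_nonneg\<close>)
  then show ?thesis
    by (subst pair_upd[where j=j]) (auto simp: R_upd[OF j] mult.commute)
qed

lemma near_cnt2:
  assumes V: "finite V" "card V \<le> m" and j: "j \<notin> V" and \<rho>: "0 \<le> \<rho>" and a: "a \<in> space Mk"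
  shows "\<P>(Z in Om. near \<rho> a (Z j) \<and> t \<le> cnt V (Z j) Z) \<le> 4 * \<rho>\<^sup>2 * btail m p t"
proof -
  note [simp] = V and [measurable] = a
  have "\<P>(Z in Om. near \<rho> a (Z j) \<and> t \<le> cnt V (Z j) Z)
     = \<P>(x in Mk \<Otimes>\<^sub>M Om. dist (X (fst a)) (X (fst (fst x))) \<le> \<rho> \<and> t \<le> cnt V (fst x) (snd x))"
    by (subst prob_upd[OF Mk, where i=j]) (auto simp: R_upd[OF j] near_def)
  also have "\<dots> \<le> btail m p t * \<P>(z in K. dist (X (fst a)) (X z) \<le> \<rho>)"
    by (rule one_le) auto
  also have "\<dots> \<le> btail m p t * (4 * \<rho>\<^sup>2)"
    using p01 near_le[OF \<rho>] by (intro mult_left_mono btail_nonneg) auto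
  finally show ?thesis by (simp add: mult_ac)
qed

lemma near_cnt2':
  assumes V: "finite V" "card V \<le> m" and j: "j \<notin> V" and \<rho>: "0 \<le> \<rho>"
  shows "\<P>(x in Mk \<Otimes>\<^sub>M Om. near \<rho> (fst x) (snd x j) \<and> t \<le> cnt V (snd x j) (snd x)) \<le> 4 * \<rho>\<^sup>2 * btail m p t"
proof -
  note [simp] = V
  have "\<P>(x in Mk \<Otimes>\<^sub>M Om. near \<rho> (fst x) (snd x j) \<and> t \<le> cnt V (snd x j) (snd x)) \<le> 4 * \<rho>\<^sup>2 * btail m p t * \<P>(a in Mk. True)"
    by (rule measure_pair_le[OF Mk Om])
      (use near_cnt2[OF V j \<rho>] p01 in \<open>auto intro!: mult_nonneg_nonneg btail_nonneg\<close>)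
  then show ?thesis using prob_space.prob_space[OF Mk] by simp
qed

lemma overlap_far: "2 * r < dist (X z1) (X z2) \<Longrightarrow> overlap z1 z2 = 0"
proof -
  assume far: "2 * r < dist (X z1) (X z2)"
  have "\<not> (R z1 c \<and> R z2 c)" for c
    using R_near[of z1 c] R_near[of z2 c] dist_triangle2[of "X z1" "X z2" "X c"] far by auto
  then have "{c\<in>space K. R z1 c \<and> R z2 c} = {}" by blast
  then show ?thesis unfolding overlap_def by (simp only: measure_empty)
qed

text \<open>Where the overlap is large, only the degree of the first vertex is used, and the
  smallness of the set of such positions pays; elsewhere the joint Chernoff bound is used, and
  \<open>16 * r^2 = 4 * (2 * r)^2\<close> accounts for proximity.\<close>

lemma near_pair:
  assumes V: "finite V" "card V \<le> m" and j: "j \<notin> V" and \<eta>: "0 \<le> \<eta>" "\<eta> \<le> 1" and s: "1 \<le> s"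
  shows "\<P>(x in Mk \<Otimes>\<^sub>M Om. near (2 * r) (fst x) (snd x j) \<and> t \<le> cnt V (fst x) (snd x) \<and> t \<le> cnt V (snd x j) (snd x))
    \<le> 256 * \<eta>\<^sup>2 * r\<^sup>2 * btail m p t + 16 * r\<^sup>2 * J m \<eta> t s"
proof -
  note [simp] = V
  let ?M = "Mk \<Otimes>\<^sub>M (Mk \<Otimes>\<^sub>M Om)"
  have MM: "prob_space ?M" by (intro prob_space_pair Mk MkOm)
  interpret MM: prob_space ?M by (rule MM)
  let ?lev = "\<lambda>z1 z2. dist (X z1) (X z2) \<le> 2 * r \<and> (1 - \<eta>) * p0 < overlap z1 z2"
  let ?A = "\<lambda>x. ?lev (fst (fst x)) (fst (fst (snd x))) \<and> t \<le> cnt V (fst x) (snd (snd x))"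
  let ?B = "\<lambda>x. (near (2 * r) (fst x) (fst (snd x)) \<and> overlap (fst (fst x)) (fst (fst (snd x))) \<le> (1 - \<eta>) * p0) \<and> t \<le> cnt V (fst x) (snd (snd x)) \<and> t \<le> cnt V (fst (snd x)) (snd (snd x))"
  have A: "\<P>(x in ?M. ?A x) \<le> btail m p t * (256 * \<eta>\<^sup>2 * r\<^sup>2)"
  proof (rule pair_le[where \<phi>="?lev"])
    fix z1 z2 assume z[measurable]: "z1 \<in> space K" "z2 \<in> space K"
    show "\<P>(x in edges q \<Otimes>\<^sub>M edges q \<Otimes>\<^sub>M Om. ?A ((z1, fst (snd x)), (z2, fst x), snd (snd x))) \<le> btail m p t"
      by (rule order_trans[OF prob_mono_pred two_fst_le[OF z(1) V]]) (auto intro!: prob_space_pair edges Om)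
  next
    fix z1 assume z: "z1 \<in> space K"
    show "\<P>(z2 in K. ?lev z1 z2) \<le> 256 * \<eta>\<^sup>2 * r\<^sup>2"
      using level_le[OF z \<eta>(1)] unfolding overlap_def .
  qed (use p01 in \<open>auto intro: btail_nonneg\<close>)
  have B: "\<P>(x in ?M. ?B x) \<le> J m \<eta> t s * (4 * (2 * r)\<^sup>2)"
  proof (rule pair_le[where \<phi>="\<lambda>z1 z2. dist (X z1) (X z2) \<le> 2 * r \<and> overlap z1 z2 \<le> (1 - \<eta>) * p0"])
    fix z1 z2 assume z[measurable]: "z1 \<in> space K" "z2 \<in> space K"
      and ov: "dist (X z1) (X z2) \<le> 2 * r \<and> overlap z1 z2 \<le> (1 - \<eta>) * p0"
    show "\<P>(x in edges q \<Otimes>\<^sub>M edges q \<Otimes>\<^sub>M Om. ?B ((z1, fst (snd x)), (z2, fst x), snd (snd x))) \<le> J m \<eta> t s"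
      by (rule order_trans[OF prob_mono_pred two_tail_le[OF z V conjunct2[OF ov] \<eta>(2) s]]) (auto intro!: prob_space_pair edges Om)
  next
    fix z1 assume [measurable]: "z1 \<in> space K"
    show "\<P>(z2 in K. dist (X z1) (X z2) \<le> 2 * r \<and> overlap z1 z2 \<le> (1 - \<eta>) * p0) \<le> 4 * (2 * r)\<^sup>2"
      using r by (intro order_trans[OF prob_mono_pred[OF K] near_le[of "2 * r" "X z1"]]) auto
  qed (use J_nonneg[OF s] in \<open>auto simp: near_def\<close>)
  have "\<P>(x in Mk \<Otimes>\<^sub>M Om. near (2 * r) (fst x) (snd x j) \<and> t \<le> cnt V (fst x) (snd x) \<and> t \<le> cnt V (snd x j) (snd x))
     = \<P>(x in ?M. near (2 * r) (fst x) (fst (snd x)) \<and> t \<le> cnt V (fst x) (snd (snd x)) \<and> t \<le> cnt V (fst (snd x)) (snd (snd x)))"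
    by (subst pair_upd[where j=j]) (auto simp: R_upd[OF j])
  also have "\<dots> \<le> \<P>(x in ?M. ?A x \<or> ?B x)"
    by (rule prob_mono_pred[OF MM]) (auto simp: near_def)
  also have "\<dots> = MM.prob ({x\<in>space ?M. ?A x} \<union> {x\<in>space ?M. ?B x})"
    by (intro arg_cong[where f=MM.prob]) auto
  also have "\<dots> \<le> \<P>(x in ?M. ?A x) + \<P>(x in ?M. ?B x)"
    by (rule measure_Un_le) auto
  finally show ?thesis using A B by (simp add: power2_eq_square mult_ac)
qed

text \<open>No proximity is assumed between the two vertices. Within distance \<open>2 * r\<close>
  the degree of the second is given up; beyond it the neighbourhoods are disjoint, which is the case
  of \<eta> equal to 1. In both cases the arc between the second vertex and \<open>i\<close>
  contributes a factor \<open>p\<close>, as \<open>i\<close> is not in \<open>V\<close>.\<close>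

lemma hit_pair:
  assumes V: "finite V" "card V \<le> m" and j: "j \<notin> V" and i: "i \<notin> V" "i \<noteq> j" and s: "1 \<le> s"
  shows "\<P>(x in Mk \<Otimes>\<^sub>M Om. hit (snd x j) i (snd x i) \<and> t \<le> cnt V (fst x) (snd x) \<and> t \<le> cnt V (snd x j) (snd x))
    \<le> p * (16 * r\<^sup>2 * btail m p t + J m 1 t s)"
proof -
  note [simp] = V
  let ?M = "Mk \<Otimes>\<^sub>M (Mk \<Otimes>\<^sub>M Om)"
  have MM: "prob_space ?M" by (intro prob_space_pair Mk MkOm)
  interpret MM: prob_space ?M by (rule MM)
  interpret K: prob_space K by (rule K)
  let ?h = "\<lambda>x. hit (fst (snd x)) i (snd (snd x) i)"
  let ?A = "\<lambda>x. near (2 * r) (fst x) (fst (snd x)) \<and> ?h x \<and> t \<le> cnt V (fst x) (snd (snd x))"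
  let ?B = "\<lambda>x. \<not> near (2 * r) (fst x) (fst (snd x)) \<and> ?h x \<and> t \<le> cnt V (fst x) (snd (snd x)) \<and> t \<le> cnt V (fst (snd x)) (snd (snd x))"
  have A: "\<P>(x in ?M. ?A x) \<le> (p * btail m p t) * (4 * (2 * r)\<^sup>2)"
  proof (rule pair_le[where \<phi>="\<lambda>z1 z2. dist (X z1) (X z2) \<le> 2 * r"])
    fix z1 z2 assume z[measurable]: "z1 \<in> space K" "z2 \<in> space K"
    show "\<P>(x in edges q \<Otimes>\<^sub>M edges q \<Otimes>\<^sub>M Om. ?A ((z1, fst (snd x)), (z2, fst x), snd (snd x))) \<le> p * btail m p t"
      by (rule order_trans[OF prob_mono_pred two_hit_le[OF z V i(1)]]) (auto intro!: prob_space_pair edges Om)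
  next
    fix z1 assume [measurable]: "z1 \<in> space K"
    show "\<P>(z2 in K. dist (X z1) (X z2) \<le> 2 * r) \<le> 4 * (2 * r)\<^sup>2"
      using r by (intro near_le) auto
  qed (use p01 in \<open>auto intro!: btail_nonneg mult_nonneg_nonneg simp: near_def\<close>)
  have B: "\<P>(x in ?M. ?B x) \<le> (p * J m 1 t s) * 1"
  proof (rule pair_le[where \<phi>="\<lambda>z1 z2. 2 * r < dist (X z1) (X z2)"])
    fix z1 z2 assume z[measurable]: "z1 \<in> space K" "z2 \<in> space K" and far: "2 * r < dist (X z1) (X z2)"
    have ov: "overlap z1 z2 \<le> (1 - 1) * p0" using overlap_far[OF far] by simp
    show "\<P>(x in edges q \<Otimes>\<^sub>M edges q \<Otimes>\<^sub>M Om. ?B ((z1, fst (snd x)), (z2, fst x), snd (snd x))) \<le> p * J m 1 t s"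
      by (rule order_trans[OF prob_mono_pred two_hit_tail_le[OF z V i(1) ov _ s]]) (auto intro!: prob_space_pair edges Om)
  qed (use J_nonneg[OF s] p01 in \<open>auto simp: near_def\<close>)
  have "\<P>(x in Mk \<Otimes>\<^sub>M Om. hit (snd x j) i (snd x i) \<and> t \<le> cnt V (fst x) (snd x) \<and> t \<le> cnt V (snd x j) (snd x))
     = \<P>(x in ?M. ?h x \<and> t \<le> cnt V (fst x) (snd (snd x)) \<and> t \<le> cnt V (fst (snd x)) (snd (snd x)))"
    by (subst pair_upd[where j=j]) (use i in \<open>auto simp: R_upd[OF j]\<close>)
  also have "\<dots> \<le> \<P>(x in ?M. ?A x \<or> ?B x)"
    by (rule prob_mono_pred[OF MM]) auto
  also have "\<dots> = MM.prob ({x\<in>space ?M. ?A x} \<union> {x\<in>space ?M. ?B x})"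
    by (intro arg_cong[where f=MM.prob]) auto
  also have "\<dots> \<le> \<P>(x in ?M. ?A x) + \<P>(x in ?M. ?B x)"
    by (rule measure_Un_le) auto
  finally show ?thesis using A B by (simp add: power2_eq_square algebra_simps)
qed

lemma all_pair:
  assumes V: "finite V" "card V \<le> m" and j: "j \<notin> V" and s: "1 \<le> s"
  shows "\<P>(x in Mk \<Otimes>\<^sub>M Om. t \<le> cnt V (fst x) (snd x) \<and> t \<le> cnt V (snd x j) (snd x))
    \<le> 16 * r\<^sup>2 * btail m p t + J m 1 t s"
proof -
  note [simp] = V
  let ?M = "Mk \<Otimes>\<^sub>M (Mk \<Otimes>\<^sub>M Om)"
  have MM: "prob_space ?M" by (intro prob_space_pair Mk MkOm)
  interpret MM: prob_space ?M by (rule MM)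
  interpret K: prob_space K by (rule K)
  let ?A = "\<lambda>x. near (2 * r) (fst x) (fst (snd x)) \<and> t \<le> cnt V (fst x) (snd (snd x))"
  let ?B = "\<lambda>x. \<not> near (2 * r) (fst x) (fst (snd x)) \<and> t \<le> cnt V (fst x) (snd (snd x)) \<and> t \<le> cnt V (fst (snd x)) (snd (snd x))"
  have A: "\<P>(x in ?M. ?A x) \<le> (btail m p t) * (4 * (2 * r)\<^sup>2)"
  proof (rule pair_le[where \<phi>="\<lambda>z1 z2. dist (X z1) (X z2) \<le> 2 * r"])
    fix z1 z2 assume z[measurable]: "z1 \<in> space K" "z2 \<in> space K"
    show "\<P>(x in edges q \<Otimes>\<^sub>M edges q \<Otimes>\<^sub>M Om. ?A ((z1, fst (snd x)), (z2, fst x), snd (snd x))) \<le> btail m p t"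
      by (rule order_trans[OF prob_mono_pred two_fst_le[OF z(1) V]]) (auto intro!: prob_space_pair edges Om)
  next
    fix z1 assume [measurable]: "z1 \<in> space K"
    show "\<P>(z2 in K. dist (X z1) (X z2) \<le> 2 * r) \<le> 4 * (2 * r)\<^sup>2"
      using r by (intro near_le) auto
  qed (use p01 in \<open>auto intro!: btail_nonneg mult_nonneg_nonneg simp: near_def\<close>)
  have B: "\<P>(x in ?M. ?B x) \<le> J m 1 t s * 1"
  proof (rule pair_le[where \<phi>="\<lambda>z1 z2. 2 * r < dist (X z1) (X z2)"])
    fix z1 z2 assume z[measurable]: "z1 \<in> space K" "z2 \<in> space K" and far: "2 * r < dist (X z1) (X z2)"
    have ov: "overlap z1 z2 \<le> (1 - 1) * p0" using overlap_far[OF far] by simp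
    show "\<P>(x in edges q \<Otimes>\<^sub>M edges q \<Otimes>\<^sub>M Om. ?B ((z1, fst (snd x)), (z2, fst x), snd (snd x))) \<le> J m 1 t s"
      by (rule order_trans[OF prob_mono_pred two_tail_le[OF z V ov _ s]]) (auto intro!: prob_space_pair edges Om)
  qed (use J_nonneg[OF s] p01 in \<open>auto simp: near_def\<close>)
  have "\<P>(x in Mk \<Otimes>\<^sub>M Om. t \<le> cnt V (fst x) (snd x) \<and> t \<le> cnt V (snd x j) (snd x))
     = \<P>(x in ?M. t \<le> cnt V (fst x) (snd (snd x)) \<and> t \<le> cnt V (fst (snd x)) (snd (snd x)))"
    by (subst pair_upd[where j=j]) (auto simp: R_upd[OF j])
  also have "\<dots> \<le> \<P>(x in ?M. ?A x \<or> ?B x)"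
    by (rule prob_mono_pred[OF MM]) auto
  also have "\<dots> = MM.prob ({x\<in>space ?M. ?A x} \<union> {x\<in>space ?M. ?B x})"
    by (intro arg_cong[where f=MM.prob]) auto
  also have "\<dots> \<le> \<P>(x in ?M. ?A x) + \<P>(x in ?M. ?B x)"
    by (rule measure_Un_le) auto
  finally show ?thesis using A B by (simp add: power2_eq_square algebra_simps)
qed

text \<open>The counterpart of \<open>exc\<close> for an additional vertex with mark
  \<open>a\<close>, which has no index of its own in the configuration \<open>Z\<close>.\<close>

definition I1 :: "nat \<Rightarrow> nat set \<Rightarrow> 'z \<times> (nat \<Rightarrow> bool) \<Rightarrow> (nat \<Rightarrow> 'z \<times> (nat \<Rightarrow> bool)) \<Rightarrow> bool" where
  "I1 k V a Z \<longleftrightarrow> ok (fst a) \<and> k \<le> cnt V a Z"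

lemma I1_meas[measurable (raw)]:
  assumes [measurable]: "f \<in> measurable N Mk" "g \<in> measurable N Om" and V: "finite V"
  shows "Measurable.pred N (\<lambda>x. I1 k V (f x) (g x))"
proof -
  have [measurable]: "(\<lambda>x. cnt V (f x) (g x)) \<in> borel_measurable N"
    by (rule cnt_meas) (use V in auto)
  show ?thesis unfolding I1_def by measurable
qed

lemma cnt_remove: "finite V \<Longrightarrow> cnt V a Z \<le> Suc (cnt (V - {j}) a Z)"
proof -
  assume V: "finite V"
  have "{i\<in>V. hit a i (Z i)} \<subseteq> insert j {i\<in>V - {j}. hit a i (Z i)}" by auto
  then have "cnt V a Z \<le> card (insert j {i\<in>V - {j}. hit a i (Z i)})"
    unfolding cnt_def using V by (intro card_mono) auto
  also have "\<dots> \<le> Suc (cnt (V - {j}) a Z)"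
    unfolding cnt_def using V by (intro card_insert_le_m1) auto
  finally show ?thesis .
qed

lemma cnt_mono: "finite V \<Longrightarrow> U \<subseteq> V \<Longrightarrow> cnt U a Z \<le> cnt V a Z"
  unfolding cnt_def by (intro card_mono) auto

text \<open>Omitting an index from a count costs at most one but makes the count independent of the
  mark at that index. This is why the thresholds \<open>k - 1\<close> and \<open>k - 2\<close> occur
  in the error bound.\<close>

lemma I1_remove: "finite V \<Longrightarrow> I1 k V a Z \<Longrightarrow> k - 1 \<le> cnt (V - {j}) a Z"
  using cnt_remove[of V a Z j] by (auto simp: I1_def)

lemma I1_remove2: "finite V \<Longrightarrow> I1 k V a Z \<Longrightarrow> k - 2 \<le> cnt (V - {j, l}) a Z"
  using cnt_remove[of V a Z j] cnt_remove[of "V - {j}" a Z l]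
  by (auto simp: I1_def insert_commute[of j l] Diff_insert2[symmetric] simp flip: Diff_insert)

lemma exc_remove: "finite V \<Longrightarrow> exc k V Z j \<Longrightarrow> k - 1 \<le> cnt (V - {j, l}) (Z j) Z"
  using cnt_remove[of "V - {j}" "Z j" Z l] by (auto simp: exc_def Diff_insert2[symmetric] insert_commute)

text \<open>
  A necessary condition for the degree condition at \<open>j\<close> to change when the points near \<open>a\<close> are
  exchanged between \<open>Z\<close> and \<open>Z'\<close>.
\<close>

definition touched :: "nat set \<Rightarrow> nat \<Rightarrow> 'z \<times> (nat \<Rightarrow> bool) \<Rightarrow> (nat \<Rightarrow> 'z \<times> (nat \<Rightarrow> bool)) \<Rightarrow> (nat \<Rightarrow> 'z \<times> (nat \<Rightarrow> bool)) \<Rightarrow> bool" where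
  "touched V j a Z Z' \<longleftrightarrow> near r a (Z j) \<or> near r a (Z' j) \<or>
     (\<exists>l\<in>V - {j}. hit (Z j) l (Z l) \<and> (near r a (Z l) \<or> near r a (Z' l)))"

text \<open>A counted neighbour of \<open>j\<close> near \<open>a\<close> puts \<open>j\<close>
  itself within \<open>2 * r\<close> of \<open>a\<close>. What remains are events in which the
  second configuration has a point near \<open>a\<close>.\<close>

lemma touched_cases:
  "touched V j a Z Z' \<Longrightarrow> near (2 * r) a (Z j) \<or> near r a (Z' j) \<or>
     (\<exists>l\<in>V - {j}. hit (Z j) l (Z l) \<and> near r a (Z' l))"
proof -
  have 1: "near r a b \<Longrightarrow> near (2 * r) a b" for b using r by (auto simp: near_def)
  have 2: "near (2 * r) a b" if "hit b l c" "near r a c" for b c l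
    using hit_near[OF that(1)] that(2) dist_triangle2[of "X (fst a)" "X (fst b)" "X (fst c)"]
    by (auto simp: near_def)
  assume "touched V j a Z Z'"
  then show ?thesis unfolding touched_def using 1 2 by blast
qed

text \<open>Untouched means that the mark of \<open>j\<close> and those of all its counted
  neighbours stay in place, so the count cannot fall. One direction is enough because the lemma is
  also applied to the exchanged configurations.\<close>

lemma exc_cong_untouched:
  assumes V: "finite V" and ex: "exc k V Z j" and nt: "\<not> touched V j a Z Z'"
    and U: "\<And>i. U i = Z i \<or> near r a (Z i) \<or> near r a (Z' i)"
  shows "exc k V U j"
proof -
  have Uj: "U j = Z j" using U[of j] nt by (auto simp: touched_def)
  have "{l\<in>V - {j}. hit (Z j) l (Z l)} \<subseteq> {l\<in>V - {j}. hit (U j) l (U l)}"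
    using nt U unfolding Uj touched_def by force
  then have "cnt (V - {j}) (Z j) Z \<le> cnt (V - {j}) (U j) U"
    unfolding cnt_def using V by (intro card_mono) auto
  with ex show ?thesis unfolding exc_def Uj by auto
qed

abbreviation Th :: "((('z \<times> (nat \<Rightarrow> bool)) \<times> (nat \<Rightarrow> 'z \<times> (nat \<Rightarrow> bool))) \<times> (nat \<Rightarrow> 'z \<times> (nat \<Rightarrow> bool))) measure" where
  "Th \<equiv> (Mk \<Otimes>\<^sub>M Om) \<Otimes>\<^sub>M Om"

lemma Th: "prob_space Th"
  by (rule prob_space_pair[OF MkOm Om])

definition swp :: "('z \<times> (nat \<Rightarrow> bool) \<Rightarrow> 'z \<times> (nat \<Rightarrow> bool) \<Rightarrow> bool) \<Rightarrow> (nat \<Rightarrow> 'z \<times> (nat \<Rightarrow> bool)) \<Rightarrow> (nat \<Rightarrow> 'z \<times> (nat \<Rightarrow> bool)) \<Rightarrow> nat \<Rightarrow> 'z \<times> (nat \<Rightarrow> bool)" where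
  "swp c Z Z' = (\<lambda>i. if c (Z i) (Z' i) then Z' i else Z i)"

text \<open>For fixed \<open>a\<close> the condition is symmetric in the two marks, so the exchange
  preserves the joint law of the copies; it remains to integrate over \<open>a\<close>. With the
  constantly true condition the two copies trade places completely.\<close>

lemma prob_exch:
  assumes P: "Measurable.pred Th (\<lambda>x. P (fst (fst x)) (snd (fst x)) (snd x))"
    and c: "Measurable.pred (Mk \<Otimes>\<^sub>M (Mk \<Otimes>\<^sub>M Mk)) (\<lambda>x. c (fst x) (fst (snd x)) (snd (snd x)))"
    and sym: "\<And>a u v. c a u v \<longleftrightarrow> c a v u"
  shows "\<P>(x in Th. P (fst (fst x)) (snd (fst x)) (snd x))
    = \<P>(x in Th. P (fst (fst x)) (swp (c (fst (fst x))) (snd (fst x)) (snd x)) (swp (c (fst (fst x))) (snd x) (snd (fst x))))"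
proof -
  have OO: "prob_space (Om \<Otimes>\<^sub>M Om)" by (rule prob_space_pair[OF Om Om])
  have "(\<lambda>x. ((fst x, fst (snd x)), snd (snd x))) \<in> measurable (Mk \<Otimes>\<^sub>M (Om \<Otimes>\<^sub>M Om)) Th" by measurable
  from measurable_compose[OF this P]
  have P1: "Measurable.pred (Mk \<Otimes>\<^sub>M (Om \<Otimes>\<^sub>M Om)) (\<lambda>x. P (fst x) (fst (snd x)) (snd (snd x)))" by simp
  have sw: "(\<lambda>x. swp (c (f x)) (g x) (h x)) \<in> measurable N Om"
    if [measurable]: "f \<in> measurable N Mk" "g \<in> measurable N Om" "h \<in> measurable N Om" for f g h and N :: "'x measure"
  proof (rule measurable_PiM_single')
    fix i :: nat
    have "(\<lambda>x. (f x, g x i, h x i)) \<in> measurable N (Mk \<Otimes>\<^sub>M (Mk \<Otimes>\<^sub>M Mk))" by measurable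
    from measurable_compose[OF this c] have [measurable]: "Measurable.pred N (\<lambda>x. c (f x) (g x i) (h x i))" by simp
    show "(\<lambda>x. swp (c (f x)) (g x) (h x) i) \<in> measurable N Mk" unfolding swp_def by measurable
  next
    show "(\<lambda>x. swp (c (f x)) (g x) (h x)) \<in> space N \<rightarrow> (\<Pi>\<^sub>E i\<in>UNIV. space Mk)"
      using measurable_space[OF that(2)] measurable_space[OF that(3)]
      by (auto simp: space_PiM PiE_iff swp_def)
  qed
  have "(\<lambda>x. ((fst (fst x), swp (c (fst (fst x))) (snd (fst x)) (snd x)), swp (c (fst (fst x))) (snd x) (snd (fst x)))) \<in> measurable Th Th"
    by (intro measurable_Pair sw) measurable
  from measurable_compose[OF this P]
  have P2: "Measurable.pred Th (\<lambda>x. P (fst (fst x)) (swp (c (fst (fst x))) (snd (fst x)) (snd x)) (swp (c (fst (fst x))) (snd x) (snd (fst x))))"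
    by simp
  have "(\<lambda>x. ((fst x, fst (snd x)), snd (snd x))) \<in> measurable (Mk \<Otimes>\<^sub>M (Om \<Otimes>\<^sub>M Om)) Th" by measurable
  from measurable_compose[OF this P2]
  have P3: "Measurable.pred (Mk \<Otimes>\<^sub>M (Om \<Otimes>\<^sub>M Om)) (\<lambda>x. P (fst x) (swp (c (fst x)) (fst (snd x)) (snd (snd x))) (swp (c (fst x)) (snd (snd x)) (fst (snd x))))"
    by simp
  have "\<P>(x in Th. P (fst (fst x)) (snd (fst x)) (snd x)) = \<P>(x in Mk \<Otimes>\<^sub>M (Om \<Otimes>\<^sub>M Om). P (fst x) (fst (snd x)) (snd (snd x)))"
    using measure_pair_assoc[OF Mk Om Om P] by simp
  also have "\<dots> = \<P>(x in Mk \<Otimes>\<^sub>M (Om \<Otimes>\<^sub>M Om). P (fst x) (swp (c (fst x)) (fst (snd x)) (snd (snd x))) (swp (c (fst x)) (snd (snd x)) (fst (snd x))))"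
  proof (rule prob_pair_cong_fst[OF Mk OO P1 P3 OO])
    fix a assume a: "a \<in> space Mk"
    have "(\<lambda>x. (a, x)) \<in> measurable (Mk \<Otimes>\<^sub>M Mk) (Mk \<Otimes>\<^sub>M (Mk \<Otimes>\<^sub>M Mk))" using a by measurable
    from measurable_compose[OF this c] have ca: "Measurable.pred (Mk \<Otimes>\<^sub>M Mk) (\<lambda>x. c a (fst x) (snd x))" by simp
    have "(\<lambda>x. (a, x)) \<in> measurable (Om \<Otimes>\<^sub>M Om) (Mk \<Otimes>\<^sub>M (Om \<Otimes>\<^sub>M Om))" using a by measurable
    from measurable_compose[OF this P1] have Pa: "Measurable.pred (Om \<Otimes>\<^sub>M Om) (\<lambda>x. P a (fst x) (snd x))" by simp
    have e: "(if c a u v then u else v) = (if c a v u then u else v)" for u v using sym[of a u v] by simp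
    show "\<P>(y in Om \<Otimes>\<^sub>M Om. P (fst (a, y)) (fst (snd (a, y))) (snd (snd (a, y)))) =
      \<P>(y in Om \<Otimes>\<^sub>M Om. P (fst (a, y)) (swp (c (fst (a, y))) (fst (snd (a, y))) (snd (snd (a, y))))
          (swp (c (fst (a, y))) (snd (snd (a, y))) (fst (snd (a, y)))))"
      using prob_swap_cond[OF Mk ca _ Pa] sym by (simp add: swp_def e)
  qed
  also have "\<dots> = \<P>(x in Th. P (fst (fst x)) (swp (c (fst (fst x))) (snd (fst x)) (snd x)) (swp (c (fst (fst x))) (snd x) (snd (fst x))))"
    using measure_pair_assoc[OF Mk Om Om P2] by simp
  finally show ?thesis .
qed

lemma near_sym: "near \<rho> a b \<longleftrightarrow> near \<rho> b a"
  by (simp add: near_def dist_commute)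

lemma exc_upd: "exc k V (Z(i := a)) i \<longleftrightarrow> I1 k (V - {i}) a Z"
  by (simp add: exc_def I1_def R_upd)

lemma exc_upd_mono:
  assumes "finite V" "j \<noteq> i" "exc k (V - {i}) Z j"
  shows "exc k V (Z(i := a)) j"
proof -
  have "cnt (V - {i} - {j}) (Z j) Z = cnt (V - {i} - {j}) (Z j) (Z(i := a))"
    by (rule R_upd[symmetric]) simp
  also have "\<dots> \<le> cnt (V - {j}) (Z j) (Z(i := a))"
    using assms by (intro cnt_mono) auto
  finally show ?thesis using assms by (auto simp: exc_def)
qed

text \<open>A single added vertex raises a degree by at most one, and only if it is a neighbour;
  hence \<open>j\<close> was already at \<open>k - 1\<close> and lies within \<open>r\<close> of the
  new point.\<close>

lemma exc_upd_diff:
  assumes V: "finite V" "j \<noteq> i" and e: "exc k V (Z(i := a)) j" and ne: "\<not> exc k (V - {i}) Z j"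
  shows "near r a (Z j)" "k - 1 \<le> cnt (V - {i} - {j}) (Z j) Z"
proof -
  have k: "k \<le> cnt (V - {j}) (Z j) (Z(i := a))" and ok: "ok (fst (Z j))"
    using e V by (auto simp: exc_def)
  have u: "cnt (V - {j} - {i}) (Z j) (Z(i := a)) = cnt (V - {i} - {j}) (Z j) Z"
    by (subst R_upd) (auto simp: Diff_insert2[symmetric] insert_commute simp flip: Diff_insert)
  show "k - 1 \<le> cnt (V - {i} - {j}) (Z j) Z"
    using cnt_remove[of "V - {j}" "Z j" "Z(i := a)" i] k V u by simp
  have "hit (Z j) i a"
  proof (rule ccontr)
    assume "\<not> hit (Z j) i a"
    then have "cnt (V - {j}) (Z j) (Z(i := a)) \<le> cnt (V - {j} - {i}) (Z j) (Z(i := a))"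
      unfolding cnt_def using V by (intro card_mono) auto
    then show False using ne ok k unfolding u by (auto simp: exc_def)
  qed
  then show "near r a (Z j)" using hit_near near_sym by blast
qed

text \<open>The sum of all bounds for the dependence of one vertex on the others. Each term has a
  factor \<open>m\<close> for the choice of a second vertex, another \<open>m\<close> where a
  neighbour of that vertex is involved, and powers of \<open>r\<close> for proximity. The term with
  \<eta> is doubled because it arises both from the exchange and from inserting the vertex into the
  configuration; for the same reason the product of the tails at \<open>k\<close> and
  \<open>k - 1\<close> is written twice. The parameter \<open>s\<close> serves overlapping
  neighbourhoods, \<open>s'\<close> disjoint ones.\<close>

definition err :: "nat \<Rightarrow> nat \<Rightarrow> real \<Rightarrow> real \<Rightarrow> real \<Rightarrow> real" where
  "err m k \<eta> s s' =
     real m * (2 * (256 * \<eta>\<^sup>2 * r\<^sup>2 * btail m p (k - 1) + 16 * r\<^sup>2 * J m \<eta> (k - 1) s)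
        + btail m p k * (4 * r\<^sup>2 * btail m p (k - 1)) + 4 * r\<^sup>2 * (16 * r\<^sup>2 * btail m p (k - 1) + J m 1 (k - 1) s')
        + 16 * r\<^sup>2 * btail m p k * btail m p k + btail m p k * (4 * r\<^sup>2 * btail m p (k - 1)))
     + real m * (real m * (4 * r\<^sup>2 * (p * (16 * r\<^sup>2 * btail m p (k - 2) + J m 1 (k - 2) s'))
        + p * btail m p (k - 1) * (4 * r\<^sup>2 * btail m p (k - 1))))"

lemma exc_prob_le: "finite V \<Longrightarrow> card V \<le> m \<Longrightarrow> \<P>(Z in Om. exc k V Z j) \<le> btail m p k"
proof -
  assume V: "finite V" "card V \<le> m"
  then have V': "finite (V - {j})" "card (V - {j}) \<le> m"
    using card_mono[of V "V - {j}"] by auto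
  interpret K: prob_space K by (rule K)
  have "\<P>(Z in Om. exc k V Z j) = \<P>(x in Mk \<Otimes>\<^sub>M Om. exc k V ((snd x)(j := fst x)) j)"
    by (rule prob_upd[OF Mk]) (use V in measurable)
  also have "\<dots> = \<P>(x in Mk \<Otimes>\<^sub>M Om. ok (fst (fst x)) \<and> k \<le> cnt (V - {j}) (fst x) (snd x))"
    by (simp add: exc_upd I1_def)
  also have "\<dots> \<le> btail m p k * \<P>(z in K. ok z)"
    by (rule one_le[OF ok_measurable V'])
  also have "\<dots> \<le> btail m p k * 1"
    using p01 by (intro mult_left_mono btail_nonneg) auto
  finally show ?thesis by simp
qed

lemma exc_hit_prob_le:
  assumes V: "finite V" "card V \<le> m" and l: "l \<noteq> j"
  shows "\<P>(Z in Om. exc k V Z j \<and> hit (Z j) l (Z l)) \<le> p * btail m p (k - 1)"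
proof -
  have V': "finite (V - {j, l})" "card (V - {j, l}) \<le> m"
    using V card_mono[of V "V - {j, l}"] by auto
  note [simp] = V V'
  have "\<P>(Z in Om. exc k V Z j \<and> hit (Z j) l (Z l)) \<le> \<P>(Z in Om. hit (Z j) l (Z l) \<and> k - 1 \<le> cnt (V - {j, l}) (Z j) Z)"
    by (rule prob_mono_pred[OF Om]) (measurable, use exc_remove[OF V(1), of k _ j l] in auto)
  also have "\<dots> = \<P>(x in Mk \<Otimes>\<^sub>M Om. hit (fst x) l (snd x l) \<and> k - 1 \<le> cnt (V - {j, l}) (fst x) (snd x))"
    using l by (subst prob_upd[OF Mk, where i=j]) (auto simp: R_upd)
  also have "\<dots> \<le> p * btail m p (k - 1)"
    by (rule one_hit_le[OF V']) simp
  finally show ?thesis .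
qed

end

text \<open>The events follow the three alternatives of \<open>touched_cases\<close>: two depend on
  the second vertex alone, the third also on one of its neighbours.\<close>

lemma sum_union_bound3:
  assumes M: "prob_space M" and J: "finite J" and L: "\<And>j. j \<in> J \<Longrightarrow> finite (L j)"
    and cJ: "card J \<le> m" and cL: "\<And>j. j \<in> J \<Longrightarrow> card (L j) \<le> m"
    and A[measurable]: "\<And>j. j \<in> J \<Longrightarrow> Measurable.pred M (A j)" and B[measurable]: "\<And>j. j \<in> J \<Longrightarrow> Measurable.pred M (B j)"
    and C[measurable]: "\<And>j l. j \<in> J \<Longrightarrow> l \<in> L j \<Longrightarrow> Measurable.pred M (C j l)"
    and a: "\<And>j. j \<in> J \<Longrightarrow> \<P>(x in M. A j x) \<le> a" and b: "\<And>j. j \<in> J \<Longrightarrow> \<P>(x in M. B j x) \<le> b"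
    and c: "\<And>j l. j \<in> J \<Longrightarrow> l \<in> L j \<Longrightarrow> \<P>(x in M. C j l x) \<le> c"
    and nn: "0 \<le> a" "0 \<le> b" "0 \<le> c"
    and P: "\<And>x. x \<in> space M \<Longrightarrow> P x \<Longrightarrow> \<exists>j\<in>J. A j x \<or> B j x \<or> (\<exists>l\<in>L j. C j l x)"
  shows "\<P>(x in M. P x) \<le> real m * (a + b + real m * c)"
proof -
  interpret prob_space M by fact
  have pc[measurable]: "Measurable.pred M (\<lambda>x. \<exists>l\<in>L j. C j l x)" if "j \<in> J" for j
    using L[OF that] C[OF that] by (intro pred_intros_finite(4)) auto
  have "\<P>(x in M. P x) \<le> \<P>(x in M. \<exists>j\<in>J. A j x \<or> B j x \<or> (\<exists>l\<in>L j. C j l x))"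
    using P J by (intro prob_mono_pred[OF M]) auto
  also have "\<dots> \<le> (\<Sum>j\<in>J. a + b + real m * c)"
  proof (rule prob_union_bound[OF M J])
    fix j assume j: "j \<in> J"
    note [measurable] = A[OF j] B[OF j] pc[OF j]
    show "Measurable.pred M (\<lambda>x. A j x \<or> B j x \<or> (\<exists>l\<in>L j. C j l x))" by measurable
    have "\<P>(x in M. \<exists>l\<in>L j. C j l x) \<le> (\<Sum>l\<in>L j. c)"
      using j by (intro prob_union_bound[OF M L]) (auto intro: c)
    also have "\<dots> \<le> real m * c" using cL[OF j] nn by (auto intro: mult_right_mono)
    finally have 3: "\<P>(x in M. \<exists>l\<in>L j. C j l x) \<le> real m * c" .
    have "\<P>(x in M. A j x \<or> B j x \<or> (\<exists>l\<in>L j. C j l x))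
       = prob ({x\<in>space M. A j x} \<union> ({x\<in>space M. B j x} \<union> {x\<in>space M. \<exists>l\<in>L j. C j l x}))"
      by (intro arg_cong[where f=prob]) auto
    also have "\<dots> \<le> \<P>(x in M. A j x) + prob ({x\<in>space M. B j x} \<union> {x\<in>space M. \<exists>l\<in>L j. C j l x})"
      by (rule measure_Un_le) auto
    also have "prob ({x\<in>space M. B j x} \<union> {x\<in>space M. \<exists>l\<in>L j. C j l x}) \<le> \<P>(x in M. B j x) + \<P>(x in M. \<exists>l\<in>L j. C j l x)"
      by (rule measure_Un_le) auto
    finally show "\<P>(x in M. A j x \<or> B j x \<or> (\<exists>l\<in>L j. C j l x)) \<le> a + b + real m * c"
      using a[OF j] b[OF j] 3 by simp
  qed
  also have "\<dots> \<le> real m * (a + b + real m * c)"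
    using cJ nn by (auto intro: mult_right_mono)
  finally show ?thesis .
qed

context mark_model
begin

lemma touched_meas[measurable (raw)]:
  assumes [measurable]: "f \<in> measurable N Mk" "g \<in> measurable N Om" "h \<in> measurable N Om" and V: "finite V"
  shows "Measurable.pred N (\<lambda>x. touched V j (f x) (g x) (h x))"
proof -
  have [measurable]: "Measurable.pred N (\<lambda>x. \<exists>l\<in>V - {j}. hit (g x j) l (g x l) \<and> (near r (f x) (g x l) \<or> near r (f x) (h x l)))"
    by (rule pred_intros_finite(4)) (use V in auto)
  show ?thesis unfolding touched_def by measurable
qed

text \<open>The product of probabilities is the probability that the fresh vertex has large degree
  in one copy while no vertex of \<open>J'\<close> exceeds in the other. After exchanging the points
  near the fresh vertex, its degree can be read off from the copy of the others, \<open>?Z\<close>;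
  the claim then compares, under this same event, the second event for \<open>?Z\<close> with the
  one for the exchanged \<open>?U\<close>.\<close>

lemma swap_error:
  assumes V: "finite V" "card V \<le> m" and JV: "J' \<subseteq> V" and s': "1 \<le> s'" and s: "1 \<le> s" and \<eta>: "0 \<le> \<eta>" "\<eta> \<le> 1"
  shows "\<bar>\<P>(x in Mk \<Otimes>\<^sub>M Om. I1 k V (fst x) (snd x) \<and> (\<forall>j\<in>J'. \<not> exc k V (snd x) j))
     - \<P>(x in Mk \<Otimes>\<^sub>M Om. I1 k V (fst x) (snd x)) * \<P>(Z in Om. \<forall>j\<in>J'. \<not> exc k V Z j)\<bar>
   \<le> real m * ((256 * \<eta>\<^sup>2 * r\<^sup>2 * btail m p (k - 1) + 16 * r\<^sup>2 * J m \<eta> (k - 1) s)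
        + 4 * r\<^sup>2 * (16 * r\<^sup>2 * btail m p (k - 1) + J m 1 (k - 1) s')
        + real m * (4 * r\<^sup>2 * (p * (16 * r\<^sup>2 * btail m p (k - 2) + J m 1 (k - 2) s'))))
     + real m * (16 * r\<^sup>2 * btail m p k * btail m p k + btail m p k * (4 * r\<^sup>2 * btail m p (k - 1))
        + real m * (p * btail m p (k - 1) * (4 * r\<^sup>2 * btail m p (k - 1))))"
proof -
  interpret Th: prob_space Th by (rule Th)
  have finJ: "finite J'" and cJ: "card J' \<le> m"
    using V JV finite_subset card_mono[OF V(1) JV] by auto
  have V1: "finite (V - {j})" "card (V - {j}) \<le> m" for j using V card_mono[of V "V - {j}"] by auto
  have V2: "finite (V - {j, l})" "card (V - {j, l}) \<le> m" for j l using V card_mono[of V "V - {j, l}"] by auto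
  note [simp] = V(1) V1(1) V2(1) finJ
  note bn = btail_nonneg[OF p01] and Jn = J_nonneg[OF s] J_nonneg[OF s']
  define G where "G Z \<longleftrightarrow> (\<forall>j\<in>J'. \<not> exc k V Z j)" for Z
  have G[measurable (raw)]: "Measurable.pred N (\<lambda>x. G (f x))" if [measurable]: "f \<in> measurable N Om" for f and N :: "'x measure"
    unfolding G_def by measurable
  let ?c = "\<lambda>a u v. near r a u \<or> near r a v"
  let ?a = "\<lambda>x. fst (fst x)" and ?Z = "\<lambda>x. snd (fst x)" and ?Z' = "\<lambda>x. snd x"
  let ?U = "\<lambda>x. swp (?c (?a x)) (?Z x) (?Z' x)" and ?V = "\<lambda>x. swp (?c (?a x)) (?Z' x) (?Z x)"
  have [measurable]: "Measurable.pred (Mk \<Otimes>\<^sub>M Mk \<Otimes>\<^sub>M Mk) (\<lambda>x. near r (fst x) (fst (snd x)) \<or> near r (fst x) (snd (snd x)))"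
    by measurable
  have sw: "(\<lambda>x. swp (?c (f x)) (g x) (h x)) \<in> measurable N Om"
    if [measurable]: "f \<in> measurable N Mk" "g \<in> measurable N Om" "h \<in> measurable N Om" for f g h and N :: "'x measure"
  proof (rule measurable_PiM_single')
    fix i :: nat
    show "(\<lambda>x. swp (?c (f x)) (g x) (h x) i) \<in> measurable N Mk" unfolding swp_def by measurable
  next
    show "(\<lambda>x. swp (?c (f x)) (g x) (h x)) \<in> space N \<rightarrow> (\<Pi>\<^sub>E i\<in>UNIV. space Mk)"
      using measurable_space[OF that(2)] measurable_space[OF that(3)]
      by (auto simp: space_PiM PiE_iff swp_def)
  qed
  have [measurable]: "?U \<in> measurable Th Om" "?V \<in> measurable Th Om"
    by (rule sw; measurable)+
  define Bad where "Bad a Z Z' \<longleftrightarrow> (\<exists>j\<in>J'. exc k V Z j \<and> touched V j a Z Z')" for a Z Z'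
  have Bad[measurable (raw)]: "Measurable.pred N (\<lambda>x. Bad (f x) (g x) (h x))"
    if [measurable]: "f \<in> measurable N Mk" "g \<in> measurable N Om" "h \<in> measurable N Om" for f g h and N :: "'x measure"
    unfolding Bad_def by measurable
  \<comment> \<open>Where nothing is exchanged, neither copy has a point within \<open>r\<close> of
    \<open>a\<close>, so neither contributes to its degree; elsewhere \<open>?V\<close> agrees with
    \<open>?Z\<close>.\<close>
  have I1V: "I1 k V (?a x) (?V x) \<longleftrightarrow> I1 k V (?a x) (?Z x)" for x
  proof -
    have "hit (?a x) j (?V x j) \<longleftrightarrow> hit (?a x) j (?Z x j)" for j
      using hit_near[of "?a x" j "?Z x j"] hit_near[of "?a x" j "?Z' x j"] by (auto simp: swp_def)
    then show ?thesis by (simp add: I1_def cnt_def)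
  qed
  have split: "\<P>(x in Th. I1 k V (?a x) (?Z x) \<and> Q x) = \<P>(x in Mk \<Otimes>\<^sub>M Om. I1 k V (fst x) (snd x) \<and> Q' x)"
    if "\<And>x. Q x = Q' (fst x)" and [measurable]: "Measurable.pred (Mk \<Otimes>\<^sub>M Om) Q'" for Q Q'
    unfolding that(1) by (rule prob_pair_fst[OF MkOm Om]) measurable
  have B0: "\<P>(x in Mk \<Otimes>\<^sub>M Om. I1 k V (fst x) (snd x) \<and> G (snd x)) = \<P>(x in Th. I1 k V (?a x) (?Z x) \<and> G (?Z x))"
    by (rule split[symmetric]) auto
  have "\<P>(x in Mk \<Otimes>\<^sub>M Om. I1 k V (fst x) (snd x)) * \<P>(Z in Om. G Z) = \<P>(x in Th. I1 k V (?a x) (?Z x) \<and> G (?Z' x))"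
    by (rule prob_pair_Times[OF MkOm Om, symmetric]) measurable
  also have "\<dots> = \<P>(x in Th. I1 k V (?a x) (?Z' x) \<and> G (?Z x))"
    using prob_exch[of "\<lambda>a Z Z'. I1 k V a Z \<and> G Z'" "\<lambda>_ _ _. True"] by (simp add: swp_def)
  also have "\<dots> = \<P>(x in Th. I1 k V (?a x) (?V x) \<and> G (?U x))"
    by (rule prob_exch[of "\<lambda>a Z Z'. I1 k V a Z' \<and> G Z" ?c]) auto
  also have "\<dots> = \<P>(x in Th. I1 k V (?a x) (?Z x) \<and> G (?U x))"
    unfolding I1V ..
  finally have B1: "\<P>(x in Mk \<Otimes>\<^sub>M Om. I1 k V (fst x) (snd x)) * \<P>(Z in Om. G Z) = \<P>(x in Th. I1 k V (?a x) (?Z x) \<and> G (?U x))" .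
  have bad1: "I1 k V (?a x) (?Z x) \<Longrightarrow> G (?Z x) \<Longrightarrow> \<not> G (?U x) \<Longrightarrow> I1 k V (?a x) (?V x) \<and> Bad (?a x) (?U x) (?V x)" for x
  proof -
    assume I: "I1 k V (?a x) (?Z x)" and g: "G (?Z x)" "\<not> G (?U x)"
    then obtain j where j: "j \<in> J'" "exc k V (?U x) j" "\<not> exc k V (?Z x) j" by (auto simp: G_def)
    have "?Z x i = ?U x i \<or> near r (?a x) (?U x i) \<or> near r (?a x) (?V x i)" for i
      by (auto simp: swp_def)
    then have "touched V j (?a x) (?U x) (?V x)"
      using exc_cong_untouched[OF V(1) j(2), of "?a x" "?V x" "?Z x"] j(3) by blast
    with j I show ?thesis unfolding I1V Bad_def by auto
  qed
  have bad2: "I1 k V (?a x) (?Z x) \<Longrightarrow> \<not> G (?Z x) \<Longrightarrow> G (?U x) \<Longrightarrow> I1 k V (?a x) (?Z x) \<and> Bad (?a x) (?Z x) (?Z' x)" for x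
  proof -
    assume I: "I1 k V (?a x) (?Z x)" and g: "\<not> G (?Z x)" "G (?U x)"
    then obtain j where j: "j \<in> J'" "exc k V (?Z x) j" "\<not> exc k V (?U x) j" by (auto simp: G_def)
    have "?U x i = ?Z x i \<or> near r (?a x) (?Z x i) \<or> near r (?a x) (?Z' x i)" for i
      by (auto simp: swp_def)
    then have "touched V j (?a x) (?Z x) (?Z' x)"
      using exc_cong_untouched[OF V(1) j(2), of "?a x" "?Z' x" "?U x"] j(3) by blast
    with j I show ?thesis unfolding Bad_def by auto
  qed
  have up: "\<P>(x in Th. P x) - \<P>(x in Th. Q x) \<le> \<P>(x in Th. B x)"
    if [measurable]: "Measurable.pred Th P" "Measurable.pred Th Q" "Measurable.pred Th B"
      and imp: "\<And>x. P x \<Longrightarrow> \<not> Q x \<Longrightarrow> B x" for P Q B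
  proof -
    have "\<P>(x in Th. P x) \<le> Th.prob ({x\<in>space Th. Q x} \<union> {x\<in>space Th. B x})"
      using imp by (intro Th.finite_measure_mono) auto
    also have "\<dots> \<le> \<P>(x in Th. Q x) + \<P>(x in Th. B x)" by (rule measure_Un_le) auto
    finally show ?thesis by simp
  qed
  have d1: "\<P>(x in Th. I1 k V (?a x) (?Z x) \<and> G (?Z x)) - \<P>(x in Th. I1 k V (?a x) (?Z x) \<and> G (?U x))
     \<le> \<P>(x in Th. I1 k V (?a x) (?V x) \<and> Bad (?a x) (?U x) (?V x))"
    by (rule up) (use bad1 in \<open>auto\<close>)
  have d2: "\<P>(x in Th. I1 k V (?a x) (?Z x) \<and> G (?U x)) - \<P>(x in Th. I1 k V (?a x) (?Z x) \<and> G (?Z x))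
     \<le> \<P>(x in Th. I1 k V (?a x) (?Z x) \<and> Bad (?a x) (?Z x) (?Z' x))"
    by (rule up) (use bad2 in \<open>auto\<close>)
  \<comment> \<open>The exchange is undone in law, and then the two copies trade places, so that the
    degree of \<open>a\<close> is again taken in \<open>?Z\<close>.\<close>
  have "\<P>(x in Th. I1 k V (?a x) (?V x) \<and> Bad (?a x) (?U x) (?V x)) = \<P>(x in Th. I1 k V (?a x) (?Z' x) \<and> Bad (?a x) (?Z x) (?Z' x))"
    by (rule prob_exch[of "\<lambda>a Z Z'. I1 k V a Z' \<and> Bad a Z Z'" ?c, symmetric]) auto
  also have "\<dots> = \<P>(x in Th. I1 k V (?a x) (?Z x) \<and> Bad (?a x) (?Z' x) (?Z x))"
    using prob_exch[of "\<lambda>a Z Z'. I1 k V a Z' \<and> Bad a Z Z'" "\<lambda>_ _ _. True"] by (simp add: swp_def)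
  finally have d1': "\<P>(x in Th. I1 k V (?a x) (?V x) \<and> Bad (?a x) (?U x) (?V x)) = \<P>(x in Th. I1 k V (?a x) (?Z x) \<and> Bad (?a x) (?Z' x) (?Z x))" .
  let ?b0 = "btail m p k" and ?b1 = "btail m p (k - 1)" and ?b2 = "btail m p (k - 2)"
  \<comment> \<open>Both large degrees occur in the same copy, so the estimates for pairs are
    needed; \<open>?Z'\<close> only contributes the chance of a point near \<open>a\<close>.\<close>
  have e1: "\<P>(x in Th. I1 k V (?a x) (?Z x) \<and> Bad (?a x) (?Z x) (?Z' x))
    \<le> real m * ((256 * \<eta>\<^sup>2 * r\<^sup>2 * ?b1 + 16 * r\<^sup>2 * J m \<eta> (k - 1) s)
        + 4 * r\<^sup>2 * (16 * r\<^sup>2 * ?b1 + J m 1 (k - 1) s')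
        + real m * (4 * r\<^sup>2 * (p * (16 * r\<^sup>2 * ?b2 + J m 1 (k - 2) s'))))"
  proof (rule sum_union_bound3[OF Th finJ _ cJ])
    fix j assume j: "j \<in> J'"
    show "card (V - {j}) \<le> m" "finite (V - {j})" using V1 by auto
    let ?A = "\<lambda>x. near (2 * r) (fst x) (snd x j) \<and> k - 1 \<le> cnt (V - {j}) (fst x) (snd x) \<and> k - 1 \<le> cnt (V - {j}) (snd x j) (snd x)"
    show "Measurable.pred Th (\<lambda>x. ?A (fst x))" by measurable
    have "\<P>(x in Th. ?A (fst x)) = \<P>(x in Mk \<Otimes>\<^sub>M Om. ?A x)"
      by (rule prob_pair_fst[OF MkOm Om]) measurable
    also have "\<dots> \<le> 256 * \<eta>\<^sup>2 * r\<^sup>2 * ?b1 + 16 * r\<^sup>2 * J m \<eta> (k - 1) s"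
      by (rule near_pair[OF V1 _ \<eta> s]) simp
    finally show "\<P>(x in Th. ?A (fst x)) \<le> 256 * \<eta>\<^sup>2 * r\<^sup>2 * ?b1 + 16 * r\<^sup>2 * J m \<eta> (k - 1) s" .
    let ?Q = "\<lambda>x. k - 1 \<le> cnt (V - {j}) (fst x) (snd x) \<and> k - 1 \<le> cnt (V - {j}) (snd x j) (snd x)"
    show "Measurable.pred Th (\<lambda>x. near r (?a x) (?Z' x j) \<and> ?Q (fst x))" by measurable
    have "\<P>(x in Th. near r (?a x) (?Z' x j) \<and> ?Q (fst x)) \<le> (4 * r\<^sup>2) * \<P>(x in Mk \<Otimes>\<^sub>M Om. ?Q x)"
    proof (rule measure_pair_le[OF MkOm Om])
      fix x assume x: "x \<in> space (Mk \<Otimes>\<^sub>M Om)"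
      then have [measurable]: "fst x \<in> space Mk" by (simp add: space_pair_measure[of Mk] mem_Times_iff)
      show "\<P>(y in Om. near r (fst (fst (x, y))) (snd (x, y) j) \<and> ?Q (fst (x, y))) \<le> 4 * r\<^sup>2"
      proof (cases "?Q x")
        case True
        then show ?thesis using near_comp[of "fst x" r j] r x by (simp add: space_pair_measure[of Mk] mem_Times_iff)
      next
        case False
        then have "{y\<in>space Om. near r (fst (fst (x, y))) (snd (x, y) j) \<and> ?Q (fst (x, y))} = {}" by auto
        then show ?thesis by (simp only: measure_empty) simp
      qed
    qed auto
    also have "\<dots> \<le> 4 * r\<^sup>2 * (16 * r\<^sup>2 * ?b1 + J m 1 (k - 1) s')"
      by (intro mult_left_mono all_pair[OF V1 _ s']) auto
    finally show "\<P>(x in Th. near r (?a x) (?Z' x j) \<and> ?Q (fst x)) \<le> 4 * r\<^sup>2 * (16 * r\<^sup>2 * ?b1 + J m 1 (k - 1) s')" .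
    fix l assume l: "l \<in> V - {j}"
    let ?Q = "\<lambda>x. hit (snd x j) l (snd x l) \<and> k - 2 \<le> cnt (V - {j, l}) (fst x) (snd x) \<and> k - 2 \<le> cnt (V - {j, l}) (snd x j) (snd x)"
    show "Measurable.pred Th (\<lambda>x. near r (?a x) (?Z' x l) \<and> ?Q (fst x))" by measurable
    have "\<P>(x in Th. near r (?a x) (?Z' x l) \<and> ?Q (fst x)) \<le> (4 * r\<^sup>2) * \<P>(x in Mk \<Otimes>\<^sub>M Om. ?Q x)"
    proof (rule measure_pair_le[OF MkOm Om])
      fix x assume x: "x \<in> space (Mk \<Otimes>\<^sub>M Om)"
      then have [measurable]: "fst x \<in> space Mk" by (simp add: space_pair_measure[of Mk] mem_Times_iff)
      show "\<P>(y in Om. near r (fst (fst (x, y))) (snd (x, y) l) \<and> ?Q (fst (x, y))) \<le> 4 * r\<^sup>2"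
      proof (cases "?Q x")
        case True
        then show ?thesis using near_comp[of "fst x" r l] r x by (simp add: space_pair_measure[of Mk] mem_Times_iff)
      next
        case False
        then have "{y\<in>space Om. near r (fst (fst (x, y))) (snd (x, y) l) \<and> ?Q (fst (x, y))} = {}" by auto
        then show ?thesis by (simp only: measure_empty) simp
      qed
    qed auto
    also have "\<dots> \<le> 4 * r\<^sup>2 * (p * (16 * r\<^sup>2 * ?b2 + J m 1 (k - 2) s'))"
      using l by (intro mult_left_mono hit_pair[OF V2 _ _ _ s']) auto
    finally show "\<P>(x in Th. near r (?a x) (?Z' x l) \<and> ?Q (fst x)) \<le> 4 * r\<^sup>2 * (p * (16 * r\<^sup>2 * ?b2 + J m 1 (k - 2) s'))" .
  next
    fix x assume "I1 k V (?a x) (?Z x) \<and> Bad (?a x) (?Z x) (?Z' x)"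
    then obtain j where I: "I1 k V (?a x) (?Z x)" and j: "j \<in> J'" "exc k V (?Z x) j" "touched V j (?a x) (?Z x) (?Z' x)"
      by (auto simp: Bad_def)
    have e: "k - 1 \<le> cnt (V - {j}) (?Z x j) (?Z x)" "k - 2 \<le> cnt (V - {j, l}) (?Z x j) (?Z x)" for l
      using exc_remove[OF V(1) j(2), of l] j(2) by (auto simp: exc_def)
    show "\<exists>j\<in>J'. (near (2 * r) (?a x) (?Z x j) \<and> k - 1 \<le> cnt (V - {j}) (?a x) (?Z x) \<and> k - 1 \<le> cnt (V - {j}) (?Z x j) (?Z x))
      \<or> (near r (?a x) (?Z' x j) \<and> k - 1 \<le> cnt (V - {j}) (?a x) (?Z x) \<and> k - 1 \<le> cnt (V - {j}) (?Z x j) (?Z x))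
      \<or> (\<exists>l\<in>V - {j}. near r (?a x) (?Z' x l) \<and> hit (?Z x j) l (?Z x l) \<and> k - 2 \<le> cnt (V - {j, l}) (?a x) (?Z x) \<and> k - 2 \<le> cnt (V - {j, l}) (?Z x j) (?Z x))"
      using touched_cases[OF j(3)] j(1) e I1_remove[OF V(1) I, of j] I1_remove2[OF V(1) I, of j] by blast
  qed (use bn Jn p01 in \<open>auto intro!: add_nonneg_nonneg mult_nonneg_nonneg\<close>)
  \<comment> \<open>The second large degree occurs in the other copy, so the two tails multiply and
    no overlap has to be considered.\<close>
  have e2: "\<P>(x in Th. I1 k V (?a x) (?Z x) \<and> Bad (?a x) (?Z' x) (?Z x))
    \<le> real m * (16 * r\<^sup>2 * ?b0 * ?b0 + ?b0 * (4 * r\<^sup>2 * ?b1) + real m * (p * ?b1 * (4 * r\<^sup>2 * ?b1)))"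
  proof (rule sum_union_bound3[OF Th finJ _ cJ])
    fix j assume j: "j \<in> J'"
    show "card (V - {j}) \<le> m" "finite (V - {j})" using V1 by auto
    let ?A = "\<lambda>x. near (2 * r) (?a x) (?Z' x j) \<and> k \<le> cnt (V - {j}) (?Z' x j) (?Z' x) \<and> k \<le> cnt V (?a x) (?Z x)"
    show "Measurable.pred Th ?A" by measurable
    have "\<P>(x in Th. ?A x) \<le> 16 * r\<^sup>2 * ?b0 * \<P>(x in Mk \<Otimes>\<^sub>M Om. k \<le> cnt V (fst x) (snd x))"
    proof (rule measure_pair_le[OF MkOm Om])
      fix x assume x: "x \<in> space (Mk \<Otimes>\<^sub>M Om)"
      then have a[measurable]: "fst x \<in> space Mk" by (simp add: space_pair_measure[of Mk] mem_Times_iff)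
      have "\<P>(y in Om. ?A (x, y)) \<le> \<P>(y in Om. near (2 * r) (fst x) (y j) \<and> k \<le> cnt (V - {j}) (y j) y)"
        by (rule prob_mono_pred[OF Om]) auto
      also have "\<dots> \<le> 4 * (2 * r)\<^sup>2 * ?b0"
        using r by (intro near_cnt2[OF V1 _ _ a]) auto
      finally show "\<P>(y in Om. ?A (x, y)) \<le> 16 * r\<^sup>2 * ?b0" by (simp add: power2_eq_square)
    qed (use bn in auto)
    also have "\<P>(x in Mk \<Otimes>\<^sub>M Om. k \<le> cnt V (fst x) (snd x)) \<le> ?b0"
      using one_le[of "\<lambda>_. True", OF _ V, of k] prob_space.prob_space[OF K] by simp
    finally show "\<P>(x in Th. ?A x) \<le> 16 * r\<^sup>2 * ?b0 * ?b0" using bn by (simp add: mult_left_mono)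
    let ?Q = "\<lambda>x. near r (fst x) (snd x j) \<and> k - 1 \<le> cnt (V - {j}) (fst x) (snd x)"
    show "Measurable.pred Th (\<lambda>x. exc k V (?Z' x) j \<and> ?Q (fst x))" by measurable
    have "\<P>(x in Th. exc k V (?Z' x) j \<and> ?Q (fst x)) \<le> ?b0 * \<P>(x in Mk \<Otimes>\<^sub>M Om. ?Q x)"
    proof (rule measure_pair_le[OF MkOm Om])
      fix x
      show "\<P>(y in Om. exc k V (snd (x, y)) j \<and> ?Q (fst (x, y))) \<le> ?b0"
        by (rule order_trans[OF prob_mono_pred[OF Om] exc_prob_le[OF V, of k j]]) auto
    qed (use bn in auto)
    also have "\<dots> \<le> ?b0 * (4 * r\<^sup>2 * ?b1)"
      using r bn by (intro mult_left_mono near_cnt1[OF V1]) auto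
    finally show "\<P>(x in Th. exc k V (?Z' x) j \<and> ?Q (fst x)) \<le> ?b0 * (4 * r\<^sup>2 * ?b1)" .
    fix l assume l: "l \<in> V - {j}"
    let ?Q = "\<lambda>x. near r (fst x) (snd x l) \<and> k - 1 \<le> cnt (V - {l}) (fst x) (snd x)"
    show "Measurable.pred Th (\<lambda>x. (exc k V (?Z' x) j \<and> hit (?Z' x j) l (?Z' x l)) \<and> ?Q (fst x))" by measurable
    have "\<P>(x in Th. (exc k V (?Z' x) j \<and> hit (?Z' x j) l (?Z' x l)) \<and> ?Q (fst x)) \<le> (p * ?b1) * \<P>(x in Mk \<Otimes>\<^sub>M Om. ?Q x)"
    proof (rule measure_pair_le[OF MkOm Om])
      fix x
      show "\<P>(y in Om. (exc k V (snd (x, y)) j \<and> hit (snd (x, y) j) l (snd (x, y) l)) \<and> ?Q (fst (x, y))) \<le> p * ?b1"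
        using l by (intro order_trans[OF prob_mono_pred[OF Om] exc_hit_prob_le[OF V, of l j k]]) auto
    qed (use bn p01 in auto)
    also have "\<dots> \<le> p * ?b1 * (4 * r\<^sup>2 * ?b1)"
      using r bn p01 by (intro mult_left_mono near_cnt1[OF V1]) auto
    finally show "\<P>(x in Th. (exc k V (?Z' x) j \<and> hit (?Z' x j) l (?Z' x l)) \<and> ?Q (fst x)) \<le> p * ?b1 * (4 * r\<^sup>2 * ?b1)" .
  next
    fix x assume "I1 k V (?a x) (?Z x) \<and> Bad (?a x) (?Z' x) (?Z x)"
    then obtain j where I: "I1 k V (?a x) (?Z x)" and j: "j \<in> J'" "exc k V (?Z' x) j" "touched V j (?a x) (?Z' x) (?Z x)"
      by (auto simp: Bad_def)
    have e: "k \<le> cnt (V - {j}) (?Z' x j) (?Z' x)" "k \<le> cnt V (?a x) (?Z x)"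
      using j(2) I by (auto simp: exc_def I1_def)
    show "\<exists>j\<in>J'. (near (2 * r) (?a x) (?Z' x j) \<and> k \<le> cnt (V - {j}) (?Z' x j) (?Z' x) \<and> k \<le> cnt V (?a x) (?Z x))
      \<or> (exc k V (?Z' x) j \<and> near r (?a x) (?Z x j) \<and> k - 1 \<le> cnt (V - {j}) (?a x) (?Z x))
      \<or> (\<exists>l\<in>V - {j}. (exc k V (?Z' x) j \<and> hit (?Z' x j) l (?Z' x l)) \<and> near r (?a x) (?Z x l) \<and> k - 1 \<le> cnt (V - {l}) (?a x) (?Z x))"
      using touched_cases[OF j(3)] j(1,2) e I1_remove[OF V(1) I] by blast
  qed (use bn p01 in \<open>auto intro!: add_nonneg_nonneg mult_nonneg_nonneg\<close>)
  have nn: "0 \<le> real m * ((256 * \<eta>\<^sup>2 * r\<^sup>2 * ?b1 + 16 * r\<^sup>2 * J m \<eta> (k - 1) s)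
        + 4 * r\<^sup>2 * (16 * r\<^sup>2 * ?b1 + J m 1 (k - 1) s')
        + real m * (4 * r\<^sup>2 * (p * (16 * r\<^sup>2 * ?b2 + J m 1 (k - 2) s'))))"
     "0 \<le> real m * (16 * r\<^sup>2 * ?b0 * ?b0 + ?b0 * (4 * r\<^sup>2 * ?b1) + real m * (p * ?b1 * (4 * r\<^sup>2 * ?b1)))"
    using bn Jn p01 by (auto intro!: add_nonneg_nonneg mult_nonneg_nonneg)
  show ?thesis
    unfolding G_def[symmetric] B0 B1 using d1 d2 e1 e2 nn unfolding d1' by linarith
qed

end

text \<open>The deviation from \<open>(1 - c)^i\<close> is multiplied by \<open>1 - c\<close> and
  increased by at most \<open>\<epsilon> * c\<close> in each step, an affine map with fixed point
  \<epsilon>. The errors therefore never accumulate beyond \<epsilon>, whatever the number of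
  steps.\<close>

lemma linear_recursion_error:
  fixes P d :: "nat \<Rightarrow> real"
  assumes P0: "P 0 = 1" and step: "\<And>i. i < m \<Longrightarrow> P (Suc i) = P i - d i"
    and d: "\<And>i. i < m \<Longrightarrow> \<bar>d i - c * P i\<bar> \<le> \<epsilon> * c"
    and c: "0 \<le> c" "c \<le> 1" and i: "i \<le> m" and \<epsilon>: "0 \<le> \<epsilon>"
  shows "\<bar>P i - (1 - c) ^ i\<bar> \<le> \<epsilon>"
  using i
proof (induction i)
  case 0
  then show ?case using P0 \<epsilon> by simp
next
  case (Suc i)
  have "P (Suc i) - (1 - c) ^ Suc i = (1 - c) * (P i - (1 - c) ^ i) - (d i - c * P i)"
    using Suc.prems step[of i] by (simp add: algebra_simps)
  also have "\<bar>\<dots>\<bar> \<le> \<bar>(1 - c) * (P i - (1 - c) ^ i)\<bar> + \<bar>d i - c * P i\<bar>" by (rule abs_triangle_ineq4)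
  also have "\<dots> \<le> (1 - c) * \<epsilon> + \<epsilon> * c"
    using Suc d[of i] c by (intro add_mono) (auto simp: abs_mult intro: mult_left_mono)
  finally show ?case by (simp add: algebra_simps)
qed

context mark_model
begin

text \<open>Resampling the mark of \<open>i\<close> makes its event one about a fresh vertex, to
  which \<open>swap_error\<close> applies. The other events still see \<open>i\<close> as a possible
  neighbour; they are replaced by the events without \<open>i\<close>, and the replacement matters
  only for a vertex near \<open>i\<close> that already has degree \<open>k - 1\<close> without
  it.\<close>

theorem indep_error:
  assumes V: "finite V" "card V \<le> m" and i: "i \<in> V" and JV: "J' \<subseteq> V - {i}"
    and s': "1 \<le> s'" and s: "1 \<le> s" and \<eta>: "0 \<le> \<eta>" "\<eta> \<le> 1"
  shows "\<bar>\<P>(Z in Om. exc k V Z i \<and> (\<forall>j\<in>J'. \<not> exc k V Z j)) - \<P>(Z in Om. exc k V Z i) * \<P>(Z in Om. \<forall>j\<in>J'. \<not> exc k V Z j)\<bar>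
    \<le> err m k \<eta> s s'"
proof -
  let ?W = "V - {i}"
  have W: "finite ?W" "card ?W \<le> m" using V card_mono[of V ?W] by auto
  have finJ: "finite J'" and cJ: "card J' \<le> m"
    using W JV finite_subset card_mono[OF W(1) JV] by auto
  have V1: "finite (?W - {j})" "card (?W - {j}) \<le> m" for j using W card_mono[of ?W "?W - {j}"] by auto
  note [simp] = V(1) W(1) V1(1) finJ
  note bn = btail_nonneg[OF p01] and Jn = J_nonneg[OF s] J_nonneg[OF s']
  let ?M = "Mk \<Otimes>\<^sub>M Om"
  interpret M: prob_space ?M by (rule MkOm)
  let ?I = "\<lambda>x. I1 k ?W (fst x) (snd x)" and ?G = "\<lambda>Z. \<forall>j\<in>J'. \<not> exc k ?W Z j"
    and ?u = "\<lambda>x. (snd x)(i := fst x)"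
  let ?A = "\<lambda>x. \<forall>j\<in>J'. \<not> exc k V (?u x) j"
  have Im[measurable]: "Measurable.pred ?M ?I" by measurable
  have um[measurable]: "?u \<in> measurable ?M Om" by measurable
  have Gm[measurable]: "Measurable.pred ?M (\<lambda>x. ?G (snd x))" "Measurable.pred Om ?G" by measurable
  have Am[measurable]: "Measurable.pred ?M ?A" by measurable
  have AG: "?G (snd x)" if "?A x" for x
    using that exc_upd_mono[OF V(1)] JV by blast
  have p1: "\<P>(Z in Om. exc k V Z i \<and> (\<forall>j\<in>J'. \<not> exc k V Z j)) = \<P>(x in ?M. ?I x \<and> ?A x)"
    by (subst prob_upd[OF Mk, where i=i]) (auto simp: exc_upd simp del: fun_upd_apply)
  have p2: "\<P>(Z in Om. exc k V Z i) = \<P>(x in ?M. ?I x)"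
    by (subst prob_upd[OF Mk, where i=i]) (auto simp: exc_upd)
  have p3: "\<P>(Z in Om. \<forall>j\<in>J'. \<not> exc k V Z j) = \<P>(x in ?M. ?A x)"
    by (subst prob_upd[OF Mk, where i=i]) (auto simp del: fun_upd_apply)
  have p4: "\<P>(Z in Om. ?G Z) = \<P>(x in ?M. ?G (snd x))"
    by (rule prob_pair_snd[OF Mk Om, symmetric]) measurable
  have up: "\<P>(x in ?M. P x) - \<P>(x in ?M. Q x) \<le> \<P>(x in ?M. B x)"
    if [measurable]: "Measurable.pred ?M P" "Measurable.pred ?M Q" "Measurable.pred ?M B"
      and imp: "\<And>x. P x \<Longrightarrow> \<not> Q x \<Longrightarrow> B x" for P Q B
  proof -
    have "\<P>(x in ?M. P x) \<le> M.prob ({x\<in>space ?M. Q x} \<union> {x\<in>space ?M. B x})"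
      using imp by (intro M.finite_measure_mono) auto
    also have "\<dots> \<le> \<P>(x in ?M. Q x) + \<P>(x in ?M. B x)" by (rule measure_Un_le) auto
    finally show ?thesis by simp
  qed
  define T where "T = 256 * \<eta>\<^sup>2 * r\<^sup>2 * btail m p (k - 1) + 16 * r\<^sup>2 * J m \<eta> (k - 1) s"
  have T0: "0 \<le> T" unfolding T_def using bn Jn by (auto intro!: add_nonneg_nonneg mult_nonneg_nonneg)
  let ?B1 = "\<lambda>j x. near (2 * r) (fst x) (snd x j) \<and> k - 1 \<le> cnt (?W - {j}) (fst x) (snd x) \<and> k - 1 \<le> cnt (?W - {j}) (snd x j) (snd x)"
  have near2: "near r a b \<Longrightarrow> near (2 * r) a b" for a b using r by (auto simp: near_def)
  have "\<P>(x in ?M. \<exists>j\<in>J'. ?B1 j x) \<le> (\<Sum>j\<in>J'. T)"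
    unfolding T_def
    by (rule prob_union_bound[OF MkOm finJ]) (measurable, rule near_pair[OF V1 _ \<eta> s], simp)
  also have "\<dots> \<le> real m * T" using T0 cJ by (auto intro: mult_right_mono)
  finally have b1: "\<P>(x in ?M. \<exists>j\<in>J'. ?B1 j x) \<le> real m * T" .
  let ?B2 = "\<lambda>j x. near r (fst x) (snd x j) \<and> k - 1 \<le> cnt (?W - {j}) (snd x j) (snd x)"
  have "\<P>(x in ?M. \<exists>j\<in>J'. ?B2 j x) \<le> (\<Sum>j\<in>J'. 4 * r\<^sup>2 * btail m p (k - 1))"
    by (rule prob_union_bound[OF MkOm finJ]) (measurable, rule near_cnt2'[OF V1], use r in auto)
  also have "\<dots> \<le> real m * (4 * r\<^sup>2 * btail m p (k - 1))" using bn cJ by (auto intro!: mult_right_mono)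
  finally have b2: "\<P>(x in ?M. \<exists>j\<in>J'. ?B2 j x) \<le> real m * (4 * r\<^sup>2 * btail m p (k - 1))" .
  have dif: "\<exists>j\<in>J'. ?B2 j x" if g: "?G (snd x)" "\<not> ?A x" for x
  proof -
    obtain j where j: "j \<in> J'" "exc k V (?u x) j" "\<not> exc k ?W (snd x) j" using g by auto
    moreover have "j \<noteq> i" using j JV by auto
    ultimately show ?thesis using exc_upd_diff[OF V(1), of j i k "snd x" "fst x"] by auto
  qed
  \<comment> \<open>Under \<open>?I\<close> the vertex causing the difference and the fresh vertex
    both have large degree and are close, which is the situation of
    \<open>near_pair\<close>.\<close>
  have c1: "\<P>(x in ?M. ?I x \<and> ?G (snd x)) - \<P>(x in ?M. ?I x \<and> ?A x) \<le> \<P>(x in ?M. \<exists>j\<in>J'. ?B1 j x)"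
  proof (rule up)
    fix x assume x: "?I x \<and> ?G (snd x)" "\<not> (?I x \<and> ?A x)"
    with dif obtain j where "j \<in> J'" "?B2 j x" by blast
    moreover have "k - 1 \<le> cnt (?W - {j}) (fst x) (snd x)" using I1_remove[OF W(1)] x by blast
    ultimately show "\<exists>j\<in>J'. ?B1 j x" using near2 by blast
  qed measurable
  have c2: "\<P>(x in ?M. ?I x \<and> ?A x) \<le> \<P>(x in ?M. ?I x \<and> ?G (snd x))"
    by (rule prob_mono_pred[OF MkOm]) (measurable, use AG in blast)
  have c3: "\<P>(x in ?M. ?G (snd x)) - \<P>(x in ?M. ?A x) \<le> \<P>(x in ?M. \<exists>j\<in>J'. ?B2 j x)"
    by (rule up) (measurable, use dif in blast)
  have c4: "\<P>(x in ?M. ?A x) \<le> \<P>(x in ?M. ?G (snd x))"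
    by (rule prob_mono_pred[OF MkOm]) (measurable, use AG in blast)
  have c5: "\<bar>\<P>(x in ?M. ?I x) * \<P>(x in ?M. ?G (snd x)) - \<P>(x in ?M. ?I x) * \<P>(x in ?M. ?A x)\<bar>
     \<le> real m * (btail m p k * (4 * r\<^sup>2 * btail m p (k - 1)))"
  proof -
    have "\<bar>\<P>(x in ?M. ?I x) * \<P>(x in ?M. ?G (snd x)) - \<P>(x in ?M. ?I x) * \<P>(x in ?M. ?A x)\<bar>
       = \<P>(x in ?M. ?I x) * \<bar>\<P>(x in ?M. ?G (snd x)) - \<P>(x in ?M. ?A x)\<bar>"
      by (simp add: right_diff_distrib[symmetric] abs_mult)
    also have "\<dots> \<le> btail m p k * (real m * (4 * r\<^sup>2 * btail m p (k - 1)))"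
    proof (rule mult_mono)
      show "\<P>(x in ?M. ?I x) \<le> btail m p k" using exc_prob_le[OF V, of k i] unfolding p2 .
      show "\<bar>\<P>(x in ?M. ?G (snd x)) - \<P>(x in ?M. ?A x)\<bar> \<le> real m * (4 * r\<^sup>2 * btail m p (k - 1))"
        using c3 c4 b2 by simp
    qed (use bn in auto)
    finally show ?thesis by (simp add: mult_ac)
  qed
  have sw: "\<bar>\<P>(x in ?M. ?I x \<and> ?G (snd x)) - \<P>(x in ?M. ?I x) * \<P>(x in ?M. ?G (snd x))\<bar> + real m * T + real m * (btail m p k * (4 * r\<^sup>2 * btail m p (k - 1)))
     \<le> err m k \<eta> s s'"
    using swap_error[OF W JV s' s \<eta>, of k] unfolding p4 T_def err_def by (simp add: algebra_simps)
  show ?thesis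
    unfolding p1 p2 p3 using sw c1 c2 c5 b1 by linarith
qed

lemma exc_prob_upper:
  assumes "i < m"
  shows "\<P>(Z in Om. exc k {..<m} Z i) \<le> btail m p k * \<P>(z in K. ok z)"
proof -
  have c: "card ({..<m} - {i}) \<le> m" using card_mono[of "{..<m}" "{..<m} - {i}"] by auto
  have "\<P>(Z in Om. exc k {..<m} Z i) = \<P>(x in Mk \<Otimes>\<^sub>M Om. ok (fst (fst x)) \<and> k \<le> cnt ({..<m} - {i}) (fst x) (snd x))"
    by (subst prob_upd[OF Mk, where i=i]) (auto simp: exc_upd I1_def)
  also have "\<dots> \<le> btail m p k * \<P>(z in K. ok z)"
    by (rule one_le[OF ok_measurable _ c]) simp
  finally show ?thesis .
qed

lemma exc_prob_lower:
  assumes "i < m" and [measurable]: "Measurable.pred K \<phi>"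
    and \<phi>: "\<And>z. z \<in> space K \<Longrightarrow> \<phi> z \<Longrightarrow> \<P>(b in K. R z b) = p0"
  shows "btail (m - 1) p k * \<P>(z in K. ok z \<and> \<phi> z) \<le> \<P>(Z in Om. exc k {..<m} Z i)"
proof -
  have c: "card ({..<m} - {i}) = m - 1" using assms by simp
  have "btail (m - 1) p k * \<P>(z in K. ok z \<and> \<phi> z)
     \<le> \<P>(x in Mk \<Otimes>\<^sub>M Om. (ok (fst (fst x)) \<and> \<phi> (fst (fst x))) \<and> k \<le> cnt ({..<m} - {i}) (fst x) (snd x))"
    by (rule one_ge[OF _ _ c]) (auto intro: \<phi>)
  also have "\<dots> \<le> \<P>(x in Mk \<Otimes>\<^sub>M Om. ok (fst (fst x)) \<and> k \<le> cnt ({..<m} - {i}) (fst x) (snd x))"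
    by (rule prob_mono_pred[OF MkOm]) auto
  also have "\<dots> = \<P>(Z in Om. exc k {..<m} Z i)"
    by (subst prob_upd[OF Mk, where i=i]) (auto simp: exc_upd I1_def)
  finally show ?thesis .
qed

text \<open>In the recursion, \<open>P i\<close> is the probability that none of the first
  \<open>i\<close> vertices exceeds, and \<open>d i\<close> what is lost at the next one.
  Approximate independence makes \<open>d i\<close> close to \<open>c * P i\<close>;
  \<open>\<epsilon>\<^sub>1\<close> accounts for the marginal probability and
  \<open>\<epsilon>\<^sub>2\<close> for the dependence, both relative to \<open>c\<close>.\<close>

theorem no_exc_approx:
  assumes c: "0 \<le> c" "c \<le> 1" and e1: "\<And>i. i < m \<Longrightarrow> \<bar>\<P>(Z in Om. exc k {..<m} Z i) - c\<bar> \<le> \<epsilon>\<^sub>1 * c"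
    and e2: "err m k \<eta> s s' \<le> \<epsilon>\<^sub>2 * c"
    and s: "1 \<le> s" "1 \<le> s'" and \<eta>: "0 \<le> \<eta>" "\<eta> \<le> 1" and nn: "0 \<le> \<epsilon>\<^sub>1" "0 \<le> \<epsilon>\<^sub>2"
  shows "\<bar>\<P>(Z in Om. \<forall>i<m. \<not> exc k {..<m} Z i) - (1 - c) ^ m\<bar> \<le> \<epsilon>\<^sub>1 + \<epsilon>\<^sub>2"
proof -
  interpret Om: prob_space Om by (rule Om)
  define V where "V = {..<m}"
  define P where "P i = \<P>(Z in Om. \<forall>j\<in>{..<i}. \<not> exc k V Z j)" for i
  define d where "d i = \<P>(Z in Om. exc k V Z i \<and> (\<forall>j\<in>{..<i}. \<not> exc k V Z j))" for i
  have fV[simp]: "finite V" by (simp add: V_def)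
  have "\<bar>P m - (1 - c) ^ m\<bar> \<le> \<epsilon>\<^sub>1 + \<epsilon>\<^sub>2"
  proof (rule linear_recursion_error[where d=d])
    show "P 0 = 1" by (simp add: P_def Om.prob_space)
    fix i assume i: "i < m"
    have "P (Suc i) = Om.prob ({Z\<in>space Om. \<forall>j\<in>{..<i}. \<not> exc k V Z j} - {Z\<in>space Om. exc k V Z i \<and> (\<forall>j\<in>{..<i}. \<not> exc k V Z j)})"
      unfolding P_def by (intro arg_cong[where f=Om.prob]) (auto simp: lessThan_Suc)
    also have "\<dots> = P i - d i"
      unfolding P_def d_def by (rule Om.finite_measure_Diff) auto
    finally show "P (Suc i) = P i - d i" .
    have "\<bar>d i - \<P>(Z in Om. exc k V Z i) * P i\<bar> \<le> err m k \<eta> s s'"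
      unfolding d_def P_def
      by (rule indep_error[OF _ _ _ _ s(2) s(1) \<eta>]) (use i in \<open>auto simp: V_def\<close>)
    moreover have "\<bar>\<P>(Z in Om. exc k V Z i) * P i - c * P i\<bar> \<le> \<epsilon>\<^sub>1 * c"
    proof -
      have "\<bar>\<P>(Z in Om. exc k V Z i) * P i - c * P i\<bar> = \<bar>\<P>(Z in Om. exc k V Z i) - c\<bar> * P i"
        by (simp add: left_diff_distrib[symmetric] abs_mult P_def)
      also have "\<dots> \<le> \<bar>\<P>(Z in Om. exc k V Z i) - c\<bar> * 1"
        by (intro mult_left_mono) (auto simp: P_def)
      also have "\<dots> \<le> \<epsilon>\<^sub>1 * c" using e1[OF i] by (simp add: V_def)
      finally show ?thesis .
    qed
    ultimately show "\<bar>d i - c * P i\<bar> \<le> (\<epsilon>\<^sub>1 + \<epsilon>\<^sub>2) * c" using e2 by (simp add: algebra_simps)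
  qed (use c nn in auto)
  then show ?thesis by (simp add: P_def V_def Ball_def)
qed

end

section \<open>Translation invariance of Lebesgue measure\<close>

lemma emeasure_lborel_translate:
  fixes c :: "'a::euclidean_space"
  assumes [measurable]: "S \<in> sets borel"
  shows "emeasure lborel {x. x - c \<in> S} = emeasure lborel S"
proof -
  have "emeasure lborel S = emeasure (distr lborel borel ((+) (- c))) S"
    by (simp only: lborel_distr_plus)
  also have "\<dots> = emeasure lborel ((+) (- c) -` S \<inter> space lborel)"
    by (rule emeasure_distr) auto
  finally show ?thesis by (simp add: vimage_def)
qed

lemma measure_lborel_translate:
  fixes c :: "'a::euclidean_space"
  assumes "S \<in> sets borel"
  shows "measure lborel {x. x - c \<in> S} = measure lborel S"
  using emeasure_lborel_translate[OF assms] by (simp add: measure_def)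

lemma fmeasurable_translate:
  fixes c :: "'a::euclidean_space"
  assumes [measurable]: "S \<in> sets borel" and fin: "emeasure lborel S < \<infinity>"
  shows "{x. x - c \<in> S} \<in> fmeasurable lborel"
  using emeasure_lborel_translate[OF assms(1), of c] fin by (intro fmeasurableI) auto

section \<open>Translates and area of a sector\<close>

lemma emeasure_lborel_finite_dist:
  fixes S :: "'a::euclidean_space set"
  assumes "\<And>x. x \<in> S \<Longrightarrow> dist x0 x \<le> r"
  shows "emeasure lborel S < \<infinity>"
proof -
  have "emeasure lborel S \<le> emeasure lborel (cball x0 r)"
    using assms by (intro emeasure_mono) (auto simp: dist_commute)
  then show ?thesis by (rule le_less_trans[OF _ emeasure_lborel_cball_finite])
qed

text \<open>The measure of \<open>S \<setminus> (S + u)\<close> is subadditive in \<open>u\<close>, and it is the whole measure of \<open>S\<close>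
  as soon as \<open>u\<close> exceeds the diameter.\<close>

lemma measure_Int_translate:
  fixes S :: "'a::euclidean_space set"
  assumes S[measurable]: "S \<in> sets borel" and sub: "\<And>x. x \<in> S \<Longrightarrow> dist x0 x \<le> r" and r: "0 < r"
    and u: "norm u \<le> 2 * r"
  shows "measure lborel (S \<inter> {x. x - u \<in> S}) \<le> measure lborel S * (1 - norm u / (4 * r))"
proof (cases "u = 0")
  case True
  then show ?thesis by simp
next
  case False
  define T where "T k = {x. x - real k *\<^sub>R u \<in> S}" for k
  have finS: "emeasure lborel S < \<infinity>" by (rule emeasure_lborel_finite_dist[OF sub])
  have Tm[measurable]: "T k \<in> fmeasurable lborel" for k
    unfolding T_def by (rule fmeasurable_translate[OF S finS])
  have T0: "T 0 = S" by (simp add: T_def)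
  have mT: "measure lborel (T k) = measure lborel S" for k
    unfolding T_def by (rule measure_lborel_translate[OF S])
  have Ts[measurable]: "T k \<in> sets borel" for k using fmeasurableD[OF Tm[of k]] by simp
  have step: "measure lborel (T k - T (Suc k)) = measure lborel (T 0 - T 1)" for k
  proof -
    have "T k - T (Suc k) = {x. x - real k *\<^sub>R u \<in> T 0 - T 1}"
      by (auto simp: T_def algebra_simps)
    then show ?thesis by (simp only:) (rule measure_lborel_translate, measurable)
  qed
  have dm: "A - B \<in> fmeasurable lborel" if "A \<in> fmeasurable lborel" "B \<in> fmeasurable lborel" for A B :: "'a set"
    using that by (intro fmeasurable_Diff) auto
  have ind: "measure lborel (T 0 - T N) \<le> real N * measure lborel (T 0 - T 1)" for N
  proof (induction N)
    case (Suc N)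
    have "measure lborel (T 0 - T (Suc N)) \<le> measure lborel ((T 0 - T N) \<union> (T N - T (Suc N)))"
      by (intro measure_mono_fmeasurable) (auto intro!: dm fmeasurable.Un Tm)
    also have "\<dots> \<le> measure lborel (T 0 - T N) + measure lborel (T N - T (Suc N))"
      by (intro measure_Un_le) auto
    finally show ?case using Suc step[of N] by (simp add: algebra_simps)
  qed simp
  \<comment> \<open>The least multiple of \<open>u\<close> longer than the diameter bound
    \<open>2 * r\<close>. The translate by it misses \<open>S\<close>, and
    \<open>norm u \<le> 2 * r\<close> gives \<open>N \<le> 4 * r / norm u\<close>, the source of the
    factor 4.\<close>
  define N where "N = nat \<lfloor>2 * r / norm u\<rfloor> + 1"
  have N1: "2 * r / norm u < real N" unfolding N_def by (simp add: r) linarith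
  have N2: "real N \<le> 2 * r / norm u + 1" unfolding N_def using r by (simp add: of_nat_nat)
  have disj: "T 0 - T N = T 0"
  proof -
    have "False" if "x \<in> S" "x - real N *\<^sub>R u \<in> S" for x
    proof -
      have "real N * norm u = dist x (x - real N *\<^sub>R u)" by (simp add: dist_norm)
      also have "\<dots> \<le> 2 * r" using sub[OF that(1)] sub[OF that(2)] dist_triangle3[of x "x - real N *\<^sub>R u" x0] by linarith
      finally show False using N1 False by (simp add: field_simps)
    qed
    then show ?thesis by (auto simp: T_def)
  qed
  have "measure lborel S \<le> real N * measure lborel (T 0 - T 1)"
    using ind[of N] disj T0 by simp
  also have "\<dots> \<le> (4 * r / norm u) * measure lborel (T 0 - T 1)"
  proof (rule mult_right_mono)
    have "1 \<le> 2 * r / norm u" using u False by simp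
    moreover have "4 * r / norm u = 2 * (2 * r / norm u)" by simp
    ultimately show "real N \<le> 4 * r / norm u" using N2 by linarith
  qed simp
  finally have le: "measure lborel S * (norm u / (4 * r)) \<le> measure lborel (T 0 - T 1)"
    using False r by (simp add: field_simps)
  have "measure lborel (T 0 - T 1) = measure lborel (T 0 - T 0 \<inter> T 1)" by (intro arg_cong[where f="measure _"]) auto
  also have "\<dots> = measure lborel (T 0) - measure lborel (T 0 \<inter> T 1)"
    by (intro measurable_measure_Diff) (auto intro: Tm)
  finally have "measure lborel (S \<inter> T 1) = measure lborel S - measure lborel (T 0 - T 1)"
    by (simp add: T0)
  then show ?thesis using le by (simp add: T_def algebra_simps)
qed

text \<open>Both translates of \<open>S'\<close> nearly fill \<open>S\<close>, so they nearly coincide with each other.\<close>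

lemma translates_close:
  fixes S S' :: "'a::euclidean_space set"
  assumes S[measurable]: "S \<in> sets borel" and S'[measurable]: "S' \<in> sets borel"
    and sub: "\<And>x. x \<in> S \<Longrightarrow> dist x0 x \<le> r" and sub': "\<And>x. x \<in> S' \<Longrightarrow> dist x1 x \<le> r" and r: "0 < r"
    and A: "measure lborel S = A" "measure lborel S' = A" "0 < A"
    and u: "(1 - \<eta>) * A < measure lborel (S \<inter> {x. x - u \<in> S'})"
    and w: "(1 - \<eta>) * A < measure lborel (S \<inter> {x. x - w \<in> S'})"
    and uw: "norm (u - w) \<le> 4 * r"
  shows "norm (u - w) \<le> 8 * \<eta> * r"
proof -
  let ?T = "\<lambda>u. {x. x - u \<in> S'}"
  have fin: "emeasure lborel S < \<infinity>" "emeasure lborel S' < \<infinity>"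
    by (rule emeasure_lborel_finite_dist[OF sub] emeasure_lborel_finite_dist[OF sub'], assumption)+
  have Sf: "S \<in> fmeasurable lborel" using fin by (intro fmeasurableI) auto
  have Tf: "?T u \<in> fmeasurable lborel" for u by (rule fmeasurable_translate[OF S' fin(2)])
  have [measurable]: "?T u \<in> sets borel" for u using fmeasurableD[OF Tf[of u]] by simp
  have If: "S \<inter> ?T u \<in> fmeasurable lborel" for u using Sf Tf by (intro fmeasurable.Int) auto
  \<comment> \<open>Two subsets of \<open>S\<close>, each missing less than a proportion \<eta>,
    intersect in more than a proportion \<open>1 - 2 * \<eta>\<close>; the intersection lies in both
    translates of \<open>S'\<close>.\<close>
  have "measure lborel (S \<inter> ?T u) + measure lborel (S \<inter> ?T w)
    = measure lborel ((S \<inter> ?T u) \<union> (S \<inter> ?T w)) + measure lborel ((S \<inter> ?T u) \<inter> (S \<inter> ?T w))"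
    using measure_Un3[OF If[of u] If[of w]] by simp
  also have "\<dots> \<le> A + measure lborel (?T u \<inter> ?T w)"
    unfolding A(1)[symmetric]
    by (intro add_mono measure_mono_fmeasurable) (use Sf Tf in \<open>auto intro!: fmeasurable.Int\<close>)
  finally have 1: "(1 - 2 * \<eta>) * A < measure lborel (?T u \<inter> ?T w)"
    using u w by (simp add: algebra_simps)
  have "?T u \<inter> ?T w = {x. x - w \<in> S' \<inter> {x. x - (u - w) \<in> S'}}" by (auto simp: algebra_simps)
  then have "measure lborel (?T u \<inter> ?T w) = measure lborel (S' \<inter> {x. x - (u - w) \<in> S'})"
    by (simp only:) (rule measure_lborel_translate, measurable)
  then have 2: "(1 - 2 * \<eta>) * A < measure lborel (S' \<inter> {x. x - (u - w) \<in> S'})" using 1 by simp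
  show ?thesis
  proof (cases "norm (u - w) \<le> 2 * r")
    case True
    have "measure lborel (S' \<inter> {x. x - (u - w) \<in> S'}) \<le> A * (1 - norm (u - w) / (4 * r))"
      using measure_Int_translate[OF S' sub' r True] A(2) by simp
    then have "(1 - 2 * \<eta>) * A < A * (1 - norm (u - w) / (4 * r))" using 2 by simp
    then have "1 - 2 * \<eta> < 1 - norm (u - w) / (4 * r)" using A(3) by (simp add: mult.commute)
    then show ?thesis using r by (simp add: field_simps)
  next
    case False
    \<comment> \<open>Beyond \<open>2 * r\<close> the two translates are disjoint, which forces
      \<open>\<eta> > 1/2\<close>; then the assumed bound \<open>4 * r\<close> is already below
      \<open>8 * \<eta> * r\<close>.\<close>
    have "False" if "x \<in> S'" "x - (u - w) \<in> S'" for x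
    proof -
      have "norm (u - w) = dist x (x - (u - w))" by (simp add: dist_norm)
      also have "\<dots> \<le> 2 * r" using sub'[OF that(1)] sub'[OF that(2)] dist_triangle3[of x "x - (u - w)" x1] by linarith
      finally show False using False by simp
    qed
    then have "S' \<inter> {x. x - (u - w) \<in> S'} = {}" by auto
    then have "(1 - 2 * \<eta>) * A < 0" using 2 by (simp only: measure_empty)
    then have "1 < 2 * \<eta>" using A(3) by (simp add: mult_less_0_iff)
    then have "4 * r \<le> 8 * \<eta> * r" using r by simp
    then show ?thesis using uw by linarith
  qed
qed

section \<open>Shears and rotations of the plane\<close>

lemma measurable_fst_borel[measurable (raw)]:
  fixes f :: "'a \<Rightarrow> 'b::second_countable_topology \<times> 'c::second_countable_topology"
  assumes "f \<in> borel_measurable M"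
  shows "(\<lambda>x. fst (f x)) \<in> borel_measurable M"
proof -
  have "(fst :: 'b \<times> 'c \<Rightarrow> _) \<in> borel_measurable borel"
    by (intro borel_measurable_continuous_onI continuous_intros)
  from measurable_compose[OF assms this] show ?thesis .
qed

lemma measurable_snd_borel[measurable (raw)]:
  fixes f :: "'a \<Rightarrow> 'b::second_countable_topology \<times> 'c::second_countable_topology"
  assumes "f \<in> borel_measurable M"
  shows "(\<lambda>x. snd (f x)) \<in> borel_measurable M"
proof -
  have "(snd :: 'b \<times> 'c \<Rightarrow> _) \<in> borel_measurable borel"
    by (intro borel_measurable_continuous_onI continuous_intros)
  from measurable_compose[OF assms this] show ?thesis .
qed

text \<open>Each horizontal line is only translated, by an amount depending on its height; Fubini
  does the rest.\<close>

lemma emeasure_shear_fst: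
  assumes [measurable]: "S \<in> sets (borel :: (real \<times> real) measure)"
  shows "emeasure lborel {x. (fst x + c * snd x, snd x) \<in> S} = emeasure lborel S"
proof -
  have T: "{x. (fst x + c * snd x, snd x) \<in> S} \<in> sets (lborel \<Otimes>\<^sub>M (lborel :: real measure))"
    unfolding lborel_prod by measurable
  have S: "S \<in> sets (lborel \<Otimes>\<^sub>M (lborel :: real measure))" unfolding lborel_prod using assms by simp
  have "emeasure (lborel \<Otimes>\<^sub>M lborel) {x. (fst x + c * snd x, snd x) \<in> S}
     = (\<integral>\<^sup>+b. emeasure lborel ((\<lambda>a. (a, b)) -` {x. (fst x + c * snd x, snd x) \<in> S}) \<partial>lborel)"
    by (rule lborel_pair.emeasure_pair_measure_alt2[OF T])
  also have "\<dots> = (\<integral>\<^sup>+b. emeasure lborel ((\<lambda>a. (a, b)) -` S) \<partial>lborel)"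
  proof (rule nn_integral_cong)
    fix b :: real
    have [measurable]: "(\<lambda>a. (a, b)) -` S \<in> sets borel" by (rule measurable_sets_borel) measurable
    have "(\<lambda>a. (a, b)) -` {x. (fst x + c * snd x, snd x) \<in> S} = {a. a - (- c * b) \<in> (\<lambda>a. (a, b)) -` S}" by auto
    then show "emeasure lborel ((\<lambda>a. (a, b)) -` {x. (fst x + c * snd x, snd x) \<in> S}) = emeasure lborel ((\<lambda>a. (a, b)) -` S)"
      by (simp only:) (rule emeasure_lborel_translate, measurable)
  qed
  also have "\<dots> = emeasure (lborel \<Otimes>\<^sub>M lborel) S"
    by (rule lborel_pair.emeasure_pair_measure_alt2[OF S, symmetric])
  finally show ?thesis by (simp add: lborel_prod)
qed

lemma emeasure_shear_snd:
  assumes [measurable]: "S \<in> sets (borel :: (real \<times> real) measure)"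
  shows "emeasure lborel {x. (fst x, snd x + c * fst x) \<in> S} = emeasure lborel S"
proof -
  have T: "{x. (fst x, snd x + c * fst x) \<in> S} \<in> sets (lborel \<Otimes>\<^sub>M (lborel :: real measure))"
    unfolding lborel_prod by measurable
  have S: "S \<in> sets (lborel \<Otimes>\<^sub>M (lborel :: real measure))" unfolding lborel_prod using assms by simp
  have "emeasure (lborel \<Otimes>\<^sub>M lborel) {x. (fst x, snd x + c * fst x) \<in> S}
     = (\<integral>\<^sup>+a. emeasure lborel (Pair a -` {x. (fst x, snd x + c * fst x) \<in> S}) \<partial>lborel)"
    by (rule lborel.emeasure_pair_measure_alt[OF T])
  also have "\<dots> = (\<integral>\<^sup>+a. emeasure lborel (Pair a -` S) \<partial>lborel)"
  proof (rule nn_integral_cong)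
    fix a :: real
    have [measurable]: "Pair a -` S \<in> sets borel" by (rule measurable_sets_borel) measurable
    have "Pair a -` {x. (fst x, snd x + c * fst x) \<in> S} = {b. b - (- c * a) \<in> Pair a -` S}" by auto
    then show "emeasure lborel (Pair a -` {x. (fst x, snd x + c * fst x) \<in> S}) = emeasure lborel (Pair a -` S)"
      by (simp only:) (rule emeasure_lborel_translate, measurable)
  qed
  also have "\<dots> = emeasure (lborel \<Otimes>\<^sub>M lborel) S"
    by (rule lborel.emeasure_pair_measure_alt[OF S, symmetric])
  finally show ?thesis by (simp add: lborel_prod)
qed

definition rot :: "real \<Rightarrow> real \<times> real \<Rightarrow> real \<times> real" where
  "rot \<theta> x = (fst x * cos \<theta> - snd x * sin \<theta>, fst x * sin \<theta> + snd x * cos \<theta>)"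

lemma rot_measurable[measurable]: "rot \<theta> \<in> borel_measurable borel"
  unfolding rot_def by measurable

lemma rot_add: "rot (\<theta> + \<tau>) x = rot \<theta> (rot \<tau> x)"
  by (simp add: rot_def cos_add sin_add algebra_simps)

text \<open>A rotation by an angle other than \<open>\<pi>\<close> is a product of three shears, which preserve area.\<close>

lemma emeasure_rot_small:
  assumes S[measurable]: "S \<in> sets borel" and c: "cos (\<theta> / 2) \<noteq> 0"
  shows "emeasure lborel {x. rot \<theta> x \<in> S} = emeasure lborel S"
proof -
  define a where "a = - tan (\<theta> / 2)"
  have s: "sin \<theta> = 2 * sin (\<theta> / 2) * cos (\<theta> / 2)" and co: "cos \<theta> = 1 - 2 * (sin (\<theta> / 2))\<^sup>2"
    using sin_double[of "\<theta> / 2"] cos_double_sin[of "\<theta> / 2"] by auto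
  have as: "a * sin \<theta> = cos \<theta> - 1"
    using c by (simp add: a_def tan_def s co power2_eq_square)
  have aa: "2 * a + a * (a * sin \<theta>) = - sin \<theta>"
  proof -
    have "2 * a + a * (a * sin \<theta>) = a * (1 + cos \<theta>)" unfolding as by (simp add: algebra_simps)
    also have "1 + cos \<theta> = 2 * (cos (\<theta> / 2))\<^sup>2" using cos_double_cos[of "\<theta> / 2"] by simp
    also have "a * \<dots> = - sin \<theta>" using c by (simp add: a_def tan_def s power2_eq_square)
    finally show ?thesis .
  qed
  have 1: "rot \<theta> x = (\<lambda>x. (fst x + a * snd x, snd x)) ((\<lambda>x. (fst x, snd x + sin \<theta> * fst x)) ((\<lambda>x. (fst x + a * snd x, snd x)) x))" for x
  proof -
    have "(fst x + a * snd x) + a * (snd x + sin \<theta> * (fst x + a * snd x))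
      = fst x * (1 + a * sin \<theta>) + snd x * (2 * a + a * (a * sin \<theta>))" by (simp add: algebra_simps)
    also have "\<dots> = fst x * (1 + a * sin \<theta>) + snd x * (- sin \<theta>)" by (simp only: aa)
    also have "\<dots> = fst x * cos \<theta> - snd x * sin \<theta>" unfolding as by simp
    finally have f: "(fst x + a * snd x) + a * (snd x + sin \<theta> * (fst x + a * snd x)) = fst x * cos \<theta> - snd x * sin \<theta>" .
    have "snd x + sin \<theta> * (fst x + a * snd x) = fst x * sin \<theta> + snd x * (1 + a * sin \<theta>)" by (simp add: algebra_simps)
    also have "\<dots> = fst x * sin \<theta> + snd x * cos \<theta>" unfolding as by simp
    finally show ?thesis using f by (simp add: rot_def)
  qed
  define T where "T = {x. (fst x + a * snd x, snd x) \<in> S}"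
  define T' where "T' = {x. (fst x, snd x + sin \<theta> * fst x) \<in> T}"
  have [measurable]: "T \<in> sets borel" unfolding T_def by measurable
  have [measurable]: "T' \<in> sets borel" unfolding T'_def by measurable
  have "{x. rot \<theta> x \<in> S} = {x. (fst x + a * snd x, snd x) \<in> T'}"
    unfolding 1 by (simp add: T_def T'_def)
  then have "emeasure lborel {x. rot \<theta> x \<in> S} = emeasure lborel T'"
    by (simp only:) (rule emeasure_shear_fst, measurable)
  also have "\<dots> = emeasure lborel T" unfolding T'_def by (rule emeasure_shear_snd) measurable
  also have "\<dots> = emeasure lborel S" unfolding T_def by (rule emeasure_shear_fst) measurable
  finally show ?thesis .
qed

text \<open>The angle is cut into equal parts of size below 1, for which the cosine of half the
  angle is positive, and the rotations are composed.\<close>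

lemma emeasure_rot:
  assumes S: "S \<in> sets borel"
  shows "emeasure lborel {x. rot \<theta> x \<in> S} = emeasure lborel S"
proof -
  obtain N :: nat where N: "\<bar>\<theta>\<bar> < real N" using reals_Archimedean2 by blast
  then have N0: "0 < N" by (cases N) auto
  define \<tau> where "\<tau> = \<theta> / real N"
  have \<tau>: "real N * \<tau> = \<theta>" using N0 by (simp add: \<tau>_def)
  have "\<bar>\<tau>\<bar> < 1" using N N0 by (simp add: \<tau>_def)
  then have "0 < cos (\<tau> / 2)"
    using pi_ge_two by (intro cos_gt_zero_pi) linarith+
  then have c: "cos (\<tau> / 2) \<noteq> 0" by simp
  have "emeasure lborel {x. rot (real n * \<tau>) x \<in> S} = emeasure lborel S" for n
  proof (induction n)
    case 0
    then show ?case by (simp add: rot_def)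
  next
    case (Suc n)
    have [measurable]: "{x. rot (real n * \<tau>) x \<in> S} \<in> sets borel"
      using S by measurable
    have "rot (real (Suc n) * \<tau>) x = rot (real n * \<tau>) (rot \<tau> x)" for x
      unfolding rot_add[symmetric] by (simp add: algebra_simps add_divide_distrib)
    then have "{x. rot (real (Suc n) * \<tau>) x \<in> S} = {x. rot \<tau> x \<in> {x. rot (real n * \<tau>) x \<in> S}}"
      by simp
    then show ?case using Suc emeasure_rot_small[OF _ c, of "{x. rot (real n * \<tau>) x \<in> S}"] by simp
  qed
  from this[of N] show ?thesis using \<tau> by simp
qed

section \<open>Measurability, symmetries and area of sectors\<close>

lemma closed_sector_rel: "closed {w :: (real \<times> real) \<times> real \<times> real \<times> real. snd (snd w) \<in> sector \<alpha> (fst w) (fst (snd w)) r}"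
proof -
  \<comment> \<open>Measuring the angle from the first bounding ray lets the parameters range over a
    compact box that is the same for all sectors. The relation is then the projection of a closed
    set along a compact factor, hence closed jointly in apex, direction and point.\<close>
  define F where "F = (\<lambda>(ts :: real \<times> real, w :: (real \<times> real) \<times> real \<times> real \<times> real).
    snd (snd w) - (fst w + fst ts *\<^sub>R (cos (fst (snd w) + snd ts), sin (fst (snd w) + snd ts))))"
  define C where "C = {0..r} \<times> {0..\<alpha>}"
  have C: "compact C" unfolding C_def by (intro compact_Times compact_Icc)
  have "closed (F -` {0})"
    unfolding F_def case_prod_beta by (intro continuous_closed_vimage continuous_intros closed_singleton)
  have "{w. snd (snd w) \<in> sector \<alpha> (fst w) (fst (snd w)) r} = {w. \<exists>ts. ts \<in> C \<and> (ts, w) \<in> F -` {0}}"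
  proof (intro set_eqI iffI)
    fix w :: "(real \<times> real) \<times> real \<times> real \<times> real"
    assume "w \<in> {w. snd (snd w) \<in> sector \<alpha> (fst w) (fst (snd w)) r}"
    then obtain t \<phi> where t: "0 \<le> t" "t \<le> r" "fst (snd w) \<le> \<phi>" "\<phi> \<le> fst (snd w) + \<alpha>"
      "snd (snd w) = fst w + t *\<^sub>R (cos \<phi>, sin \<phi>)" by (auto simp: sector_def)
    then have "(t, \<phi> - fst (snd w)) \<in> C \<and> ((t, \<phi> - fst (snd w)), w) \<in> F -` {0}"
      by (auto simp: C_def F_def)
    then show "w \<in> {w. \<exists>ts. ts \<in> C \<and> (ts, w) \<in> F -` {0}}" by blast
  next
    fix w :: "(real \<times> real) \<times> real \<times> real \<times> real"
    assume "w \<in> {w. \<exists>ts. ts \<in> C \<and> (ts, w) \<in> F -` {0}}"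
    then obtain t s where "0 \<le> t" "t \<le> r" "0 \<le> s" "s \<le> \<alpha>"
      "snd (snd w) = fst w + t *\<^sub>R (cos (fst (snd w) + s), sin (fst (snd w) + s))"
      by (auto simp: C_def F_def)
    then show "w \<in> {w. snd (snd w) \<in> sector \<alpha> (fst w) (fst (snd w)) r}"
      unfolding sector_def mem_Collect_eq by (intro exI[of _ t] exI[of _ "fst (snd w) + s"]) auto
  qed
  also have "closed \<dots>"
    by (rule closed_compact_projection[OF C \<open>closed (F -` {0})\<close>])
  finally show ?thesis .
qed

lemma sector_measurable[measurable (raw)]:
  assumes [measurable]: "f \<in> borel_measurable M" "g \<in> borel_measurable M" "h \<in> borel_measurable M"
  shows "Measurable.pred M (\<lambda>x. h x \<in> sector \<alpha> (f x) (g x) r)"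
proof -
  have "{w :: (real \<times> real) \<times> real \<times> real \<times> real. snd (snd w) \<in> sector \<alpha> (fst w) (fst (snd w)) r} \<in> sets borel"
    by (rule borel_closed[OF closed_sector_rel])
  then have "Measurable.pred borel (\<lambda>w :: (real \<times> real) \<times> real \<times> real \<times> real. snd (snd w) \<in> sector \<alpha> (fst w) (fst (snd w)) r)"
    by (simp add: pred_def)
  moreover have "(\<lambda>x. (f x, g x, h x)) \<in> borel_measurable M" by measurable
  ultimately have "Measurable.pred M (\<lambda>x. snd (snd (f x, g x, h x)) \<in> sector \<alpha> (fst (f x, g x, h x)) (fst (snd (f x, g x, h x))) r)"
    by (rule measurable_compose[rotated])
  then show ?thesis by simp
qed

lemma sector_sets[measurable]: "sector \<alpha> x y r \<in> sets borel"
proof -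
  have "Measurable.pred borel (\<lambda>z. z \<in> sector \<alpha> x y r)"
    by (rule sector_measurable) auto
  from predE[OF this] show ?thesis by (simp only: space_borel UNIV_I simp_thms Collect_mem_eq)
qed

lemma sector_dist: "z \<in> sector \<alpha> x y r \<Longrightarrow> dist x z \<le> r"
proof -
  assume "z \<in> sector \<alpha> x y r"
  then obtain t \<phi> where t: "0 \<le> t" "t \<le> r" "z = x + t *\<^sub>R (cos \<phi>, sin \<phi>)" by (auto simp: sector_def)
  have "norm (cos \<phi>, sin \<phi>) = 1" by (simp add: norm_Pair)
  with t show ?thesis by (simp add: dist_norm del: scaleR_Pair)
qed

lemma sector_translate: "z \<in> sector \<alpha> x y r \<longleftrightarrow> z - x \<in> sector \<alpha> 0 y r"
proof -
  have "z = x + w \<longleftrightarrow> z - x = 0 + w" for w :: "real \<times> real" by (auto simp: algebra_simps)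
  then show ?thesis unfolding sector_def mem_Collect_eq by (simp only:)
qed

lemma sector_rot: "rot \<theta> z \<in> sector \<alpha> 0 (y + \<theta>) r \<longleftrightarrow> z \<in> sector \<alpha> 0 y r"
proof
  have *: "rot \<tau> z \<in> sector \<alpha> 0 (y + \<tau>) r" if "z \<in> sector \<alpha> 0 y r" for \<tau> z y
  proof -
    from that obtain t \<phi> where t: "0 \<le> t" "t \<le> r" "y \<le> \<phi>" "\<phi> \<le> y + \<alpha>" "z = 0 + t *\<^sub>R (cos \<phi>, sin \<phi>)"
      by (auto simp: sector_def simp del: scaleR_Pair)
    have "rot \<tau> z = 0 + t *\<^sub>R (cos (\<phi> + \<tau>), sin (\<phi> + \<tau>))"
      using t(5) by (simp add: rot_def cos_add sin_add algebra_simps)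
    then show ?thesis unfolding sector_def mem_Collect_eq using t
      by (intro exI[of _ t] exI[of _ "\<phi> + \<tau>"] conjI) (simp_all del: scaleR_Pair)
  qed
  show "z \<in> sector \<alpha> 0 y r \<Longrightarrow> rot \<theta> z \<in> sector \<alpha> 0 (y + \<theta>) r" by (rule *)
  assume "rot \<theta> z \<in> sector \<alpha> 0 (y + \<theta>) r"
  from *[OF this, of "- \<theta>"] show "z \<in> sector \<alpha> 0 y r"
    unfolding rot_add[symmetric] by (simp add: rot_def)
qed

lemma emeasure_sector_rot: "emeasure lborel (sector \<alpha> 0 y r) = emeasure lborel (sector \<alpha> 0 0 r)"
  using emeasure_rot[of "sector \<alpha> 0 (0 + y) r" y] sector_rot[of y _ \<alpha> 0 r] by simp

text \<open>The polar angle of a nonzero point is unique up to multiples of \<open>2 * pi\<close>;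
  with \<open>y\<close> and \<theta> in one period and \<open>\<alpha> \<le> 2 * pi\<close> only the
  multiples 0 and 1 can fall into the sector. The second alternative is a sector running past the
  positive horizontal axis.\<close>

lemma sector_origin_iff:
  assumes t: "0 < t" "t \<le> r" and \<alpha>: "0 < \<alpha>" "\<alpha> \<le> 2 * pi" and \<theta>: "0 \<le> \<theta>" "\<theta> < 2 * pi" and y: "0 \<le> y" "y < 2 * pi"
  shows "t *\<^sub>R (cos \<theta>, sin \<theta>) \<in> sector \<alpha> 0 y r \<longleftrightarrow> (\<theta> - \<alpha> \<le> y \<and> y \<le> \<theta>) \<or> \<theta> + 2 * pi - \<alpha> \<le> y"
proof
  assume "t *\<^sub>R (cos \<theta>, sin \<theta>) \<in> sector \<alpha> 0 y r"
  then obtain s \<phi> where s: "0 \<le> s" "t *\<^sub>R (cos \<theta>, sin \<theta>) = s *\<^sub>R (cos \<phi>, sin \<phi>)" and \<phi>: "y \<le> \<phi>" "\<phi> \<le> y + \<alpha>"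
    by (auto simp: sector_def simp del: scaleR_Pair)
  have "norm (t *\<^sub>R (cos \<theta>, sin \<theta>)) = norm (s *\<^sub>R (cos \<phi>, sin \<phi>))" using s(2) by simp
  then have "t = s" using s(1) t by (simp add: norm_Pair del: scaleR_Pair)
  then have "sin \<phi> = sin \<theta> \<and> cos \<phi> = cos \<theta>" using s(2) t by simp
  then obtain n :: int where n: "\<phi> = \<theta> + 2 * pi * n" using sin_cos_eq_iff by blast
  have "n < 2"
  proof (rule ccontr)
    assume "\<not> n < 2"
    then have "2 * pi * 2 \<le> 2 * pi * real_of_int n" by (intro mult_left_mono) auto
    then show False using n \<phi> \<alpha> \<theta> y by linarith
  qed
  moreover have "-1 < n"
  proof (rule ccontr)
    assume "\<not> -1 < n"
    then have "2 * pi * real_of_int n \<le> 2 * pi * (-1)" by (intro mult_left_mono) auto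
    then show False using n \<phi> \<alpha> \<theta> y by linarith
  qed
  ultimately have "n = 0 \<or> n = 1" by auto
  then show "(\<theta> - \<alpha> \<le> y \<and> y \<le> \<theta>) \<or> \<theta> + 2 * pi - \<alpha> \<le> y" using n \<phi> by auto
next
  assume h: "(\<theta> - \<alpha> \<le> y \<and> y \<le> \<theta>) \<or> \<theta> + 2 * pi - \<alpha> \<le> y"
  have "\<exists>\<phi>. y \<le> \<phi> \<and> \<phi> \<le> y + \<alpha> \<and> (cos \<phi>, sin \<phi>) = (cos \<theta>, sin \<theta>)"
  proof (cases "\<theta> - \<alpha> \<le> y \<and> y \<le> \<theta>")
    case True
    then show ?thesis by (intro exI[of _ \<theta>]) auto
  next
    case False
    with h show ?thesis using \<theta> y by (intro exI[of _ "\<theta> + 2 * pi"]) auto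
  qed
  then obtain \<phi> where "y \<le> \<phi>" "\<phi> \<le> y + \<alpha>" "(cos \<phi>, sin \<phi>) = (cos \<theta>, sin \<theta>)" by blast
  then show "t *\<^sub>R (cos \<theta>, sin \<theta>) \<in> sector \<alpha> 0 y r"
    unfolding sector_def mem_Collect_eq using t
    by (intro exI[of _ t] exI[of _ \<phi>]) (simp del: scaleR_Pair)
qed

lemma emeasure_sector_angles:
  assumes t: "0 < t" "t \<le> r" and \<alpha>: "0 < \<alpha>" "\<alpha> \<le> 2 * pi" and \<theta>: "0 \<le> \<theta>" "\<theta> < 2 * pi"
  shows "emeasure lborel {y\<in>{0..<2 * pi}. t *\<^sub>R (cos \<theta>, sin \<theta>) \<in> sector \<alpha> 0 y r} = ennreal \<alpha>"
proof -
  have eq: "{y\<in>{0..<2 * pi}. t *\<^sub>R (cos \<theta>, sin \<theta>) \<in> sector \<alpha> 0 y r}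
    = {y\<in>{0..<2 * pi}. (\<theta> - \<alpha> \<le> y \<and> y \<le> \<theta>) \<or> \<theta> + 2 * pi - \<alpha> \<le> y}"
    using sector_origin_iff[OF t \<alpha> \<theta>] by auto
  show ?thesis
  proof (cases "\<alpha> \<le> \<theta>")
    case True
    then have "{y\<in>{0..<2 * pi}. (\<theta> - \<alpha> \<le> y \<and> y \<le> \<theta>) \<or> \<theta> + 2 * pi - \<alpha> \<le> y} = {\<theta> - \<alpha>..\<theta>}"
      using \<theta> by auto
    then show ?thesis unfolding eq using \<alpha> by simp
  next
    case False
    \<comment> \<open>The admissible directions form two intervals at the ends of the period, so the
      gap between them is measured instead; its length is \<open>2 * pi - \<alpha>\<close>.\<close>
    then have "{y\<in>{0..<2 * pi}. (\<theta> - \<alpha> \<le> y \<and> y \<le> \<theta>) \<or> \<theta> + 2 * pi - \<alpha> \<le> y} = {0..<2 * pi} - {\<theta><..<\<theta> + 2 * pi - \<alpha>}"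
      using \<theta> \<alpha> by auto
    moreover have "emeasure lborel ({0..<2 * pi} - {\<theta><..<\<theta> + 2 * pi - \<alpha>}) = emeasure lborel {0..<2 * pi} - emeasure lborel {\<theta><..<\<theta> + 2 * pi - \<alpha>}"
      using \<theta> \<alpha> False by (intro emeasure_Diff) auto
    ultimately show ?thesis unfolding eq using \<alpha> by (simp add: ennreal_minus)
  qed
qed

text \<open>Double counting instead of polar coordinates: rotations preserve area, so all directions
  give the same area \<open>?g\<close>, and integrating over the directions gives
  \<open>2 * pi * ?g\<close>. By Fubini this is also the integral over \<open>z\<close> of the
  measure of the directions whose sector contains \<open>z\<close>, which is \<alpha> on the
  punctured disc; the origin, which lies in all sectors, is a null set.\<close>

lemma emeasure_sector:
  assumes r: "0 < r" and \<alpha>: "0 < \<alpha>" "\<alpha> \<le> 2 * pi"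
  shows "emeasure lborel (sector \<alpha> 0 y r) = ennreal (\<alpha> * r\<^sup>2 / 2)"
proof -
  let ?g = "emeasure lborel (sector \<alpha> 0 0 r)"
  have fin: "?g < \<infinity>"
    by (rule emeasure_lborel_finite_dist[of _ 0 r]) (rule sector_dist)
  let ?h = "\<lambda>y z. indicator {0..<2 * pi} y * indicator (sector \<alpha> 0 y r) z :: ennreal"
  have [measurable]: "(\<lambda>x. ?h (fst x) (snd x)) \<in> borel_measurable (lborel \<Otimes>\<^sub>M lborel)"
  proof -
    have [measurable]: "Measurable.pred (lborel \<Otimes>\<^sub>M lborel) (\<lambda>x :: real \<times> real \<times> real. snd x \<in> sector \<alpha> 0 (fst x) r)"
      by (rule sector_measurable) (auto simp: measurable_cong_sets[OF sets_pair_measure_cong[OF sets_lborel sets_lborel] refl] borel_prod)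
    show ?thesis
      unfolding indicator_def by measurable
  qed
  have "(\<integral>\<^sup>+y. \<integral>\<^sup>+z. ?h y z \<partial>lborel \<partial>lborel) = (\<integral>\<^sup>+y. indicator {0..<2 * pi} y * ?g \<partial>lborel)"
  proof (rule nn_integral_cong)
    fix y :: real
    have "(\<integral>\<^sup>+z. ?h y z \<partial>lborel) = indicator {0..<2 * pi} y * emeasure lborel (sector \<alpha> 0 y r)"
      by (simp add: nn_integral_cmult)
    then show "(\<integral>\<^sup>+z. ?h y z \<partial>lborel) = indicator {0..<2 * pi} y * ?g"
      by (simp only: emeasure_sector_rot[of \<alpha> y r])
  qed
  also have "\<dots> = ennreal (2 * pi) * ?g" by (simp add: nn_integral_multc)
  finally have 1: "(\<integral>\<^sup>+y. \<integral>\<^sup>+z. ?h y z \<partial>lborel \<partial>lborel) = ennreal (2 * pi) * ?g" .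
  have "(\<integral>\<^sup>+y. \<integral>\<^sup>+z. ?h y z \<partial>lborel \<partial>lborel) = (\<integral>\<^sup>+z. \<integral>\<^sup>+y. ?h y z \<partial>lborel \<partial>lborel)"
    by (rule lborel_pair.Fubini'[symmetric]) (simp add: case_prod_beta)
  also have "\<dots> = (\<integral>\<^sup>+z. ennreal \<alpha> * indicator (cball 0 r) z \<partial>(lborel :: (real \<times> real) measure))"
  proof (rule nn_integral_cong_AE)
    have "AE z in lborel. z \<noteq> (0 :: real \<times> real)" by (rule AE_lborel_singleton)
    then show "AE z :: real \<times> real in lborel. (\<integral>\<^sup>+y. ?h y z \<partial>lborel) = ennreal \<alpha> * indicator (cball 0 r) z"
    proof eventually_elim
      case (elim z)
      define t where "t = norm z"
      have t: "0 < t" using elim by (simp add: t_def)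
      have "(fst z)\<^sup>2 + (snd z)\<^sup>2 = t\<^sup>2" by (simp add: t_def norm_prod_def)
      then have "(fst z / t)\<^sup>2 + (snd z / t)\<^sup>2 = 1"
        using t by (simp add: power_divide flip: add_divide_distrib)
      then obtain \<theta> where \<theta>: "0 \<le> \<theta>" "\<theta> < 2 * pi" "fst z / t = cos \<theta>" "snd z / t = sin \<theta>"
        using sincos_total_2pi by blast
      have z: "z = t *\<^sub>R (cos \<theta>, sin \<theta>)" unfolding \<theta>(3,4)[symmetric] using t by (simp add: prod_eq_iff)
      have m: "{y\<in>{0..<2 * pi}. z \<in> sector \<alpha> 0 y r} \<in> sets lborel"
      proof -
        have "Measurable.pred borel (\<lambda>y. z \<in> sector \<alpha> 0 y r)" by (rule sector_measurable) auto
        from predE[OF this] have [measurable]: "{y. z \<in> sector \<alpha> 0 y r} \<in> sets borel" by simp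
        have "{y\<in>{0..<2 * pi}. z \<in> sector \<alpha> 0 y r} = {0..<2 * pi} \<inter> {y. z \<in> sector \<alpha> 0 y r}" by auto
        then show ?thesis by simp
      qed
      have "(\<integral>\<^sup>+y. ?h y z \<partial>lborel) = (\<integral>\<^sup>+y. indicator {y\<in>{0..<2 * pi}. z \<in> sector \<alpha> 0 y r} y \<partial>lborel)"
        by (intro nn_integral_cong) (auto simp: indicator_def)
      also have "\<dots> = emeasure lborel {y\<in>{0..<2 * pi}. z \<in> sector \<alpha> 0 y r}"
        using m by simp
      also have "\<dots> = ennreal \<alpha> * indicator (cball 0 r) z"
      proof (cases "t \<le> r")
        case True
        then show ?thesis using emeasure_sector_angles[OF t True \<alpha> \<theta>(1,2)] unfolding z[symmetric]
          by (simp add: t_def)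
      next
        case False
        have "z \<notin> sector \<alpha> 0 y r" for y using sector_dist[of z \<alpha> 0 y r] False by (auto simp: t_def dist_norm)
        then show ?thesis using False by (simp add: t_def)
      qed
      finally show ?case .
    qed
  qed
  also have "\<dots> = ennreal \<alpha> * emeasure lborel (cball (0 :: real \<times> real) r)"
    by (rule nn_integral_cmult_indicator) simp
  also have "\<dots> = ennreal \<alpha> * ennreal (pi * r\<^sup>2)"
    using r by (simp add: emeasure_cball unit_ball_vol_2 power2_eq_square)
  finally have 2: "ennreal (2 * pi) * ?g = ennreal (\<alpha> * (pi * r\<^sup>2))"
    using 1 \<alpha> by (simp add: ennreal_mult)
  obtain g where g: "?g = ennreal g" "0 \<le> g" using fin by (cases ?g) auto
  have "2 * pi * g = \<alpha> * (pi * r\<^sup>2)" using 2 g \<alpha> by (simp add: ennreal_mult[symmetric])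
  then have "g = \<alpha> * r\<^sup>2 / 2" by simp
  then show ?thesis unfolding emeasure_sector_rot[of \<alpha> y r] g(1) by (simp only:)
qed

section \<open>The two degree models of the sector graph\<close>

abbreviation unit_square :: "(real \<times> real) set" where "unit_square \<equiv> {0..1} \<times> {0..1}"

abbreviation "point_law \<equiv> uniform_measure lborel unit_square"

abbreviation "angle_law \<equiv> uniform_measure lborel {0..<2 * pi :: real}"

abbreviation "failure_law v \<equiv> measure_pmf (bernoulli_pmf v)"

abbreviation vertex_law :: "real \<Rightarrow> ((real \<times> real) \<times> real \<times> bool) measure" where
  "vertex_law v \<equiv> point_law \<Otimes>\<^sub>M (angle_law \<Otimes>\<^sub>M failure_law v)"

lemma emeasure_unit_square: "emeasure lborel unit_square = 1"
proof -
  have "emeasure (lborel \<Otimes>\<^sub>M lborel) ({0..1::real} \<times> {0..1::real}) = emeasure lborel {0..1::real} * emeasure lborel {0..1::real}"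
    by (rule lborel.emeasure_pair_measure_Times) auto
  then show ?thesis by (simp add: lborel_prod)
qed

lemma unit_square_sets[measurable]: "unit_square \<in> sets borel"
  by (intro borel_closed closed_Times) auto

lemma point_law: "prob_space point_law"
  by (rule prob_space_uniform_measure) (simp_all add: emeasure_unit_square)

lemma angle_law: "prob_space angle_law"
  by (rule prob_space_uniform_measure) simp_all

lemma failure_law: "prob_space (failure_law v)"
  by (rule measure_pmf.prob_space_axioms)

lemma vertex_law: "prob_space (vertex_law v)"
  by (intro prob_space_pair point_law angle_law failure_law)

lemma measure_point_law:
  assumes "S \<in> sets borel"
  shows "measure point_law S = measure lborel (S \<inter> unit_square)"
proof -
  have "emeasure point_law S = emeasure lborel (unit_square \<inter> S) / 1"
    using assms by (subst emeasure_uniform_measure) (auto simp: emeasure_unit_square)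
  then show ?thesis by (simp add: measure_def Int_commute divide_ennreal_def)
qed

lemma measure_point_law_le:
  assumes "S \<in> fmeasurable lborel"
  shows "measure point_law S \<le> measure lborel S"
proof -
  have S: "S \<in> sets borel" using fmeasurableD[OF assms] by simp
  show ?thesis
    unfolding measure_point_law[OF S] using S by (intro measure_mono_fmeasurable assms) auto
qed

lemma measure_box: "a \<le> b \<Longrightarrow> c \<le> d \<Longrightarrow> emeasure lborel ({a..b} \<times> {c..d} :: (real \<times> real) set) = ennreal ((b - a) * (d - c))"
proof -
  assume "a \<le> b" "c \<le> d"
  moreover have "emeasure (lborel \<Otimes>\<^sub>M lborel) ({a..b} \<times> {c..d}) = emeasure lborel {a..b} * emeasure lborel {c..d}"
    by (rule lborel.emeasure_pair_measure_Times) auto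
  ultimately show ?thesis by (simp add: lborel_prod ennreal_mult)
qed

lemma box_fmeasurable: "({a..b} \<times> {c..d} :: (real \<times> real) set) \<in> fmeasurable lborel"
proof -
  have "emeasure lborel ({a..b} \<times> {c..d} :: (real \<times> real) set) \<le> emeasure lborel ({min a b..max a b} \<times> {min c d..max c d} :: (real \<times> real) set)"
    by (intro emeasure_mono) (auto intro!: borel_closed closed_Times)
  also have "\<dots> < \<infinity>" by (subst measure_box) auto
  finally show ?thesis by (intro fmeasurableI) (auto intro!: borel_closed closed_Times)
qed

lemma near_point_law:
  fixes x :: "real \<times> real"
  assumes "0 \<le> \<rho>" and S: "S \<in> sets borel" "\<And>z. z \<in> S \<Longrightarrow> dist x z \<le> \<rho>"
  shows "measure point_law S \<le> 4 * \<rho>\<^sup>2"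
proof -
  interpret prob_space point_law by (rule point_law)
  let ?B = "{fst x - \<rho>..fst x + \<rho>} \<times> {snd x - \<rho>..snd x + \<rho>}"
  have "S \<subseteq> ?B"
  proof
    fix z assume "z \<in> S"
    then have d: "dist x z \<le> \<rho>" by (rule S(2))
    have "dist (fst x) (fst z) \<le> \<rho>" "dist (snd x) (snd z) \<le> \<rho>"
      using dist_fst_le[of x z] dist_snd_le[of x z] d by auto
    then show "z \<in> ?B" by (auto simp: dist_real_def mem_Times_iff abs_le_iff)
  qed
  then have "measure point_law S \<le> measure point_law ?B"
    by (intro finite_measure_mono) (auto intro!: borel_closed closed_Times)
  also have "\<dots> \<le> measure lborel ?B" by (rule measure_point_law_le[OF box_fmeasurable])
  also have "\<dots> = 4 * \<rho>\<^sup>2" using assms(1) by (simp add: measure_def measure_box power2_eq_square)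
  finally show ?thesis .
qed

lemma prob_not_failed: "0 \<le> v \<Longrightarrow> v \<le> 1 \<Longrightarrow> \<P>(b in failure_law v. \<not> b) = 1 - v"
proof -
  assume "0 \<le> v" "v \<le> 1"
  moreover have "{b\<in>space (failure_law v). \<not> b} = {False}" by auto
  ultimately show ?thesis by (simp add: measure_pmf_single)
qed

text \<open>The assumption \<open>small\<close> says that the sector area does not exceed that of
  the unit square, so that \<open>p0\<close> is a probability; it holds for all large
  \<open>n\<close> because \<open>r n\<close> tends to 0.\<close>

locale sector_params =
  fixes \<alpha> v q r :: real
  assumes \<alpha>: "0 < \<alpha>" "\<alpha> \<le> 2 * pi" and v: "0 \<le> v" "v < 1" and q: "0 \<le> q" "q \<le> 1" and r: "0 < r"
    and small: "\<alpha> * r\<^sup>2 / 2 \<le> 1"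
begin

definition A :: real where "A = \<alpha> * r\<^sup>2 / 2"

lemma A_pos: "0 < A" using \<alpha> r by (simp add: A_def)

definition p0 :: real where "p0 = (1 - v) * A"

lemma p0: "0 \<le> p0" "p0 \<le> 1"
  using v A_pos small mult_le_one[of "1 - v" A] by (auto simp: p0_def A_def)

abbreviation "K \<equiv> vertex_law v"

definition ok :: "(real \<times> real) \<times> real \<times> bool \<Rightarrow> bool" where "ok z \<longleftrightarrow> \<not> snd (snd z)"

definition Rout :: "(real \<times> real) \<times> real \<times> bool \<Rightarrow> (real \<times> real) \<times> real \<times> bool \<Rightarrow> bool" where
  "Rout a b \<longleftrightarrow> ok b \<and> fst b \<in> sector \<alpha> (fst a) (fst (snd a)) r"

text \<open>The sector belongs to the other vertex: what decides about an in-neighbour is its own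
  angle, so in-degree estimates condition on the angle of \<open>b\<close> and let its position
  vary.\<close>

definition Rin :: "(real \<times> real) \<times> real \<times> bool \<Rightarrow> (real \<times> real) \<times> real \<times> bool \<Rightarrow> bool" where
  "Rin a b \<longleftrightarrow> ok b \<and> fst a \<in> sector \<alpha> (fst b) (fst (snd b)) r"

lemma X_meas: "f \<in> measurable M K \<Longrightarrow> (\<lambda>x. fst (f x)) \<in> borel_measurable M"
proof -
  assume "f \<in> measurable M K"
  then have "(\<lambda>x. fst (f x)) \<in> measurable M point_law" by (rule measurable_compose[OF _ measurable_fst])
  then show ?thesis by (simp cong: measurable_cong_sets)
qed

lemma Y_meas: "f \<in> measurable M K \<Longrightarrow> (\<lambda>x. fst (snd (f x))) \<in> borel_measurable M"
proof -
  assume "f \<in> measurable M K"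
  then have "(\<lambda>x. fst (snd (f x))) \<in> measurable M angle_law"
    by (rule measurable_compose[OF _ measurable_compose[OF measurable_snd measurable_fst]])
  then show ?thesis by (simp cong: measurable_cong_sets)
qed

lemma ok_meas: "f \<in> measurable M K \<Longrightarrow> Measurable.pred M (\<lambda>x. ok (f x))"
proof -
  assume "f \<in> measurable M K"
  then have "(\<lambda>x. snd (snd (f x))) \<in> measurable M (failure_law v)"
    by (rule measurable_compose[OF _ measurable_compose[OF measurable_snd measurable_snd]])
  then have "(\<lambda>x. snd (snd (f x))) \<in> measurable M (count_space UNIV)" by simp
  then show ?thesis unfolding ok_def by measurable
qed

lemma Rout_meas: "f \<in> measurable M K \<Longrightarrow> g \<in> measurable M K \<Longrightarrow> Measurable.pred M (\<lambda>x. Rout (f x) (g x))"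
  unfolding Rout_def by (intro pred_intros_logic ok_meas sector_measurable X_meas Y_meas)

lemma Rin_meas: "f \<in> measurable M K \<Longrightarrow> g \<in> measurable M K \<Longrightarrow> Measurable.pred M (\<lambda>x. Rin (f x) (g x))"
  unfolding Rin_def by (intro pred_intros_logic ok_meas sector_measurable X_meas Y_meas)

lemma space_K: "space K = UNIV"
  by (auto simp: space_pair_measure)

lemma sector_fm: "sector \<alpha> x y r \<in> fmeasurable lborel"
proof (rule fmeasurableI)
  show "emeasure lborel (sector \<alpha> x y r) < \<infinity>"
    by (rule emeasure_lborel_finite_dist[OF sector_dist])
qed simp

lemma sector_eq: "sector \<alpha> x y r = {z. z - x \<in> sector \<alpha> 0 y r}"
  using sector_translate by auto

lemma measure_sector: "measure lborel (sector \<alpha> x y r) = A"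
proof -
  have "measure lborel (sector \<alpha> x y r) = measure lborel (sector \<alpha> 0 y r)"
    unfolding sector_eq[of x] by (rule measure_lborel_translate) simp
  also have "\<dots> = A" using A_pos by (simp add: measure_def emeasure_sector[OF r \<alpha>] A_def)
  finally show ?thesis .
qed

text \<open>The displacements \<open>z - x\<close> for which the sector with apex \<open>z\<close>
  and direction \<open>y\<close> contains \<open>x\<close>. The possible positions of an
  in-neighbour with given angle form a translate of this set, which is the sector turned by
  \<open>pi\<close>.\<close>

definition refl_sector :: "real \<Rightarrow> (real \<times> real) set" where "refl_sector y = {w. - w \<in> sector \<alpha> 0 y r}"

lemma refl_sector_sets[measurable]: "refl_sector y \<in> sets borel"
proof -
  have "Measurable.pred borel (\<lambda>w. - w \<in> sector \<alpha> 0 y r)" by (rule sector_measurable) auto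
  from predE[OF this] show ?thesis by (simp add: refl_sector_def)
qed

lemma refl_sector_dist: "w \<in> refl_sector y \<Longrightarrow> dist 0 w \<le> r"
  using sector_dist[of "- w" \<alpha> 0 y r] by (simp add: refl_sector_def dist_norm)

lemma measure_refl_sector: "measure lborel (refl_sector y) = A"
proof -
  have "refl_sector y = {x. rot pi x \<in> sector \<alpha> 0 y r}" by (auto simp: refl_sector_def rot_def uminus_prod_def)
  then show ?thesis using measure_sector[of 0 y] by (simp add: measure_def emeasure_rot)
qed

lemma in_sector_iff: "x \<in> sector \<alpha> z y r \<longleftrightarrow> z - x \<in> refl_sector y"
  using sector_translate[of x \<alpha> z y r] by (simp add: refl_sector_def)

lemma refl_translate_fm: "{z. z - x \<in> refl_sector y} \<in> fmeasurable lborel"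
  by (rule fmeasurable_translate) (use emeasure_lborel_finite_dist[OF refl_sector_dist] in auto)

lemma measure_refl_translate: "measure lborel {z. z - x \<in> refl_sector y} = A"
  using measure_lborel_translate[of "refl_sector y" x] by (simp add: measure_refl_sector)

lemma K_ok: "\<P>(b in K. ok b) = 1 - v"
proof -
  have "\<P>(b in K. ok b) = \<P>(y in angle_law \<Otimes>\<^sub>M failure_law v. \<not> snd y)"
    unfolding ok_def by (rule prob_pair_snd) (auto intro!: point_law prob_space_pair angle_law failure_law)
  also have "\<dots> = \<P>(b in failure_law v. \<not> b)"
    by (rule prob_pair_snd) (auto intro!: angle_law failure_law)
  finally show ?thesis using prob_not_failed[of v] v by simp
qed

lemma K_point:
  assumes [measurable]: "S \<in> sets borel"
  shows "\<P>(b in K. ok b \<and> fst b \<in> S) = (1 - v) * measure point_law S"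
proof -
  have "\<P>(b in K. ok b \<and> fst b \<in> S) = \<P>(b in K. fst b \<in> S \<and> \<not> snd (snd b))"
    by (rule arg_cong[where f="measure _"]) (auto simp: ok_def)
  also have "\<dots> = \<P>(x in point_law. x \<in> S) * \<P>(y in angle_law \<Otimes>\<^sub>M failure_law v. \<not> snd y)"
    by (rule prob_pair_Times) (auto intro!: point_law prob_space_pair angle_law failure_law)
  also have "\<P>(y in angle_law \<Otimes>\<^sub>M failure_law v. \<not> snd y) = \<P>(b in failure_law v. \<not> b)"
    by (rule prob_pair_snd) (auto intro!: angle_law failure_law)
  finally show ?thesis using prob_not_failed[of v] v by simp
qed

lemma YF: "prob_space (angle_law \<Otimes>\<^sub>M failure_law v)"
  by (intro prob_space_pair angle_law failure_law)

text \<open>Fixing angle and failure state leaves a set of positions to be measured. The predicate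
  \<open>Q\<close> keeps the survival of the vertex as a separate factor.\<close>

lemma prob_K_le:
  assumes P: "Measurable.pred K P" and imp: "\<And>b. P b \<Longrightarrow> Q (snd (snd b))"
    and c: "0 \<le> c" and le: "\<And>y f. {x. P (x, y, f)} \<in> sets borel \<Longrightarrow> measure point_law {x. P (x, y, f)} \<le> c"
  shows "\<P>(b in K. P b) \<le> c * \<P>(f in failure_law v. Q f)"
proof -
  have sl: "{x. P (x, y, f)} \<in> sets borel" for y f
  proof -
    have "(\<lambda>x. (x, y, f)) \<in> measurable point_law K" by measurable
    from measurable_compose[OF this P] have "Measurable.pred point_law (\<lambda>x. P (x, y, f))" .
    from predE[OF this] show ?thesis by simp
  qed
  have "\<P>(b in K. P b) = \<P>(x in (angle_law \<Otimes>\<^sub>M failure_law v) \<Otimes>\<^sub>M point_law. P (snd x, fst x))"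
    by (rule measure_pair_swap[OF point_law YF P])
  also have "\<dots> \<le> c * \<P>(y in angle_law \<Otimes>\<^sub>M failure_law v. Q (snd y))"
  proof (rule measure_pair_le[OF YF point_law _ _ c])
    have "(\<lambda>x. (snd x, fst x)) \<in> measurable ((angle_law \<Otimes>\<^sub>M failure_law v) \<Otimes>\<^sub>M point_law) K" by measurable
    from measurable_compose[OF this P] show "Measurable.pred ((angle_law \<Otimes>\<^sub>M failure_law v) \<Otimes>\<^sub>M point_law) (\<lambda>x. P (snd x, fst x))" .
    show "Measurable.pred (angle_law \<Otimes>\<^sub>M failure_law v) (\<lambda>y. Q (snd y))"
      by (rule measurable_compose[OF measurable_snd]) simp
    show "\<P>(x in point_law. P (snd (y, x), fst (y, x))) \<le> c" for y
      using le[OF sl, of "fst y" "snd y"] by simp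
    show "P (snd (y, x), fst (y, x)) \<Longrightarrow> Q (snd y)" for y x
      using imp[of "(x, y)"] by simp
  qed
  also have "\<P>(y in angle_law \<Otimes>\<^sub>M failure_law v. Q (snd y)) = \<P>(f in failure_law v. Q f)"
    by (rule prob_pair_snd) (auto intro!: angle_law failure_law)
  finally show ?thesis .
qed

lemma point_law_mono: "S \<subseteq> T \<Longrightarrow> T \<in> sets borel \<Longrightarrow> measure point_law S \<le> measure point_law T"
proof -
  interpret prob_space point_law by (rule point_law)
  show "S \<subseteq> T \<Longrightarrow> T \<in> sets borel \<Longrightarrow> measure point_law S \<le> measure point_law T"
    by (rule finite_measure_mono) auto
qed

lemma out_prob_le: "\<P>(b in K. Rout a b) \<le> p0"
proof -
  have "\<P>(b in K. Rout a b) = (1 - v) * measure point_law (sector \<alpha> (fst a) (fst (snd a)) r)"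
    unfolding Rout_def by (rule K_point) simp
  also have "\<dots> \<le> (1 - v) * A"
    using v measure_point_law_le[OF sector_fm, of "fst a" "fst (snd a)"] measure_sector by (intro mult_left_mono) auto
  finally show ?thesis by (simp add: p0_def)
qed

lemma out_overlap_le:
  "\<P>(c in K. Rout a c \<and> Rout b c) \<le> (1 - v) * measure lborel (sector \<alpha> (fst a) (fst (snd a)) r \<inter> {z. z - fst b \<in> sector \<alpha> 0 (fst (snd b)) r})"
proof -
  let ?S = "sector \<alpha> (fst a) (fst (snd a)) r \<inter> sector \<alpha> (fst b) (fst (snd b)) r"
  have "\<P>(c in K. Rout a c \<and> Rout b c) = \<P>(c in K. ok c \<and> fst c \<in> ?S)"
    by (rule arg_cong[where f="measure _"]) (auto simp: Rout_def)
  also have "\<dots> = (1 - v) * measure point_law ?S" by (rule K_point) simp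
  also have "\<dots> \<le> (1 - v) * measure lborel ?S"
    using v by (intro mult_left_mono measure_point_law_le fmeasurable.Int sector_fm) auto
  finally show ?thesis unfolding sector_eq[of "fst b"] .
qed

lemma overlap_pred:
  assumes RR: "\<And>f g (M :: (((real \<times> real) \<times> real \<times> bool) \<times> ((real \<times> real) \<times> real \<times> bool)) measure). f \<in> measurable M K \<Longrightarrow> g \<in> measurable M K \<Longrightarrow> Measurable.pred M (\<lambda>x. RR (f x) (g x))"
  shows "(\<lambda>b. \<P>(c in K. RR a c \<and> RR b c)) \<in> borel_measurable K"
proof -
  interpret K: prob_space K by (rule vertex_law)
  have "Measurable.pred (K \<Otimes>\<^sub>M K) (\<lambda>x. RR a (snd x) \<and> RR (fst x) (snd x))"
    by (intro pred_intros_logic RR measurable_const measurable_fst measurable_snd) (simp add: space_K)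
  from predE[OF this] have S: "{x\<in>space (K \<Otimes>\<^sub>M K). RR a (snd x) \<and> RR (fst x) (snd x)} \<in> sets (K \<Otimes>\<^sub>M K)" .
  have "(\<lambda>b. emeasure K {c\<in>space K. RR a c \<and> RR b c}) \<in> borel_measurable K"
  proof (rule K.measurable_emeasure)
    have "{x\<in>space (K \<Otimes>\<^sub>M K). snd x \<in> {c\<in>space K. RR a c \<and> RR (fst x) c}}
      = {x\<in>space (K \<Otimes>\<^sub>M K). RR a (snd x) \<and> RR (fst x) (snd x)}" by (auto simp: space_K)
    then show "{x\<in>space (K \<Otimes>\<^sub>M K). snd x \<in> {c\<in>space K. RR a c \<and> RR (fst x) c}} \<in> sets (K \<Otimes>\<^sub>M K)"
      using S by (simp only:)
  qed auto
  then show ?thesis unfolding measure_def by (rule measurable_compose[where g=enn2real]) simp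
qed

text \<open>The sectors of \<open>a\<close> and \<open>b\<close> point in different directions, so
  the best overlap need not occur at displacement zero, and comparing with the position of
  \<open>a\<close> is not the right thing. For a fixed direction of \<open>b\<close>, however, any
  two positions with large overlap are close to each other by \<open>translates_close\<close>;
  fixing one of them, \<open>u\<close>, confines all others to a disc of radius
  \<open>8 * \<eta> * r\<close>.\<close>

lemma out_level_le:
  assumes \<eta>: "0 \<le> \<eta>"
  shows "\<P>(b in K. dist (fst a) (fst b) \<le> 2 * r \<and> (1 - \<eta>) * p0 < \<P>(c in K. Rout a c \<and> Rout b c)) \<le> 256 * \<eta>\<^sup>2 * r\<^sup>2"
proof -
  let ?P = "\<lambda>b. dist (fst a) (fst b) \<le> 2 * r \<and> (1 - \<eta>) * p0 < \<P>(c in K. Rout a c \<and> Rout b c)"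
  have "\<P>(b in K. ?P b) \<le> 256 * \<eta>\<^sup>2 * r\<^sup>2 * \<P>(f in failure_law v. True)"
  proof (rule prob_K_le[where Q="\<lambda>_. True"])
    have [measurable]: "(\<lambda>b. \<P>(c in K. Rout a c \<and> Rout b c)) \<in> borel_measurable K"
      by (rule overlap_pred) (rule Rout_meas)
    have [measurable]: "(\<lambda>b. fst b) \<in> borel_measurable K" by (rule X_meas) simp
    show "Measurable.pred K ?P" by measurable
    fix y f assume S: "{x. ?P (x, y, f)} \<in> sets borel"
    show "measure point_law {x. ?P (x, y, f)} \<le> 256 * \<eta>\<^sup>2 * r\<^sup>2"
    proof (cases "{x. ?P (x, y, f)} = {}")
      case True
      then show ?thesis by (simp only: measure_empty) simp
    next
      case False
      then obtain u where u: "?P (u, y, f)" by blast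
      have lev: "(1 - \<eta>) * A < measure lborel (sector \<alpha> (fst a) (fst (snd a)) r \<inter> {z. z - w \<in> sector \<alpha> 0 y r})"
        if "?P (w, y, f)" for w
      proof -
        have "(1 - \<eta>) * p0 < (1 - v) * measure lborel (sector \<alpha> (fst a) (fst (snd a)) r \<inter> {z. z - w \<in> sector \<alpha> 0 y r})"
          using that out_overlap_le[of a "(w, y, f)"] by simp
        then have "(1 - v) * ((1 - \<eta>) * A) < (1 - v) * measure lborel (sector \<alpha> (fst a) (fst (snd a)) r \<inter> {z. z - w \<in> sector \<alpha> 0 y r})"
          by (simp add: p0_def mult_ac)
        then show ?thesis using v by simp
      qed
      have "dist u w \<le> 8 * \<eta> * r" if w: "?P (w, y, f)" for w
      proof -
        have "dist u w \<le> 4 * r"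
          using u w dist_triangle3[of u w "fst a"] by simp
        then show ?thesis
          unfolding dist_norm
          by (intro translates_close[where S="sector \<alpha> (fst a) (fst (snd a)) r" and S'="sector \<alpha> 0 y r"
                and ?x0.0="fst a" and ?x1.0=0 and A=A] lev[OF u] lev[OF w] r A_pos measure_sector sector_dist) auto
      qed
      then have "measure point_law {x. ?P (x, y, f)} \<le> 4 * (8 * \<eta> * r)\<^sup>2"
        using \<eta> r by (intro near_point_law[where x=u]) (use S in auto)
      then show ?thesis by (simp add: power2_eq_square mult_ac)
    qed
  qed auto
  then show ?thesis by (simp add: measure_pmf.prob_space[simplified])
qed

lemma near_K_le: "0 \<le> \<rho> \<Longrightarrow> \<P>(b in K. dist x (fst b) \<le> \<rho>) \<le> 4 * \<rho>\<^sup>2"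
proof -
  assume \<rho>: "0 \<le> \<rho>"
  have D[measurable]: "{z. dist x z \<le> \<rho>} \<in> sets borel"
  proof -
    have "{z. dist x z \<le> \<rho>} = cball x \<rho>" by auto
    then show ?thesis by simp
  qed
  have "\<P>(b in K. fst b \<in> {z. dist x z \<le> \<rho>}) = \<P>(z in point_law. z \<in> {z. dist x z \<le> \<rho>})"
    by (rule prob_pair_fst[OF point_law YF]) measurable
  also have "{z\<in>space point_law. z \<in> {z. dist x z \<le> \<rho>}} = {z. dist x z \<le> \<rho>}" by auto
  also have "measure point_law {z. dist x z \<le> \<rho>} \<le> 4 * \<rho>\<^sup>2"
    by (rule near_point_law[OF \<rho> D]) simp
  finally show ?thesis by (simp only: mem_Collect_eq)
qed

lemma in_prob_le: "\<P>(b in K. Rin a b) \<le> p0"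
proof -
  have "\<P>(b in K. Rin a b) \<le> A * \<P>(f in failure_law v. \<not> f)"
  proof (rule prob_K_le)
    show "Measurable.pred K (Rin a)" by (rule Rin_meas) (simp_all add: space_K)
    fix y f assume S: "{x. Rin a (x, y, f)} \<in> sets borel"
    have "measure point_law {x. Rin a (x, y, f)} \<le> measure point_law {z. z - fst a \<in> refl_sector y}"
      using fmeasurableD[OF refl_translate_fm]
      by (intro point_law_mono) (auto simp: Rin_def in_sector_iff)
    also have "\<dots> \<le> A" using measure_point_law_le[OF refl_translate_fm] measure_refl_translate by metis
    finally show "measure point_law {x. Rin a (x, y, f)} \<le> A" .
  qed (use A_pos in \<open>auto simp: Rin_def ok_def\<close>)
  then show ?thesis using v prob_not_failed[of v] by (simp add: p0_def mult.commute)
qed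

text \<open>Here the comparison is direct: for a vertex \<open>c\<close> of given angle, being an
  in-neighbour of both \<open>a\<close> and \<open>b\<close> means lying in two translates of one
  and the same reflected sector, and the bound for their intersection falls linearly with the
  distance.\<close>

lemma in_overlap_le:
  assumes "dist (fst a) (fst b) \<le> 2 * r"
  shows "\<P>(c in K. Rin a c \<and> Rin b c) \<le> p0 * (1 - dist (fst a) (fst b) / (4 * r))"
proof -
  have nn: "0 \<le> 1 - dist (fst a) (fst b) / (4 * r)" using assms r by (simp add: field_simps)
  have "\<P>(c in K. Rin a c \<and> Rin b c) \<le> (A * (1 - dist (fst a) (fst b) / (4 * r))) * \<P>(f in failure_law v. \<not> f)"
  proof (rule prob_K_le)
    show "Measurable.pred K (\<lambda>c. Rin a c \<and> Rin b c)" by (intro pred_intros_logic Rin_meas) (simp_all add: space_K)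
    fix y f assume S: "{x. Rin a (x, y, f) \<and> Rin b (x, y, f)} \<in> sets borel"
    let ?T = "refl_sector y \<inter> {w. w - (fst b - fst a) \<in> refl_sector y}"
    have Tm: "?T \<in> sets borel" by measurable
    have eq: "{z. z - fst a \<in> ?T} = {z. z - fst a \<in> refl_sector y} \<inter> {z. z - fst b \<in> refl_sector y}"
      by (auto simp: algebra_simps)
    have f: "{z. z - fst a \<in> ?T} \<in> fmeasurable lborel"
      unfolding eq by (intro fmeasurable.Int refl_translate_fm)
    have "measure point_law {x. Rin a (x, y, f) \<and> Rin b (x, y, f)} \<le> measure point_law {z. z - fst a \<in> ?T}"
      using fmeasurableD[OF f] unfolding eq
      by (intro point_law_mono) (auto simp: Rin_def in_sector_iff)
    also have "\<dots> \<le> measure lborel {z. z - fst a \<in> ?T}" by (rule measure_point_law_le[OF f])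
    also have "\<dots> = measure lborel ?T" by (rule measure_lborel_translate[OF Tm])
    also have "\<dots> \<le> measure lborel (refl_sector y) * (1 - norm (fst b - fst a) / (4 * r))"
      using assms by (intro measure_Int_translate[OF _ refl_sector_dist r]) (auto simp: dist_norm norm_minus_commute)
    finally show "measure point_law {x. Rin a (x, y, f) \<and> Rin b (x, y, f)} \<le> A * (1 - dist (fst a) (fst b) / (4 * r))"
      by (simp add: measure_refl_sector dist_norm norm_minus_commute)
  qed (use A_pos nn in \<open>auto simp: Rin_def ok_def\<close>)
  then show ?thesis using v prob_not_failed[of v] by (simp add: p0_def mult_ac)
qed

lemma p0_pos: "0 < p0" using v A_pos by (simp add: p0_def)

lemma in_level_le:
  assumes \<eta>: "0 \<le> \<eta>"
  shows "\<P>(b in K. dist (fst a) (fst b) \<le> 2 * r \<and> (1 - \<eta>) * p0 < \<P>(c in K. Rin a c \<and> Rin b c)) \<le> 256 * \<eta>\<^sup>2 * r\<^sup>2"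
proof -
  have X: "(\<lambda>b. fst b) \<in> borel_measurable K" by (rule X_meas) simp
  have Xp: "Measurable.pred K (\<lambda>b. dist (fst a) (fst b) \<le> c)" for c
    using X by measurable
  have "dist (fst a) (fst b) \<le> 4 * \<eta> * r" if "dist (fst a) (fst b) \<le> 2 * r" "(1 - \<eta>) * p0 < \<P>(c in K. Rin a c \<and> Rin b c)" for b
  proof -
    have "(1 - \<eta>) * p0 < p0 * (1 - dist (fst a) (fst b) / (4 * r))" using in_overlap_le[OF that(1)] that(2) by simp
    then have "1 - \<eta> < 1 - dist (fst a) (fst b) / (4 * r)" using p0_pos by (simp add: mult.commute)
    then show ?thesis using r by (simp add: field_simps)
  qed
  then have "\<P>(b in K. dist (fst a) (fst b) \<le> 2 * r \<and> (1 - \<eta>) * p0 < \<P>(c in K. Rin a c \<and> Rin b c)) \<le> \<P>(b in K. dist (fst a) (fst b) \<le> 4 * \<eta> * r)"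
    by (intro prob_mono_pred[OF vertex_law Xp]) auto
  also have "\<dots> \<le> 4 * (4 * \<eta> * r)\<^sup>2" using \<eta> r by (intro near_K_le) auto
  also have "\<dots> \<le> 256 * \<eta>\<^sup>2 * r\<^sup>2" by (simp add: power_mult_distrib)
  finally show ?thesis .
qed

sublocale out: mark_model K Rout ok fst r q p0
proof (rule mark_model.intro)
  show "prob_space K" by (rule vertex_law)
  show "Measurable.pred (K \<Otimes>\<^sub>M K) (\<lambda>x. Rout (fst x) (snd x))" by (rule Rout_meas) auto
  show "Measurable.pred K ok" by (rule ok_meas) simp
  show "fst \<in> borel_measurable K" by (rule X_meas) simp
  show "dist (fst a) (fst b) \<le> r" if "Rout a b" for a b
    using that sector_dist[of "fst b" \<alpha> "fst a" "fst (snd a)" r] by (simp add: Rout_def)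
qed (use q r near_K_le out_prob_le p0 out_level_le in auto)

sublocale inn: mark_model K Rin ok fst r q p0
proof (rule mark_model.intro)
  show "prob_space K" by (rule vertex_law)
  show "Measurable.pred (K \<Otimes>\<^sub>M K) (\<lambda>x. Rin (fst x) (snd x))" by (rule Rin_meas) auto
  show "Measurable.pred K ok" by (rule ok_meas) simp
  show "fst \<in> borel_measurable K" by (rule X_meas) simp
  show "dist (fst a) (fst b) \<le> r" if "Rin a b" for a b
    using that sector_dist[of "fst a" \<alpha> "fst b" "fst (snd b)" r] by (simp add: Rin_def dist_commute)
qed (use q r near_K_le in_prob_le p0 in_level_le in auto)

text \<open>At distance at least \<open>r\<close> from the boundary all neighbourhoods lie in the
  square and the connection probability is exactly \<open>p0\<close>.\<close>

definition interior_mark :: "(real \<times> real) \<times> real \<times> bool \<Rightarrow> bool" where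
  "interior_mark z \<longleftrightarrow> fst z \<in> {r..1 - r} \<times> {r..1 - r}"

lemma interior_ball: "interior_mark z \<Longrightarrow> dist (fst z) w \<le> r \<Longrightarrow> w \<in> unit_square"
  using dist_fst_le[of "fst z" w] dist_snd_le[of "fst z" w]
  by (auto simp: interior_mark_def mem_Times_iff dist_real_def abs_le_iff)

lemma out_prob_eq: "interior_mark z \<Longrightarrow> \<P>(b in K. Rout z b) = p0"
proof -
  assume z: "interior_mark z"
  have "\<P>(b in K. Rout z b) = (1 - v) * measure point_law (sector \<alpha> (fst z) (fst (snd z)) r)"
    unfolding Rout_def by (rule K_point) simp
  also have "measure point_law (sector \<alpha> (fst z) (fst (snd z)) r) = measure lborel (sector \<alpha> (fst z) (fst (snd z)) r \<inter> unit_square)"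
    by (rule measure_point_law) simp
  also have "sector \<alpha> (fst z) (fst (snd z)) r \<inter> unit_square = sector \<alpha> (fst z) (fst (snd z)) r"
    using interior_ball[OF z sector_dist] by blast
  finally show ?thesis by (simp add: p0_def measure_sector)
qed

lemma in_prob_eq: "interior_mark z \<Longrightarrow> \<P>(b in K. Rin z b) = p0"
proof -
  assume z: "interior_mark z"
  have P: "Measurable.pred K (Rin z)" by (rule Rin_meas) (simp_all add: space_K)
  have "\<P>(b in K. Rin z b) = \<P>(x in (angle_law \<Otimes>\<^sub>M failure_law v) \<Otimes>\<^sub>M point_law. Rin z (snd x, fst x))"
    by (rule measure_pair_swap[OF point_law YF P])
  also have "\<dots> = A * \<P>(y in angle_law \<Otimes>\<^sub>M failure_law v. \<not> snd y)"
  proof (rule measure_pair_cong[OF YF point_law])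
    have "(\<lambda>x. (snd x, fst x)) \<in> measurable ((angle_law \<Otimes>\<^sub>M failure_law v) \<Otimes>\<^sub>M point_law) K" by measurable
    from measurable_compose[OF this P] show "Measurable.pred ((angle_law \<Otimes>\<^sub>M failure_law v) \<Otimes>\<^sub>M point_law) (\<lambda>x. Rin z (snd x, fst x))" .
    show "Measurable.pred (angle_law \<Otimes>\<^sub>M failure_law v) (\<lambda>y. \<not> snd y)" by measurable
    fix y :: "real \<times> bool" assume "\<not> snd y"
    then have "{x. Rin z (x, y)} = {x. x - fst z \<in> refl_sector (fst y)}"
      by (auto simp: Rin_def ok_def in_sector_iff)
    moreover have "measure point_law {x. x - fst z \<in> refl_sector (fst y)} = A"
    proof -
      have "measure point_law {x. x - fst z \<in> refl_sector (fst y)} = measure lborel ({x. x - fst z \<in> refl_sector (fst y)} \<inter> unit_square)"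
        using fmeasurableD[OF refl_translate_fm] by (intro measure_point_law) auto
      also have "{x. x - fst z \<in> refl_sector (fst y)} \<inter> unit_square = {x. x - fst z \<in> refl_sector (fst y)}"
      proof -
        have "x \<in> unit_square" if "x - fst z \<in> refl_sector (fst y)" for x
          using interior_ball[OF z, of x] refl_sector_dist[OF that] by (simp add: dist_norm norm_minus_commute)
        then show ?thesis by blast
      qed
      finally show ?thesis by (simp add: measure_refl_translate)
    qed
    ultimately show "\<P>(x in point_law. Rin z (snd (y, x), fst (y, x))) = A" by simp
  qed (use A_pos in \<open>auto simp: Rin_def ok_def\<close>)
  also have "\<P>(y in angle_law \<Otimes>\<^sub>M failure_law v. \<not> snd y) = \<P>(f in failure_law v. \<not> f)"
    by (rule prob_pair_snd) (auto intro!: angle_law failure_law)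
  finally show ?thesis using v prob_not_failed[of v] by (simp add: p0_def mult.commute)
qed

lemma interior_meas: "Measurable.pred K interior_mark"
proof -
  have [measurable]: "(\<lambda>b. fst b) \<in> borel_measurable K" by (rule X_meas) simp
  have [measurable]: "{r..1 - r} \<times> {r..1 - r} \<in> sets (borel :: (real \<times> real) measure)"
    by (intro borel_closed closed_Times) auto
  show ?thesis unfolding interior_mark_def by measurable
qed

text \<open>Boundary effects cost only a factor \<open>(1 - 2 * r)^2 \<ge> 1 - 4 * r\<close>, which
  tends to 1 together with the vanishing of \<open>r\<close>.\<close>

lemma interior_prob: "2 * r \<le> 1 \<Longrightarrow> (1 - v) * (1 - 4 * r) \<le> \<P>(z in K. ok z \<and> interior_mark z)"
proof -
  assume r2: "2 * r \<le> 1"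
  let ?B = "{r..1 - r} \<times> {r..1 - r} :: (real \<times> real) set"
  have B: "?B \<in> sets borel" by (intro borel_closed closed_Times) auto
  have "\<P>(z in K. ok z \<and> interior_mark z) = (1 - v) * measure point_law ?B"
    unfolding interior_mark_def by (rule K_point[OF B])
  also have "measure point_law ?B = measure lborel (?B \<inter> unit_square)" by (rule measure_point_law[OF B])
  also have "?B \<inter> unit_square = ?B" using r by auto
  also have "measure lborel ?B = (1 - r - r) * (1 - r - r)"
    using r2 measure_box[of r "1 - r" r "1 - r"] by (simp add: measure_def)
  also have "(1 - v) * ((1 - r - r) * (1 - r - r)) \<ge> (1 - v) * (1 - 4 * r)"
    using v r by (intro mult_left_mono) (auto simp: algebra_simps)
  finally show ?thesis .
qed

end

section \<open>From the sample space to an i.i.d. sequence of marks\<close>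

lemma prob_zip_pair:
  assumes A: "prob_space A" and B: "prob_space B" and C: "prob_space C"
    and P[measurable]: "Measurable.pred ((\<Pi>\<^sub>M i\<in>(UNIV::'i set). A \<Otimes>\<^sub>M B) \<Otimes>\<^sub>M C) P"
  shows "\<P>(x in (\<Pi>\<^sub>M i\<in>(UNIV::'i set). A \<Otimes>\<^sub>M B) \<Otimes>\<^sub>M C. P x)
    = \<P>(x in (\<Pi>\<^sub>M i\<in>(UNIV::'i set). A) \<Otimes>\<^sub>M ((\<Pi>\<^sub>M i\<in>(UNIV::'i set). B) \<Otimes>\<^sub>M C).
        P (zip_seq (fst x, fst (snd x)), snd (snd x)))"
proof -
  let ?A = "\<Pi>\<^sub>M i\<in>(UNIV::'i set). A" and ?B = "\<Pi>\<^sub>M i\<in>(UNIV::'i set). B" and ?AB = "\<Pi>\<^sub>M i\<in>(UNIV::'i set). A \<Otimes>\<^sub>M B"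
  have ps: "prob_space ?A" "prob_space ?B" "prob_space ?AB" "prob_space (?A \<Otimes>\<^sub>M ?B)"
    by (intro prob_space_iid prob_space_pair A B)+
  have "\<P>(x in ?AB \<Otimes>\<^sub>M C. P x) = \<P>(x in C \<Otimes>\<^sub>M ?AB. P (snd x, fst x))"
    by (rule measure_pair_swap[OF ps(3) C P])
  also have "\<dots> = \<P>(x in C \<Otimes>\<^sub>M (?A \<Otimes>\<^sub>M ?B). P (zip_seq (snd x), fst x))"
  proof (rule prob_pair_cong_fst[OF C ps(3) _ _ ps(4)])
    fix c assume [measurable]: "c \<in> space C"
    show "\<P>(y in ?AB. P (snd (c, y), fst (c, y))) = \<P>(y in ?A \<Otimes>\<^sub>M ?B. P (zip_seq (snd (c, y)), fst (c, y)))"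
      by (subst prob_zip_seq[OF A B]) simp_all
  qed measurable
  also have "\<dots> = \<P>(x in (?A \<Otimes>\<^sub>M ?B) \<Otimes>\<^sub>M C. P (zip_seq (fst x), snd x))"
    by (subst measure_pair_swap[OF C ps(4)]) simp_all
  also have "\<dots> = \<P>(x in ?A \<Otimes>\<^sub>M (?B \<Otimes>\<^sub>M C). P (zip_seq (fst x, fst (snd x)), snd (snd x)))"
    by (subst measure_pair_assoc[OF ps(1,2) C]) simp_all
  finally show ?thesis .
qed

lemma prob_rows_pair:
  assumes B: "prob_space B" and C: "prob_space C" and g: "inj (\<lambda>(i, j). g i j)"
    and P[measurable]: "Measurable.pred ((\<Pi>\<^sub>M i\<in>(UNIV::'i set). \<Pi>\<^sub>M j\<in>(UNIV::'j set). B) \<Otimes>\<^sub>M C) P"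
  shows "\<P>(x in (\<Pi>\<^sub>M i\<in>(UNIV::'i set). \<Pi>\<^sub>M j\<in>(UNIV::'j set). B) \<Otimes>\<^sub>M C. P x)
    = \<P>(x in (\<Pi>\<^sub>M e\<in>(UNIV::'e set). B) \<Otimes>\<^sub>M C. P (\<lambda>i j. fst x (g i j), snd x))"
proof -
  let ?W = "\<Pi>\<^sub>M i\<in>(UNIV::'i set). \<Pi>\<^sub>M j\<in>(UNIV::'j set). B" and ?E = "\<Pi>\<^sub>M e\<in>(UNIV::'e set). B"
  have ps: "prob_space ?W" "prob_space ?E" by (intro prob_space_iid B)+
  have m: "(\<lambda>E i j. E (g i j)) \<in> measurable ?E ?W"
    by (intro measurable_PiM_single') (auto simp: space_PiM PiE_iff)
  have mP: "Measurable.pred (C \<Otimes>\<^sub>M ?E) (\<lambda>x. P (\<lambda>i j. snd x (g i j), fst x))"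
  proof -
    have "(\<lambda>x. (\<lambda>i j. snd x (g i j), fst x)) \<in> measurable (C \<Otimes>\<^sub>M ?E) (?W \<Otimes>\<^sub>M C)"
      using m by (intro measurable_Pair measurable_compose[OF measurable_snd m]) auto
    from measurable_compose[OF this P] show ?thesis .
  qed
  have "\<P>(x in ?W \<Otimes>\<^sub>M C. P x) = \<P>(x in C \<Otimes>\<^sub>M ?W. P (snd x, fst x))"
    by (rule measure_pair_swap[OF ps(1) C P])
  also have "\<dots> = \<P>(x in C \<Otimes>\<^sub>M ?E. P (\<lambda>i j. snd x (g i j), fst x))"
  proof (rule prob_pair_cong_fst[OF C ps(1) _ mP ps(2)])
    fix c assume [measurable]: "c \<in> space C"
    have "Measurable.pred ?W (\<lambda>w. P (w, c))" by measurable
    from measure_distr_pred[OF distr_rows[OF B g] m this refl]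
    show "\<P>(y in ?W. P (snd (c, y), fst (c, y))) = \<P>(y in ?E. P (\<lambda>i j. snd (c, y) (g i j), fst (c, y)))"
      by simp
  qed measurable
  also have "\<dots> = \<P>(x in ?E \<Otimes>\<^sub>M C. P (\<lambda>i j. fst x (g i j), snd x))"
    using measure_pair_swap[OF C ps(2) mP] by simp
  finally show ?thesis .
qed

type_synonym mark = "((real \<times> real) \<times> real \<times> bool) \<times> (nat \<Rightarrow> bool)"

text \<open>Out-degrees use \<open>g i j = (i, j)\<close>, in-degrees \<open>g i j = (j, i)\<close>.\<close>

definition marks :: "(nat \<Rightarrow> nat \<Rightarrow> nat \<times> nat) \<Rightarrow> sample \<Rightarrow> nat \<Rightarrow> mark" where
  "marks g = (\<lambda>(X, Y, F, E, N) i. ((X i, Y i, F i), \<lambda>j. E (g i j)))"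

definition count :: "sample \<Rightarrow> nat" where
  "count = (\<lambda>(X, Y, F, E, N). N)"

abbreviation count_law :: "nat \<Rightarrow> nat measure" where
  "count_law n \<equiv> measure_pmf (poisson_pmf (real n))"

abbreviation marks_law :: "real \<Rightarrow> real \<Rightarrow> (nat \<Rightarrow> mark) measure" where
  "marks_law v q \<equiv> \<Pi>\<^sub>M i\<in>(UNIV::nat set). vertex_law v \<Otimes>\<^sub>M edges q"

lemma measurable_marks:
  "marks g \<in> measurable (sample_space n v q) (marks_law v q)"
proof -
  let ?S = "sample_space n v q"
  have 1: "(\<lambda>\<omega>. fst \<omega> i) \<in> measurable ?S point_law" for i
    unfolding sample_space_def by measurable
  have 2: "(\<lambda>\<omega>. fst (snd \<omega>) i) \<in> measurable ?S angle_law" for i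
    unfolding sample_space_def by measurable
  have 3: "(\<lambda>\<omega>. fst (snd (snd \<omega>)) i) \<in> measurable ?S (failure_law v)" for i
    unfolding sample_space_def
    by (intro measurable_compose[OF measurable_snd] measurable_compose[OF measurable_fst] measurable_component_singleton) simp
  have 4: "(\<lambda>\<omega>. fst (snd (snd (snd \<omega>))) e) \<in> measurable ?S (failure_law q)" for e
    unfolding sample_space_def
    by (intro measurable_compose[OF measurable_snd] measurable_compose[OF measurable_fst] measurable_component_singleton) simp
  have row: "(\<lambda>\<omega> j. fst (snd (snd (snd \<omega>))) (g i j)) \<in> measurable ?S (edges q)" for i
    by (rule measurable_PiM_single') (use 4 in auto)
  have el: "(\<lambda>\<omega>. ((fst \<omega> i, fst (snd \<omega>) i, fst (snd (snd \<omega>)) i), \<lambda>j. fst (snd (snd (snd \<omega>))) (g i j)))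
     \<in> measurable ?S (vertex_law v \<Otimes>\<^sub>M edges q)" for i
    by (intro measurable_Pair 1 2 3 row)
  have "(\<lambda>\<omega> i. ((fst \<omega> i, fst (snd \<omega>) i, fst (snd (snd \<omega>)) i), \<lambda>j. fst (snd (snd (snd \<omega>))) (g i j))) \<in> measurable ?S (marks_law v q)"
    by (rule measurable_PiM_single') (use el in \<open>auto simp: space_PiM space_pair_measure\<close>)
  then show ?thesis by (simp add: marks_def case_prod_beta)
qed

lemma measurable_count: "count \<in> measurable (sample_space n v q) (count_law n)"
  unfolding sample_space_def count_def case_prod_beta
  by (intro measurable_compose[OF measurable_snd] measurable_snd)

text \<open>The sequence of marks is unzipped into points, angles and vertex failures one factor at
  a time, each time with the outer factors held fixed. Innermost, \<open>prob_rows_pair\<close>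
  replaces the independent rows by the array of arc failures read through \<open>g\<close>.\<close>

lemma prob_sample_space:
  assumes g: "inj (\<lambda>(i, j). g i j)"
    and P: "Measurable.pred (marks_law v q \<Otimes>\<^sub>M count_law n) P"
  shows "\<P>(\<omega> in sample_space n v q. P (marks g \<omega>, count \<omega>)) = \<P>(x in marks_law v q \<Otimes>\<^sub>M count_law n. P x)"
proof -
  let ?X = "\<Pi>\<^sub>M i\<in>(UNIV::nat set). point_law" and ?Y = "\<Pi>\<^sub>M i\<in>(UNIV::nat set). angle_law"
    and ?F = "\<Pi>\<^sub>M i\<in>(UNIV::nat set). failure_law v" and ?E = "\<Pi>\<^sub>M e\<in>(UNIV::(nat \<times> nat) set). failure_law q"
    and ?W = "\<Pi>\<^sub>M i\<in>(UNIV::nat set). edges q" and ?N = "count_law n"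
    and ?YF = "\<Pi>\<^sub>M i\<in>(UNIV::nat set). angle_law \<Otimes>\<^sub>M failure_law v" and ?K = "\<Pi>\<^sub>M i\<in>(UNIV::nat set). vertex_law v"
  have N: "prob_space ?N" by (rule measure_pmf.prob_space_axioms)
  have E: "prob_space (edges q)" by (rule prob_space_iid[OF failure_law])
  have ps: "prob_space ?X" "prob_space ?Y" "prob_space ?F" "prob_space ?E" "prob_space ?W" "prob_space ?YF" "prob_space ?K"
    by (intro prob_space_iid prob_space_pair point_law angle_law failure_law E)+
  note [measurable] = P
  have "\<P>(x in marks_law v q \<Otimes>\<^sub>M ?N. P x)
      = \<P>(x in ?K \<Otimes>\<^sub>M (?W \<Otimes>\<^sub>M ?N). P (zip_seq (fst x, fst (snd x)), snd (snd x)))"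
    by (rule prob_zip_pair[OF vertex_law E N P])
  also have "\<dots> = \<P>(x in ?X \<Otimes>\<^sub>M (?YF \<Otimes>\<^sub>M (?W \<Otimes>\<^sub>M ?N)).
      P (zip_seq (zip_seq (fst x, fst (snd x)), fst (snd (snd x))), snd (snd (snd x))))"
    by (subst prob_zip_pair[OF point_law prob_space_pair[OF angle_law failure_law] prob_space_pair[OF ps(5) N]]) simp_all
  also have "\<dots> = \<P>(x in ?X \<Otimes>\<^sub>M (?Y \<Otimes>\<^sub>M (?F \<Otimes>\<^sub>M (?E \<Otimes>\<^sub>M ?N))).
      P (\<lambda>i. ((fst x i, fst (snd x) i, fst (snd (snd x)) i), \<lambda>j. fst (snd (snd (snd x))) (g i j)), snd (snd (snd (snd x)))))"
  proof (rule prob_pair_cong_fst[OF ps(1)])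
    show "prob_space (?YF \<Otimes>\<^sub>M (?W \<Otimes>\<^sub>M ?N))" "prob_space (?Y \<Otimes>\<^sub>M (?F \<Otimes>\<^sub>M (?E \<Otimes>\<^sub>M ?N)))"
      by (intro prob_space_pair ps N)+
    show "Measurable.pred (?X \<Otimes>\<^sub>M (?YF \<Otimes>\<^sub>M (?W \<Otimes>\<^sub>M ?N)))
      (\<lambda>x. P (zip_seq (zip_seq (fst x, fst (snd x)), fst (snd (snd x))), snd (snd (snd x))))" by measurable
    show m: "Measurable.pred (?X \<Otimes>\<^sub>M (?Y \<Otimes>\<^sub>M (?F \<Otimes>\<^sub>M (?E \<Otimes>\<^sub>M ?N))))
      (\<lambda>x. P (\<lambda>i. ((fst x i, fst (snd x) i, fst (snd (snd x)) i), \<lambda>j. fst (snd (snd (snd x))) (g i j)), snd (snd (snd (snd x)))))"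
      using measurable_compose[OF measurable_Pair[OF measurable_marks[of g n v q] measurable_count[of n v q]] P]
      unfolding marks_def count_def sample_space_def case_prod_beta .
    fix X assume X[measurable]: "X \<in> space ?X"
    have "\<P>(y in ?YF \<Otimes>\<^sub>M (?W \<Otimes>\<^sub>M ?N). P (zip_seq (zip_seq (X, fst y), fst (snd y)), snd (snd y)))
      = \<P>(y in ?Y \<Otimes>\<^sub>M (?F \<Otimes>\<^sub>M (?W \<Otimes>\<^sub>M ?N)).
        P (zip_seq (zip_seq (X, zip_seq (fst y, fst (snd y))), fst (snd (snd y))), snd (snd (snd y))))"
      by (subst prob_zip_pair[OF angle_law failure_law prob_space_pair[OF ps(5) N]]) simp_all
    also have "\<dots> = \<P>(y in ?Y \<Otimes>\<^sub>M (?F \<Otimes>\<^sub>M (?E \<Otimes>\<^sub>M ?N)).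
       P (\<lambda>i. ((X i, fst y i, fst (snd y) i), \<lambda>j. fst (snd (snd y)) (g i j)), snd (snd (snd y))))"
    proof (rule prob_pair_cong_fst[OF ps(2)])
      show "prob_space (?F \<Otimes>\<^sub>M (?W \<Otimes>\<^sub>M ?N))" "prob_space (?F \<Otimes>\<^sub>M (?E \<Otimes>\<^sub>M ?N))"
        by (intro prob_space_pair ps N)+
      show "Measurable.pred (?Y \<Otimes>\<^sub>M (?F \<Otimes>\<^sub>M (?W \<Otimes>\<^sub>M ?N)))
        (\<lambda>y. P (zip_seq (zip_seq (X, zip_seq (fst y, fst (snd y))), fst (snd (snd y))), snd (snd (snd y))))" by measurable
      have "(\<lambda>y. (X, y)) \<in> measurable (?Y \<Otimes>\<^sub>M (?F \<Otimes>\<^sub>M (?E \<Otimes>\<^sub>M ?N))) (?X \<Otimes>\<^sub>M (?Y \<Otimes>\<^sub>M (?F \<Otimes>\<^sub>M (?E \<Otimes>\<^sub>M ?N))))"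
        by (rule measurable_Pair1'[OF X])
      from measurable_compose[OF this m]
      show m2: "Measurable.pred (?Y \<Otimes>\<^sub>M (?F \<Otimes>\<^sub>M (?E \<Otimes>\<^sub>M ?N)))
         (\<lambda>y. P (\<lambda>i. ((X i, fst y i, fst (snd y) i), \<lambda>j. fst (snd (snd y)) (g i j)), snd (snd (snd y))))" by simp
      fix Y assume Y[measurable]: "Y \<in> space ?Y"
      show "\<P>(y in ?F \<Otimes>\<^sub>M (?W \<Otimes>\<^sub>M ?N).
           P (zip_seq (zip_seq (X, zip_seq (fst (Y, y), fst (snd (Y, y)))), fst (snd (snd (Y, y)))), snd (snd (snd (Y, y)))))
        = \<P>(y in ?F \<Otimes>\<^sub>M (?E \<Otimes>\<^sub>M ?N).
           P (\<lambda>i. ((X i, fst (Y, y) i, fst (snd (Y, y)) i), \<lambda>j. fst (snd (snd (Y, y))) (g i j)), snd (snd (snd (Y, y)))))"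
      proof (rule prob_pair_cong_fst[OF ps(3)])
        show "prob_space (?W \<Otimes>\<^sub>M ?N)" "prob_space (?E \<Otimes>\<^sub>M ?N)"
          by (intro prob_space_pair ps N)+
        show "Measurable.pred (?F \<Otimes>\<^sub>M (?W \<Otimes>\<^sub>M ?N))
          (\<lambda>y. P (zip_seq (zip_seq (X, zip_seq (fst (Y, y), fst (snd (Y, y)))), fst (snd (snd (Y, y)))), snd (snd (snd (Y, y)))))"
          unfolding fst_conv snd_conv by measurable
        have "(\<lambda>y. (Y, y)) \<in> measurable (?F \<Otimes>\<^sub>M (?E \<Otimes>\<^sub>M ?N)) (?Y \<Otimes>\<^sub>M (?F \<Otimes>\<^sub>M (?E \<Otimes>\<^sub>M ?N)))"
          by (rule measurable_Pair1'[OF Y])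
        from measurable_compose[OF this m2]
        show "Measurable.pred (?F \<Otimes>\<^sub>M (?E \<Otimes>\<^sub>M ?N))
          (\<lambda>y. P (\<lambda>i. ((X i, fst (Y, y) i, fst (snd (Y, y)) i), \<lambda>j. fst (snd (snd (Y, y))) (g i j)), snd (snd (snd (Y, y)))))" .
        fix F assume F[measurable]: "F \<in> space ?F"
        have "Measurable.pred (?W \<Otimes>\<^sub>M ?N) (\<lambda>y. P (zip_seq (zip_seq (X, zip_seq (Y, F)), fst y), snd y))"
          by measurable
        from prob_rows_pair[OF failure_law N g this]
        show "\<P>(y in ?W \<Otimes>\<^sub>M ?N. P (zip_seq (zip_seq (X, zip_seq (fst (Y, F, y), fst (snd (Y, F, y)))), fst (snd (snd (Y, F, y)))), snd (snd (snd (Y, F, y)))))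
          = \<P>(y in ?E \<Otimes>\<^sub>M ?N. P (\<lambda>i. ((X i, fst (Y, F, y) i, fst (snd (Y, F, y)) i), \<lambda>j. fst (snd (snd (Y, F, y))) (g i j)), snd (snd (snd (Y, F, y)))))"
          by (simp add: zip_seq_def)
      qed
    qed
    finally show "\<P>(y in ?YF \<Otimes>\<^sub>M (?W \<Otimes>\<^sub>M ?N). P (zip_seq (zip_seq (fst (X, y), fst (snd (X, y))), fst (snd (snd (X, y)))), snd (snd (snd (X, y)))))
       = \<P>(y in ?Y \<Otimes>\<^sub>M (?F \<Otimes>\<^sub>M (?E \<Otimes>\<^sub>M ?N)).
         P (\<lambda>i. ((fst (X, y) i, fst (snd (X, y)) i, fst (snd (snd (X, y))) i), \<lambda>j. fst (snd (snd (snd (X, y)))) (g i j)), snd (snd (snd (snd (X, y))))))"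
      by simp
  qed
  also have "\<dots> = \<P>(\<omega> in sample_space n v q. P (marks g \<omega>, count \<omega>))"
    by (simp add: marks_def count_def sample_space_def case_prod_beta)
  finally show ?thesis ..
qed

text \<open>A positive \<open>k\<close> makes the value 0 for the empty set agree with the vacuous
  condition on the right.\<close>

lemma max_less_iff: "finite S \<Longrightarrow> 0 < k \<Longrightarrow> (if S = {} then 0 else Max (f ` S)) < (k::nat) \<longleftrightarrow> (\<forall>i\<in>S. f i < k)"
  by auto

context sector_params
begin

text \<open>Stated for an arbitrary number \<open>m\<close> of points, unrelated to the component
  \<open>N\<close> of the sample, so that it serves the binomial and the Poisson graph.\<close>

lemma max_out_less_iff:
  assumes k: "0 < k"
  shows "max_out_degree (faulty_sector_graph \<alpha> r m X Y F E) < k \<longleftrightarrow>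
    (\<forall>i<m. \<not> out.exc k {..<m} (marks Pair (X, Y, F, E, N)) i)"
proof -
  let ?G = "faulty_sector_graph \<alpha> r m X Y F E"
  have vs: "verts ?G = {i. i < m \<and> \<not> F i}" by (simp add: faulty_sector_graph_def)
  have deg: "out_degree ?G i = out.cnt ({..<m} - {i}) (marks Pair (X, Y, F, E, N) i) (marks Pair (X, Y, F, E, N))"
    if "i < m" "\<not> F i" for i
  proof -
    let ?S = "{j\<in>{..<m} - {i}. out.hit (marks Pair (X, Y, F, E, N) i) j (marks Pair (X, Y, F, E, N) j)}"
    have "out_arcs ?G i = Pair i ` ?S"
      using that by (auto simp: out_arcs_def faulty_sector_graph_def out.hit_def Rout_def ok_def marks_def)
    then show ?thesis by (simp add: out_degree_def out.cnt_def card_image inj_on_def)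
  qed
  have "max_out_degree ?G < k \<longleftrightarrow> (\<forall>i\<in>verts ?G. out_degree ?G i < k)"
    unfolding max_out_degree_def by (rule max_less_iff) (simp_all add: vs k)
  also have "\<dots> \<longleftrightarrow> (\<forall>i<m. \<not> out.exc k {..<m} (marks Pair (X, Y, F, E, N)) i)"
  proof -
    have "ok (fst (marks Pair (X, Y, F, E, N) i)) \<longleftrightarrow> \<not> F i" for i by (simp add: ok_def marks_def)
    then show ?thesis using deg by (auto simp: vs out.exc_def not_le)
  qed
  finally show ?thesis .
qed

lemma max_in_less_iff:
  assumes k: "0 < k"
  shows "max_in_degree (faulty_sector_graph \<alpha> r m X Y F E) < k \<longleftrightarrow>
    (\<forall>i<m. \<not> inn.exc k {..<m} (marks (\<lambda>i j. (j, i)) (X, Y, F, E, N)) i)"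
proof -
  let ?G = "faulty_sector_graph \<alpha> r m X Y F E" and ?M = "marks (\<lambda>i j. (j, i)) (X, Y, F, E, N)"
  have vs: "verts ?G = {i. i < m \<and> \<not> F i}" by (simp add: faulty_sector_graph_def)
  have deg: "in_degree ?G i = inn.cnt ({..<m} - {i}) (?M i) ?M"
    if "i < m" "\<not> F i" for i
  proof -
    let ?S = "{j\<in>{..<m} - {i}. inn.hit (?M i) j (?M j)}"
    have "in_arcs ?G i = (\<lambda>j. (j, i)) ` ?S"
      using that by (auto simp: in_arcs_def faulty_sector_graph_def inn.hit_def Rin_def ok_def marks_def)
    then show ?thesis by (simp add: in_degree_def inn.cnt_def card_image inj_on_def)
  qed
  have "max_in_degree ?G < k \<longleftrightarrow> (\<forall>i\<in>verts ?G. in_degree ?G i < k)"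
    unfolding max_in_degree_def by (rule max_less_iff) (simp_all add: vs k)
  also have "\<dots> \<longleftrightarrow> (\<forall>i<m. \<not> inn.exc k {..<m} ?M i)"
  proof -
    have "ok (fst (?M i)) \<longleftrightarrow> \<not> F i" for i by (simp add: ok_def marks_def)
    then show ?thesis using deg by (auto simp: vs inn.exc_def not_le)
  qed
  finally show ?thesis .
qed

end

section \<open>Poisson and binomial tails\<close>

definition ppmf :: "real \<Rightarrow> nat \<Rightarrow> real" where
  "ppmf \<mu> k = \<mu> ^ k / fact k * exp (- \<mu>)"

definition ptail :: "real \<Rightarrow> nat \<Rightarrow> real" where
  "ptail \<mu> k = measure_pmf.prob (poisson_pmf \<mu>) {j. k \<le> j}"

lemma ppmf_pos: "0 < \<mu> \<Longrightarrow> 0 < ppmf \<mu> k"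
  by (simp add: ppmf_def)

lemma ppmf_Suc: "ppmf \<mu> (Suc k) = ppmf \<mu> k * (\<mu> / real (Suc k))"
  by (simp add: ppmf_def field_simps)

lemma ptail_split: "0 < \<mu> \<Longrightarrow> ptail \<mu> k = ppmf \<mu> k + ptail \<mu> (Suc k)"
proof -
  assume \<mu>: "0 < \<mu>"
  have "{j. k \<le> j} = {k} \<union> {j. Suc k \<le> j}" by auto
  then have "ptail \<mu> k = measure_pmf.prob (poisson_pmf \<mu>) ({k} \<union> {j. Suc k \<le> j})" by (simp add: ptail_def)
  also have "\<dots> = measure_pmf.prob (poisson_pmf \<mu>) {k} + measure_pmf.prob (poisson_pmf \<mu>) {j. Suc k \<le> j}"
    by (rule measure_pmf.finite_measure_Union) auto
  finally show ?thesis using \<mu> by (simp add: ptail_def measure_pmf_single pmf_poisson ppmf_def)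
qed

lemma ptail_nonneg: "0 \<le> ptail \<mu> k" and ptail_le_1: "ptail \<mu> k \<le> 1"
  by (simp_all add: ptail_def)

lemma ppmf_le_ptail: "0 < \<mu> \<Longrightarrow> ppmf \<mu> k \<le> ptail \<mu> k"
  using ptail_split[of \<mu> k] ptail_nonneg[of \<mu> "Suc k"] by linarith

lemma ptail_pos: "0 < \<mu> \<Longrightarrow> 0 < ptail \<mu> k"
  using ppmf_le_ptail[of \<mu> k] ppmf_pos[of \<mu> k] by linarith

lemma ptail_antimono: "k \<le> l \<Longrightarrow> ptail \<mu> l \<le> ptail \<mu> k"
  unfolding ptail_def by (intro measure_pmf.finite_measure_mono) auto

lemma ptail_tendsto_0: "ptail \<mu> \<longlonglongrightarrow> 0"
proof -
  have I: "(\<Inter>k. {j :: nat. k \<le> j}) = {}"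
  proof (rule equals0I)
    fix x :: nat assume "x \<in> (\<Inter>k. {j. k \<le> j})"
    then have "x \<in> {j. Suc x \<le> j}" by (rule INT_D) simp
    then show False by simp
  qed
  have "(\<lambda>k. measure_pmf.prob (poisson_pmf \<mu>) {j. k \<le> j}) \<longlonglongrightarrow> measure_pmf.prob (poisson_pmf \<mu>) (\<Inter>k. {j. k \<le> j})"
    by (rule measure_pmf.finite_Lim_measure_decseq) (auto simp: decseq_def)
  from this[unfolded I measure_empty] show ?thesis by (simp only: ptail_def[symmetric])
qed

lemma ptail_sums: "0 < \<mu> \<Longrightarrow> (\<lambda>j. ppmf \<mu> (k + j)) sums ptail \<mu> k"
proof -
  assume \<mu>: "0 < \<mu>"
  have "(\<Sum>j<n. ppmf \<mu> (k + j)) = ptail \<mu> k - ptail \<mu> (k + n)" for n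
  proof (induction n)
    case (Suc n)
    then show ?case using ptail_split[OF \<mu>, of "k + n"] by simp
  qed simp
  moreover have "(\<lambda>n. ptail \<mu> k - ptail \<mu> (k + n)) \<longlonglongrightarrow> ptail \<mu> k - 0"
    using LIMSEQ_ignore_initial_segment[OF ptail_tendsto_0[of \<mu>], where k=k]
    by (intro tendsto_intros) (simp add: add.commute)
  ultimately show ?thesis by (simp add: sums_def)
qed

text \<open>The ratio of consecutive masses at \<open>k + j\<close> is at most the one at
  \<open>k\<close>, so the ratio passes to the tails termwise. With \<open>k\<close> much larger
  than \<mu> consecutive tails are far apart, which is what separates the values of
  \<open>f\<close>.\<close>

lemma ptail_Suc_le: "0 < \<mu> \<Longrightarrow> ptail \<mu> (Suc k) \<le> \<mu> / real (Suc k) * ptail \<mu> k"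
proof -
  assume \<mu>: "0 < \<mu>"
  have "ppmf \<mu> (Suc k + j) \<le> \<mu> / real (Suc k) * ppmf \<mu> (k + j)" for j
  proof -
    have "ppmf \<mu> (Suc k + j) = ppmf \<mu> (k + j) * (\<mu> / real (Suc (k + j)))"
      using ppmf_Suc[of \<mu> "k + j"] by simp
    also have "\<dots> \<le> ppmf \<mu> (k + j) * (\<mu> / real (Suc k))"
      using \<mu> ppmf_pos[OF \<mu>, of "k + j"] by (intro mult_left_mono divide_left_mono) auto
    finally show ?thesis by (simp add: mult.commute)
  qed
  from sums_le[OF this ptail_sums[OF \<mu>] sums_mult[OF ptail_sums[OF \<mu>]]] show ?thesis .
qed

lemma ptail_le_ppmf: "0 < \<mu> \<Longrightarrow> (1 - \<mu> / real (Suc k)) * ptail \<mu> k \<le> ppmf \<mu> k"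
  using ptail_split[of \<mu> k] ptail_Suc_le[of \<mu> k] by (simp add: algebra_simps)

text \<open>A crude form of Stirling's bound; the induction step rests on
  \<open>e \<le> (1 + 1/k)^(k + 1)\<close>.\<close>

lemma fact_le: "1 \<le> k \<Longrightarrow> fact k \<le> exp 1 * real k * (real k / exp 1) ^ k"
proof (induction k rule: dec_induct)
  case base
  then show ?case by simp
next
  case (step k)
  have k: "0 < real k" using step by simp
  have "1 / (real k + 1) \<le> ln (1 + 1 / real k)"
    using ln_one_minus_pos_upper_bound[of "1 / (real k + 1)"] k
    by (simp add: ln_div field_simps)
  then have "1 \<le> real (Suc k) * ln (1 + 1 / real k)" using k by (simp add: field_simps)
  then have "exp 1 \<le> exp (real (Suc k) * ln (1 + 1 / real k))" by simp
  also have "\<dots> = exp (ln (1 + 1 / real k)) ^ Suc k" by (rule exp_of_nat_mult)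
  also have "exp (ln (1 + 1 / real k)) = 1 + 1 / real k" using k by (intro exp_ln) (simp add: add_pos_pos)
  also have "1 + 1 / real k = real (Suc k) / real k" using k by (simp add: field_simps)
  finally have e: "exp 1 * real k ^ Suc k \<le> real (Suc k) ^ Suc k"
    using k by (simp add: power_divide field_simps del: power_Suc)
  have "fact (Suc k) \<le> real (Suc k) * (exp 1 * real k * (real k / exp 1) ^ k)"
    unfolding fact_Suc using step by (simp del: of_nat_Suc)
  also have "\<dots> = real (Suc k) * (exp 1 * real k ^ Suc k / exp 1 ^ k)"
    by (simp add: power_divide)
  also have "\<dots> \<le> real (Suc k) * (real (Suc k) ^ Suc k / exp 1 ^ k)"
    using e by (intro mult_left_mono divide_right_mono) auto
  also have "\<dots> = exp 1 * real (Suc k) * (real (Suc k) / exp 1) ^ Suc k"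
    by (simp add: power_divide)
  finally show ?case .
qed

text \<open>The left-hand side is the Chernoff bound for the Poisson tail at \<open>k\<close>. It
  exceeds the mass at \<open>k\<close> by a polynomial factor only, so bounds from exponential
  moments can be stated relative to the very tail with which they are compared.\<close>

lemma chernoff_le_ppmf:
  assumes k: "1 \<le> k" and \<mu>: "0 < \<mu>"
  shows "(\<mu> / real k) ^ k * exp (real k - \<mu>) \<le> exp 1 * real k * ppmf \<mu> k"
proof -
  have "(\<mu> / real k) ^ k * exp (real k - \<mu>) * fact k \<le> (\<mu> / real k) ^ k * exp (real k - \<mu>) * (exp 1 * real k * (real k / exp 1) ^ k)"
    using fact_le[OF k] \<mu> by (intro mult_left_mono) auto
  also have "\<dots> = exp 1 * real k * \<mu> ^ k * exp (- \<mu>)"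
  proof -
    have "exp 1 ^ k = exp (real k)" by (simp add: exp_of_nat_mult[symmetric])
    then show ?thesis using k \<mu> by (simp add: power_divide exp_diff exp_minus field_simps)
  qed
  finally have "(\<mu> / real k) ^ k * exp (real k - \<mu>) \<le> exp 1 * real k * \<mu> ^ k * exp (- \<mu>) / fact k"
    by (simp add: field_simps)
  then show ?thesis by (simp add: ppmf_def mult_ac)
qed

definition bpmf :: "nat \<Rightarrow> real \<Rightarrow> nat \<Rightarrow> real" where
  "bpmf N p a = real (N choose a) * p ^ a * (1 - p) ^ (N - a)"

lemma bpmf_nonneg: "0 \<le> p \<Longrightarrow> p \<le> 1 \<Longrightarrow> 0 \<le> bpmf N p a"
  by (simp add: bpmf_def)

lemma bpmf_Suc_Suc: "bpmf (Suc N) p (Suc a) = p * bpmf N p a + (1 - p) * bpmf N p (Suc a)"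
proof (cases "Suc a \<le> N")
  case True
  then have e: "(1 - p) ^ (N - a) = (1 - p) * (1 - p) ^ (N - Suc a)"
    by (metis Suc_diff_le diff_Suc_Suc power_Suc)
  show ?thesis unfolding bpmf_def binomial_Suc_Suc diff_Suc_Suc e by (simp add: algebra_simps)
next
  case False
  then show ?thesis by (simp add: bpmf_def binomial_eq_0)
qed

lemma btail_split: "btail N p a = bpmf N p a + btail N p (Suc a)"
proof (induction N arbitrary: a)
  case 0
  then show ?case by (cases a) (auto simp: bpmf_def)
next
  case (Suc N)
  show ?case
  proof (cases a)
    case 0
    have "btail (Suc N) p (Suc 0) = p + (1 - p) * btail N p (Suc 0)" by simp
    also have "btail N p (Suc 0) = 1 - (1 - p) ^ N" using Suc[of 0] by (simp add: bpmf_def)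
    finally show ?thesis using 0 by (simp add: bpmf_def algebra_simps)
  next
    case [simp]: (Suc b)
    show ?thesis using Suc.IH[of b] Suc.IH[of "Suc b"] by (simp add: bpmf_Suc_Suc algebra_simps)
  qed
qed

lemma btail_zero: "N < a \<Longrightarrow> btail N p a = 0"
proof (induction N arbitrary: a)
  case 0
  then show ?case by (cases a) auto
next
  case (Suc N)
  then show ?case by (cases a) auto
qed

lemma bpmf_ratio:
  assumes p: "0 \<le> p" "p < 1"
  shows "bpmf N p (Suc j) \<le> real N * p / ((1 - p) * real (Suc j)) * bpmf N p j"
proof (cases "j < N")
  case False
  then have "bpmf N p (Suc j) = 0" by (simp add: bpmf_def binomial_eq_0)
  moreover have "0 \<le> real N * p / ((1 - p) * real (Suc j)) * bpmf N p j"
    using p bpmf_nonneg[of p N j] by (intro mult_nonneg_nonneg divide_nonneg_nonneg) auto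
  ultimately show ?thesis by simp
next
  case True
  have "Suc j * (N choose Suc j) = (N - j) * (N choose j)"
    by (simp only: binomial_absorption binomial_absorb_comp)
  then have c: "real (Suc j) * real (N choose Suc j) = real (N - j) * real (N choose j)"
    by (metis of_nat_mult)
  have e: "(1 - p) ^ (N - j) = (1 - p) * (1 - p) ^ (N - Suc j)"
    using True by (metis Suc_diff_Suc power_Suc)
  have "real (Suc j) * (1 - p) * bpmf N p (Suc j) = (real (Suc j) * real (N choose Suc j)) * p ^ Suc j * ((1 - p) * (1 - p) ^ (N - Suc j))"
    by (simp add: bpmf_def)
  also have "\<dots> = real (N - j) * p * bpmf N p j"
    unfolding c e[symmetric] by (simp add: bpmf_def)
  also have "\<dots> \<le> real N * p * bpmf N p j"
    using p bpmf_nonneg[of p N j] by (intro mult_right_mono) auto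
  finally show ?thesis using p by (simp add: field_simps del: of_nat_Suc)
qed

text \<open>Downward induction, starting above \<open>N\<close>, where the tail vanishes: the bound
  on the ratio of consecutive masses decreases with the index, so the one at \<open>a\<close> holds
  at every later index and passes from masses to tails.\<close>

lemma btail_ratio:
  assumes p: "0 \<le> p" "p < 1" and \<rho>: "real N * p / ((1 - p) * real (Suc a)) \<le> \<rho>"
  shows "btail N p (Suc a) \<le> \<rho> * btail N p a"
proof -
  have "a \<le> b \<Longrightarrow> btail N p (Suc b) \<le> \<rho> * btail N p b" for b
  proof (induction "Suc N - b" arbitrary: b)
    case 0
    then have "N < b" by simp
    then show ?case by (simp add: btail_zero)
  next
    case (Suc d)
    have "bpmf N p (Suc b) \<le> real N * p / ((1 - p) * real (Suc b)) * bpmf N p b" using p by (rule bpmf_ratio)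
    also have "\<dots> \<le> real N * p / ((1 - p) * real (Suc a)) * bpmf N p b"
      using p Suc.prems bpmf_nonneg[of p N b] by (intro mult_right_mono divide_left_mono mult_left_mono) auto
    also have "\<dots> \<le> \<rho> * bpmf N p b" using \<rho> p bpmf_nonneg[of p N b] by (intro mult_right_mono) auto
    finally have 1: "bpmf N p (Suc b) \<le> \<rho> * bpmf N p b" .
    have 2: "btail N p (Suc (Suc b)) \<le> \<rho> * btail N p (Suc b)"
      using Suc by (intro Suc.hyps(1)) auto
    show ?case using 1 2 btail_split[of N p b] btail_split[of N p "Suc b"] by (simp add: algebra_simps)
  qed
  then show ?thesis by simp
qed

lemma btail_le_bpmf:
  assumes p: "0 \<le> p" "p < 1" and \<rho>: "real N * p / ((1 - p) * real (Suc a)) \<le> \<rho>"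
  shows "(1 - \<rho>) * btail N p a \<le> bpmf N p a"
  using btail_ratio[OF assms] btail_split[of N p a] by (simp add: algebra_simps)

lemma bpmf_le_btail: "0 \<le> p \<Longrightarrow> p \<le> 1 \<Longrightarrow> bpmf N p a \<le> btail N p a"
  using btail_split[of N p a] btail_nonneg[of p N "Suc a"] by linarith

text \<open>The binomial coefficient is at most \<open>N^a / a!\<close>, and
  \<open>1 - p \<le> exp (- p)\<close>. Replacing \<open>N\<close> by \<open>n\<close> costs
  \<open>\<theta> * a\<close> and \<open>\<theta> * \<mu>\<close> in the exponent, and the
  \<open>a\<close> successes missing from the power of \<open>1 - p\<close> cost
  \<open>(\<mu> / n) * a\<close>.\<close>

lemma bpmf_upper:
  assumes n: "0 < n" and \<mu>: "0 < \<mu>" "\<mu> \<le> real n" and N: "\<bar>real N - real n\<bar> \<le> \<theta> * real n" and \<theta>: "0 \<le> \<theta>"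
  shows "bpmf N (\<mu> / real n) a \<le> ppmf \<mu> a * exp (\<theta> * (real a + \<mu>) + \<mu> / real n * real a)"
proof (cases "a \<le> N")
  case False
  then have "bpmf N (\<mu> / real n) a = 0" by (simp add: bpmf_def binomial_eq_0)
  then show ?thesis using ppmf_pos[OF \<mu>(1), of a] by (simp add: less_imp_le)
next
  case True
  define p where "p = \<mu> / real n"
  have p: "0 \<le> p" "p \<le> 1" using \<mu> n by (auto simp: p_def)
  have "bpmf N p a \<le> (real N ^ a / fact a) * p ^ a * exp (- p) ^ (N - a)"
    unfolding bpmf_def
  proof (intro mult_mono power_mono)
    have "real ((N choose a) * fact a) \<le> real (N ^ a)"
      using binomial_fact_pow[of N a] by (simp only: of_nat_le_iff)
    then show "real (N choose a) \<le> real N ^ a / fact a" by (simp add: field_simps)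
    show "1 - p \<le> exp (- p)" using exp_ge_add_one_self[of "- p"] by simp
  qed (use p in auto)
  also have "exp (- p) ^ (N - a) = exp (- p * (real N - real a))"
    using True by (simp add: exp_of_nat_mult[symmetric] of_nat_diff mult.commute)
  also have "(real N ^ a / fact a) * p ^ a = (\<mu> ^ a / fact a) * (real N / real n) ^ a"
    by (simp add: p_def power_divide)
  also have "(\<mu> ^ a / fact a) * (real N / real n) ^ a * exp (- p * (real N - real a))
      \<le> (\<mu> ^ a / fact a) * exp \<theta> ^ a * exp (- \<mu> + \<theta> * \<mu> + p * real a)"
  proof (intro mult_mono power_mono mult_left_mono)
    have "real N / real n \<le> 1 + \<theta>" using N n by (simp add: field_simps abs_le_iff)
    also have "\<dots> \<le> exp \<theta>" by (rule exp_ge_add_one_self)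
    finally show "real N / real n \<le> exp \<theta>" .
    have "(1 - \<theta>) * real n \<le> real N" using N by (simp add: algebra_simps abs_le_iff)
    then have "p * ((1 - \<theta>) * real n) \<le> p * real N" using p by (intro mult_left_mono)
    then have "\<mu> - \<theta> * \<mu> \<le> p * real N" using n by (simp add: p_def algebra_simps)
    then show "exp (- p * (real N - real a)) \<le> exp (- \<mu> + \<theta> * \<mu> + p * real a)" by (simp add: algebra_simps)
  qed (use \<mu> in auto)
  also have "\<dots> = ppmf \<mu> a * exp (\<theta> * (real a + \<mu>) + \<mu> / real n * real a)"
    by (simp add: ppmf_def p_def exp_of_nat_mult[symmetric] exp_add[symmetric] algebra_simps)
  finally show ?thesis by (simp add: p_def)
qed

lemma binomial_lower: "a \<le> N \<Longrightarrow> real (N - a) ^ a \<le> real (N choose a) * fact a"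
proof (induction a)
  case (Suc a)
  have "real (N - Suc a) ^ Suc a \<le> real (N - a) ^ a * real (N - a)"
    using Suc.prems by (simp add: mult.commute) (intro mult_mono power_mono, auto)
  also have "\<dots> \<le> real (N choose a) * fact a * real (N - a)"
    using Suc by (intro mult_right_mono) auto
  also have "\<dots> = real ((N - a) * (N choose a)) * fact a" by simp
  also have "(N - a) * (N choose a) = Suc a * (N choose Suc a)"
    using Suc.prems by (metis binomial_absorb_comp binomial_absorption mult.commute Suc_times_binomial_eq)
  finally show ?case by (simp add: algebra_simps)
qed simp

text \<open>Bernoulli's inequality handles the falling factorial, and
  \<open>ln (1 - p) \<ge> - p - 2 * p^2\<close> the power of \<open>1 - p\<close>. Each loses a
  factor \<open>1 - \<tau>\<close>, whence \<open>1 - 2 * \<tau>\<close>.\<close>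

lemma bpmf_lower:
  assumes n: "0 < n" and \<mu>: "0 < \<mu>" "2 * \<mu> \<le> real n" and N: "\<bar>real N - real n\<bar> \<le> \<theta> * real n" and \<theta>: "0 \<le> \<theta>"
    and a: "\<theta> + real a / real n \<le> 1" and aN: "a \<le> N"
    and x: "real a * (\<theta> + real a / real n) \<le> \<tau>" and y: "\<theta> * \<mu> + 2 * (\<mu> / real n)\<^sup>2 * real N \<le> \<tau>" and \<tau>: "\<tau> \<le> 1"
  shows "ppmf \<mu> a * (1 - 2 * \<tau>) \<le> bpmf N (\<mu> / real n) a"
proof -
  define p where "p = \<mu> / real n"
  have p: "0 \<le> p" "p \<le> 1 / 2" using \<mu> n by (auto simp: p_def field_simps)
  have 1: "1 - \<tau> \<le> ((real N - real a) / real n) ^ a"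
  proof -
    have "1 - \<tau> \<le> 1 + real a * (- (\<theta> + real a / real n))" using x unfolding mult_minus_right by linarith
    also have "\<dots> \<le> (1 + (- (\<theta> + real a / real n))) ^ a" using a by (intro Bernoulli_inequality) simp
    also have "\<dots> \<le> ((real N - real a) / real n) ^ a"
    proof (rule power_mono)
      have "1 + - (\<theta> + real a / real n) = ((1 - \<theta>) * real n - real a) / real n" using n by (simp add: field_simps)
      also have "\<dots> \<le> (real N - real a) / real n"
        using N by (intro divide_right_mono) (auto simp: algebra_simps abs_le_iff)
      finally show "1 + - (\<theta> + real a / real n) \<le> (real N - real a) / real n" .
    qed (use a in simp)
    finally show ?thesis .
  qed
  have 2: "exp (- \<mu>) * (1 - \<tau>) \<le> (1 - p) ^ (N - a)"
  proof -
    have ln: "- p - 2 * p\<^sup>2 \<le> ln (1 - p)" using p by (intro ln_one_minus_pos_lower_bound) auto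
    have "p * real N \<le> \<mu> + \<theta> * \<mu>"
    proof -
      have "real N \<le> (1 + \<theta>) * real n" using N by (simp add: algebra_simps abs_le_iff)
      then have "p * real N \<le> p * ((1 + \<theta>) * real n)" using p by (intro mult_left_mono)
      then show ?thesis using n by (simp add: p_def algebra_simps)
    qed
    then have "- \<mu> - \<tau> \<le> real N * (- p - 2 * p\<^sup>2)" using y by (simp add: p_def algebra_simps)
    also have "\<dots> \<le> real N * ln (1 - p)" using ln by (intro mult_left_mono) auto
    finally have "exp (- \<mu> - \<tau>) \<le> exp (real N * ln (1 - p))" by simp
    also have "exp (real N * ln (1 - p)) = exp (ln (1 - p)) ^ N" by (rule exp_of_nat_mult)
    also have "exp (ln (1 - p)) = 1 - p" using p by (intro exp_ln) auto
    also have "(1 - p) ^ N \<le> (1 - p) ^ (N - a)" using p by (intro power_decreasing) auto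
    finally have "exp (- \<mu>) * exp (- \<tau>) \<le> (1 - p) ^ (N - a)" by (simp add: exp_add[symmetric])
    moreover have "exp (- \<mu>) * (1 - \<tau>) \<le> exp (- \<mu>) * exp (- \<tau>)"
      using exp_ge_add_one_self[of "- \<tau>"] by (intro mult_left_mono) auto
    ultimately show ?thesis by linarith
  qed
  have "ppmf \<mu> a * (1 - 2 * \<tau>) \<le> ppmf \<mu> a * ((1 - \<tau>) * (1 - \<tau>))"
    using ppmf_pos[OF \<mu>(1), of a] by (intro mult_left_mono) (auto simp: algebra_simps)
  also have "\<dots> = (\<mu> ^ a / fact a) * (1 - \<tau>) * (exp (- \<mu>) * (1 - \<tau>))" by (simp add: ppmf_def)
  also have "\<dots> \<le> (\<mu> ^ a / fact a) * ((real N - real a) / real n) ^ a * (1 - p) ^ (N - a)"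
    using 1 2 \<mu> \<tau> aN n by (intro mult_mono mult_left_mono mult_nonneg_nonneg) auto
  also have "\<dots> = (real (N - a) ^ a / fact a) * p ^ a * (1 - p) ^ (N - a)"
    using aN by (simp add: p_def power_divide of_nat_diff)
  also have "\<dots> \<le> real (N choose a) * p ^ a * (1 - p) ^ (N - a)"
    using binomial_lower[OF aN] p by (intro mult_right_mono) (auto simp: field_simps)
  finally show ?thesis by (simp add: bpmf_def p_def)
qed

text \<open>Here \<open>\<theta>\<close> bounds the relative deviation of the number of points from \<open>n\<close>, and \<open>\<tau>\<close> every
  relative error in the comparison of tails.\<close>

locale tail_params =
  fixes n k :: nat and \<mu> \<theta> \<tau> :: real
  assumes n: "0 < n" and \<mu>: "0 < \<mu>" "2 * \<mu> \<le> real n" and k: "4 \<le> k" and \<theta>: "0 \<le> \<theta>"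
    and \<tau>: "0 < \<tau>" "\<tau> \<le> 1 / 2"
    and H1: "16 * \<mu> \<le> \<tau> * real k" and H2: "4 * \<theta> * real k \<le> \<tau>" and H3: "4 * (real k)\<^sup>2 \<le> \<tau> * real n"
begin

lemma \<mu>_le: "32 * \<mu> \<le> real k"
  using H1 mult_right_mono[OF \<tau>(2), of "real k"] by linarith

lemma \<theta>_le: "\<theta> \<le> 1 / 32"
proof -
  have "\<theta> * 16 \<le> 4 * \<theta> * real k" using k \<theta> mult_left_mono[of 4 "real k" "4 * \<theta>"] by simp
  then show ?thesis using H2 \<tau> by linarith
qed

lemma k_sq_n: "(real k)\<^sup>2 / real n \<le> \<tau> / 4"
  using H3 n by (simp add: field_simps)

text \<open>Indices down to \<open>k - 2\<close> are included because the error terms use thresholds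
  lowered by up to two. Dividing by \<open>1 - \<tau>\<close> passes from mass to tail, and
  \<open>exp \<tau> / (1 - \<tau>) \<le> 1 + 6 * \<tau>\<close> for \<tau> up to 1/2.\<close>

lemma btail_upper:
  assumes N: "\<bar>real N - real n\<bar> \<le> \<theta> * real n" and a: "k - 2 \<le> a" "a \<le> k"
  shows "btail N (\<mu> / real n) a \<le> ppmf \<mu> a * (1 + 6 * \<tau>)"
proof -
  define p where "p = \<mu> / real n"
  have p: "0 \<le> p" "p \<le> 1 / 2" using \<mu> n by (auto simp: p_def field_simps)
  have ak: "real a \<le> real k" "real k \<le> 2 * real (Suc a)" using a k by auto
  have "real N * p \<le> 2 * \<mu>"
  proof -
    have "real N \<le> (1 + \<theta>) * real n" using N by (simp add: algebra_simps abs_le_iff)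
    also have "\<dots> \<le> 2 * real n" using \<theta>_le by (intro mult_right_mono) auto
    finally have "real N * p \<le> (2 * real n) * p" using p by (intro mult_right_mono)
    then show ?thesis using n by (simp add: p_def)
  qed
  moreover have "(1 / 2) * (real k / 2) \<le> (1 - p) * real (Suc a)"
    using p ak k by (intro mult_mono) auto
  ultimately have "real N * p / ((1 - p) * real (Suc a)) \<le> 2 * \<mu> / ((1 / 2) * (real k / 2))"
    using p k \<mu> by (intro frac_le) auto
  also have "\<dots> \<le> \<tau>" using H1 k \<mu> by (simp add: field_simps)
  finally have \<rho>: "real N * p / ((1 - p) * real (Suc a)) \<le> \<tau>" .
  have "(1 - \<tau>) * btail N p a \<le> bpmf N p a"
    using p by (intro btail_le_bpmf \<rho>) auto
  also have "\<dots> \<le> ppmf \<mu> a * exp (\<theta> * (real a + \<mu>) + \<mu> / real n * real a)"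
    unfolding p_def by (rule bpmf_upper) (use n \<mu> N \<theta> in auto)
  also have "\<dots> \<le> ppmf \<mu> a * exp \<tau>"
  proof -
    have "\<theta> * (real a + \<mu>) \<le> \<theta> * (2 * real k)" using \<theta> ak \<mu>_le k by (intro mult_left_mono) auto
    moreover have "\<mu> / real n * real a \<le> real k / real n * real k"
      using ak \<mu>_le n \<mu> by (intro mult_mono divide_right_mono) auto
    moreover have "real k / real n * real k = (real k)\<^sup>2 / real n" by (simp add: power2_eq_square)
    moreover have "\<theta> * (2 * real k) = (4 * \<theta> * real k) / 2" by simp
    ultimately have "\<theta> * (real a + \<mu>) + \<mu> / real n * real a \<le> \<tau>"
      using H2 k_sq_n \<tau> by linarith
    then show ?thesis using ppmf_pos[OF \<mu>(1), of a] by (intro mult_left_mono) auto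
  qed
  also have "\<dots> \<le> ppmf \<mu> a * (1 + \<tau> + \<tau>\<^sup>2)"
    using ppmf_pos[OF \<mu>(1), of a] \<tau> by (intro mult_left_mono exp_bound) auto
  also have "\<dots> \<le> ppmf \<mu> a * ((1 - \<tau>) * (1 + 6 * \<tau>))"
  proof -
    have "\<tau> * \<tau> \<le> \<tau> * (1 / 2)" using \<tau> by (intro mult_left_mono) auto
    moreover have "(1 - \<tau>) * (1 + 6 * \<tau>) = 1 + 5 * \<tau> - 6 * (\<tau> * \<tau>)" by (simp add: algebra_simps)
    ultimately have "1 + \<tau> + \<tau>\<^sup>2 \<le> (1 - \<tau>) * (1 + 6 * \<tau>)" using \<tau> unfolding power2_eq_square by linarith
    then show ?thesis using ppmf_pos[OF \<mu>(1), of a] by (intro mult_left_mono) auto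
  qed
  finally have "(1 - \<tau>) * btail N p a \<le> (1 - \<tau>) * (ppmf \<mu> a * (1 + 6 * \<tau>))" by (simp add: mult_ac)
  then show ?thesis using \<tau> by (simp add: p_def)
qed

lemma btail_lower:
  assumes N: "\<bar>real N - real n\<bar> \<le> \<theta> * real n"
  shows "ppmf \<mu> k * (1 - 2 * \<tau>) \<le> btail N (\<mu> / real n) k"
proof -
  have k1: "real k \<le> (real k)\<^sup>2" using k by (simp add: power2_eq_square)
  have kn: "real k / real n \<le> \<tau> / 4"
    using k_sq_n divide_right_mono[OF k1, of "real n"] by linarith
  have N1: "(31 / 32) * real n \<le> real N" "real N \<le> (33 / 32) * real n"
    using N mult_right_mono[OF \<theta>_le, of "real n"] by (auto simp: abs_le_iff)
  have "ppmf \<mu> k * (1 - 2 * \<tau>) \<le> bpmf N (\<mu> / real n) k"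
  proof (rule bpmf_lower[OF n \<mu> N \<theta>])
    show "\<theta> + real k / real n \<le> 1" using \<theta>_le kn \<tau> by linarith
    have "real k / real n \<le> 1 / 8" using kn \<tau> by linarith
    then have "real k \<le> (1 / 8) * real n" using n by (simp add: field_simps)
    then have "real k \<le> real N" using N1 by linarith
    then show "k \<le> N" by simp
    have "real k * (\<theta> + real k / real n) = \<theta> * real k + (real k)\<^sup>2 / real n"
      by (simp add: power2_eq_square algebra_simps)
    moreover have "\<theta> * real k = (4 * \<theta> * real k) / 4" by simp
    ultimately show "real k * (\<theta> + real k / real n) \<le> \<tau>" using H2 k_sq_n \<tau> by linarith
    have "\<theta> * \<mu> \<le> \<theta> * real k" using \<theta> \<mu>_le \<mu> by (intro mult_left_mono) auto
    also have "\<theta> * real k \<le> \<tau> / 4" using H2 by simp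
    finally have b1: "\<theta> * \<mu> \<le> \<tau> / 4" .
    have "2 * (\<mu> / real n)\<^sup>2 * real N \<le> 2 * (\<mu> / real n)\<^sup>2 * (2 * real n)"
      using N1 by (intro mult_left_mono) auto
    also have "\<dots> = 4 * (\<mu>\<^sup>2 / real n)"
      using n by (simp add: power2_eq_square field_simps)
    also have "\<dots> \<le> 4 * ((real k / 32)\<^sup>2 / real n)"
      using \<mu>_le \<mu> by (intro mult_left_mono divide_right_mono power_mono) auto
    also have "\<dots> = ((real k)\<^sup>2 / real n) / 256" by (simp add: power_divide)
    also have "\<dots> \<le> (real k)\<^sup>2 / real n"
    proof -
      have "y / 256 \<le> y" if "0 \<le> y" for y :: real using that by simp
      from this[of "(real k)\<^sup>2 / real n"] show ?thesis by simp
    qed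
    also have "\<dots> \<le> \<tau> / 4" by (rule k_sq_n)
    finally have b2: "2 * (\<mu> / real n)\<^sup>2 * real N \<le> \<tau> / 4" .
    show "\<theta> * \<mu> + 2 * (\<mu> / real n)\<^sup>2 * real N \<le> \<tau>"
      by (rule order_trans[OF add_mono[OF b1 b2]]) (use \<tau> in simp)
  qed (use \<tau> in auto)
  also have "\<dots> \<le> btail N (\<mu> / real n) k" using \<mu> n by (intro bpmf_le_btail) auto
  finally show ?thesis .
qed

lemma ptail_upper: "ptail \<mu> k \<le> ppmf \<mu> k * (1 + \<tau>)"
proof -
  have "\<mu> / real (Suc k) \<le> \<tau> / 16" using H1 \<mu> k \<tau> by (simp add: field_simps)
  then have "(1 - \<tau> / 16) * ptail \<mu> k \<le> (1 - \<mu> / real (Suc k)) * ptail \<mu> k"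
    using ptail_nonneg[of \<mu> k] by (intro mult_right_mono) auto
  also have "\<dots> \<le> ppmf \<mu> k" by (rule ptail_le_ppmf[OF \<mu>(1)])
  also have "\<dots> \<le> ppmf \<mu> k * ((1 - \<tau> / 16) * (1 + \<tau>))"
  proof -
    have "\<tau> * \<tau> \<le> \<tau> * (1 / 2)" using \<tau> by (intro mult_left_mono) auto
    then have "1 \<le> (1 - \<tau> / 16) * (1 + \<tau>)" using \<tau> by (simp add: algebra_simps)
    then show ?thesis using ppmf_pos[OF \<mu>(1), of k] by (simp add: mult_left_mono[of 1, simplified])
  qed
  finally have "(1 - \<tau> / 16) * ptail \<mu> k \<le> (1 - \<tau> / 16) * (ppmf \<mu> k * (1 + \<tau>))" by (simp add: mult_ac)
  then show ?thesis using \<tau> by simp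
qed

lemma ppmf_pred: "ppmf \<mu> (k - 1) = ppmf \<mu> k * (real k / \<mu>)"
  using ppmf_Suc[of \<mu> "k - 1"] k \<mu> by simp

lemma ppmf_pred2: "ppmf \<mu> (k - 2) \<le> ppmf \<mu> k * (real k / \<mu>)\<^sup>2"
proof -
  have "Suc (k - 2) = k - 1" using k by simp
  then have "ppmf \<mu> (k - 1) = ppmf \<mu> (k - 2) * (\<mu> / real (k - 1))" using ppmf_Suc[of \<mu> "k - 2"] by simp
  then have "ppmf \<mu> (k - 2) = ppmf \<mu> (k - 1) * (real (k - 1) / \<mu>)" using k \<mu> by simp
  also have "\<dots> \<le> ppmf \<mu> (k - 1) * (real k / \<mu>)"
    using ppmf_pos[OF \<mu>(1), of "k - 1"] \<mu> by (intro mult_left_mono divide_right_mono) auto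
  finally show ?thesis unfolding ppmf_pred power2_eq_square by (simp only: mult.assoc)
qed

text \<open>The identity \<open>2 (s - 1) + (1 - \<eta>) (s - 1)^2 = (s^2 - 1) - \<eta> (s -
  1)^2\<close> with \<open>s^2 = k / \<mu>\<close> shows that for \<eta> equal to 0 the joint bound
  is essentially the Chernoff bound for a single Poisson variable, as it must be for coinciding
  neighbourhoods. The remainder is the gain; \<open>M \<ge> \<mu> / 2\<close> and
  \<open>s - 1 \<ge> s / 2\<close> make it at least \<open>\<eta> * k / 8\<close>. The factor
  \<open>k / \<mu>\<close> comes from the threshold \<open>k - 1\<close>.\<close>

lemma chernoff_overlap:
  assumes M: "\<mu> / 2 \<le> M" "M \<le> (1 + \<theta>) * \<mu>" and \<eta>: "0 \<le> \<eta>" "\<eta> \<le> 1" and s: "s = sqrt (real k / \<mu>)"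
  shows "(1 / s) ^ (2 * (k - 1)) * exp (M * (2 * (s - 1) + (1 - \<eta>) * (s - 1)\<^sup>2))
    \<le> (real k / \<mu>) * (6 * real k) * exp (- (\<eta> * real k / 8)) * ppmf \<mu> k"
proof -
  have kp: "0 < real k" using k by simp
  have s2: "s\<^sup>2 = real k / \<mu>" using \<mu> by (simp add: s)
  have "4 \<le> real k / \<mu>" using \<mu>_le \<mu> by (simp add: field_simps)
  then have "2 \<le> s" unfolding s using real_le_rsqrt[of 2 "real k / \<mu>"] by simp
  have "(1 / s) ^ (2 * (k - 1)) = (\<mu> / real k) ^ (k - 1)"
    by (simp add: power_mult power_divide s2)
  also have "\<dots> = (real k / \<mu>) * (\<mu> / real k) ^ k"
    using k \<mu> by (cases k) auto
  finally have 1: "(1 / s) ^ (2 * (k - 1)) = (real k / \<mu>) * (\<mu> / real k) ^ k" .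
  have "2 * (s - 1) + (1 - \<eta>) * (s - 1)\<^sup>2 = (s\<^sup>2 - 1) - \<eta> * (s - 1)\<^sup>2"
    by (simp add: power2_eq_square algebra_simps)
  then have "M * (2 * (s - 1) + (1 - \<eta>) * (s - 1)\<^sup>2) = M * (s\<^sup>2 - 1) - M * (\<eta> * (s - 1)\<^sup>2)"
    by (simp add: algebra_simps)
  also have "\<dots> \<le> (real k - \<mu> + \<theta> * real k) - \<eta> * real k / 8"
  proof (rule diff_mono)
    have "M * (s\<^sup>2 - 1) \<le> (1 + \<theta>) * \<mu> * (real k / \<mu> - 1)"
      unfolding s2 using M \<mu>_le \<mu> by (intro mult_right_mono) (auto simp: field_simps)
    also have "\<dots> = (1 + \<theta>) * (real k - \<mu>)" using \<mu> by (simp add: field_simps)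
    also have "\<dots> \<le> real k - \<mu> + \<theta> * real k" using \<theta> \<mu> by (simp add: algebra_simps)
    finally show "M * (s\<^sup>2 - 1) \<le> real k - \<mu> + \<theta> * real k" .
    have "(s / 2)\<^sup>2 \<le> (s - 1)\<^sup>2" using \<open>2 \<le> s\<close> by (intro power_mono) auto
    then have "(\<mu> / 2) * (\<eta> * (real k / \<mu> / 4)) \<le> M * (\<eta> * (s - 1)\<^sup>2)"
      using M \<mu> \<eta> by (intro mult_mono mult_left_mono) (auto simp: power_divide s2)
    then show "\<eta> * real k / 8 \<le> M * (\<eta> * (s - 1)\<^sup>2)" using \<mu> by (simp add: field_simps)
  qed
  also have "\<dots> = (real k - \<mu>) + \<theta> * real k + (- (\<eta> * real k / 8))" by simp
  finally have "exp (M * (2 * (s - 1) + (1 - \<eta>) * (s - 1)\<^sup>2))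
      \<le> exp (real k - \<mu>) * exp (\<theta> * real k) * exp (- (\<eta> * real k / 8))"
    unfolding exp_add[symmetric] by simp
  also have "\<dots> \<le> exp (real k - \<mu>) * 2 * exp (- (\<eta> * real k / 8))"
  proof (intro mult_right_mono mult_left_mono)
    have "exp (\<theta> * real k) \<le> 1 + 2 * (\<theta> * real k)"
      using H2 \<tau> \<theta> by (intro real_exp_bound_lemma) auto
    then show "exp (\<theta> * real k) \<le> 2" using H2 \<tau> by simp
  qed auto
  finally have 2: "exp (M * (2 * (s - 1) + (1 - \<eta>) * (s - 1)\<^sup>2)) \<le> exp (real k - \<mu>) * 2 * exp (- (\<eta> * real k / 8))" .
  have "(1 / s) ^ (2 * (k - 1)) * exp (M * (2 * (s - 1) + (1 - \<eta>) * (s - 1)\<^sup>2))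
    \<le> ((real k / \<mu>) * (\<mu> / real k) ^ k) * (exp (real k - \<mu>) * 2 * exp (- (\<eta> * real k / 8)))"
    unfolding 1 using \<mu> by (intro mult_left_mono 2) auto
  also have "\<dots> = (real k / \<mu>) * 2 * exp (- (\<eta> * real k / 8)) * ((\<mu> / real k) ^ k * exp (real k - \<mu>))" by simp
  also have "\<dots> \<le> (real k / \<mu>) * 2 * exp (- (\<eta> * real k / 8)) * (exp 1 * real k * ppmf \<mu> k)"
    using k \<mu> by (intro mult_left_mono chernoff_le_ppmf) auto
  also have "\<dots> \<le> (real k / \<mu>) * 2 * exp (- (\<eta> * real k / 8)) * (3 * real k * ppmf \<mu> k)"
    using \<mu> exp_le ppmf_pos[OF \<mu>(1), of k] by (intro mult_left_mono mult_right_mono) auto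
  finally show ?thesis by (simp add: mult_ac)
qed

text \<open>For disjoint neighbourhoods the quadratic term drops out, so
  \<open>s = k / \<mu>\<close>, the optimal parameter for one vertex, is used, and the bound is the
  square of one for a single vertex. The power \<open>(k / \<mu>)^2\<close> inside the square covers
  thresholds down to \<open>k - 2\<close>.\<close>

lemma chernoff_disjoint:
  assumes M: "0 \<le> M" "M \<le> (1 + \<theta>) * \<mu>" and t: "t = k - 1 \<or> t = k - 2" and s: "s = real k / \<mu>"
  shows "(1 / s) ^ (2 * t) * exp (M * (2 * (s - 1) + (1 - 1) * (s - 1)\<^sup>2))
    \<le> ((real k / \<mu>)\<^sup>2 * (6 * real k) * ppmf \<mu> k)\<^sup>2"
proof -
  have s1: "1 \<le> s" using \<mu>_le \<mu> by (simp add: s field_simps)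
  have "(1 / s) ^ t \<le> s\<^sup>2 * (1 / s) ^ k"
  proof -
    have "(1 / s) ^ t \<le> (1 / s) ^ (k - 2)" using t s1 by (intro power_decreasing) auto
    also have "(1 / s) ^ k = (1 / s) ^ (k - 2) * (1 / s)\<^sup>2"
    proof -
      have "(1 / s) ^ (k - 2 + 2) = (1 / s) ^ (k - 2) * (1 / s)\<^sup>2" by (rule power_add)
      moreover have "k - 2 + 2 = k" using k by simp
      ultimately show ?thesis by (simp only:)
    qed
    then have "(1 / s) ^ (k - 2) = s\<^sup>2 * (1 / s) ^ k" using s1 by (simp add: power_divide)
    finally show ?thesis .
  qed
  then have 1: "(1 / s) ^ t \<le> (real k / \<mu>)\<^sup>2 * (\<mu> / real k) ^ k" by (simp add: s)
  have "M * (s - 1) \<le> (1 + \<theta>) * \<mu> * (s - 1)" using M s1 by (intro mult_right_mono) auto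
  also have "\<dots> = (1 + \<theta>) * (real k - \<mu>)" using \<mu> by (simp add: s field_simps)
  also have "\<dots> \<le> (real k - \<mu>) + \<theta> * real k" using \<theta> \<mu> by (simp add: algebra_simps)
  finally have "exp (M * (s - 1)) \<le> exp (real k - \<mu>) * exp (\<theta> * real k)" unfolding exp_add[symmetric] by simp
  also have "\<dots> \<le> exp (real k - \<mu>) * 2"
  proof (intro mult_left_mono)
    have "exp (\<theta> * real k) \<le> 1 + 2 * (\<theta> * real k)"
      using H2 \<tau> \<theta> by (intro real_exp_bound_lemma) auto
    then show "exp (\<theta> * real k) \<le> 2" using H2 \<tau> by simp
  qed auto
  finally have 2: "exp (M * (s - 1)) \<le> exp (real k - \<mu>) * 2" .
  have "(1 / s) ^ t * exp (M * (s - 1)) \<le> ((real k / \<mu>)\<^sup>2 * (\<mu> / real k) ^ k) * (exp (real k - \<mu>) * 2)"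
    using 1 2 s1 \<mu> by (intro mult_mono) auto
  also have "\<dots> = (real k / \<mu>)\<^sup>2 * 2 * ((\<mu> / real k) ^ k * exp (real k - \<mu>))" by simp
  also have "\<dots> \<le> (real k / \<mu>)\<^sup>2 * 2 * (exp 1 * real k * ppmf \<mu> k)"
    using k \<mu> by (intro mult_left_mono chernoff_le_ppmf) auto
  also have "\<dots> \<le> (real k / \<mu>)\<^sup>2 * 2 * (3 * real k * ppmf \<mu> k)"
    using exp_le ppmf_pos[OF \<mu>(1), of k] by (intro mult_left_mono mult_right_mono) auto
  finally have "(1 / s) ^ t * exp (M * (s - 1)) \<le> (real k / \<mu>)\<^sup>2 * (6 * real k) * ppmf \<mu> k" by (simp add: mult_ac)
  then have "((1 / s) ^ t * exp (M * (s - 1)))\<^sup>2 \<le> ((real k / \<mu>)\<^sup>2 * (6 * real k) * ppmf \<mu> k)\<^sup>2"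
    using s1 by (intro power_mono) auto
  moreover have "((1 / s) ^ t * exp (M * (s - 1)))\<^sup>2 = (1 / s) ^ (2 * t) * exp (M * (2 * (s - 1) + (1 - 1) * (s - 1)\<^sup>2))"
    by (simp add: power_mult_distrib power_mult[symmetric] exp_double[symmetric] mult_ac)
  ultimately show ?thesis by simp
qed

end

section \<open>Error bounds relative to the Poisson tail\<close>

context mark_model
begin

text \<open>All terms are expressed through \<open>M = m * r^2\<close>, the order of the number of
  points near a vertex, and \<open>x = k / \<mu>\<close>, the price of lowering a threshold by one.
  The constant \<open>D\<close> links \<open>n * r^2\<close> to \<mu>, so that \<open>M\<close> is
  at most of order \<open>D * \<mu>\<close> and powers of \<open>x\<close> cancel powers of \<mu> as
  far as possible. The bound is proportional to the mass at \<open>k\<close>, hence relative to the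
  probability of one exceedance.\<close>

lemma err_bound:
  assumes T: "tail_params n k \<mu> \<theta> \<tau>" and pn: "p = \<mu> / real n"
    and m: "\<bar>real m - real n\<bar> \<le> \<theta> * real n" and D: "0 \<le> D" "real n * r\<^sup>2 \<le> D * \<mu>"
    and c: "0 < c" "c \<le> 1" "c \<le> \<mu>" and \<eta>: "0 \<le> \<eta>" "\<eta> \<le> 1"
  shows "err m k \<eta> (sqrt (real k / \<mu>)) (real k / \<mu>)
    \<le> 4096 * (D + D\<^sup>2) / c ^ 3 * (\<eta>\<^sup>2 * real k + (real k)\<^sup>2 * exp (- (\<eta> * real k / 8)) + real k ^ 6 * (ppmf \<mu> k + 1 / real n)) * ppmf \<mu> k"
proof -
  interpret T: tail_params n k \<mu> \<theta> \<tau> by (rule T)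
  note \<mu> = T.\<mu>
  have n0: "0 < real n" using T.n by simp
  define K where "K = real k"
  define P where "P = ppmf \<mu> k"
  define x where "x = K / \<mu>"
  define e where "e = exp (- (\<eta> * K / 8))"
  define M where "M = real m * r\<^sup>2"
  define Mp where "Mp = real m * p"
  define b0 where "b0 = btail m p k"
  define b1 where "b1 = btail m p (k - 1)"
  define b2 where "b2 = btail m p (k - 2)"
  define J\<eta> where "J\<eta> = J m \<eta> (k - 1) (sqrt (real k / \<mu>))"
  define J1 where "J1 = J m 1 (k - 1) (real k / \<mu>)"
  define J2 where "J2 = J m 1 (k - 2) (real k / \<mu>)"
  have P0: "0 < P" unfolding P_def by (rule ppmf_pos[OF \<mu>(1)])
  have K1: "4 \<le> K" using T.k by (simp add: K_def)
  have \<mu>K: "\<mu> \<le> K" using T.\<mu>_le \<mu> by (simp add: K_def)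
  have x0: "0 \<le> x" and \<mu>x: "\<mu> * x = K" using \<mu> K1 by (auto simp: x_def)
  have e0: "0 < e" by (simp add: e_def)
  have s1: "1 \<le> sqrt (real k / \<mu>)" "1 \<le> real k / \<mu>" using \<mu>K \<mu> by (auto simp: K_def field_simps)
  have nn: "0 \<le> M" "0 \<le> Mp" "0 \<le> b0" "0 \<le> b1" "0 \<le> b2" "0 \<le> J\<eta>" "0 \<le> J1" "0 \<le> J2"
    unfolding M_def Mp_def b0_def b1_def b2_def J\<eta>_def J1_def J2_def
    using p01 by (auto intro: btail_nonneg J_nonneg s1)
  have m2: "real m \<le> (1 + \<theta>) * real n" "real n / 2 \<le> real m"
    using m mult_right_mono[OF T.\<theta>_le, of "real n"] by (auto simp: algebra_simps abs_le_iff)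
  have "(1 + \<theta>) * real n \<le> 2 * real n" using T.\<theta>_le n0 by (intro mult_right_mono) auto
  then have m3: "real m \<le> 2 * real n" using m2 by linarith
  have p0: "0 \<le> p" by (rule p01)
  have Mp1: "\<mu> / 2 \<le> Mp" "Mp \<le> (1 + \<theta>) * \<mu>"
    using mult_right_mono[OF m2(1) p0] mult_right_mono[OF m2(2) p0] n0 by (auto simp: Mp_def pn)
  have Mp2: "Mp \<le> 2 * \<mu>" using mult_right_mono[OF m3 p0] n0 by (simp add: Mp_def pn)
  have MD: "M \<le> 2 * D * \<mu>"
    using mult_right_mono[OF m3, of "r\<^sup>2"] D by (simp add: M_def)
  have rD: "r\<^sup>2 \<le> D * \<mu> / real n" using D n0 by (simp add: field_simps)
  have t4: "1 + 6 * \<tau> \<le> 4" using T.\<tau> by simp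
  have B0: "b0 \<le> 4 * P"
  proof -
    have "b0 \<le> P * (1 + 6 * \<tau>)" unfolding b0_def P_def pn by (rule T.btail_upper[OF m]) auto
    also have "\<dots> \<le> P * 4" using t4 P0 by (intro mult_left_mono) auto
    finally show ?thesis by simp
  qed
  have B1: "b1 \<le> 4 * x * P"
  proof -
    have "b1 \<le> ppmf \<mu> (k - 1) * (1 + 6 * \<tau>)" unfolding b1_def pn by (rule T.btail_upper[OF m]) (use T.k in auto)
    also have "\<dots> \<le> (P * x) * 4" unfolding T.ppmf_pred using t4 P0 x0 T.\<tau> mult_nonneg_nonneg[OF less_imp_le[OF P0] x0]
      by (intro mult_mono) (auto simp: P_def x_def K_def)
    finally show ?thesis by (simp add: mult_ac)
  qed
  have B2: "b2 \<le> 4 * x\<^sup>2 * P"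
  proof -
    have "b2 \<le> ppmf \<mu> (k - 2) * (1 + 6 * \<tau>)" unfolding b2_def pn by (rule T.btail_upper[OF m]) (use T.k in auto)
    also have "\<dots> \<le> (P * x\<^sup>2) * 4" using t4 P0 x0 T.ppmf_pred2 T.\<tau> ppmf_pos[OF \<mu>(1), of "k - 2"]
      by (intro mult_mono) (auto simp: P_def x_def K_def)
    finally show ?thesis by (simp add: mult_ac)
  qed
  have BJ: "J\<eta> \<le> x * (6 * K) * e * P"
    unfolding J\<eta>_def J_def Mp_def[symmetric] x_def K_def e_def P_def
    using T.chernoff_overlap[OF Mp1 \<eta> refl] by (simp add: Mp_def)
  have BJ1: "J1 \<le> 36 * K\<^sup>2 * x ^ 4 * P\<^sup>2" and BJ2: "J2 \<le> 36 * K\<^sup>2 * x ^ 4 * P\<^sup>2"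
  proof -
    have eq: "(x\<^sup>2 * (6 * K) * P)\<^sup>2 = 36 * K\<^sup>2 * x ^ 4 * P\<^sup>2"
      by (simp add: power2_eq_square power4_eq_xxxx)
    have "J1 \<le> (x\<^sup>2 * (6 * K) * P)\<^sup>2"
      unfolding J1_def J_def x_def K_def P_def
      using T.chernoff_disjoint[OF nn(2) Mp1(2), of "k - 1", OF _ refl] by (simp only: Mp_def refl simp_thms)
    then show "J1 \<le> 36 * K\<^sup>2 * x ^ 4 * P\<^sup>2" by (simp only: eq)
    have "J2 \<le> (x\<^sup>2 * (6 * K) * P)\<^sup>2"
      unfolding J2_def J_def x_def K_def P_def
      using T.chernoff_disjoint[OF nn(2) Mp1(2), of "k - 2", OF _ refl] by (simp only: Mp_def refl simp_thms)
    then show "J2 \<le> 36 * K\<^sup>2 * x ^ 4 * P\<^sup>2" by (simp only: eq)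
  qed
  have i1: "M * b1 \<le> 8 * D * K * P"
  proof -
    have "M * b1 \<le> (2 * D * \<mu>) * (4 * x * P)" using MD B1 nn D \<mu> by (intro mult_mono) auto
    also have "\<dots> = 8 * D * (\<mu> * x) * P" by simp
    finally show ?thesis unfolding \<mu>x .
  qed
  have i2: "M * J\<eta> \<le> 12 * D * K\<^sup>2 * e * P"
  proof -
    have "M * J\<eta> \<le> (2 * D * \<mu>) * (x * (6 * K) * e * P)" using MD BJ nn D \<mu> by (intro mult_mono) auto
    also have "\<dots> = 12 * D * ((\<mu> * x) * K) * e * P" by simp
    finally show ?thesis unfolding \<mu>x by (simp add: power2_eq_square)
  qed
  have i3: "M \<le> 2 * D * K" using MD mult_left_mono[OF \<mu>K, of "2 * D"] D by simp
  have i5: "r\<^sup>2 * b1 \<le> 4 * D * K * P / real n"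
  proof -
    have "r\<^sup>2 * b1 \<le> (D * \<mu> / real n) * (4 * x * P)" using rD B1 nn D \<mu> by (intro mult_mono) auto
    also have "\<dots> = 4 * D * (\<mu> * x) * P / real n" by simp
    finally show ?thesis unfolding \<mu>x .
  qed
  have MMp: "M * Mp \<le> 4 * D * \<mu>\<^sup>2"
  proof -
    have "M * Mp \<le> (2 * D * \<mu>) * (2 * \<mu>)" using MD Mp2 nn D \<mu> by (intro mult_mono) auto
    then show ?thesis by (simp add: power2_eq_square)
  qed
  have i6: "M * Mp * (r\<^sup>2 * b2) \<le> 16 * D\<^sup>2 * K ^ 3 * P / real n"
  proof -
    have "M * Mp * (r\<^sup>2 * b2) \<le> (4 * D * \<mu>\<^sup>2) * ((D * \<mu> / real n) * (4 * x\<^sup>2 * P))"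
      using rD B2 nn D \<mu> by (intro mult_mono[OF MMp] mult_mono[OF rD B2]) auto
    also have "\<dots> = 16 * D\<^sup>2 * \<mu> * (\<mu> * x)\<^sup>2 * P / real n" by (simp add: power2_eq_square)
    also have "\<dots> \<le> 16 * D\<^sup>2 * K * (\<mu> * x)\<^sup>2 * P / real n"
      using \<mu>K D P0 by (intro divide_right_mono mult_right_mono mult_left_mono) auto
    finally show ?thesis unfolding \<mu>x by (simp add: power2_eq_square power3_eq_cube)
  qed
  have c3: "c ^ 3 \<le> \<mu> ^ 3" "c ^ 3 \<le> \<mu>\<^sup>2"
  proof -
    show "c ^ 3 \<le> \<mu> ^ 3" using c by (intro power_mono) auto
    have "c ^ 3 \<le> c\<^sup>2" using c by (intro power_decreasing) auto
    also have "\<dots> \<le> \<mu>\<^sup>2" using c by (intro power_mono) auto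
    finally show "c ^ 3 \<le> \<mu>\<^sup>2" .
  qed
  have c3p: "0 < c ^ 3" using c by simp
  have x4: "x ^ 4 * \<mu> ^ 4 = K ^ 4" using \<mu>x by (metis mult.commute power_mult_distrib)
  \<comment> \<open>Four powers of \<open>x\<close> meet one power of \<mu>. The three missing
    powers are paid for by \<open>\<mu> \<ge> c\<close>, whence the division by
    \<open>c^3\<close>.\<close>
  have i7: "M * J1 \<le> 72 * D * K ^ 6 * P\<^sup>2 / c ^ 3"
  proof -
    have "M * J1 \<le> (2 * D * \<mu>) * (36 * K\<^sup>2 * x ^ 4 * P\<^sup>2)" using MD BJ1 nn D \<mu> by (intro mult_mono) auto
    also have "\<dots> = 72 * D * K\<^sup>2 * (x ^ 4 * \<mu> ^ 4) * P\<^sup>2 / \<mu> ^ 3"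
      using \<mu> by (simp add: power3_eq_cube power4_eq_xxxx field_simps)
    also have "\<dots> \<le> 72 * D * K\<^sup>2 * (x ^ 4 * \<mu> ^ 4) * P\<^sup>2 / c ^ 3"
      using c3 c3p D x0 by (intro divide_left_mono) (auto intro!: mult_nonneg_nonneg mult_pos_pos simp: \<mu>)
    finally show ?thesis unfolding x4 by (simp add: power_add[symmetric] mult.assoc)
  qed
  have i8: "M * Mp * J2 \<le> 144 * D * K ^ 6 * P\<^sup>2 / c ^ 3"
  proof -
    have "M * Mp * J2 \<le> (4 * D * \<mu>\<^sup>2) * (36 * K\<^sup>2 * x ^ 4 * P\<^sup>2)" using nn D \<mu> by (intro mult_mono[OF MMp BJ2]) auto
    also have "\<dots> = 144 * D * K\<^sup>2 * (x ^ 4 * \<mu> ^ 4) * P\<^sup>2 / \<mu>\<^sup>2"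
      using \<mu> by (simp add: power2_eq_square power4_eq_xxxx field_simps)
    also have "\<dots> \<le> 144 * D * K\<^sup>2 * (x ^ 4 * \<mu> ^ 4) * P\<^sup>2 / c ^ 3"
      using c3 c3p D x0 by (intro divide_left_mono) (auto intro!: mult_nonneg_nonneg mult_pos_pos simp: \<mu>)
    finally show ?thesis unfolding x4 by (simp add: power_add[symmetric] mult.assoc)
  qed
  have i9: "M * Mp * b1\<^sup>2 \<le> 64 * D * K\<^sup>2 * P\<^sup>2"
  proof -
    have "M * Mp * b1\<^sup>2 \<le> (4 * D * \<mu>\<^sup>2) * (4 * x * P)\<^sup>2" using nn D \<mu> by (intro mult_mono[OF MMp] power_mono[OF B1]) auto
    also have "\<dots> = 64 * D * (\<mu> * x)\<^sup>2 * P\<^sup>2" by (simp add: power2_eq_square)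
    finally show ?thesis unfolding \<mu>x .
  qed
  have j3: "b0 * (M * b1) \<le> 32 * D * K * P\<^sup>2"
  proof -
    have "b0 * (M * b1) \<le> (4 * P) * (8 * D * K * P)" using nn P0 by (intro mult_mono[OF B0 i1]) auto
    then show ?thesis by (simp add: power2_eq_square mult_ac)
  qed
  have j4: "M * (r\<^sup>2 * b1) \<le> 8 * D\<^sup>2 * K\<^sup>2 * P / real n"
  proof -
    have "M * (r\<^sup>2 * b1) \<le> (2 * D * K) * (4 * D * K * P / real n)" using nn D K1 by (intro mult_mono[OF i3 i5]) auto
    then show ?thesis by (simp add: power2_eq_square mult_ac)
  qed
  have j6: "M * b0\<^sup>2 \<le> 32 * D * K * P\<^sup>2"
  proof -
    have "M * b0\<^sup>2 \<le> (2 * D * K) * (4 * P)\<^sup>2" using nn D K1 by (intro mult_mono[OF i3 power_mono[OF B0]]) auto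
    then show ?thesis by (simp add: power2_eq_square mult_ac)
  qed
  have "err m k \<eta> (sqrt (real k / \<mu>)) (real k / \<mu>)
    = 512 * \<eta>\<^sup>2 * (M * b1) + 32 * (M * J\<eta>) + 8 * (b0 * (M * b1)) + 64 * (M * (r\<^sup>2 * b1)) + 4 * (M * J1)
      + 16 * (M * b0\<^sup>2) + 64 * (M * Mp * (r\<^sup>2 * b2)) + 4 * (M * Mp * J2) + 4 * (M * Mp * b1\<^sup>2)"
    unfolding err_def b0_def[symmetric] b1_def[symmetric] b2_def[symmetric] J\<eta>_def[symmetric] J1_def[symmetric] J2_def[symmetric]
      M_def Mp_def by (simp add: power2_eq_square algebra_simps)
  also have "\<dots> \<le> 512 * \<eta>\<^sup>2 * (8 * D * K * P) + 32 * (12 * D * K\<^sup>2 * e * P) + 8 * (32 * D * K * P\<^sup>2) + 64 * (8 * D\<^sup>2 * K\<^sup>2 * P / real n)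
      + 4 * (72 * D * K ^ 6 * P\<^sup>2 / c ^ 3) + 16 * (32 * D * K * P\<^sup>2) + 64 * (16 * D\<^sup>2 * K ^ 3 * P / real n)
      + 4 * (144 * D * K ^ 6 * P\<^sup>2 / c ^ 3) + 4 * (64 * D * K\<^sup>2 * P\<^sup>2)"
    by (intro add_mono mult_left_mono i1 i2 j3 j4 i7 j6 i6 i8 i9) auto
  \<comment> \<open>The coefficient \<open>512 * 8 = 4096\<close> of the term with
    \<open>\<eta>^2\<close> is taken for all terms; the others have smaller ones. The factor
    \<open>K^6\<close> dominates the powers of \<open>K\<close> in all terms that carry a second
    mass or a division by \<open>n\<close>.\<close>
  also have "\<dots> \<le> 4096 * (D + D\<^sup>2) / c ^ 3 * (\<eta>\<^sup>2 * K + K\<^sup>2 * e + K ^ 6 * (P + 1 / real n)) * P"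
  proof -
    define C where "C = (D + D\<^sup>2) / c ^ 3"
    have c31: "c ^ 3 \<le> 1" using c by (simp add: power_le_one)
    have DC: "D \<le> C" "D\<^sup>2 \<le> C" "D / c ^ 3 \<le> C"
    proof -
      have "(D + D\<^sup>2) * c ^ 3 \<le> (D + D\<^sup>2) * 1" using c31 D by (intro mult_left_mono) auto
      then have "D + D\<^sup>2 \<le> C" unfolding C_def using c3p by (simp add: pos_le_divide_eq)
      then show "D \<le> C" "D\<^sup>2 \<le> C" using D zero_le_power2[of D] by linarith+
      show "D / c ^ 3 \<le> C" unfolding C_def using c3p by (intro divide_right_mono) auto
    qed
    have C0: "0 \<le> C" using DC D by linarith
    have Kp: "K \<le> K ^ 6" "K\<^sup>2 \<le> K ^ 6" "K ^ 3 \<le> K ^ 6"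
      using K1 power_increasing[of 1 6 K] by (auto intro: power_increasing)
    have q1: "512 * \<eta>\<^sup>2 * (8 * D * K * P) \<le> 4096 * C * (\<eta>\<^sup>2 * K) * P"
    proof -
      have "D * (\<eta>\<^sup>2 * K * P) \<le> C * (\<eta>\<^sup>2 * K * P)" using DC K1 P0 by (intro mult_right_mono) auto
      then show ?thesis by (simp add: mult_ac)
    qed
    have q2: "32 * (12 * D * K\<^sup>2 * e * P) \<le> 4096 * C * (K\<^sup>2 * e) * P"
    proof -
      have "384 * D * (K\<^sup>2 * e * P) \<le> 4096 * C * (K\<^sup>2 * e * P)" using DC C0 D e0 P0 by (intro mult_right_mono) auto
      then show ?thesis by (simp add: mult_ac)
    qed
    have q3: "8 * (32 * D * K * P\<^sup>2) + 16 * (32 * D * K * P\<^sup>2) + 4 * (64 * D * K\<^sup>2 * P\<^sup>2) \<le> 1024 * (C * (K ^ 6 * P\<^sup>2))"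
    proof -
      have "D * (K * P\<^sup>2) \<le> C * (K ^ 6 * P\<^sup>2)" "D * (K\<^sup>2 * P\<^sup>2) \<le> C * (K ^ 6 * P\<^sup>2)"
        using DC C0 Kp K1 by (auto intro!: mult_mono mult_right_mono)
      then show ?thesis by (simp add: mult_ac)
    qed
    have q4: "4 * (72 * D * K ^ 6 * P\<^sup>2 / c ^ 3) + 4 * (144 * D * K ^ 6 * P\<^sup>2 / c ^ 3) \<le> 864 * (C * (K ^ 6 * P\<^sup>2))"
    proof -
      have "864 * (D / c ^ 3 * (K ^ 6 * P\<^sup>2)) \<le> 864 * (C * (K ^ 6 * P\<^sup>2))" using DC K1 by (intro mult_right_mono mult_left_mono) auto
      then show ?thesis by (simp add: mult_ac)
    qed
    have lin: "a \<le> c \<Longrightarrow> b \<le> c \<Longrightarrow> 512 * a + 1024 * b \<le> 1536 * c" for a b c :: real by linarith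
    have q5: "64 * (8 * D\<^sup>2 * K\<^sup>2 * P / real n) + 64 * (16 * D\<^sup>2 * K ^ 3 * P / real n) \<le> 1536 * (C * (K ^ 6 * (P / real n)))"
    proof -
      have "D\<^sup>2 * (K\<^sup>2 * (P / real n)) \<le> C * (K ^ 6 * (P / real n))" "D\<^sup>2 * (K ^ 3 * (P / real n)) \<le> C * (K ^ 6 * (P / real n))"
        using DC C0 Kp K1 P0 n0 by (auto intro!: mult_mono mult_right_mono divide_right_mono)
      then have "512 * (D\<^sup>2 * (K\<^sup>2 * (P / real n))) + 1024 * (D\<^sup>2 * (K ^ 3 * (P / real n))) \<le> 1536 * (C * (K ^ 6 * (P / real n)))"
        using lin by blast
      then show ?thesis by (simp add: mult_ac)
    qed
    have nn2: "0 \<le> C * (K ^ 6 * P\<^sup>2)" "0 \<le> C * (K ^ 6 * (P / real n))" using C0 K1 P0 n0 by auto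
    have "4096 * (D + D\<^sup>2) / c ^ 3 * (\<eta>\<^sup>2 * K + K\<^sup>2 * e + K ^ 6 * (P + 1 / real n)) * P
      = 4096 * C * (\<eta>\<^sup>2 * K) * P + 4096 * C * (K\<^sup>2 * e) * P + 4096 * (C * (K ^ 6 * P\<^sup>2)) + 4096 * (C * (K ^ 6 * (P / real n)))"
    proof -
      have "4096 * (D + D\<^sup>2) / c ^ 3 = 4096 * C" by (simp add: C_def)
      then show ?thesis by (simp add: power2_eq_square algebra_simps)
    qed
    moreover have "a + b + c1 + e1 + d1 + c2 + e2 + d2 + c3 \<le> a' + b' + 4096 * s + 4096 * u"
      if "a \<le> a'" "b \<le> b'" "c1 + c2 + c3 \<le> 1024 * s" "d1 + d2 \<le> 864 * s" "e1 + e2 \<le> 1536 * u" "0 \<le> s" "0 \<le> u"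
      for a b c1 e1 d1 c2 e2 d2 c3 a' b' s u :: real
      using that by linarith
    note this[OF q1 q2 q3 q4 q5 nn2]
    ultimately show ?thesis by (simp only:)
  qed
  finally show ?thesis unfolding K_def P_def e_def .
qed

text \<open>The target exceedance probability is \<open>w * ptail \<mu> k\<close>: survival of the
  vertex times the Poisson tail, boundary effects ignored. Marginal probabilities agree with it up
  to a relative error \<open>6 * \<tau>\<close>, and \<open>err\<close> is measured in units of it,
  which produces the division by \<open>w\<close>.\<close>

theorem main_bound:
  assumes T: "tail_params n k \<mu> \<theta> \<tau>" and pn: "p = \<mu> / real n"
    and m: "\<bar>real m - real n\<bar> + 1 \<le> \<theta> * real n" and D: "0 \<le> D" "real n * r\<^sup>2 \<le> D * \<mu>"
    and c: "0 < c" "c \<le> 1" "c \<le> \<mu>" and \<eta>: "0 \<le> \<eta>" "\<eta> \<le> 1"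
    and w: "w = \<P>(z in K. ok z)" "0 < w" and \<phi>m: "Measurable.pred K \<phi>"
    and \<phi>: "\<And>z. z \<in> space K \<Longrightarrow> \<phi> z \<Longrightarrow> \<P>(b in K. R z b) = p0"
    and int: "w * (1 - 4 * r) \<le> \<P>(z in K. ok z \<and> \<phi> z)" and r4: "4 * r \<le> \<tau>"
  shows "\<bar>\<P>(Z in Om. \<forall>i<m. \<not> exc k {..<m} Z i) - (1 - w * ptail \<mu> k) ^ m\<bar>
    \<le> 6 * \<tau> + 4096 * (D + D\<^sup>2) / c ^ 3 / w * (\<eta>\<^sup>2 * real k + (real k)\<^sup>2 * exp (- (\<eta> * real k / 8)) + real k ^ 6 * (ptail \<mu> k + 1 / real n))"
proof -
  interpret T: tail_params n k \<mu> \<theta> \<tau> by (rule T)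
  interpret K: prob_space K by (rule K)
  note \<mu> = T.\<mu>
  have m': "\<bar>real m - real n\<bar> \<le> \<theta> * real n" and m1: "\<bar>real (m - 1) - real n\<bar> \<le> \<theta> * real n" if "0 < m"
    using m that by (auto simp: of_nat_diff abs_le_iff)
  have mm: "\<bar>real m - real n\<bar> \<le> \<theta> * real n" using m by linarith
  have \<xi>: "0 < ptail \<mu> k" "ptail \<mu> k \<le> 1" using ptail_pos[OF \<mu>(1)] ptail_le_1 by auto
  have w1: "w \<le> 1" unfolding w by simp
  define P where "P = ppmf \<mu> k"
  have P0: "0 < P" unfolding P_def by (rule ppmf_pos[OF \<mu>(1)])
  have P\<xi>: "P \<le> ptail \<mu> k" unfolding P_def by (rule ppmf_le_ptail[OF \<mu>(1)])
  have \<xi>P: "ptail \<mu> k \<le> P * (1 + \<tau>)" unfolding P_def by (rule T.ptail_upper)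
  define C where "C = 4096 * (D + D\<^sup>2) / c ^ 3"
  have C0: "0 \<le> C" unfolding C_def using c D by simp
  define E where "E = \<eta>\<^sup>2 * real k + (real k)\<^sup>2 * exp (- (\<eta> * real k / 8)) + real k ^ 6 * (ptail \<mu> k + 1 / real n)"
  have E0: "0 \<le> E" unfolding E_def using \<xi> by (auto intro!: add_nonneg_nonneg)
  have "\<bar>\<P>(Z in Om. \<forall>i<m. \<not> exc k {..<m} Z i) - (1 - w * ptail \<mu> k) ^ m\<bar> \<le> 6 * \<tau> + C / w * E"
  proof (rule no_exc_approx)
    show "0 \<le> w * ptail \<mu> k" "w * ptail \<mu> k \<le> 1" using w \<xi> w1 by (auto intro: mult_le_one)
    have "1 \<le> real k / \<mu>" using T.\<mu>_le \<mu> by (simp add: field_simps)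
    then show "1 \<le> sqrt (real k / \<mu>)" "1 \<le> real k / \<mu>" by auto
    show "0 \<le> \<eta>" "\<eta> \<le> 1" by (rule \<eta>)+
    show "0 \<le> 6 * \<tau>" "0 \<le> C / w * E" using T.\<tau> C0 w E0 by auto
    have "err m k \<eta> (sqrt (real k / \<mu>)) (real k / \<mu>) \<le> C * (\<eta>\<^sup>2 * real k + (real k)\<^sup>2 * exp (- (\<eta> * real k / 8)) + real k ^ 6 * (P + 1 / real n)) * P"
      unfolding C_def P_def by (rule err_bound[OF T pn mm D c \<eta>])
    also have "\<dots> \<le> C * E * ptail \<mu> k"
      unfolding E_def using C0 P\<xi> P0 \<xi>
      by (intro mult_mono mult_left_mono add_mono) (auto intro!: mult_nonneg_nonneg add_nonneg_nonneg)
    also have "\<dots> = C / w * E * (w * ptail \<mu> k)" using w by simp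
    finally show "err m k \<eta> (sqrt (real k / \<mu>)) (real k / \<mu>) \<le> C / w * E * (w * ptail \<mu> k)" .
    fix i assume i: "i < m"
    have u: "\<P>(Z in Om. exc k {..<m} Z i) \<le> (1 + 6 * \<tau>) * (w * ptail \<mu> k)"
    proof -
      have "\<P>(Z in Om. exc k {..<m} Z i) \<le> btail m p k * w"
        unfolding w by (rule exc_prob_upper[OF i])
      also have "\<dots> \<le> (P * (1 + 6 * \<tau>)) * w"
        unfolding pn P_def using T.btail_upper[OF mm, of k] w by (intro mult_right_mono) auto
      also have "\<dots> \<le> (ptail \<mu> k * (1 + 6 * \<tau>)) * w"
        using P\<xi> T.\<tau> w by (intro mult_right_mono) auto
      finally show ?thesis by (simp add: mult_ac)
    qed
    have l: "(1 - 6 * \<tau>) * (w * ptail \<mu> k) \<le> \<P>(Z in Om. exc k {..<m} Z i)"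
    proof (cases "6 * \<tau> \<le> 1")
      case False
      then have "(1 - 6 * \<tau>) * (w * ptail \<mu> k) \<le> 0" using w \<xi> by (intro mult_nonpos_nonneg) auto
      then show ?thesis using measure_nonneg order_trans by blast
    next
      case True
      \<comment> \<open>Three losses are combined: \<open>1 - 2 * \<tau>\<close> from Poisson to
        binomial mass, \<open>1 - \<tau>\<close> from the boundary strip, and
        \<open>1 + \<tau>\<close> from Poisson mass to Poisson tail.\<close>
      have "(1 - 6 * \<tau>) * (1 + \<tau>) \<le> (1 - 2 * \<tau>) * (1 - \<tau>)"
        using T.\<tau> by (simp add: algebra_simps)
      then have "(1 - 6 * \<tau>) * (1 + \<tau>) * (P * w) \<le> (1 - 2 * \<tau>) * (1 - \<tau>) * (P * w)"
        using P0 w by (intro mult_right_mono) auto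
      moreover have "(1 - 6 * \<tau>) * w * ptail \<mu> k \<le> (1 - 6 * \<tau>) * w * (P * (1 + \<tau>))"
        using True w \<xi>P by (intro mult_left_mono) auto
      ultimately have "(1 - 6 * \<tau>) * (w * ptail \<mu> k) \<le> (P * (1 - 2 * \<tau>)) * (w * (1 - \<tau>))" by (simp add: mult_ac)
      also have "\<dots> \<le> btail (m - 1) p k * \<P>(z in K. ok z \<and> \<phi> z)"
      proof (rule mult_mono)
        show "P * (1 - 2 * \<tau>) \<le> btail (m - 1) p k"
          unfolding pn P_def using i by (intro T.btail_lower m1) auto
        have "w * (1 - \<tau>) \<le> w * (1 - 4 * r)" using r4 w(2) by (intro mult_left_mono) auto
        then show "w * (1 - \<tau>) \<le> \<P>(z in K. ok z \<and> \<phi> z)" using int by (rule order_trans)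
      qed (use p01 w True T.\<tau> in \<open>auto intro: btail_nonneg\<close>)
      also have "\<dots> \<le> \<P>(Z in Om. exc k {..<m} Z i)"
        by (rule exc_prob_lower[OF i \<phi>m \<phi>])
      finally show ?thesis .
    qed
    show "\<bar>\<P>(Z in Om. exc k {..<m} Z i) - w * ptail \<mu> k\<bar> \<le> 6 * \<tau> * (w * ptail \<mu> k)"
      using u l by (simp add: abs_le_iff algebra_simps)
  qed
  then show ?thesis unfolding C_def E_def .
qed

end

lemma mult_exp_neg_le_1: "y * exp (- y) \<le> (1 :: real)"
proof -
  have "y \<le> exp y" using exp_ge_add_one_self[of y] by linarith
  then have "y * exp (- y) \<le> exp y * exp (- y)" by (intro mult_right_mono) auto
  then show ?thesis by (simp add: exp_minus_inverse)
qed

text \<open>The error is absolute and uniform in \<open>n * x\<close>, however large: a relative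
  error in the exponent \<open>y = m * x\<close> enters multiplied by \<open>y * exp (- y)\<close>,
  which is at most 1.\<close>

lemma pow_exp_approx:
  fixes x \<theta> :: real
  assumes x: "0 \<le> x" "x \<le> 1 / 2" and mn: "\<bar>real m - real n\<bar> \<le> \<theta> * real n" and \<theta>0: "0 \<le> \<theta>" and \<theta>: "\<theta> \<le> 1 / 2"
  shows "\<bar>(1 - x) ^ m - exp (- (real n * x))\<bar> \<le> 2 * x + 2 * \<theta>"
proof -
  have e: "exp (real m * ln (1 - x)) = (1 - x) ^ m"
    unfolding exp_of_nat_mult using x by simp
  have up: "(1 - x) ^ m \<le> exp (- (real m * x))"
  proof -
    have "(1 - x) ^ m \<le> exp (- x) ^ m" using x exp_ge_add_one_self[of "- x"] by (intro power_mono) auto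
    also have "\<dots> = exp (real m * (- x))" by (rule exp_of_nat_mult[symmetric])
    finally show ?thesis by simp
  qed
  have lo: "exp (- (real m * x)) - 2 * x \<le> (1 - x) ^ m"
  proof -
    have "- x - 2 * x\<^sup>2 \<le> ln (1 - x)" using x by (intro ln_one_minus_pos_lower_bound) auto
    then have "real m * (- x - 2 * x\<^sup>2) \<le> real m * ln (1 - x)" by (intro mult_left_mono) auto
    then have "exp (- (real m * x) + (- (2 * x * (real m * x)))) \<le> (1 - x) ^ m"
      unfolding e[symmetric] by (simp add: algebra_simps power2_eq_square)
    moreover have "exp (- (real m * x)) * (1 - 2 * x * (real m * x)) \<le> exp (- (real m * x)) * exp (- (2 * x * (real m * x)))"
      using exp_ge_add_one_self[of "- (2 * x * (real m * x))"] by (intro mult_left_mono) auto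
    moreover have "2 * x * ((real m * x) * exp (- (real m * x))) \<le> 2 * x * 1"
      using x mult_exp_neg_le_1 by (intro mult_left_mono) auto
    ultimately show ?thesis unfolding exp_add by (simp add: algebra_simps)
  qed
  have mono: "exp (- a) - exp (- b) \<le> 2 * \<theta>" "exp (- b) \<le> exp (- a)"
    if ab: "a \<le> b" "b - a \<le> 2 * \<theta> * a" "0 \<le> \<theta>" for a b :: real
  proof -
    have "1 - (b - a) \<le> exp (a - b)" using exp_ge_add_one_self[of "a - b"] by linarith
    then have "exp (- a) * (1 - (b - a)) \<le> exp (- a) * exp (a - b)" by (intro mult_left_mono) auto
    also have "\<dots> = exp (- b)" by (simp add: exp_add[symmetric])
    finally have "exp (- a) - exp (- b) \<le> exp (- a) * (b - a)" by (simp add: algebra_simps)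
    also have "\<dots> \<le> exp (- a) * (2 * \<theta> * a)" using ab by (intro mult_left_mono) auto
    also have "\<dots> = 2 * \<theta> * (a * exp (- a))" by simp
    also have "\<dots> \<le> 2 * \<theta> * 1" using ab mult_exp_neg_le_1 by (intro mult_left_mono) auto
    finally show "exp (- a) - exp (- b) \<le> 2 * \<theta>" by simp
    show "exp (- b) \<le> exp (- a)" using ab by simp
  qed
  have "\<bar>exp (- (real m * x)) - exp (- (real n * x))\<bar> \<le> 2 * \<theta>"
  proof (cases "n = 0")
    case True
    then show ?thesis using mn \<theta>0 by simp
  next
    case False
    have h: "real n / 2 \<le> real m" using mn mult_right_mono[OF \<theta>, of "real n"] by (auto simp: abs_le_iff)
    show ?thesis
    proof (cases "m \<le> n")
      case True
      have "(real n - real m) * x \<le> \<theta> * real n * x" using mn x by (intro mult_right_mono) auto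
      also have "\<dots> \<le> \<theta> * (2 * real m) * x" using h x \<theta>0 by (intro mult_right_mono mult_left_mono) auto
      finally have "real n * x - real m * x \<le> 2 * \<theta> * (real m * x)" by (simp add: algebra_simps)
      from mono[OF _ this \<theta>0] show ?thesis using True x by (simp add: mult_right_mono)
    next
      case False
      have "(real m - real n) * x \<le> \<theta> * real n * x" using mn x by (intro mult_right_mono) auto
      also have "\<dots> \<le> 2 * \<theta> * (real n * x)" using x \<theta>0 by simp
      finally have "real m * x - real n * x \<le> 2 * \<theta> * (real n * x)" by (simp add: algebra_simps)
      from mono[OF _ this \<theta>0] show ?thesis using False x by (simp add: mult_right_mono abs_minus_commute)
    qed
  qed
  then show ?thesis using up lo by linarith
qed

section \<open>Moments of the Poisson law and elementary bounds on its masses\<close>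

lemma ppmf_sums: "0 < \<mu> \<Longrightarrow> ppmf \<mu> sums 1"
  using ptail_sums[of \<mu> 0] by (simp add: ptail_def)

lemma ppmf_moment1: "0 < \<mu> \<Longrightarrow> (\<lambda>j. real j * ppmf \<mu> j) sums \<mu>"
proof -
  assume \<mu>: "0 < \<mu>"
  have "(\<lambda>j. real (Suc j) * ppmf \<mu> (Suc j)) sums (\<mu> * 1)"
    using sums_mult[OF ppmf_sums[OF \<mu>], of \<mu>] by (simp add: ppmf_Suc mult.commute del: of_nat_Suc)
  then show ?thesis by (subst (asm) sums_Suc_iff) simp
qed

lemma ppmf_moment2: "0 < \<mu> \<Longrightarrow> (\<lambda>j. real j * (real j - 1) * ppmf \<mu> j) sums \<mu>\<^sup>2"
proof -
  assume \<mu>: "0 < \<mu>"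
  have eq: "(\<lambda>j. real (Suc j) * (real (Suc j) - 1) * ppmf \<mu> (Suc j)) = (\<lambda>j. \<mu> * (real j * ppmf \<mu> j))"
    by (rule ext) (simp add: ppmf_Suc field_simps)
  have "(\<lambda>j. real (Suc j) * (real (Suc j) - 1) * ppmf \<mu> (Suc j)) sums (\<mu> * \<mu>)"
    using sums_mult[OF ppmf_moment1[OF \<mu>], of \<mu>] by (simp only: eq)
  then show ?thesis by (subst (asm) sums_Suc_iff) (simp add: power2_eq_square)
qed

lemma ppmf_variance: "0 < \<mu> \<Longrightarrow> (\<lambda>j. (real j - \<mu>)\<^sup>2 * ppmf \<mu> j) sums \<mu>"
proof -
  assume \<mu>: "0 < \<mu>"
  have "(\<lambda>j. real j * (real j - 1) * ppmf \<mu> j + (1 - 2 * \<mu>) * (real j * ppmf \<mu> j) + \<mu>\<^sup>2 * ppmf \<mu> j)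
     sums (\<mu>\<^sup>2 + (1 - 2 * \<mu>) * \<mu> + \<mu>\<^sup>2 * 1)"
    by (intro sums_add sums_mult ppmf_moment2 ppmf_moment1 ppmf_sums \<mu>)
  moreover have "real j * (real j - 1) * ppmf \<mu> j + (1 - 2 * \<mu>) * (real j * ppmf \<mu> j) + \<mu>\<^sup>2 * ppmf \<mu> j = (real j - \<mu>)\<^sup>2 * ppmf \<mu> j" for j
    by (simp add: power2_eq_square algebra_simps)
  moreover have "\<mu>\<^sup>2 + (1 - 2 * \<mu>) * \<mu> + \<mu>\<^sup>2 * 1 = \<mu>" by (simp add: power2_eq_square algebra_simps)
  ultimately show ?thesis by simp
qed

lemma poisson_chebyshev:
  assumes \<mu>: "0 < \<mu>" and t: "0 < t"
  shows "measure_pmf.prob (poisson_pmf \<mu>) {j. t < \<bar>real j - \<mu>\<bar>} \<le> \<mu> / t\<^sup>2"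
proof -
  let ?A = "{j. t < \<bar>real j - \<mu>\<bar>}"
  have s: "(\<lambda>j. (real j - \<mu>)\<^sup>2 * ppmf \<mu> j / t\<^sup>2) sums (\<mu> / t\<^sup>2)"
    by (rule sums_divide[OF ppmf_variance[OF \<mu>]])
  have "emeasure (measure_pmf (poisson_pmf \<mu>)) ?A = (\<integral>\<^sup>+j. indicator ?A j \<partial>measure_pmf (poisson_pmf \<mu>))"
    by simp
  also have "\<dots> = (\<integral>\<^sup>+j. ennreal (pmf (poisson_pmf \<mu>) j) * indicator ?A j \<partial>count_space UNIV)"
    by (rule nn_integral_measure_pmf)
  also have "\<dots> = (\<Sum>j. ennreal (pmf (poisson_pmf \<mu>) j) * indicator ?A j)"
    by (rule nn_integral_count_space_nat)
  also have "\<dots> \<le> (\<Sum>j. ennreal ((real j - \<mu>)\<^sup>2 * ppmf \<mu> j / t\<^sup>2))"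
  proof (rule suminf_le)
    fix j
    show "ennreal (pmf (poisson_pmf \<mu>) j) * indicator ?A j \<le> ennreal ((real j - \<mu>)\<^sup>2 * ppmf \<mu> j / t\<^sup>2)"
    proof (cases "j \<in> ?A")
      case True
      then have "t\<^sup>2 \<le> \<bar>real j - \<mu>\<bar>\<^sup>2" using t by (intro power_mono) auto
      then have "t\<^sup>2 * ppmf \<mu> j \<le> (real j - \<mu>)\<^sup>2 * ppmf \<mu> j"
        using ppmf_pos[OF \<mu>, of j] by (intro mult_right_mono) auto
      then have "ppmf \<mu> j \<le> (real j - \<mu>)\<^sup>2 * ppmf \<mu> j / t\<^sup>2" using t by (simp add: field_simps)
      moreover have "pmf (poisson_pmf \<mu>) j = ppmf \<mu> j" using \<mu> by (simp add: pmf_poisson ppmf_def)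
      ultimately show ?thesis using True by (simp only: indicator_simps mult_1_right ennreal_leI)
    qed simp
  qed auto
  also have "\<dots> = ennreal (\<mu> / t\<^sup>2)"
  proof (rule suminf_ennreal_eq[OF _ s])
    show "0 \<le> (real j - \<mu>)\<^sup>2 * ppmf \<mu> j / t\<^sup>2" for j
      by (intro divide_nonneg_nonneg mult_nonneg_nonneg less_imp_le[OF ppmf_pos[OF \<mu>]]) auto
  qed
  finally show ?thesis
    using \<mu> by (simp add: measure_pmf.emeasure_eq_measure)
qed

lemma ppmf_lower: "0 < \<mu> \<Longrightarrow> 0 < j \<Longrightarrow> (\<mu> / real j) ^ j * exp (- \<mu>) \<le> ppmf \<mu> j"
proof -
  assume \<mu>: "0 < \<mu>" and j: "0 < j"
  have "(fact j :: real) \<le> real j ^ j" using fact_le_power[of j, where 'a=real] by simp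
  then have "\<mu> ^ j / real j ^ j \<le> \<mu> ^ j / fact j" using \<mu> j by (intro divide_left_mono) auto
  then show ?thesis unfolding ppmf_def power_divide by (intro mult_right_mono) auto
qed

text \<open>That a Poisson variable of mean \<open>j\<close> takes the value \<open>j\<close> with
  probability at most 1 gives \<open>1 / j! \<le> (e / j)^j\<close>.\<close>

lemma ppmf_upper: "0 < \<mu> \<Longrightarrow> 0 < j \<Longrightarrow> ppmf \<mu> j \<le> (\<mu> * exp 1 / real j) ^ j"
proof -
  assume \<mu>: "0 < \<mu>" and j: "0 < j"
  have "ppmf (real j) j \<le> 1" using ppmf_le_ptail[of "real j" j] ptail_le_1[of "real j" j] j by simp
  then have "1 / fact j \<le> exp (real j) / real j ^ j"
    using j by (simp add: ppmf_def exp_minus field_simps)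
  then have "\<mu> ^ j * (1 / fact j) \<le> \<mu> ^ j * (exp (real j) / real j ^ j)" using \<mu> by (intro mult_left_mono) auto
  moreover have "exp (real j) = exp 1 ^ j" using exp_of_nat_mult[of j 1] by simp
  ultimately have "\<mu> ^ j * (1 / fact j) \<le> (\<mu> * exp 1 / real j) ^ j" by (simp add: power_divide power_mult_distrib)
  moreover have "ppmf \<mu> j \<le> \<mu> ^ j / fact j * 1" unfolding ppmf_def using \<mu> by (intro mult_left_mono) auto
  ultimately show ?thesis by simp
qed

lemma ptail_le_2_ppmf: "0 < \<mu> \<Longrightarrow> 2 * \<mu> \<le> real (Suc j) \<Longrightarrow> ptail \<mu> j \<le> 2 * ppmf \<mu> j"
proof -
  assume \<mu>: "0 < \<mu>" "2 * \<mu> \<le> real (Suc j)"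
  have "(1 / 2) * ptail \<mu> j \<le> (1 - \<mu> / real (Suc j)) * ptail \<mu> j"
    using \<mu> ptail_nonneg[of \<mu> j] by (intro mult_right_mono) (auto simp: field_simps)
  also have "\<dots> \<le> ppmf \<mu> j" by (rule ptail_le_ppmf[OF \<mu>(1)])
  finally show ?thesis by simp
qed

section \<open>The threshold index\<close>

locale tail_threshold =
  fixes \<mu> :: "nat \<Rightarrow> real" and c :: real
  assumes c: "0 < c" and \<mu>c: "\<And>n. 0 < n \<Longrightarrow> c \<le> \<mu> n" and \<mu>_ln: "(\<lambda>n. \<mu> n / ln (real n)) \<longlonglongrightarrow> 0"
begin

lemma \<mu>_pos: "0 < n \<Longrightarrow> 0 < \<mu> n"
  using \<mu>c[of n] c by simp

definition f :: "nat \<Rightarrow> nat \<Rightarrow> real" where "f n k = real n * ptail (\<mu> n) k"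

definition K :: "nat \<Rightarrow> nat" where "K n = (LEAST k. f n k * f n (Suc k) \<le> 1)"

lemma f_nonneg: "0 \<le> f n k"
  by (simp add: f_def ptail_nonneg)

lemma f_antimono: "k \<le> l \<Longrightarrow> f n l \<le> f n k"
  unfolding f_def by (intro mult_left_mono ptail_antimono) auto

lemma f_K: "f n (K n) * f n (Suc (K n)) \<le> 1"
proof -
  have "(\<lambda>k. f n k * f n (Suc k)) \<longlonglongrightarrow> (real n * 0) * (real n * 0)"
    unfolding f_def by (intro tendsto_mult tendsto_const ptail_tendsto_0 LIMSEQ_Suc)
  then have "eventually (\<lambda>k. f n k * f n (Suc k) < 1) sequentially" by (intro order_tendstoD(2)) auto
  then obtain k where "f n k * f n (Suc k) < 1" by (auto simp: eventually_sequentially)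
  then have "f n k * f n (Suc k) \<le> 1" by simp
  then show ?thesis unfolding K_def by (rule LeastI)
qed

lemma f_K_pred: "0 < K n \<Longrightarrow> 1 < f n (K n - 1) * f n (K n)"
  using not_less_Least[of "K n - 1" "\<lambda>k. f n k * f n (Suc k) \<le> 1"] unfolding K_def[symmetric] by simp

lemma f_Suc_K: "f n (Suc (K n)) \<le> 1"
proof (rule ccontr)
  assume *: "\<not> ?thesis"
  have "1 * 1 < f n (Suc (K n)) * f n (Suc (K n))" using * by (intro mult_strict_mono) auto
  also have "\<dots> \<le> f n (K n) * f n (Suc (K n))" by (intro mult_right_mono f_antimono f_nonneg) auto
  finally show False using f_K[of n] by simp
qed

lemma f_pred_K: "0 < K n \<Longrightarrow> 1 < f n (K n - 1)"
proof (rule ccontr)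
  assume K: "0 < K n" and *: "\<not> ?thesis"
  have "f n (K n) \<le> f n (K n - 1)" by (rule f_antimono) simp
  then have "f n (K n - 1) * f n (K n) \<le> 1 * 1" using * f_nonneg by (intro mult_mono) auto
  then show False using f_K_pred[OF K] by simp
qed

text \<open>If \<open>K n\<close> were at most \<open>L * \<mu> n\<close>, the mass at
  \<open>K n + 1\<close> would be at least \<open>exp (- \<mu> n * (1 + L' * ln L'))\<close>, which
  beats \<open>1 / n\<close> because \<open>\<mu> n\<close> is of smaller order than
  \<open>ln n\<close>; but \<open>f n (K n + 1)\<close> is at most 1.\<close>

lemma K_gt_\<mu>: "1 \<le> L \<Longrightarrow> eventually (\<lambda>n. L * \<mu> n < real (K n)) sequentially"
proof -
  assume L: "1 \<le> L"
  \<comment> \<open>The summand \<open>1 / c\<close> absorbs the index shift by one, as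
    \<open>\<mu> n \<ge> c\<close>.\<close>
  define L' where "L' = L + 1 / c"
  have L': "1 \<le> L'" using L c by (simp add: L'_def add_increasing2)
  have d: "0 < 1 + L' * ln L'" using L' by (simp add: add_pos_nonneg)
  have "eventually (\<lambda>n. \<mu> n / ln (real n) < 1 / (1 + L' * ln L')) sequentially"
    using d by (intro order_tendstoD(2)[OF \<mu>_ln]) auto
  moreover have "eventually (\<lambda>n. 3 \<le> n) sequentially" by (rule eventually_ge_at_top)
  ultimately show ?thesis
  proof eventually_elim
    case (elim n)
    have n: "0 < n" "1 < real n" using elim by auto
    have ln: "0 < ln (real n)" using n by simp
    show ?case
    proof (rule ccontr)
      assume "\<not> ?thesis"
      then have "real (Suc (K n)) \<le> L * \<mu> n + 1" by simp
      also have "1 \<le> (1 / c) * \<mu> n" using \<mu>c[OF n(1)] c by simp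
      finally have j: "real (Suc (K n)) \<le> L' * \<mu> n" by (simp add: L'_def algebra_simps)
      let ?j = "Suc (K n)"
      have "exp (- (L' * \<mu> n * ln L')) \<le> exp (real ?j * ln (1 / L'))"
        using mult_right_mono[OF j, of "ln L'"] L' by (simp add: ln_div)
      also have "\<dots> = (1 / L') ^ ?j" using L' by (subst exp_of_nat_mult) simp
      also have "\<dots> \<le> (\<mu> n / real ?j) ^ ?j"
        using j L' by (intro power_mono) (auto simp: field_simps simp del: of_nat_Suc)
      finally have "exp (- (L' * \<mu> n * ln L')) * exp (- \<mu> n) \<le> (\<mu> n / real ?j) ^ ?j * exp (- \<mu> n)"
        by (intro mult_right_mono) auto
      also have "\<dots> \<le> ppmf (\<mu> n) ?j" using \<mu>_pos[OF n(1)] by (intro ppmf_lower) auto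
      also have "\<dots> \<le> ptail (\<mu> n) ?j" by (rule ppmf_le_ptail[OF \<mu>_pos[OF n(1)]])
      also have "\<dots> \<le> 1 / real n" using f_Suc_K[of n] n by (simp add: f_def field_simps)
      also have "\<dots> = exp (- ln (real n))" using n by (simp add: exp_minus field_simps)
      finally have "ln (real n) \<le> \<mu> n * (1 + L' * ln L')" unfolding exp_add[symmetric] by (simp add: algebra_simps)
      then have "1 / (1 + L' * ln L') \<le> \<mu> n / ln (real n)" using d ln by (simp add: field_simps)
      then show False using elim by simp
    qed
  qed
qed

lemma \<mu>_div_K: "(\<lambda>n. \<mu> n / real (K n)) \<longlonglongrightarrow> 0"
proof (rule LIMSEQ_I)
  fix e :: real assume e: "0 < e"
  have "eventually (\<lambda>n. (1 + 1 / e) * \<mu> n < real (K n)) sequentially" using e by (intro K_gt_\<mu>) auto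
  moreover have "eventually (\<lambda>n. 0 < n) sequentially" by (rule eventually_gt_at_top)
  ultimately have "eventually (\<lambda>n. norm (\<mu> n / real (K n) - 0) < e) sequentially"
  proof eventually_elim
    case (elim n)
    have "\<mu> n + \<mu> n / e < real (K n)" using elim by (simp add: algebra_simps)
    then have "\<mu> n / e < real (K n)" using \<mu>_pos[of n] elim by linarith
    moreover have "0 < \<mu> n / e" using \<mu>_pos[of n] elim e by simp
    ultimately have "0 < real (K n)" by linarith
    with \<open>\<mu> n / e < real (K n)\<close> show ?case using e \<mu>_pos[of n] elim by (simp add: field_simps)
  qed
  then show "\<exists>no. \<forall>n\<ge>no. norm (\<mu> n / real (K n) - 0) < e" by (simp add: eventually_sequentially)
qed

lemma K_at_top: "filterlim (\<lambda>n. real (K n)) at_top sequentially"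
  unfolding filterlim_at_top
proof
  fix Z :: real
  have "eventually (\<lambda>n. (1 + \<bar>Z\<bar> / c) * \<mu> n < real (K n)) sequentially" using c by (intro K_gt_\<mu>) auto
  moreover have "eventually (\<lambda>n. 0 < n) sequentially" by (rule eventually_gt_at_top)
  ultimately show "eventually (\<lambda>n. Z \<le> real (K n)) sequentially"
  proof eventually_elim
    case (elim n)
    have "(\<bar>Z\<bar> / c) * c \<le> (\<bar>Z\<bar> / c) * \<mu> n" using c \<mu>c elim by (intro mult_left_mono) auto
    then have "\<bar>Z\<bar> \<le> (\<bar>Z\<bar> / c) * \<mu> n" using c by simp
    moreover have "\<mu> n + (\<bar>Z\<bar> / c) * \<mu> n < real (K n)" using elim by (simp add: algebra_simps)
    ultimately show ?case using \<mu>_pos[of n] elim by linarith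
  qed
qed

text \<open>For \<open>j = K n - 1\<close>, which is above \<open>exp 2 * \<mu> n\<close>, the mass
  at \<open>j\<close> is at most \<open>exp (- j)\<close>, while \<open>f n j\<close> exceeds 1;
  hence \<open>exp j < 2 * n\<close>. The summand 2 covers \<open>ln 2\<close> and the index
  shift.\<close>

lemma K_le_ln: "eventually (\<lambda>n. real (K n) \<le> ln (real n) + 2) sequentially"
proof -
  have "eventually (\<lambda>n. (exp 2 + 1 / c) * \<mu> n < real (K n)) sequentially"
    using c by (intro K_gt_\<mu>) (auto simp: add_increasing2)
  moreover have "eventually (\<lambda>n. 3 \<le> n) sequentially" by (rule eventually_ge_at_top)
  moreover have "eventually (\<lambda>n. 2 \<le> real (K n)) sequentially"
    using K_at_top unfolding filterlim_at_top by blast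
  ultimately show ?thesis
  proof eventually_elim
    case (elim n)
    have n: "0 < n" using elim by simp
    have \<mu>: "0 < \<mu> n" by (rule \<mu>_pos[OF n])
    define j where "j = K n - 1"
    have j: "0 < j" "K n = Suc j" using elim by (auto simp: j_def)
    have "1 \<le> (1 / c) * \<mu> n" using \<mu>c[OF n] c by simp
    then have jl: "exp 2 * \<mu> n \<le> real j" using elim j by (simp add: algebra_simps)
    have e2: "3 \<le> exp (2 :: real)" using exp_ge_add_one_self[of 2] by simp
    have "2 * \<mu> n \<le> exp 2 * \<mu> n" using e2 \<mu> by (intro mult_right_mono) auto
    then have "1 < real n * (2 * ppmf (\<mu> n) j)"
      using f_pred_K[of n] j mult_left_mono[OF ptail_le_2_ppmf[OF \<mu>, of j], of "real n"] jl
      by (simp add: f_def j_def[symmetric])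
    also have "\<dots> \<le> real n * (2 * exp (- real j))"
    proof (intro mult_left_mono)
      have "ppmf (\<mu> n) j \<le> (\<mu> n * exp 1 / real j) ^ j" by (rule ppmf_upper[OF \<mu> j(1)])
      also have "\<dots> \<le> exp (- 1) ^ j"
      proof (rule power_mono)
        have "exp 1 * exp 1 = exp (2 :: real)" by (simp add: exp_add[symmetric])
        then have "\<mu> n * exp 1 * exp 1 = exp 2 * \<mu> n" by (metis mult.assoc mult.commute)
      then have "\<mu> n * exp 1 * exp 1 \<le> real j" using jl by linarith
      then show "\<mu> n * exp 1 / real j \<le> exp (- 1)" using j by (simp add: exp_minus field_simps)
      qed (use \<mu> in auto)
      also have "\<dots> = exp (- real j)" using exp_of_nat_mult[of j "- 1 :: real"] by simp
      finally show "ppmf (\<mu> n) j \<le> exp (- real j)" .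
    qed auto
    finally have "exp (real j) < 2 * real n" by (simp add: exp_minus field_simps)
    then have "real j < ln (2 * real n)" using n by (simp add: ln_less_cancel_iff[symmetric] del: ln_less_cancel_iff)
    also have "\<dots> = ln 2 + ln (real n)" using n by (simp add: ln_mult)
    finally show ?case using j ln_2_less_1 by simp
  qed
qed

text \<open>One factor of the square of \<open>f n (K n + 1)\<close> is at most
  \<open>\<mu> / (K + 1)\<close> times \<open>f n (K n)\<close>, and the product of the two values
  of \<open>f n\<close> is at most 1 by the choice of \<open>K n\<close>.\<close>

lemma f_Suc_K_tendsto: "(\<lambda>n. f n (Suc (K n))) \<longlonglongrightarrow> 0"
proof (rule real_tendsto_sandwich[OF _ _ tendsto_const])
  show "(\<lambda>n. sqrt (\<mu> n / real (K n))) \<longlonglongrightarrow> 0"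
    using tendsto_real_sqrt[OF \<mu>_div_K] by simp
  show "eventually (\<lambda>n. 0 \<le> f n (Suc (K n))) sequentially" by (simp add: f_nonneg)
  have "eventually (\<lambda>n. 1 \<le> real (K n)) sequentially" using K_at_top unfolding filterlim_at_top by blast
  moreover have "eventually (\<lambda>n. 0 < n) sequentially" by (rule eventually_gt_at_top)
  ultimately show "eventually (\<lambda>n. f n (Suc (K n)) \<le> sqrt (\<mu> n / real (K n))) sequentially"
  proof eventually_elim
    case (elim n)
    have \<mu>: "0 < \<mu> n" using elim by (intro \<mu>_pos) auto
    have "f n (Suc (K n)) \<le> \<mu> n / real (Suc (K n)) * f n (K n)"
      unfolding f_def using mult_left_mono[OF ptail_Suc_le[OF \<mu>, of "K n"], of "real n"] by (simp add: mult_ac)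
    then have "f n (Suc (K n)) * f n (Suc (K n)) \<le> \<mu> n / real (Suc (K n)) * f n (K n) * f n (Suc (K n))"
      by (intro mult_right_mono f_nonneg)
    also have "\<dots> \<le> \<mu> n / real (Suc (K n)) * 1"
      using f_K[of n] \<mu> unfolding mult.assoc by (intro mult_left_mono) auto
    also have "\<dots> \<le> \<mu> n / real (K n)" using \<mu> elim by (simp add: frac_le)
    finally show ?case by (intro real_le_rsqrt) (simp add: power2_eq_square)
  qed
qed

text \<open>The mirror image: the product of the values at \<open>K n - 1\<close> and
  \<open>K n\<close> exceeds 1, and the step from \<open>K n - 1\<close> to \<open>K n\<close> loses
  at least a factor \<open>\<mu> / K\<close>, so the square of the first value is at least
  \<open>K / \<mu>\<close>.\<close>

lemma f_pred_K_at_top: "filterlim (\<lambda>n. f n (K n - 1)) at_top sequentially"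
proof -
  have e1: "eventually (\<lambda>n. 1 \<le> real (K n)) sequentially" using K_at_top unfolding filterlim_at_top by blast
  have e2: "eventually (\<lambda>n. 0 < n) sequentially" by (rule eventually_gt_at_top)
  have "eventually (\<lambda>n. 0 < \<mu> n / real (K n)) sequentially"
    using e1 e2 by eventually_elim (auto intro!: divide_pos_pos \<mu>_pos)
  then have "filterlim (\<lambda>n. inverse (\<mu> n / real (K n))) at_top sequentially"
    by (rule filterlim_inverse_at_top[OF \<mu>_div_K])
  then have lim: "filterlim (\<lambda>n. sqrt (inverse (\<mu> n / real (K n)))) at_top sequentially"
    by (rule filterlim_compose[OF sqrt_at_top])
  show ?thesis
  proof (rule filterlim_at_top_mono[OF lim])
    show "eventually (\<lambda>n. sqrt (inverse (\<mu> n / real (K n))) \<le> f n (K n - 1)) sequentially"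
      using e1 e2
    proof eventually_elim
      case (elim n)
      have \<mu>: "0 < \<mu> n" using elim by (intro \<mu>_pos) auto
      have K: "0 < K n" using elim by simp
      have "f n (K n) \<le> \<mu> n / real (K n) * f n (K n - 1)"
        unfolding f_def using mult_left_mono[OF ptail_Suc_le[OF \<mu>, of "K n - 1"], of "real n"] K by (simp add: mult_ac)
      then have "f n (K n - 1) * f n (K n) \<le> f n (K n - 1) * (\<mu> n / real (K n) * f n (K n - 1))"
        by (intro mult_left_mono f_nonneg)
      also have "\<dots> = (f n (K n - 1))\<^sup>2 * (\<mu> n / real (K n))" by (simp add: power2_eq_square)
      finally have "1 \<le> (f n (K n - 1))\<^sup>2 * (\<mu> n / real (K n))"
        using f_K_pred[OF K] by linarith
      then have "inverse (\<mu> n / real (K n)) \<le> (f n (K n - 1))\<^sup>2" using \<mu> K by (simp add: field_simps)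
      then show ?case by (intro real_le_lsqrt f_nonneg) 
    qed
  qed
qed

text \<open>The error bounds contain \<open>k^6\<close> times a tail, for \<open>k\<close> between
  \<open>K n - 1\<close> and \<open>K n + 1\<close>. By the choice of \<open>K n\<close> the value
  \<open>f n (K n)\<close> is at most of order \<open>sqrt K\<close>, one index lower costs a
  further factor of order \<open>K / \<mu>\<close>, and \<open>K n\<close> is at most logarithmic;
  so the tail is bounded by a power of \<open>ln n\<close> divided by \<open>n\<close>.\<close>

lemma K_pow_ptail: "(\<lambda>n. real (Suc (K n)) ^ 6 * ptail (\<mu> n) (K n - 1)) \<longlonglongrightarrow> 0"
proof (rule real_tendsto_sandwich[OF _ _ tendsto_const])
  define C where "C = 8 / c ^ 3"
  have C: "0 < C" using c by (simp add: C_def)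
  show "(\<lambda>n. (ln (real n) + 3) ^ 6 * (1 + C * (ln (real n) + 3) ^ 3) / real n) \<longlonglongrightarrow> 0"
    using C by real_asymp
  show "eventually (\<lambda>n. 0 \<le> real (Suc (K n)) ^ 6 * ptail (\<mu> n) (K n - 1)) sequentially"
    by (simp add: ptail_nonneg)
  have "eventually (\<lambda>n. 1 \<le> real (K n)) sequentially" using K_at_top unfolding filterlim_at_top by blast
  moreover have "eventually (\<lambda>n. 0 < n) sequentially" by (rule eventually_gt_at_top)
  moreover have "eventually (\<lambda>n. 2 * \<mu> n < real (K n)) sequentially" by (rule K_gt_\<mu>) simp
  moreover note K_le_ln
  ultimately show "eventually (\<lambda>n. real (Suc (K n)) ^ 6 * ptail (\<mu> n) (K n - 1)
    \<le> (ln (real n) + 3) ^ 6 * (1 + C * (ln (real n) + 3) ^ 3) / real n) sequentially"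
  proof eventually_elim
    case (elim n)
    have \<mu>: "0 < \<mu> n" "c \<le> \<mu> n" using elim by (auto intro: \<mu>_pos \<mu>c)
    have K: "0 < K n" using elim by simp
    define x where "x = real (Suc (K n))"
    have x: "0 < x" "real (K n) \<le> x" "x \<le> ln (real n) + 3" using elim by (auto simp: x_def)
    \<comment> \<open>Consecutive tails cannot be much farther apart than their masses, because an
      index above \<open>2 * \<mu>\<close> has a tail of at most twice its mass.\<close>
    have "f n (K n) * (\<mu> n / (2 * x)) \<le> f n (Suc (K n))"
    proof -
      have "ptail (\<mu> n) (K n) * (\<mu> n / (2 * x)) \<le> (2 * ppmf (\<mu> n) (K n)) * (\<mu> n / (2 * x))"
        using \<mu> x elim by (intro mult_right_mono ptail_le_2_ppmf) auto
      also have "\<dots> = ppmf (\<mu> n) (Suc (K n))" unfolding ppmf_Suc x_def[symmetric] by simp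
      also have "\<dots> \<le> ptail (\<mu> n) (Suc (K n))" by (rule ppmf_le_ptail[OF \<mu>(1)])
      finally have "real n * (ptail (\<mu> n) (K n) * (\<mu> n / (2 * x))) \<le> real n * ptail (\<mu> n) (Suc (K n))"
        by (intro mult_left_mono) auto
      then show ?thesis unfolding f_def by (simp only: mult.assoc)
    qed
    then have "f n (K n) * (f n (K n) * (\<mu> n / (2 * x))) \<le> 1"
      using f_K[of n] mult_left_mono[OF _ f_nonneg[of n "K n"]] by (meson order_trans)
    then have a: "(f n (K n))\<^sup>2 \<le> 2 * x / \<mu> n" using \<mu> x by (simp add: field_simps power2_eq_square)
    have "f n (K n - 1) \<le> 2 * (real (K n) / \<mu> n) * f n (K n)"
    proof -
      have "ptail (\<mu> n) (K n - 1) \<le> 2 * ppmf (\<mu> n) (K n - 1)"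
        using \<mu> elim K by (intro ptail_le_2_ppmf) auto
      also have "\<dots> = 2 * (real (K n) / \<mu> n) * ppmf (\<mu> n) (K n)"
        using ppmf_Suc[of "\<mu> n" "K n - 1"] K \<mu> by simp
      also have "\<dots> \<le> 2 * (real (K n) / \<mu> n) * ptail (\<mu> n) (K n)"
        using \<mu> by (intro mult_left_mono ppmf_le_ptail) auto
      finally have "real n * ptail (\<mu> n) (K n - 1) \<le> real n * (2 * (real (K n) / \<mu> n) * ptail (\<mu> n) (K n))"
        by (intro mult_left_mono) auto
      then show ?thesis unfolding f_def by (simp only: mult_ac)
    qed
    also have "\<dots> \<le> 2 * (x / \<mu> n) * f n (K n)"
      using x \<mu> f_nonneg[of n "K n"] by (intro mult_right_mono mult_left_mono divide_right_mono) auto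
    finally have "(f n (K n - 1))\<^sup>2 \<le> (2 * (x / \<mu> n) * f n (K n))\<^sup>2" by (intro power_mono f_nonneg)
    also have "\<dots> = 4 * (x / \<mu> n)\<^sup>2 * (f n (K n))\<^sup>2" by (simp only: power_mult_distrib) simp
    also have "\<dots> \<le> 4 * (x / \<mu> n)\<^sup>2 * (2 * x / \<mu> n)" using a by (intro mult_left_mono) auto
    also have "\<dots> = 8 * x ^ 3 / \<mu> n ^ 3" by (simp add: power2_eq_square power3_eq_cube)
    also have "\<dots> \<le> 8 * x ^ 3 / c ^ 3" using \<mu> c x by (intro divide_left_mono power_mono) auto
    also have "\<dots> = C * x ^ 3" by (simp add: C_def)
    finally have b: "(f n (K n - 1))\<^sup>2 \<le> C * x ^ 3" .
    have "f n (K n - 1) \<le> (f n (K n - 1))\<^sup>2"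
      using f_pred_K[OF K] by (simp add: power2_eq_square)
    then have "f n (K n - 1) \<le> 1 + C * x ^ 3" using b by linarith
    then have p: "ptail (\<mu> n) (K n - 1) \<le> (1 + C * x ^ 3) / real n"
      using elim by (simp add: f_def field_simps)
    have "x ^ 6 * ptail (\<mu> n) (K n - 1) \<le> x ^ 6 * ((1 + C * x ^ 3) / real n)"
      using x by (intro mult_left_mono p) auto
    also have "\<dots> \<le> (ln (real n) + 3) ^ 6 * ((1 + C * (ln (real n) + 3) ^ 3) / real n)"
      using x C by (intro mult_mono power_mono divide_right_mono add_mono mult_left_mono) auto
    finally show ?case by (simp add: x_def)
  qed
qed

end

text \<open>As \<open>\<mu> n \<ge> c\<close>, \<open>\<mu> n\<close> is at most the constant
  \<open>c powr (- \<epsilon>)\<close> times \<open>\<mu> n powr (1 + \<epsilon>)\<close>.\<close>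

lemma powr_smallo_imp:
  fixes \<mu> :: "nat \<Rightarrow> real"
  assumes c: "0 < c" and \<mu>c: "\<And>n. 0 < n \<Longrightarrow> c \<le> \<mu> n" and \<epsilon>: "0 < \<epsilon>"
    and o: "(\<lambda>n. \<mu> n powr (1 + \<epsilon>)) \<in> o(\<lambda>n. ln (real n))"
  shows "(\<lambda>n. \<mu> n / ln (real n)) \<longlonglongrightarrow> 0"
proof -
  have "\<mu> \<in> O(\<lambda>n. \<mu> n powr (1 + \<epsilon>))"
  proof (rule bigoI[of _ "c powr (- \<epsilon>)"])
    show "eventually (\<lambda>n. norm (\<mu> n) \<le> c powr (- \<epsilon>) * norm (\<mu> n powr (1 + \<epsilon>))) sequentially"
      using eventually_gt_at_top[of 0]
    proof eventually_elim
      case (elim n)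
      have \<mu>: "0 < \<mu> n" "c \<le> \<mu> n" using \<mu>c[OF elim] c by auto
      have "c powr (- \<epsilon>) * c powr \<epsilon> \<le> c powr (- \<epsilon>) * \<mu> n powr \<epsilon>" using \<mu> c \<epsilon> by (intro mult_left_mono powr_mono2) auto
      then have "1 \<le> c powr (- \<epsilon>) * \<mu> n powr \<epsilon>" using c by (simp add: powr_add[symmetric])
      then have "\<mu> n * 1 \<le> \<mu> n * (c powr (- \<epsilon>) * \<mu> n powr \<epsilon>)" using \<mu> by (intro mult_left_mono) auto
      then show ?case using \<mu> by (simp add: powr_add mult_ac)
    qed
  qed
  from landau_o.big_small_trans[OF this o] show ?thesis by (rule smalloD_tendsto)
qed

section \<open>Convergence of the degree distribution\<close>

text \<open>Conditioning on the count: for values within \<open>t\<close> of \<open>n\<close> the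
  bound applies, and by Chebyshev's inequality the other values have probability at most
  \<open>n / t^2\<close>.\<close>

lemma prob_mixture:
  fixes P :: "nat \<Rightarrow> 'a \<Rightarrow> bool"
  assumes A: "prob_space A" and P[measurable]: "\<And>m. Measurable.pred A (P m)"
    and n: "0 < n" and t: "0 < t" and a: "0 \<le> a" "a \<le> 1"
    and bound: "\<forall>m. \<bar>real m - real n\<bar> \<le> t \<longrightarrow> \<bar>\<P>(Z in A. P m Z) - a\<bar> \<le> \<epsilon>"
  shows "Measurable.pred (A \<Otimes>\<^sub>M count_law n) (\<lambda>x. P (snd x) (fst x))"
    and "\<bar>\<P>(x in A \<Otimes>\<^sub>M count_law n. P (snd x) (fst x)) - a\<bar> \<le> \<epsilon> + real n / t\<^sup>2"
proof -
  let ?B = "count_law n" and ?W = "\<lambda>m. \<bar>real m - real n\<bar> \<le> t"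
  interpret A: prob_space A by (rule A)
  have B: "prob_space ?B" by (rule measure_pmf.prob_space_axioms)
  have BA: "prob_space (?B \<Otimes>\<^sub>M A)" by (rule prob_space_pair[OF B A])
  interpret BA: prob_space "?B \<Otimes>\<^sub>M A" by (rule BA)
  have eq: "(\<lambda>x. P (snd x) (fst x)) = (\<lambda>x. \<exists>m. snd x = m \<and> P m (fst x))" for P :: "nat \<Rightarrow> 'b \<Rightarrow> bool" by auto
  have eq': "(\<lambda>x. P (fst x) (snd x)) = (\<lambda>x. \<exists>m. fst x = m \<and> P m (snd x))" for P :: "nat \<Rightarrow> 'b \<Rightarrow> bool" by auto
  have s: "snd \<in> measurable (A \<Otimes>\<^sub>M ?B) (count_space UNIV)" "fst \<in> measurable (?B \<Otimes>\<^sub>M A) (count_space UNIV)"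
    using measurable_snd[of A ?B] measurable_fst[of ?B A] by (simp_all cong: measurable_cong_sets)
  note [measurable] = s
  show m1: "Measurable.pred (A \<Otimes>\<^sub>M ?B) (\<lambda>x. P (snd x) (fst x))"
    unfolding eq by measurable
  have m2[measurable]: "Measurable.pred (?B \<Otimes>\<^sub>M A) (\<lambda>x. P (fst x) (snd x))"
    unfolding eq' by measurable
  have W[measurable]: "Measurable.pred ?B ?W" "Measurable.pred ?B (\<lambda>m. \<not> ?W m)" by simp_all
  have WB[measurable]: "Measurable.pred (?B \<Otimes>\<^sub>M A) (\<lambda>x. ?W (fst x))"
    by (rule measurable_compose[OF measurable_fst W(1)])
  have \<epsilon>: "0 \<le> \<epsilon>" using bound[rule_format, of n] t by (simp add: abs_le_iff)
  define \<delta> where "\<delta> = real n / t\<^sup>2"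
  define X where "X = \<P>(x in ?B \<Otimes>\<^sub>M A. P (fst x) (snd x))"
  have Xeq: "\<P>(x in A \<Otimes>\<^sub>M ?B. P (snd x) (fst x)) = X"
    unfolding X_def using measure_pair_swap[OF A B m1] by simp
  have nW: "\<P>(m in ?B. \<not> ?W m) \<le> \<delta>"
    using poisson_chebyshev[of "real n" t] n t unfolding \<delta>_def by (simp add: not_le)
  have "\<P>(m in ?B. \<not> ?W m) = 1 - \<P>(m in ?B. ?W m)"
    by (rule measure_pmf.prob_neg) simp
  then have pW: "1 - \<delta> \<le> \<P>(m in ?B. ?W m)" using nW by linarith
  have u1: "X \<le> \<P>(x in ?B \<Otimes>\<^sub>M A. (?W (fst x) \<and> P (fst x) (snd x)) \<or> \<not> ?W (fst x))"
    unfolding X_def by (rule BA.finite_measure_mono) auto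
  have u2: "\<P>(x in ?B \<Otimes>\<^sub>M A. (?W (fst x) \<and> P (fst x) (snd x)) \<or> \<not> ?W (fst x))
    \<le> \<P>(x in ?B \<Otimes>\<^sub>M A. ?W (fst x) \<and> P (fst x) (snd x)) + \<P>(x in ?B \<Otimes>\<^sub>M A. \<not> ?W (fst x))"
  proof -
    have "{x\<in>space (?B \<Otimes>\<^sub>M A). (?W (fst x) \<and> P (fst x) (snd x)) \<or> \<not> ?W (fst x)}
      = {x\<in>space (?B \<Otimes>\<^sub>M A). ?W (fst x) \<and> P (fst x) (snd x)} \<union> {x\<in>space (?B \<Otimes>\<^sub>M A). \<not> ?W (fst x)}" by blast
    then show ?thesis by (simp only:) (rule measure_Un_le; measurable)
  qed
  have u3: "\<P>(x in ?B \<Otimes>\<^sub>M A. \<not> ?W (fst x)) = \<P>(m in ?B. \<not> ?W m)"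
    by (rule prob_pair_fst[OF B A W(2)])
  have u4: "\<P>(x in ?B \<Otimes>\<^sub>M A. ?W (fst x) \<and> P (fst x) (snd x)) \<le> (a + \<epsilon>) * \<P>(m in ?B. ?W m)"
  proof (rule measure_pair_le[OF B A _ W(1)])
    show "Measurable.pred (?B \<Otimes>\<^sub>M A) (\<lambda>x. ?W (fst x) \<and> P (fst x) (snd x))" by (intro pred_intros_logic WB m2)
    fix m assume "?W m"
    then show "\<P>(y in A. ?W (fst (m, y)) \<and> P (fst (m, y)) (snd (m, y))) \<le> a + \<epsilon>"
      using bound[rule_format, of m] by (simp add: abs_le_iff)
  qed (use a \<epsilon> in auto)
  have u5: "(a + \<epsilon>) * \<P>(m in ?B. ?W m) \<le> (a + \<epsilon>) * 1" using a \<epsilon> by (intro mult_left_mono) auto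
  have up: "X \<le> a + \<epsilon> + \<delta>" 
    using order_trans[OF u1 order_trans[OF u2 add_mono[OF order_trans[OF u4 u5] order_trans[OF eq_refl[OF u3] nW]]]] by simp
  \<comment> \<open>The maximum with 0 keeps the factor nonnegative, as
    \<open>measure_pair_ge\<close> requires.\<close>
  have "max 0 (a - \<epsilon>) * \<P>(m in ?B. ?W m) \<le> \<P>(x in ?B \<Otimes>\<^sub>M A. P (fst x) (snd x))"
  proof (rule measure_pair_ge[OF B A m2 W(1)])
    fix m assume "?W m"
    then show "max 0 (a - \<epsilon>) \<le> \<P>(y in A. P (fst (m, y)) (snd (m, y)))"
      using bound[rule_format, of m] by (simp add: abs_le_iff)
  qed simp
  moreover have "max 0 (a - \<epsilon>) * (1 - \<delta>) \<le> max 0 (a - \<epsilon>) * \<P>(m in ?B. ?W m)"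
    using pW by (intro mult_left_mono) auto
  moreover have "max 0 (a - \<epsilon>) * \<delta> \<le> 1 * \<delta>"
    using a \<epsilon> t by (intro mult_right_mono) (auto simp: \<delta>_def)
  ultimately have "a - \<epsilon> - \<delta> \<le> X" unfolding X_def by (simp add: right_diff_distrib)
  then show "\<bar>\<P>(x in A \<Otimes>\<^sub>M ?B. P (snd x) (fst x)) - a\<bar> \<le> \<epsilon> + real n / t\<^sup>2"
    using up unfolding Xeq \<delta>_def[symmetric] by (simp add: abs_le_iff)
qed

lemma marks_law: "prob_space (marks_law v q)"
  by (intro prob_space_PiM prob_space_pair vertex_law failure_law)

lemma sample_space: "prob_space (sample_space n v q)"
  unfolding sample_space_def
  by (intro prob_space_pair prob_space_PiM point_law angle_law failure_law measure_pmf.prob_space_axioms)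

text \<open>Treats the two models at once: the number of points is either the Poisson count or the
  constant \<open>n\<close>. The Chebyshev term is kept in the binomial case too, so that both share
  one bound.\<close>

lemma prob_marks:
  assumes g: "inj (\<lambda>(i, j). g i j)" and P: "\<And>m. Measurable.pred (marks_law v q) (P m)"
    and n: "0 < n" and t: "0 < t" and a: "0 \<le> a" "a \<le> 1"
    and bound: "\<forall>m. \<bar>real m - real n\<bar> \<le> t \<longrightarrow> \<bar>\<P>(Z in marks_law v q. P m Z) - a\<bar> \<le> \<epsilon>"
    and N: "N = count \<or> N = (\<lambda>_. n)"
  shows "Measurable.pred (sample_space n v q) (\<lambda>\<omega>. P (N \<omega>) (marks g \<omega>))"
    and "\<bar>\<P>(\<omega> in sample_space n v q. P (N \<omega>) (marks g \<omega>)) - a\<bar> \<le> \<epsilon> + real n / t\<^sup>2"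
proof -
  let ?S = "sample_space n v q"
  note mix = prob_mixture[OF marks_law P n t a bound]
  have B: "prob_space (count_law n)" by (rule measure_pmf.prob_space_axioms)
  have pair: "(\<lambda>\<omega>. (marks g \<omega>, count \<omega>)) \<in> measurable ?S (marks_law v q \<Otimes>\<^sub>M count_law n)"
    by (intro measurable_Pair measurable_marks measurable_count)
  have pos: "0 \<le> real n / t\<^sup>2" by simp
  show "Measurable.pred ?S (\<lambda>\<omega>. P (N \<omega>) (marks g \<omega>))"
    using N
  proof
    assume "N = count"
    then show ?thesis using measurable_compose[OF pair mix(1)] by simp
  next
    assume "N = (\<lambda>_. n)"
    then show ?thesis using measurable_compose[OF measurable_marks P] by simp
  qed
  show "\<bar>\<P>(\<omega> in ?S. P (N \<omega>) (marks g \<omega>)) - a\<bar> \<le> \<epsilon> + real n / t\<^sup>2"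
    using N
  proof
    assume "N = count"
    then show ?thesis using mix(2) prob_sample_space[OF g mix(1)] by simp
  next
    assume *: "N = (\<lambda>_. n)"
    have m: "Measurable.pred (marks_law v q \<Otimes>\<^sub>M count_law n) (\<lambda>x. P n (fst x))"
      by (rule measurable_compose[OF measurable_fst P])
    have "\<P>(\<omega> in ?S. P n (marks g \<omega>)) = \<P>(Z in marks_law v q. P n Z)"
      using prob_sample_space[OF g m] prob_pair_fst[OF marks_law B P] by simp
    moreover have "\<bar>\<P>(Z in marks_law v q. P n Z) - a\<bar> \<le> \<epsilon>" using bound t by simp
    ultimately show ?thesis using pos unfolding * by linarith
  qed
qed

context sector_params
begin

abbreviation degrees :: "nat \<Rightarrow> (sample \<Rightarrow> nat) set" where
  "degrees n \<equiv> {\<lambda>\<omega>. max_out_degree (poisson_graph \<alpha> r \<omega>), \<lambda>\<omega>. max_in_degree (poisson_graph \<alpha> r \<omega>),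
     \<lambda>\<omega>. max_out_degree (binomial_graph \<alpha> r n \<omega>), \<lambda>\<omega>. max_in_degree (binomial_graph \<alpha> r n \<omega>)}"

lemma out_meas: "Measurable.pred (marks_law v q) (\<lambda>Z. \<forall>i<m. \<not> out.exc k {..<m} Z i)"
  by measurable

lemma inn_meas: "Measurable.pred (marks_law v q) (\<lambda>Z. \<forall>i<m. \<not> inn.exc k {..<m} Z i)"
  by measurable

lemma prob_degrees:
  assumes n: "0 < n" and k: "0 < k" and t: "0 < t" and a: "0 \<le> a" "a \<le> 1"
    and out: "\<forall>m. \<bar>real m - real n\<bar> \<le> t \<longrightarrow> \<bar>\<P>(Z in marks_law v q. \<forall>i<m. \<not> out.exc k {..<m} Z i) - a\<bar> \<le> \<epsilon>"
    and inn: "\<forall>m. \<bar>real m - real n\<bar> \<le> t \<longrightarrow> \<bar>\<P>(Z in marks_law v q. \<forall>i<m. \<not> inn.exc k {..<m} Z i) - a\<bar> \<le> \<epsilon>"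
    and \<Delta>: "\<Delta> \<in> degrees n"
  shows "Measurable.pred (sample_space n v q) (\<lambda>\<omega>. \<Delta> \<omega> < k)"
    and "\<bar>\<P>(\<omega> in sample_space n v q. \<Delta> \<omega> < k) - a\<bar> \<le> \<epsilon> + real n / t\<^sup>2"
proof -
  have g: "inj (\<lambda>(i, j). (i, j))" "inj (\<lambda>(i, j). (j, i))" for i j :: nat by (auto simp: inj_on_def)
  note o = prob_marks[OF g(1) out_meas n t a out]
  note i = prob_marks[OF g(2) inn_meas n t a inn]
  have e: "max_out_degree (poisson_graph \<alpha> r \<omega>) < k \<longleftrightarrow> (\<forall>i<count \<omega>. \<not> out.exc k {..<count \<omega>} (marks Pair \<omega>) i)"
    "max_out_degree (binomial_graph \<alpha> r n \<omega>) < k \<longleftrightarrow> (\<forall>i<n. \<not> out.exc k {..<n} (marks Pair \<omega>) i)"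
    "max_in_degree (poisson_graph \<alpha> r \<omega>) < k \<longleftrightarrow> (\<forall>i<count \<omega>. \<not> inn.exc k {..<count \<omega>} (marks (\<lambda>i j. (j, i)) \<omega>) i)"
    "max_in_degree (binomial_graph \<alpha> r n \<omega>) < k \<longleftrightarrow> (\<forall>i<n. \<not> inn.exc k {..<n} (marks (\<lambda>i j. (j, i)) \<omega>) i)" for \<omega>
    by (cases \<omega>; simp only: poisson_graph_def binomial_graph_def count_def prod.case max_out_less_iff[OF k] max_in_less_iff[OF k])+
  have c: "count = count \<or> count = (\<lambda>_. n)" "(\<lambda>_. n) = count \<or> (\<lambda>_. n) = (\<lambda>_. n)" by simp_all
  show "Measurable.pred (sample_space n v q) (\<lambda>\<omega>. \<Delta> \<omega> < k)"
    using \<Delta> o(1)[OF c(1)] o(1)[OF c(2)] i(1)[OF c(1)] i(1)[OF c(2)] by (auto simp only: e insert_iff empty_iff)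
  show "\<bar>\<P>(\<omega> in sample_space n v q. \<Delta> \<omega> < k) - a\<bar> \<le> \<epsilon> + real n / t\<^sup>2"
    using \<Delta> o(2)[OF c(1)] o(2)[OF c(2)] i(2)[OF c(1)] i(2)[OF c(2)] by (auto simp only: e insert_iff empty_iff)
qed

text \<open>The power with exponent \<open>m\<close> is replaced by an exponential that depends on
  \<open>n\<close> only. The extra 1 in \<open>t + 1 \<le> \<theta> * real n\<close> leaves room for
  \<open>m - 1\<close>, the number of possible neighbours of one of \<open>m\<close>
  vertices.\<close>

lemma degree_error:
  assumes T: "tail_params n k \<mu> \<theta> \<tau>" and \<mu>: "\<mu> = real n * ((1 - q) * p0)"
    and D: "0 \<le> D" "real n * r\<^sup>2 \<le> D * \<mu>" and c: "0 < c" "c \<le> 1" "c \<le> \<mu>" and \<eta>: "0 \<le> \<eta>" "\<eta> \<le> 1"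
    and r: "2 * r \<le> 1" "4 * r \<le> \<tau>" and t: "0 < t" "t + 1 \<le> \<theta> * real n" and \<xi>: "ptail \<mu> k \<le> 1 / 2"
    and \<Delta>: "\<Delta> \<in> degrees n"
  shows "Measurable.pred (sample_space n v q) (\<lambda>\<omega>. \<Delta> \<omega> < k)"
    and "\<bar>\<P>(\<omega> in sample_space n v q. \<Delta> \<omega> < k) - exp (- (real n * (1 - v) * ptail \<mu> k))\<bar>
      \<le> (6 * \<tau> + 4096 * (D + D\<^sup>2) / c ^ 3 / (1 - v)
          * (\<eta>\<^sup>2 * real k + (real k)\<^sup>2 * exp (- (\<eta> * real k / 8)) + real k ^ 6 * (ptail \<mu> k + 1 / real n))
        + (2 * ptail \<mu> k + 2 * \<theta>)) + real n / t\<^sup>2"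
proof -
  interpret T: tail_params n k \<mu> \<theta> \<tau> by (rule T)
  let ?E = "6 * \<tau> + 4096 * (D + D\<^sup>2) / c ^ 3 / (1 - v)
          * (\<eta>\<^sup>2 * real k + (real k)\<^sup>2 * exp (- (\<eta> * real k / 8)) + real k ^ 6 * (ptail \<mu> k + 1 / real n))"
  let ?a = "exp (- (real n * (1 - v) * ptail \<mu> k))"
  have p: "(1 - q) * p0 = \<mu> / real n" using \<mu> T.n by simp
  have w: "1 - v = \<P>(z in K. ok z)" "0 < 1 - v" using K_ok v by auto
  have close: "\<bar>Q - ?a\<bar> \<le> ?E + (2 * ptail \<mu> k + 2 * \<theta>)"
    if m: "\<bar>real m - real n\<bar> \<le> t" and Q: "\<bar>Q - (1 - (1 - v) * ptail \<mu> k) ^ m\<bar> \<le> ?E" for m Q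
  proof -
    have x: "0 \<le> (1 - v) * ptail \<mu> k" "(1 - v) * ptail \<mu> k \<le> ptail \<mu> k"
      using v ptail_nonneg[of \<mu> k] by (auto simp: mult_left_le_one_le)
    have "\<bar>(1 - (1 - v) * ptail \<mu> k) ^ m - exp (- (real n * ((1 - v) * ptail \<mu> k)))\<bar> \<le> 2 * ((1 - v) * ptail \<mu> k) + 2 * \<theta>"
      using x \<xi> m t T.\<theta> T.\<theta>_le by (intro pow_exp_approx) auto
    then have "\<bar>(1 - (1 - v) * ptail \<mu> k) ^ m - ?a\<bar> \<le> 2 * ptail \<mu> k + 2 * \<theta>"
      using x unfolding mult.assoc by linarith
    then show ?thesis using Q by linarith
  qed
  have int: "(1 - v) * (1 - 4 * r) \<le> \<P>(z in K. ok z \<and> interior_mark z)" by (rule interior_prob[OF r(1)])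
  have mt: "\<bar>real m - real n\<bar> + 1 \<le> \<theta> * real n" if "\<bar>real m - real n\<bar> \<le> t" for m
    using that t by linarith
  have out: "\<bar>\<P>(Z in marks_law v q. \<forall>i<m. \<not> out.exc k {..<m} Z i) - ?a\<bar> \<le> ?E + (2 * ptail \<mu> k + 2 * \<theta>)"
    if m: "\<bar>real m - real n\<bar> \<le> t" for m
    using out.main_bound[OF T _ mt[OF m] D c \<eta> w interior_meas out_prob_eq int r(2)] p
    by (intro close[OF m]) (simp add: out.p_def)
  have inn: "\<bar>\<P>(Z in marks_law v q. \<forall>i<m. \<not> inn.exc k {..<m} Z i) - ?a\<bar> \<le> ?E + (2 * ptail \<mu> k + 2 * \<theta>)"
    if m: "\<bar>real m - real n\<bar> \<le> t" for m
    using inn.main_bound[OF T _ mt[OF m] D c \<eta> w interior_meas in_prob_eq int r(2)] p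
    by (intro close[OF m]) (simp add: inn.p_def)
  have k: "0 < k" using T.k by simp
  have a: "0 \<le> ?a" "?a \<le> 1" using v ptail_nonneg[of \<mu> k] by auto
  have o: "\<forall>m. \<bar>real m - real n\<bar> \<le> t \<longrightarrow> \<bar>\<P>(Z in marks_law v q. \<forall>i<m. \<not> out.exc k {..<m} Z i) - ?a\<bar> \<le> ?E + (2 * ptail \<mu> k + 2 * \<theta>)"
    using out by blast
  have i: "\<forall>m. \<bar>real m - real n\<bar> \<le> t \<longrightarrow> \<bar>\<P>(Z in marks_law v q. \<forall>i<m. \<not> inn.exc k {..<m} Z i) - ?a\<bar> \<le> ?E + (2 * ptail \<mu> k + 2 * \<theta>)"
    using inn by blast
  show "Measurable.pred (sample_space n v q) (\<lambda>\<omega>. \<Delta> \<omega> < k)"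
    by (rule prob_degrees(1)[OF T.n k t(1) a o i \<Delta>])
  show "\<bar>\<P>(\<omega> in sample_space n v q. \<Delta> \<omega> < k) - ?a\<bar> \<le> ?E + (2 * ptail \<mu> k + 2 * \<theta>) + real n / t\<^sup>2"
    by (rule prob_degrees(2)[OF T.n k t(1) a o i \<Delta>])
qed

end

locale sector_asymptotics =
  fixes \<alpha> v q c :: real and v_n q_n r \<mu> :: "nat \<Rightarrow> real"
  assumes \<alpha>: "0 < \<alpha>" "\<alpha> \<le> 2 * pi"
    and v_n: "\<And>n. n > 0 \<Longrightarrow> v_n n \<in> {0..1}" "v_n \<longlonglongrightarrow> v" and v: "v < 1"
    and q_n: "\<And>n. n > 0 \<Longrightarrow> q_n n \<in> {0..1}" "q_n \<longlonglongrightarrow> q" and q: "q < 1"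
    and r: "\<And>n. n > 0 \<Longrightarrow> r n > 0"
    and \<mu>_eq: "\<And>n. \<mu> n = \<alpha> / 2 * real n * (r n)\<^sup>2 * (1 - v_n n) * (1 - q_n n)"
    and threshold: "tail_threshold \<mu> c"
begin

sublocale tail_threshold \<mu> c by (rule threshold)

abbreviation degrees :: "nat \<Rightarrow> (sample \<Rightarrow> nat) set" where
  "degrees n \<equiv> {\<lambda>\<omega>. max_out_degree (poisson_graph \<alpha> (r n) \<omega>), \<lambda>\<omega>. max_in_degree (poisson_graph \<alpha> (r n) \<omega>),
     \<lambda>\<omega>. max_out_degree (binomial_graph \<alpha> (r n) n \<omega>), \<lambda>\<omega>. max_in_degree (binomial_graph \<alpha> (r n) n \<omega>)}"

abbreviation S :: "nat \<Rightarrow> sample measure" where "S n \<equiv> sample_space n (v_n n) (q_n n)"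

abbreviation E :: "nat \<Rightarrow> nat \<Rightarrow> real" where "E n k \<equiv> exp (- (real n * (1 - v_n n) * ptail (\<mu> n) k))"

definition w :: real where "w = (1 - v) / 2"

lemma w: "0 < w" and w_le: "eventually (\<lambda>n. w \<le> 1 - v_n n) sequentially"
proof -
  show "0 < w" using v by (simp add: w_def)
  have "eventually (\<lambda>n. v_n n < (1 + v) / 2) sequentially" using v by (intro order_tendstoD(2)[OF v_n(2)]) auto
  then show "eventually (\<lambda>n. w \<le> 1 - v_n n) sequentially" by eventually_elim (simp add: w_def field_simps)
qed

text \<open>The indices \<open>K n - 1\<close>, \<open>K n\<close> and \<open>K n + 1\<close> are
  needed; allowing any sequence within one of \<open>K n\<close> covers them in a single proof.
  Measurability is carried along because it is obtained from the same model, whose parameters are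
  known to be admissible for large \<open>n\<close>.\<close>

lemma degree_limit:
  assumes k: "eventually (\<lambda>n. K n \<le> Suc (k n) \<and> k n \<le> Suc (K n)) sequentially" and \<Delta>: "\<And>n. \<Delta> n \<in> degrees n"
  shows "eventually (\<lambda>n. Measurable.pred (S n) (\<lambda>\<omega>. \<Delta> n \<omega> < k n)) sequentially"
    and "(\<lambda>n. \<P>(\<omega> in S n. \<Delta> n \<omega> < k n) - E n (k n)) \<longlonglongrightarrow> 0"
proof -
  define u where "u = (1 - q) / 2"
  have u: "0 < u" using q by (simp add: u_def)
  have "eventually (\<lambda>n. q_n n < (1 + q) / 2) sequentially" using q by (intro order_tendstoD(2)[OF q_n(2)]) auto
  then have u_le: "eventually (\<lambda>n. u \<le> 1 - q_n n) sequentially" by eventually_elim (simp add: u_def field_simps)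
  \<comment> \<open>From \<open>n r^2 = 2 \<mu> / (\<alpha> (1 - v_n) (1 - q_n))\<close> and the
    lower bounds \<open>w\<close> and \<open>u\<close> for the two survival probabilities.\<close>
  define D where "D = 2 / (\<alpha> * w * u)"
  have D: "0 < D" using \<alpha> w u by (simp add: D_def)
  define c1 where "c1 = min c 1"
  have c1: "0 < c1" "c1 \<le> 1" "c1 \<le> c" using c by (auto simp: c1_def)
  define C where "C = 4096 * (D + D\<^sup>2) / c1 ^ 3 / w"
  define x where "x n = real (k n)" for n
  \<comment> \<open>The window \<open>t = n^(2/3)\<close> exceeds the Poisson fluctuations of order
    \<open>sqrt n\<close>, so \<open>n / t^2\<close> vanishes, yet its relative size \<theta> stays
    far below \<open>1 / ln n\<close>, as the product of \<theta> and \<open>k\<close> has to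
    vanish. The factor 2 makes room for the 1 in \<open>t + 1\<close>.\<close>
  define \<theta> where "\<theta> n = 2 * real n powr (- 1 / 3)" for n
  define t where "t n = real n powr (2 / 3)" for n
  \<comment> \<open>Chosen as a sum of everything that \<tau> has to dominate, so that
    \<open>H1\<close>, \<open>H2\<close> and \<open>H3\<close> of \<open>tail_params\<close> as well
    as \<open>4 * r n \<le> \<tau> n\<close> hold by construction.\<close>
  define \<tau> where "\<tau> n = 16 * (\<mu> n / x n) + 4 * (\<theta> n * x n) + 4 * ((x n)\<^sup>2 / real n) + 4 * r n" for n
  \<comment> \<open>Then \<open>\<eta>^2 * x\<close> is \<open>x^(-1/2)\<close> and
    \<open>\<eta> * x / 8\<close> is \<open>x^(1/4) / 8\<close>, so both summands of
    \<open>G\<close> vanish.\<close>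
  define \<eta> where "\<eta> n = x n powr (- 3 / 4)" for n
  define G where "G n = (\<eta> n)\<^sup>2 * x n + (x n)\<^sup>2 * exp (- (\<eta> n * x n / 8))" for n
  define \<xi> where "\<xi> n = ptail (\<mu> n) (k n)" for n
  define J where "J n = x n ^ 6 * (\<xi> n + 1 / real n)" for n
  define W where "W n = real n / (t n)\<^sup>2" for n
  have pos: "eventually (\<lambda>n. 0 < n) sequentially" by (rule eventually_gt_at_top)
  have KL: "eventually (\<lambda>n. 2 \<le> real (K n)) sequentially" using K_at_top unfolding filterlim_at_top by blast
  have xK: "eventually (\<lambda>n. real (K n) - 1 \<le> x n \<and> x n \<le> real (K n) + 1) sequentially"
    using k by eventually_elim (auto simp: x_def)
  have x_top: "filterlim x at_top sequentially"
  proof (rule filterlim_at_top_mono)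
    show "filterlim (\<lambda>n. - 1 + real (K n)) at_top sequentially"
      by (rule filterlim_tendsto_add_at_top[OF tendsto_const K_at_top])
    show "eventually (\<lambda>n. - 1 + real (K n) \<le> x n) sequentially" using xK by eventually_elim simp
  qed
  have x4: "eventually (\<lambda>n. 4 \<le> x n) sequentially" using x_top unfolding filterlim_at_top by blast
  have xln: "eventually (\<lambda>n. x n \<le> ln (real n) + 3) sequentially" using xK K_le_ln by eventually_elim simp
  have \<mu>x: "(\<lambda>n. \<mu> n / x n) \<longlonglongrightarrow> 0"
  proof (rule real_tendsto_sandwich[OF _ _ tendsto_const])
    show "(\<lambda>n. 2 * (\<mu> n / real (K n))) \<longlonglongrightarrow> 0" by (rule tendsto_mult_right_zero[OF \<mu>_div_K])
    show "eventually (\<lambda>n. 0 \<le> \<mu> n / x n) sequentially"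
      using pos by eventually_elim (simp add: x_def less_imp_le[OF \<mu>_pos])
    show "eventually (\<lambda>n. \<mu> n / x n \<le> 2 * (\<mu> n / real (K n))) sequentially"
      using pos KL xK
    proof eventually_elim
      case (elim n)
      have "\<mu> n / x n \<le> \<mu> n / (real (K n) / 2)" using elim \<mu>_pos[of n] by (intro divide_left_mono) auto
      then show ?case by (simp add: mult.commute)
    qed
  qed
  have \<mu>_le_x: "eventually (\<lambda>n. \<mu> n \<le> x n) sequentially"
  proof -
    have "eventually (\<lambda>n. \<mu> n / x n < 1) sequentially" by (rule order_tendstoD(2)[OF \<mu>x]) simp
    with x4 show ?thesis by eventually_elim (simp add: field_simps)
  qed
  have Dr: "eventually (\<lambda>n. real n * (r n)\<^sup>2 \<le> D * \<mu> n) sequentially"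
    using u_le w_le pos
  proof eventually_elim
    case (elim n)
    have "w * u \<le> (1 - v_n n) * (1 - q_n n)" using elim w u by (intro mult_mono) auto
    then have "(\<alpha> / 2 * real n * (r n)\<^sup>2) * (w * u) \<le> (\<alpha> / 2 * real n * (r n)\<^sup>2) * ((1 - v_n n) * (1 - q_n n))"
      using \<alpha> by (intro mult_left_mono) auto
    also have "\<dots> = \<mu> n" by (simp add: \<mu>_eq)
    finally show ?case using \<alpha> w u by (simp add: D_def field_simps)
  qed
  have \<theta>0: "\<theta> \<longlonglongrightarrow> 0" unfolding \<theta>_def by real_asymp
  have \<theta>x: "(\<lambda>n. \<theta> n * x n) \<longlonglongrightarrow> 0"
  proof (rule real_tendsto_sandwich[OF _ _ tendsto_const])
    show "(\<lambda>n. 2 * real n powr (- 1 / 3) * (ln (real n) + 3)) \<longlonglongrightarrow> 0" by real_asymp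
    show "eventually (\<lambda>n. \<theta> n * x n \<le> 2 * real n powr (- 1 / 3) * (ln (real n) + 3)) sequentially"
      using xln by eventually_elim (unfold \<theta>_def, intro mult_left_mono, auto)
  qed (simp add: \<theta>_def x_def)
  have xpow: "(\<lambda>n. x n ^ j / real n) \<longlonglongrightarrow> 0" if "j = 2 \<or> j = 6" for j :: nat
  proof (rule real_tendsto_sandwich[OF _ _ tendsto_const])
    show "(\<lambda>n. (ln (real n) + 3) ^ j / real n) \<longlonglongrightarrow> 0" using that by (elim disjE; hypsubst; real_asymp)
    show "eventually (\<lambda>n. x n ^ j / real n \<le> (ln (real n) + 3) ^ j / real n) sequentially"
      using xln by eventually_elim (auto simp: x_def intro!: divide_right_mono power_mono)
  qed (simp add: x_def)
  \<comment> \<open>As \<open>\<mu> n\<close> is at most \<open>x n\<close>, which is at most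
    logarithmic, the bound on \<open>n * r^2\<close> makes \<open>r^2\<close> at most of order
    \<open>(ln n) / n\<close>.\<close>
  have r0: "r \<longlonglongrightarrow> 0"
  proof (rule real_tendsto_sandwich[OF _ _ tendsto_const])
    have "(\<lambda>n. sqrt (D * ((ln (real n) + 3) / real n))) \<longlonglongrightarrow> sqrt (D * 0)"
      by (intro tendsto_real_sqrt tendsto_mult tendsto_const) real_asymp
    then show "(\<lambda>n. sqrt (D * ((ln (real n) + 3) / real n))) \<longlonglongrightarrow> 0" by simp
    show "eventually (\<lambda>n. 0 \<le> r n) sequentially" using pos by eventually_elim (simp add: r less_imp_le)
    show "eventually (\<lambda>n. r n \<le> sqrt (D * ((ln (real n) + 3) / real n))) sequentially"
      using pos Dr \<mu>_le_x xln
    proof eventually_elim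
      case (elim n)
      have "real n * (r n)\<^sup>2 \<le> D * (ln (real n) + 3)"
        using elim D mult_left_mono[of "\<mu> n" "ln (real n) + 3" D] by linarith
      then have "(r n)\<^sup>2 \<le> D * ((ln (real n) + 3) / real n)" using elim by (simp add: field_simps)
      then show ?case by (rule real_le_rsqrt)
    qed
  qed
  have \<tau>0: "\<tau> \<longlonglongrightarrow> 0"
  proof -
    have "(\<lambda>n. 16 * (\<mu> n / x n) + 4 * (\<theta> n * x n) + 4 * ((x n)\<^sup>2 / real n) + 4 * r n) \<longlonglongrightarrow> 16 * 0 + 4 * 0 + 4 * 0 + 4 * 0"
      by (intro tendsto_add tendsto_mult tendsto_const \<mu>x \<theta>x r0) (use xpow[of 2] in auto)
    then show ?thesis by (simp add: \<tau>_def[abs_def])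
  qed
  have G0: "G \<longlonglongrightarrow> 0"
  proof -
    have "((\<lambda>y::real. (y powr (- 3 / 4))\<^sup>2 * y + y\<^sup>2 * exp (- (y powr (- 3 / 4) * y / 8))) \<longlongrightarrow> 0) at_top"
      by real_asymp
    from filterlim_compose[OF this x_top] show ?thesis by (simp add: G_def[abs_def] \<eta>_def)
  qed
  have x\<xi>: "(\<lambda>n. x n ^ 6 * \<xi> n) \<longlonglongrightarrow> 0"
  proof (rule real_tendsto_sandwich[OF _ _ tendsto_const K_pow_ptail])
    show "eventually (\<lambda>n. x n ^ 6 * \<xi> n \<le> real (Suc (K n)) ^ 6 * ptail (\<mu> n) (K n - 1)) sequentially"
      using k by eventually_elim (auto simp: x_def \<xi>_def ptail_nonneg simp del: of_nat_Suc intro!: mult_mono power_mono ptail_antimono)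
  qed (simp add: x_def \<xi>_def ptail_nonneg)
  have \<xi>0: "\<xi> \<longlonglongrightarrow> 0"
  proof (rule real_tendsto_sandwich[OF _ _ tendsto_const x\<xi>])
    show "eventually (\<lambda>n. \<xi> n \<le> x n ^ 6 * \<xi> n) sequentially"
      using x4
    proof eventually_elim
      case (elim n)
      have "1 * \<xi> n \<le> x n ^ 6 * \<xi> n" using elim by (intro mult_right_mono one_le_power) (auto simp: \<xi>_def ptail_nonneg)
      then show ?case by simp
    qed
  qed (simp add: \<xi>_def ptail_nonneg)
  have J0: "J \<longlonglongrightarrow> 0"
  proof -
    have "(\<lambda>n. x n ^ 6 * \<xi> n + x n ^ 6 / real n) \<longlonglongrightarrow> 0 + 0" by (intro tendsto_add x\<xi> xpow) simp
    then show ?thesis by (simp add: J_def[abs_def] distrib_left)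
  qed
  have W0: "W \<longlonglongrightarrow> 0" unfolding W_def t_def by real_asymp
  have err0: "(\<lambda>n. (6 * \<tau> n + C * (G n + J n) + (2 * \<xi> n + 2 * \<theta> n)) + W n) \<longlonglongrightarrow> 0"
  proof -
    have "(\<lambda>n. (6 * \<tau> n + C * (G n + J n) + (2 * \<xi> n + 2 * \<theta> n)) + W n) \<longlonglongrightarrow> (6 * 0 + C * (0 + 0) + (2 * 0 + 2 * 0)) + 0"
      by (intro tendsto_add tendsto_mult tendsto_const \<tau>0 G0 J0 \<xi>0 \<theta>0 W0)
    then show ?thesis by simp
  qed
  have \<tau>h: "eventually (\<lambda>n. \<tau> n < 1 / 2) sequentially" by (rule order_tendstoD(2)[OF \<tau>0]) simp
  have \<xi>h: "eventually (\<lambda>n. \<xi> n < 1 / 2) sequentially" by (rule order_tendstoD(2)[OF \<xi>0]) simp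
  have rh: "eventually (\<lambda>n. r n < 1 / 4) sequentially" by (rule order_tendstoD(2)[OF r0]) simp
  have lnn: "eventually (\<lambda>n. 2 * (ln (real n) + 3) \<le> real n) sequentially" by real_asymp
  have tn: "eventually (\<lambda>n. t n + 1 \<le> \<theta> n * real n) sequentially" unfolding t_def \<theta>_def by real_asymp
  have "eventually (\<lambda>n. Measurable.pred (S n) (\<lambda>\<omega>. \<Delta> n \<omega> < k n)
    \<and> \<bar>\<P>(\<omega> in S n. \<Delta> n \<omega> < k n) - E n (k n)\<bar> \<le> (6 * \<tau> n + C * (G n + J n) + (2 * \<xi> n + 2 * \<theta> n)) + W n) sequentially"
    using pos x4 xln \<mu>_le_x Dr u_le w_le \<tau>h \<xi>h rh lnn tn
  proof eventually_elim
    case (elim n)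
    have n: "0 < n" and n0: "0 < real n" using elim by auto
    have \<mu>n: "0 < \<mu> n" "c1 \<le> \<mu> n" using \<mu>_pos[OF n] \<mu>c[OF n] c1 by auto
    have rn: "0 < r n" by (rule r[OF n])
    have vq: "0 \<le> v_n n" "v_n n < 1" "0 \<le> q_n n" "q_n n \<le> 1"
      using v_n(1)[OF n] q_n(1)[OF n] elim(7) w by auto
    have "\<alpha> * (r n)\<^sup>2 / 2 \<le> 1"
    proof -
      have "(r n)\<^sup>2 \<le> (1 / 4)\<^sup>2" using rn elim(10) by (intro power_mono) auto
      then have "\<alpha> * (r n)\<^sup>2 \<le> (2 * pi) * (1 / 4)\<^sup>2" using \<alpha> by (intro mult_mono) auto
      also have "\<dots> \<le> (2 * 4) * (1 / 4)\<^sup>2" using pi_less_4 by (intro mult_right_mono) auto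
      finally show ?thesis by (simp add: power_divide)
    qed
    then interpret P: sector_params \<alpha> "v_n n" "q_n n" "r n" by unfold_locales (use \<alpha> vq rn in auto)
    have nonneg: "0 \<le> \<mu> n / x n" "0 \<le> \<theta> n * x n" "0 \<le> (x n)\<^sup>2 / real n" using \<mu>n by (auto simp: x_def \<theta>_def)
    have T: "tail_params n (k n) (\<mu> n) (\<theta> n) (\<tau> n)"
    proof
      show "4 \<le> k n" using elim by (simp add: x_def)
      show "0 < \<tau> n" unfolding \<tau>_def using nonneg rn by linarith
      have "16 * (\<mu> n / x n) \<le> \<tau> n" "4 * ((x n)\<^sup>2 / real n) \<le> \<tau> n" "4 * (\<theta> n * x n) \<le> \<tau> n"
        unfolding \<tau>_def using nonneg rn by linarith+
      then show "16 * \<mu> n \<le> \<tau> n * real (k n)" "4 * (real (k n))\<^sup>2 \<le> \<tau> n * real n" "4 * \<theta> n * real (k n) \<le> \<tau> n"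
        using elim(2) n0 by (simp_all add: x_def field_simps)
      have "2 * \<mu> n \<le> 2 * (ln (real n) + 3)" using order_trans[OF elim(4,3)] by (intro mult_left_mono) auto
      then show "2 * \<mu> n \<le> real n" using elim(11) by (rule order_trans)
      show "0 < n" "0 < \<mu> n" by (rule n, rule \<mu>n)
      show "0 \<le> \<theta> n" by (simp add: \<theta>_def)
      show "\<tau> n \<le> 1 / 2" using elim(8) by simp
    qed
    have \<mu>': "\<mu> n = real n * ((1 - q_n n) * P.p0)" by (simp add: \<mu>_eq P.p0_def P.A_def)
    have \<eta>1: "0 \<le> \<eta> n" "\<eta> n \<le> 1"
    proof -
      have "x n powr (- 3 / 4) \<le> x n powr 0" using elim(2) by (intro powr_mono) auto
      then show "0 \<le> \<eta> n" "\<eta> n \<le> 1" using elim(2) by (auto simp: \<eta>_def)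
    qed
    have r': "2 * r n \<le> 1" "4 * r n \<le> \<tau> n" unfolding \<tau>_def using elim(10) nonneg by linarith+
    have t': "0 < t n" "t n + 1 \<le> \<theta> n * real n" using n elim(12) by (auto simp: t_def)
    have \<xi>': "ptail (\<mu> n) (k n) \<le> 1 / 2" using elim(9) by (simp add: \<xi>_def)
    have D0: "0 \<le> D" using D by simp
    note err = P.degree_error[OF T \<mu>' D0 _ c1(1,2) \<mu>n(2) \<eta>1 r' t' \<xi>' \<Delta>]
    have Drn: "real n * (r n)\<^sup>2 \<le> D * \<mu> n" by (rule elim(5))
    have GJ: "0 \<le> G n + J n" using \<mu>n n0 by (auto simp: G_def J_def x_def \<xi>_def ptail_nonneg intro!: add_nonneg_nonneg mult_nonneg_nonneg)
    have "4096 * (D + D\<^sup>2) / c1 ^ 3 / (1 - v_n n) \<le> C"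
      unfolding C_def using elim(7) w D c1 by (intro divide_left_mono) auto
    then have "4096 * (D + D\<^sup>2) / c1 ^ 3 / (1 - v_n n) * (G n + J n) \<le> C * (G n + J n)"
      using GJ by (rule mult_right_mono)
    then show ?case using err[OF Drn] unfolding G_def J_def x_def \<xi>_def W_def by auto
  qed
  note ev = this
  show "eventually (\<lambda>n. Measurable.pred (S n) (\<lambda>\<omega>. \<Delta> n \<omega> < k n)) sequentially"
    using ev by eventually_elim simp
  show "(\<lambda>n. \<P>(\<omega> in S n. \<Delta> n \<omega> < k n) - E n (k n)) \<longlonglongrightarrow> 0"
    by (rule Lim_null_comparison[OF _ err0]) (use ev in \<open>eventually_elim, simp\<close>)
qed

theorem degree_concentration:
  assumes \<Delta>: "\<And>n. \<Delta> n \<in> degrees n"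
  shows "(\<lambda>n. \<P>(\<omega> in S n. int (\<Delta> n \<omega>) = int (K n) - 1) - E n (K n)) \<longlonglongrightarrow> 0"
    and "(\<lambda>n. \<P>(\<omega> in S n. int (\<Delta> n \<omega>) = int (K n)) + E n (K n)) \<longlonglongrightarrow> 1"
proof -
  let ?F = "\<lambda>n k. \<P>(\<omega> in S n. \<Delta> n \<omega> < k)"
  have pos: "eventually (\<lambda>n. 0 < n) sequentially" by (rule eventually_gt_at_top)
  have KL: "eventually (\<lambda>n. 2 \<le> real (K n)) sequentially" using K_at_top unfolding filterlim_at_top by blast
  have ev: "eventually (\<lambda>n. K n \<le> Suc (K n - 1) \<and> K n - 1 \<le> Suc (K n)) sequentially"
    "eventually (\<lambda>n. K n \<le> Suc (K n) \<and> K n \<le> Suc (K n)) sequentially"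
    "eventually (\<lambda>n. K n \<le> Suc (Suc (K n)) \<and> Suc (K n) \<le> Suc (K n)) sequentially"
    by (rule always_eventually; auto)+
  note a = degree_limit[OF ev(1) \<Delta>] and b = degree_limit[OF ev(2) \<Delta>] and c = degree_limit[OF ev(3) \<Delta>]
  \<comment> \<open>The approximate expected number of vertices with degree at least
    \<open>K n - 1\<close> tends to infinity, so the maximum reaches \<open>K n - 1\<close> with
    probability tending to 1. For \<open>K n + 1\<close> the corresponding number tends to 0. Only
    the values \<open>K n - 1\<close> and \<open>K n\<close> remain.\<close>
  have "filterlim (\<lambda>n. real n * (1 - v_n n) * ptail (\<mu> n) (K n - 1)) at_top sequentially"
  proof (rule filterlim_at_top_mono)
    show "filterlim (\<lambda>n. w * f n (K n - 1)) at_top sequentially"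
      by (rule filterlim_tendsto_pos_mult_at_top[OF tendsto_const w f_pred_K_at_top])
    show "eventually (\<lambda>n. w * f n (K n - 1) \<le> real n * (1 - v_n n) * ptail (\<mu> n) (K n - 1)) sequentially"
      using w_le
    proof eventually_elim
      case (elim n)
      have "w * f n (K n - 1) \<le> (1 - v_n n) * f n (K n - 1)" using elim f_nonneg by (intro mult_right_mono)
      then show ?case by (simp add: f_def mult_ac)
    qed
  qed
  then have "filterlim (\<lambda>n. - (real n * (1 - v_n n) * ptail (\<mu> n) (K n - 1))) at_bot sequentially"
    by (simp only: filterlim_uminus_at_top)
  from filterlim_compose[OF exp_at_bot this] have Ea: "(\<lambda>n. E n (K n - 1)) \<longlonglongrightarrow> 0" .
  have Fa: "(\<lambda>n. ?F n (K n - 1)) \<longlonglongrightarrow> 0" using tendsto_add[OF a(2) Ea] by simp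
  have "(\<lambda>n. (1 - v_n n) * f n (Suc (K n))) \<longlonglongrightarrow> (1 - v) * 0"
    by (intro tendsto_mult tendsto_diff tendsto_const v_n(2) f_Suc_K_tendsto)
  then have "(\<lambda>n. exp (- ((1 - v_n n) * f n (Suc (K n))))) \<longlonglongrightarrow> exp (- ((1 - v) * 0))"
    by (intro tendsto_exp tendsto_minus)
  then have Ec: "(\<lambda>n. E n (Suc (K n))) \<longlonglongrightarrow> 1" by (simp add: f_def mult_ac)
  have Fc: "(\<lambda>n. ?F n (Suc (K n))) \<longlonglongrightarrow> 1" using tendsto_add[OF c(2) Ec] by simp
  have diff: "\<P>(\<omega> in S n. int (\<Delta> n \<omega>) = int j) = ?F n (Suc j) - ?F n j"
    if "Measurable.pred (S n) (\<lambda>\<omega>. \<Delta> n \<omega> < j)" "Measurable.pred (S n) (\<lambda>\<omega>. \<Delta> n \<omega> < Suc j)" for n j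
  proof -
    interpret prob_space "S n" by (rule sample_space)
    have "{\<omega>\<in>space (S n). int (\<Delta> n \<omega>) = int j} = {\<omega>\<in>space (S n). \<Delta> n \<omega> < Suc j} - {\<omega>\<in>space (S n). \<Delta> n \<omega> < j}"
      by auto
    moreover have "{\<omega>\<in>space (S n). \<Delta> n \<omega> < j} \<subseteq> {\<omega>\<in>space (S n). \<Delta> n \<omega> < Suc j}" by auto
    note finite_measure_Diff[OF predE[OF that(2)] predE[OF that(1)] this]
    ultimately show ?thesis by (simp only:)
  qed
  have e1: "eventually (\<lambda>n. \<P>(\<omega> in S n. int (\<Delta> n \<omega>) = int (K n) - 1) - E n (K n) = (?F n (K n) - E n (K n)) - ?F n (K n - 1)) sequentially"
    using KL a(1) b(1)
  proof eventually_elim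
    case (elim n)
    then have "int (K n) - 1 = int (K n - 1)" "K n = Suc (K n - 1)" by auto
    then show ?case using diff[of n "K n - 1"] elim by simp
  qed
  have e2: "eventually (\<lambda>n. \<P>(\<omega> in S n. int (\<Delta> n \<omega>) = int (K n)) + E n (K n) = ?F n (Suc (K n)) - (?F n (K n) - E n (K n))) sequentially"
    using c(1) b(1)
  proof eventually_elim
    case (elim n)
    then show ?case using diff[of n "K n"] by simp
  qed
  have "(\<lambda>n. (?F n (K n) - E n (K n)) - ?F n (K n - 1)) \<longlonglongrightarrow> 0 - 0" by (rule tendsto_diff[OF b(2) Fa])
  then show "(\<lambda>n. \<P>(\<omega> in S n. int (\<Delta> n \<omega>) = int (K n) - 1) - E n (K n)) \<longlonglongrightarrow> 0"
    by (subst tendsto_cong[OF e1]) simp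
  have "(\<lambda>n. ?F n (Suc (K n)) - (?F n (K n) - E n (K n))) \<longlonglongrightarrow> 1 - 0" by (rule tendsto_diff[OF Fc b(2)])
  then show "(\<lambda>n. \<P>(\<omega> in S n. int (\<Delta> n \<omega>) = int (K n)) + E n (K n)) \<longlonglongrightarrow> 1"
    by (subst tendsto_cong[OF e2]) simp
qed

end

theorem theorem1:
  fixes \<alpha> v q :: real and v_n q_n r \<mu> :: "nat \<Rightarrow> real"
  assumes "0 < \<alpha>" and "\<alpha> \<le> 2 * pi"
    and "\<And>n. n > 0 \<Longrightarrow> v_n n \<in> {0..1}" and "v_n \<longlonglongrightarrow> v" and "v \<in> {0..<1}"
    and "\<And>n. n > 0 \<Longrightarrow> q_n n \<in> {0..1}" and "q_n \<longlonglongrightarrow> q" and "q \<in> {0..<1}"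
    and "\<And>n. n > 0 \<Longrightarrow> r n > 0"
    and "\<And>n. \<mu> n = \<alpha> / 2 * real n * (r n)\<^sup>2 * (1 - v_n n) * (1 - q_n n)"
    and "(INF n\<in>{0<..}. \<mu> n) > 0"
    and "\<exists>\<epsilon>>0. (\<lambda>n. \<mu> n powr (1 + \<epsilon>)) \<in> o(\<lambda>n. ln (real n))"
  shows "\<exists>k :: nat \<Rightarrow> int. \<exists>\<xi> :: nat \<Rightarrow> real.
    (\<forall>n>0. \<xi> n = measure_pmf.prob (poisson_pmf (\<mu> n)) {j. int j \<ge> k n}) \<and>
    (\<forall>\<Delta> \<in> {\<lambda>n \<omega>. max_out_degree (poisson_graph \<alpha> (r n) \<omega>),
            \<lambda>n \<omega>. max_in_degree (poisson_graph \<alpha> (r n) \<omega>),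
            \<lambda>n \<omega>. max_out_degree (binomial_graph \<alpha> (r n) n \<omega>),
            \<lambda>n \<omega>. max_in_degree (binomial_graph \<alpha> (r n) n \<omega>)}.
      (\<lambda>n. \<P>(\<omega> in sample_space n (v_n n) (q_n n). int (\<Delta> n \<omega>) = k n - 1)
            - exp (- (real n * (1 - v_n n) * \<xi> n))) \<longlonglongrightarrow> 0 \<and>
      (\<lambda>n. \<P>(\<omega> in sample_space n (v_n n) (q_n n). int (\<Delta> n \<omega>) = k n)
            + exp (- (real n * (1 - v_n n) * \<xi> n))) \<longlonglongrightarrow> 1)"
proof -
  define c where "c = (INF n\<in>{0<..}. \<mu> n)"
  \<comment> \<open>Infima of sets of reals are meaningful only for sets bounded below; here 0 is a
    bound, as all factors of \<open>\<mu> n\<close> are nonnegative.\<close>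
  have "bdd_below (\<mu> ` {0<..})"
  proof (rule bdd_belowI2)
    fix n :: nat assume "n \<in> {0<..}"
    then show "0 \<le> \<mu> n" unfolding assms(10) using assms(1) assms(3,6)[of n] by simp
  qed
  then have \<mu>c: "c \<le> \<mu> n" if "0 < n" for n unfolding c_def using that by (intro cINF_lower) auto
  have c: "0 < c" using assms(11) by (simp add: c_def)
  obtain \<epsilon> where \<epsilon>: "0 < \<epsilon>" "(\<lambda>n. \<mu> n powr (1 + \<epsilon>)) \<in> o(\<lambda>n. ln (real n))" using assms(12) by blast
  have "(\<lambda>n. \<mu> n / ln (real n)) \<longlonglongrightarrow> 0" by (rule powr_smallo_imp[OF c \<mu>c \<epsilon>])
  with c \<mu>c have T: "tail_threshold \<mu> c" by (rule tail_threshold.intro)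
  have "v < 1" "q < 1" using assms(5,8) by simp_all
  then interpret sector_asymptotics \<alpha> v q c v_n q_n r \<mu>
    by (intro sector_asymptotics.intro assms(1-4,6,7,9,10) T)
  show ?thesis
  proof (intro exI[of _ "\<lambda>n. int (K n)"] exI[of _ "\<lambda>n. ptail (\<mu> n) (K n)"] conjI ballI allI impI, goal_cases)
    case (1 n)
    show ?case by (simp add: ptail_def)
  next
    case (2 \<Delta>)
    then have "\<Delta> n \<in> degrees n" for n by auto
    then show ?case by (rule degree_concentration(1))
  next
    case (3 \<Delta>)
    then have "\<Delta> n \<in> degrees n" for n by auto
    then show ?case by (rule degree_concentration(2))
  qed
qed

end
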